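(* Let $\mathbf A\in\mathbb{R}^{n\times d}$, $\epsilon\in(0,1)$, $k$ a positive integer, and let $\mathcal X$ be the set of $n\times k$ matrices whose rows are standard basis vectors. (1) There are distributions of random sketching matrices $\mathbf T\in\mathbb{R}^{d\times t}$, $\mathbf S\in\mathbb{R}^{s\times n}$ and $\mathbf W\in\mathbb{R}^{w\times nd}$, with $t=O(\log(nk)/\epsilon^2)$, $s=O(k/\epsilon)$ and $w=O(\frac{k^2}{\epsilon^3}\log n)$, such that $\mathbf S\mathbf A$, $\mathbf A\mathbf T$ and $\mathbf W\operatorname{vec}(\mathbf A)$ suffice to compute, with at least constant probability, a $(1+\epsilon)$-approximate solution to the $k$-means problem, i.e. $\tilde{\mathbf X}\in\mathcal X$, $\tilde{\mathbf C}\in\mathbb{R}^{k\times d}$ with $\|\tilde{\mathbf X}\tilde{\mathbf C}-\mathbf A\|_F^2\le(1+\epsilon)\min_{\mathbf X\in\mathcal X,\mathbf C\in\mathbb{R}^{k\times d}}\|\mathbf X\mathbf C-\mathbf A\|_F^2$. (2) There is an algorithm which computes a $(1+\epsilon)$-approximate solution to the $k$-means problem in the turnstile streaming model with at least constant probability using $\tilde O(n/\epsilon^2+dk/\epsilon)$ space for $n,d>\operatorname{poly}(k/\epsilon)$, in $n^{\tilde O(k^2/\epsilon)}$ additional time.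
   Context: $\operatorname{vec}(\mathbf A)\in\mathbb{R}^{nd}$ is the flattening of $\mathbf A$. In a turnstile stream, $\mathbf A$ is initialized to $0$ and receives arbitrary entrywise updates $\mathbf A_{i,j}\leftarrow\mathbf A_{i,j}+\Delta$ with $\Delta\in\mathbb{R}$; the algorithm must output both the assignment $\tilde{\mathbf X}$ and the centers $\tilde{\mathbf C}$. *)

theory Defs
  imports
    "HOL-Probability.Probability"
    "HOL-Library.Log_Nat"
    "Jordan_Normal_Form.Matrix"
begin

section \<open>The k-means problem\<close>

definition frob_sq :: "real mat \<Rightarrow> real" where
  "frob_sq A = (\<Sum>i<dim_row A. \<Sum>j<dim_col A. (A $$ (i, j))\<^sup>2)"

definition assignment_mats :: "nat \<Rightarrow> nat \<Rightarrow> real mat set" where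
  "assignment_mats n k = {X \<in> carrier_mat n k. \<forall>i<n. \<exists>j<k. row X i = unit_vec k j}"

text \<open>For \<open>k \<ge> 1\<close> the infimum is attained: there are finitely many \<open>X\<close>, and for each of them
  the objective is a least-squares problem in \<open>C\<close>.\<close>

definition kmeans_opt :: "nat \<Rightarrow> real mat \<Rightarrow> real" where
  "kmeans_opt k A =
     (INF (X, C) \<in> assignment_mats (dim_row A) k \<times> carrier_mat k (dim_col A). frob_sq (X * C - A))"

definition approx_kmeans :: "real \<Rightarrow> nat \<Rightarrow> real mat \<Rightarrow> real mat \<Rightarrow> real mat \<Rightarrow> bool" where
  "approx_kmeans \<epsilon> k A X C \<longleftrightarrow>
     X \<in> assignment_mats (dim_row A) k \<and> C \<in> carrier_mat k (dim_col A) \<and>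
     frob_sq (X * C - A) \<le> (1 + \<epsilon>) * kmeans_opt k A"

definition flatten_list :: "real mat \<Rightarrow> real list" where
  "flatten_list A =
     map (\<lambda>l. A $$ (l div dim_col A, l mod dim_col A)) [0..<dim_row A * dim_col A]"

definition flatten :: "real mat \<Rightarrow> real Matrix.vec" where
  "flatten A = vec_of_list (flatten_list A)"


section \<open>Turnstile streams\<close>

type_synonym update = "nat \<times> nat \<times> real"

definition apply_update :: "update \<Rightarrow> real mat \<Rightarrow> real mat" where
  "apply_update = (\<lambda>(i, j, \<delta>) A. mat (dim_row A) (dim_col A)
     (\<lambda>(a, b). if a = i \<and> b = j then A $$ (a, b) + \<delta> else A $$ (a, b)))"

definition stream_mat :: "nat \<Rightarrow> nat \<Rightarrow> update list \<Rightarrow> real mat" where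
  "stream_mat n d \<sigma> = fold apply_update \<sigma> (0\<^sub>m n d)"

definition valid_stream :: "nat \<Rightarrow> nat \<Rightarrow> update list \<Rightarrow> bool" where
  "valid_stream n d \<sigma> \<longleftrightarrow> (\<forall>(i, j, \<delta>) \<in> set \<sigma>. i < n \<and> j < d)"


section \<open>A randomized real RAM with a one-way input stream\<close>

text \<open>Since entries and updates are arbitrary reals, algorithms are programs for a real RAM:
  memory consists of finitely many growing arrays of naturals and of reals, the latter with exact
  field arithmetic and comparison. Programs contain no real constants and there is no rounding
  operation from reals to naturals. The input stream is read once, from left to right.\<close>

datatype nexp =
    NLit nat
  | NGet nat nexp
  | NAdd nexp nexp
  | NSub nexp nexp
  | NMul nexp nexp
  | NDiv nexp nexp
  | NMod nexp nexp

datatype rexp =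
    ROfNat nexp
  | RGet nat nexp
  | RAdd rexp rexp
  | RSub rexp rexp
  | RMul rexp rexp
  | RDiv rexp rexp

datatype bexp =
    NLess nexp nexp
  | RLess rexp rexp
  | BNot bexp
  | BAnd bexp bexp

text \<open>\<open>NPut a e f\<close> is the assignment \<open>a[e] := f\<close>; \<open>NRand a e f\<close> assigns to \<open>a[e]\<close> a fresh
  uniform element of \<open>{0..f}\<close>; \<open>Next b p q x\<close> consumes the next update, storing \<open>1\<close> in \<open>b[0]\<close> and
  its row, column and increment in \<open>p[0]\<close>, \<open>q[0]\<close>, \<open>x[0]\<close>, or stores \<open>0\<close> in \<open>b[0]\<close> at the end of
  the stream.\<close>

datatype com =
    Halt
  | NPut nat nexp nexp
  | RPut nat nexp rexp
  | NRand nat nexp nexp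
  | Next nat nat nat nat
  | Seq com com
  | Cond bexp com com
  | Loop bexp com

record state =
  nats :: "nat \<Rightarrow> nat list"
  reals :: "nat \<Rightarrow> real list"
  input :: "update list"

definition fetch :: "'a::zero list \<Rightarrow> nat \<Rightarrow> 'a" where
  "fetch xs i = (if i < length xs then xs ! i else 0)"

definition store :: "'a::zero list \<Rightarrow> nat \<Rightarrow> 'a \<Rightarrow> 'a list" where
  "store xs i v =
     (if i < length xs then xs[i := v] else xs @ replicate (i - length xs) 0 @ [v])"

definition put_nat :: "nat \<Rightarrow> nat \<Rightarrow> nat \<Rightarrow> state \<Rightarrow> state" where
  "put_nat a i v s = s\<lparr>nats := (nats s)(a := store (nats s a) i v)\<rparr>"

definition put_real :: "nat \<Rightarrow> nat \<Rightarrow> real \<Rightarrow> state \<Rightarrow> state" where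
  "put_real a i v s = s\<lparr>reals := (reals s)(a := store (reals s a) i v)\<rparr>"

primrec nval :: "nexp \<Rightarrow> state \<Rightarrow> nat" where
  "nval (NLit v) s = v"
| "nval (NGet a e) s = fetch (nats s a) (nval e s)"
| "nval (NAdd e f) s = nval e s + nval f s"
| "nval (NSub e f) s = nval e s - nval f s"
| "nval (NMul e f) s = nval e s * nval f s"
| "nval (NDiv e f) s = nval e s div nval f s"
| "nval (NMod e f) s = nval e s mod nval f s"

primrec rval :: "rexp \<Rightarrow> state \<Rightarrow> real" where
  "rval (ROfNat e) s = real (nval e s)"
| "rval (RGet a e) s = fetch (reals s a) (nval e s)"
| "rval (RAdd e f) s = rval e s + rval f s"
| "rval (RSub e f) s = rval e s - rval f s"
| "rval (RMul e f) s = rval e s * rval f s"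
| "rval (RDiv e f) s = rval e s / rval f s"

primrec bval :: "bexp \<Rightarrow> state \<Rightarrow> bool" where
  "bval (NLess e f) s \<longleftrightarrow> nval e s < nval f s"
| "bval (RLess e f) s \<longleftrightarrow> rval e s < rval f s"
| "bval (BNot b) s \<longleftrightarrow> \<not> bval b s"
| "bval (BAnd b c) s \<longleftrightarrow> bval b s \<and> bval c s"

definition read_next :: "nat \<Rightarrow> nat \<Rightarrow> nat \<Rightarrow> nat \<Rightarrow> state \<Rightarrow> state" where
  "read_next b p q x s =
     (case input s of
        [] \<Rightarrow> put_nat b 0 0 s
      | (i, j, \<delta>) # \<sigma> \<Rightarrow>
          put_nat b 0 1 (put_nat p 0 i (put_nat q 0 j (put_real x 0 \<delta> (s\<lparr>input := \<sigma>\<rparr>)))))"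

primrec step :: "com \<Rightarrow> state \<Rightarrow> (com \<times> state) pmf" where
  "step Halt s = return_pmf (Halt, s)"
| "step (NPut a e f) s = return_pmf (Halt, put_nat a (nval e s) (nval f s) s)"
| "step (RPut a e f) s = return_pmf (Halt, put_real a (nval e s) (rval f s) s)"
| "step (NRand a e f) s =
     map_pmf (\<lambda>v. (Halt, put_nat a (nval e s) v s)) (pmf_of_set {..nval f s})"
| "step (Next b p q x) s = return_pmf (Halt, read_next b p q x s)"
| "step (Seq c c') s =
     (if c = Halt then return_pmf (c', s)
      else map_pmf (\<lambda>(c'', s'). (Seq c'' c', s')) (step c s))"
| "step (Cond b c c') s = return_pmf (if bval b s then c else c', s)"
| "step (Loop b c) s = return_pmf (if bval b s then Seq c (Loop b c) else Halt, s)"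

text \<open>Running time is the number of steps.\<close>

primrec steps :: "nat \<Rightarrow> com \<times> state \<Rightarrow> (com \<times> state) pmf" where
  "steps 0 cfg = return_pmf cfg"
| "steps (Suc m) cfg = bind_pmf (step (fst cfg) (snd cfg)) (steps m)"

text \<open>A real occupies one cell, and a natural is charged its bit length, so that large naturals
  cannot be used to pack data for free. Given this charge, counting one step per natural-number
  operation is accurate up to a factor polynomial in the space. Only finitely many arrays are
  ever nonempty. The unread part of the input stream is not part of the memory.\<close>

definition mem_size :: "state \<Rightarrow> nat" where
  "mem_size s =
     (\<Sum>a | nats s a \<noteq> []. \<Sum>v \<leftarrow> nats s a. 1 + floorlog 2 v) +
     (\<Sum>a | reals s a \<noteq> []. length (reals s a))"

text \<open>Output convention: array \<open>1\<close> of naturals holds the cluster labels and array \<open>1\<close> of reals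
  the centers in row-major order. A label \<open>\<ge> k\<close> yields a zero row, so that \<open>out_assignment\<close> is then
  not an element of \<open>assignment_mats\<close>.\<close>

definition out_assignment :: "nat \<Rightarrow> nat \<Rightarrow> state \<Rightarrow> real mat" where
  "out_assignment n k s = mat n k (\<lambda>(i, j). if fetch (nats s 1) i = j then 1 else 0)"

definition out_centers :: "nat \<Rightarrow> nat \<Rightarrow> state \<Rightarrow> real mat" where
  "out_centers k d s = mat k d (\<lambda>(i, j). fetch (reals s 1) (i * d + j))"

definition outputs_approx :: "real \<Rightarrow> nat \<Rightarrow> real mat \<Rightarrow> (com \<times> state) set" where
  "outputs_approx \<epsilon> k A = {(c, s). c = Halt \<and>
     approx_kmeans \<epsilon> k A (out_assignment (dim_row A) k s) (out_centers k (dim_col A) s)}"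

definition stream_input :: "nat \<Rightarrow> nat \<Rightarrow> nat \<Rightarrow> real \<Rightarrow> update list \<Rightarrow> state" where
  "stream_input n d k \<epsilon> \<sigma> =
     \<lparr>nats = (\<lambda>_. [])(0 := [n, d, k]), reals = (\<lambda>_. [])(0 := [\<epsilon>]), input = \<sigma>\<rparr>"

text \<open>The arguments after \<open>W\<close> are the sketches \<open>S * A\<close>, \<open>A * T\<close> and \<open>W *\<^sub>v flatten A\<close>.\<close>

definition sketch_input ::
  "nat \<Rightarrow> nat \<Rightarrow> nat \<Rightarrow> real \<Rightarrow> real mat \<Rightarrow> real mat \<Rightarrow> real mat \<Rightarrow>
   real mat \<Rightarrow> real mat \<Rightarrow> real Matrix.vec \<Rightarrow> state" where
  "sketch_input n d k \<epsilon> T S W SA AT Wa =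
     \<lparr>nats = (\<lambda>_. [])(0 := [n, d, k, dim_col T, dim_row S, dim_row W]),
      reals = (\<lambda>_. [])(0 := [\<epsilon>], 2 := flatten_list T, 3 := flatten_list S, 4 := flatten_list W,
        5 := flatten_list SA, 6 := flatten_list AT, 7 := list_of_vec Wa),
      input = []\<rparr>"


section \<open>Asymptotic bounds\<close>

text \<open>The bound \<open>O(x log^e x)\<close> behind the soft-O of \<open>x\<close>; the shift by \<open>2\<close> keeps the logarithm
  bounded away from \<open>0\<close> for \<open>x \<ge> 0\<close>.\<close>

definition soft_bound :: "real \<Rightarrow> nat \<Rightarrow> real \<Rightarrow> real" where
  "soft_bound c e x = c * x * ln (2 + x) ^ e"

end

(* A small sketch already determines the combinatorial part of a near-optimal clustering. If X is the
   optimal assignment, then S X has entries in {-n..n}, so it can be found by trying (2n+1)^(sk)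
   integer matrices M. For the right M, the centers pinv(M) (S A) solve a sketched regression problem
   and are (1 + eps)-optimal: S preserves the column space of X, and in S the residual of
   the optimal solution stays almost orthogonal to X. Given candidate centers, A T locates an almost nearest
   center for every row, since only n k differences are compared. Finally W vec(A) estimates the cost
   of every candidate, and a union bound over the candidates determines w.

   All three sketches have entries +-1, and only fourth moments matter. Second and fourth moments give
   Chebyshev upper tails; lower tails are exponential, because exp(-y) <= 1 - y + y^2/2 lets
   Chernoff's method run on exp(-lambda Z^2). Upper tails are needed only for the optimal solution, lower
   tails for all competitors. For streaming, the sign of an index below b^2 is the product
   of two table entries selected by its base-b digits. Such signs still have bounded fourth moments, but
   need only 2b stored bits, so that the tables fit into the claimed space. *)

theory Submission
  imports Defs
begin

text \<open>The union bounds work only because each sketch is tested against vectors that are fixed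
  before it is drawn. The candidate centers depend on S alone and the labels on S and T, so T is
  analysed for fixed S, and W for fixed S and T. Hence W meets one competitor per guess and not one
  per labeling, and the logarithm of the number of guesses, of order (k^2 / \<epsilon>) log n, is
  what enters w. Failure is budgeted in units of 1/24: three events for S and two each for T and W
  make 7/24 < 1/3. All approximations are relative, with error \<epsilon>/10. A net argument for the
  column space usually needs an upper bound on the operator norm. Rounding to integer points instead
  charges the error to the Frobenius norm, so that a first moment is enough. In the streaming half
  the signs of W are the obstacle: w tables of size about sqrt n + sqrt d have to fit into roughly n
  + d cells, and this dictates the condition n, d > (k / \<epsilon>)^6.\<close>

section \<open>Expectations over finitely supported distributions\<close>

abbreviation (input) expect :: "'a pmf \<Rightarrow> ('a \<Rightarrow> real) \<Rightarrow> real" where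
  "expect p f \<equiv> measure_pmf.expectation p f"

text \<open>All distributions that are averaged over have finite support, so finiteness of
  \<open>set_pmf\<close> stands in for every integrability condition.\<close>

lemma expect_add:
  assumes "finite (set_pmf p)"
  shows "expect p (\<lambda>x. f x + g x) = expect p f + expect p g"
  using assms by (intro Bochner_Integration.integral_add) (auto intro: integrable_measure_pmf_finite)

lemma expect_diff:
  assumes "finite (set_pmf p)"
  shows "expect p (\<lambda>x. f x - g x) = expect p f - expect p g"
  using assms by (intro Bochner_Integration.integral_diff) (auto intro: integrable_measure_pmf_finite)

lemma expect_sum:
  assumes "finite (set_pmf p)"
  shows "expect p (\<lambda>x. \<Sum>i\<in>I. f i x) = (\<Sum>i\<in>I. expect p (f i))"
  using assms by (intro Bochner_Integration.integral_sum) (auto intro: integrable_measure_pmf_finite)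

lemma expect_cong:
  assumes "\<And>x. x \<in> set_pmf p \<Longrightarrow> f x = g x"
  shows "expect p f = expect p g"
  using assms by (intro integral_cong_AE) (auto simp: AE_measure_pmf_iff)

lemma expect_mono:
  assumes "finite (set_pmf p)" "\<And>x. x \<in> set_pmf p \<Longrightarrow> f x \<le> g x"
  shows "expect p f \<le> expect p g"
  using assms by (intro integral_mono_AE) (auto simp: AE_measure_pmf_iff intro: integrable_measure_pmf_finite)

lemma expect_nonneg:
  assumes "\<And>x. x \<in> set_pmf p \<Longrightarrow> 0 \<le> f x"
  shows "0 \<le> expect p f"
  using assms by (intro integral_nonneg_AE) (auto simp: AE_measure_pmf_iff)

lemma expect_bind:
  assumes "finite (set_pmf p)" "\<And>x. x \<in> set_pmf p \<Longrightarrow> finite (set_pmf (f x))"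
  shows "expect (bind_pmf p f) h = expect p (\<lambda>x. expect (f x) h)"
  using assms by (subst pmf_expectation_bind[of "set_pmf p"]) (auto simp: integral_measure_pmf[of "set_pmf p"])

lemma finite_replicate_pmf: "finite (set_pmf p) \<Longrightarrow> finite (set_pmf (replicate_pmf m p))"
  using finite_lists_length_eq[of "set_pmf p" m]
  by (auto simp: set_replicate_pmf elim: rev_finite_subset)

declare replicate_pmf.simps(2)[simp del]

lemma expect_replicate_Suc:
  assumes "finite (set_pmf p)"
  shows "expect (replicate_pmf (Suc m) p) h = expect p (\<lambda>x. expect (replicate_pmf m p) (\<lambda>xs. h (x # xs)))"
  using assms by (simp add: replicate_pmf.simps(2) expect_bind finite_replicate_pmf)

lemma markov_pmf:
  assumes "finite (set_pmf p)" "\<And>x. x \<in> set_pmf p \<Longrightarrow> 0 \<le> f x" "a > 0"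
  shows "measure_pmf.prob p {x. a \<le> f x} \<le> expect p f / a"
proof -
  have "measure_pmf.prob p {x. a \<le> f x} = expect p (indicator {x. a \<le> f x})" by simp
  also have "\<dots> \<le> expect p (\<lambda>x. f x / a)"
    using assms by (intro expect_mono) (auto simp: indicator_def field_simps)
  finally show ?thesis by simp
qed

section \<open>Random signs with bounded fourth moments\<close>

text \<open>Bits are naturals because \<open>NRand\<close> with bound \<open>1\<close> draws exactly
  this distribution. A bit x stands for the sign 1 - 2 x.\<close>

definition coin :: "nat pmf" where "coin = pmf_of_set {..1}"

lemma finite_coin[simp]: "finite (set_pmf coin)"
  unfolding coin_def by simp

lemma expect_coin: "expect coin h = (h 0 + h 1) / 2"
  unfolding coin_def by (subst integral_pmf_of_set) (auto simp: atMost_Suc)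

text \<open>A Khintchine inequality of order four: the forms are isotropic, and their fourth moment
  is at most \<open>K\<close> times the square of the second. Together with the sign property of S
  this is all that the analysis knows about a row of a sketch, so that independent signs and table
  signs are treated alike.\<close>

definition good4 :: "'a pmf \<Rightarrow> ('a \<Rightarrow> 'i \<Rightarrow> real) \<Rightarrow> 'i set \<Rightarrow> real \<Rightarrow> bool" where
  "good4 \<rho> sg I K \<longleftrightarrow> finite (set_pmf \<rho>) \<and> finite I \<and> 1 \<le> K \<and>
     (\<forall>x. expect \<rho> (\<lambda>l. (\<Sum>i\<in>I. sg l i * x i)\<^sup>2) = (\<Sum>i\<in>I. (x i)\<^sup>2) \<and>
          expect \<rho> (\<lambda>l. (\<Sum>i\<in>I. sg l i * x i) ^ 4) \<le> K * (\<Sum>i\<in>I. (x i)\<^sup>2)\<^sup>2)"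

text \<open>Cauchy-Schwarz for the two fourth moments, carried out as a weighted inequality between
  means. With a, b the squared norms, the weights b/a and a/b balance the two halves to K a b / 2
  each. If a or b vanishes, so does the corresponding form.\<close>

lemma good4_mixed:
  assumes g: "good4 \<rho> sg I K"
  shows "expect \<rho> (\<lambda>l. (\<Sum>i\<in>I. sg l i * x i)\<^sup>2 * (\<Sum>i\<in>I. sg l i * y i)\<^sup>2)
     \<le> K * (\<Sum>i\<in>I. (x i)\<^sup>2) * (\<Sum>i\<in>I. (y i)\<^sup>2)"
proof -
  let ?X = "\<lambda>l. \<Sum>i\<in>I. sg l i * x i" and ?Y = "\<lambda>l. \<Sum>i\<in>I. sg l i * y i"
  let ?a = "\<Sum>i\<in>I. (x i)\<^sup>2" and ?b = "\<Sum>i\<in>I. (y i)\<^sup>2"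
  have fin: "finite (set_pmf \<rho>)" "finite I" using g by (auto simp: good4_def)
  have nn: "?a \<ge> 0" "?b \<ge> 0" by (auto intro: sum_nonneg)
  consider "?a = 0" | "?b = 0" | "?a > 0" "?b > 0" using nn by linarith
  then show ?thesis
  proof cases
    case 1
    then have "\<forall>i\<in>I. x i = 0" using fin by (simp add: sum_nonneg_eq_0_iff)
    then have "?X l = 0" for l by simp
    with 1 show ?thesis by simp
  next
    case 2
    then have "\<forall>i\<in>I. y i = 0" using fin by (simp add: sum_nonneg_eq_0_iff)
    then have "?Y l = 0" for l by simp
    with 2 show ?thesis by simp
  next
    case 3
    have le: "u\<^sup>2 * v\<^sup>2 \<le> (?b / ?a / 2) * u ^ 4 + (?a / ?b / 2) * v ^ 4" for u v :: real
    proof -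
      have "0 \<le> (?b * u\<^sup>2 - ?a * v\<^sup>2)\<^sup>2 / (2 * ?a * ?b)" using 3 by simp
      also have "\<dots> = (?b / ?a / 2) * u ^ 4 + (?a / ?b / 2) * v ^ 4 - u\<^sup>2 * v\<^sup>2"
        using 3 by (simp add: field_simps power2_eq_square power4_eq_xxxx)
      finally show ?thesis by simp
    qed
    have "expect \<rho> (\<lambda>l. (?X l)\<^sup>2 * (?Y l)\<^sup>2) \<le>
        expect \<rho> (\<lambda>l. (?b / ?a / 2) * ?X l ^ 4 + (?a / ?b / 2) * ?Y l ^ 4)"
      by (rule expect_mono[OF fin(1)]) (rule le)
    also have "\<dots> = (?b / ?a / 2) * expect \<rho> (\<lambda>l. ?X l ^ 4) + (?a / ?b / 2) * expect \<rho> (\<lambda>l. ?Y l ^ 4)"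
      by (simp add: expect_add[OF fin(1)])
    also have "\<dots> \<le> (?b / ?a / 2) * (K * ?a\<^sup>2) + (?a / ?b / 2) * (K * ?b\<^sup>2)"
      using g nn by (intro add_mono mult_left_mono) (auto simp: good4_def)
    also have "\<dots> = K * ?a * ?b" using 3 by (simp add: field_simps power2_eq_square)
    finally show ?thesis .
  qed
qed

text \<open>Polarisation of the second moment identity.\<close>

lemma good4_bilinear:
  assumes g: "good4 \<rho> sg I K"
  shows "expect \<rho> (\<lambda>l. (\<Sum>i\<in>I. sg l i * x i) * (\<Sum>i\<in>I. sg l i * y i)) = (\<Sum>i\<in>I. x i * y i)"
proof -
  let ?X = "\<lambda>z l. \<Sum>i\<in>I. sg l i * z i"
  have fin: "finite (set_pmf \<rho>)" using g by (auto simp: good4_def)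
  have sq: "expect \<rho> (\<lambda>l. (?X z l)\<^sup>2) = (\<Sum>i\<in>I. (z i)\<^sup>2)" for z
    using g by (auto simp: good4_def)
  have "?X x l * ?X y l = (1/2) * ((?X (\<lambda>i. x i + y i) l)\<^sup>2 - (?X x l)\<^sup>2 - (?X y l)\<^sup>2)" for l
    unfolding distrib_left sum.distrib by (simp add: power2_eq_square algebra_simps)
  then have "expect \<rho> (\<lambda>l. ?X x l * ?X y l) =
     (1/2) * ((\<Sum>i\<in>I. (x i + y i)\<^sup>2) - (\<Sum>i\<in>I. (x i)\<^sup>2) - (\<Sum>i\<in>I. (y i)\<^sup>2))"
    by (simp only: expect_diff[OF fin] integral_mult_right_zero sq)
  also have "\<dots> = (\<Sum>i\<in>I. x i * y i)"
    by (simp add: power2_sum sum.distrib sum_distrib_left mult.assoc)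
  finally show ?thesis .
qed

text \<open>Averaging over the first sign cancels its odd powers and leaves the recursion x^4 + 6
  x^2 s + 3 s^2 \<le> 3 (x^2 + s)^2, where s is the squared norm of the remaining vector. This is
  the source of the constant 3.\<close>

lemma good4_coins: "good4 (replicate_pmf b coin) (\<lambda>l q. 1 - 2 * real (l ! q)) {..<b} 3"
proof -
  let ?Z = "\<lambda>b x l. \<Sum>q<b. (1 - 2 * real (l ! q)) * x q"
  have Z: "?Z (Suc b) x (c # l) = (1 - 2 * real c) * x 0 + ?Z b (\<lambda>q. x (Suc q)) l" for b x c l
    by (simp add: sum.lessThan_Suc_shift del: sum.lessThan_Suc)
  have fin: "finite (set_pmf (replicate_pmf b coin))" for b by (simp add: finite_replicate_pmf)
  have 2: "expect (replicate_pmf b coin) (\<lambda>l. (?Z b x l)\<^sup>2) = (\<Sum>q<b. (x q)\<^sup>2)" for x b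
  proof (induction b arbitrary: x)
    case (Suc b)
    have "((x 0 + z)\<^sup>2 + (- x 0 + z)\<^sup>2) / 2 = (x 0)\<^sup>2 + z\<^sup>2" for z
      by (simp add: power2_eq_square algebra_simps)
    then show ?case
      by (simp only: expect_replicate_Suc finite_coin Z expect_coin expect_add[OF fin, symmetric]
          integral_divide_zero[symmetric] )
         (simp add: expect_add[OF fin] Suc.IH sum.lessThan_Suc_shift del: sum.lessThan_Suc)
  qed simp
  have 4: "expect (replicate_pmf b coin) (\<lambda>l. ?Z b x l ^ 4) \<le> 3 * (\<Sum>q<b. (x q)\<^sup>2)\<^sup>2" for x
  proof (induction b arbitrary: x)
    case (Suc b)
    let ?y = "\<lambda>q. x (Suc q)"
    have *: "((x 0 + z) ^ 4 + (- x 0 + z) ^ 4) / 2 = x 0 ^ 4 + 6 * (x 0)\<^sup>2 * z\<^sup>2 + z ^ 4" for z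
      by (simp add: power2_eq_square power4_eq_xxxx algebra_simps)
    have "expect (replicate_pmf (Suc b) coin) (\<lambda>l. ?Z (Suc b) x l ^ 4) =
       expect (replicate_pmf b coin) (\<lambda>l. ((x 0 + ?Z b ?y l) ^ 4 + (- x 0 + ?Z b ?y l) ^ 4) / 2)"
      by (simp only: expect_replicate_Suc finite_coin Z expect_coin expect_add[OF fin, symmetric]
          integral_divide_zero[symmetric]) simp
    also have "\<dots> = x 0 ^ 4 + 6 * (x 0)\<^sup>2 * (\<Sum>q<b. (?y q)\<^sup>2) + expect (replicate_pmf b coin) (\<lambda>l. ?Z b ?y l ^ 4)"
      unfolding * by (simp only: expect_add[OF fin] integral_mult_right_zero 2) simp
    also have "\<dots> \<le> x 0 ^ 4 + 6 * (x 0)\<^sup>2 * (\<Sum>q<b. (?y q)\<^sup>2) + 3 * (\<Sum>q<b. (?y q)\<^sup>2)\<^sup>2"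
      using Suc.IH[of ?y] by simp
    also have "\<dots> \<le> 3 * ((x 0)\<^sup>2 + (\<Sum>q<b. (?y q)\<^sup>2))\<^sup>2"
    proof -
      have "3 * ((x 0)\<^sup>2 + s)\<^sup>2 = x 0 ^ 4 + 6 * (x 0)\<^sup>2 * s + 3 * s\<^sup>2 + 2 * ((x 0)\<^sup>2)\<^sup>2" for s
        by (simp add: power2_eq_square power4_eq_xxxx algebra_simps)
      then show ?thesis by simp
    qed
    finally show ?case by (simp add: sum.lessThan_Suc_shift del: sum.lessThan_Suc)
  qed simp
  from 2 4 show ?thesis by (auto simp: good4_def fin)
qed

lemma good4_mono: "good4 \<rho> sg I K \<Longrightarrow> K \<le> K' \<Longrightarrow> good4 \<rho> sg I K'"
  unfolding good4_def by (meson mult_right_mono order_trans zero_le_power2)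

text \<open>Condition on the second factor first.\<close>

lemma good4_tensor:
  fixes sg :: "'a \<Rightarrow> 'i \<Rightarrow> real"
  assumes g1: "good4 \<rho>1 sg1 I1 K1" and g2: "good4 \<rho>2 sg2 I2 K2"
    and \<rho>: "\<rho> = do {x \<leftarrow> \<rho>1; y \<leftarrow> \<rho>2; return_pmf (c x y)}"
    and sg: "\<And>x y i. x \<in> set_pmf \<rho>1 \<Longrightarrow> y \<in> set_pmf \<rho>2 \<Longrightarrow> i \<in> I \<Longrightarrow> sg (c x y) i = sg1 x (h1 i) * sg2 y (h2 i)"
    and I: "finite I" "h1 ` I \<subseteq> I1" "h2 ` I \<subseteq> I2" "inj_on (\<lambda>i. (h1 i, h2 i)) I"
  shows "good4 \<rho> sg I (K1 * K2)"
proof -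
  have fin: "finite (set_pmf \<rho>1)" "finite (set_pmf \<rho>2)" "finite I1" "finite I2"
    and K: "1 \<le> K1" "1 \<le> K2" using g1 g2 by (auto simp: good4_def)
  have ex: "expect \<rho> f = expect \<rho>2 (\<lambda>y. expect \<rho>1 (\<lambda>x. f (c x y)))" for f :: "_ \<Rightarrow> real"
  proof -
    have "\<rho> = do {y \<leftarrow> \<rho>2; x \<leftarrow> \<rho>1; return_pmf (c x y)}"
      unfolding \<rho> by (rule bind_commute_pmf)
    then show ?thesis by (simp add: expect_bind fin)
  qed
  show ?thesis unfolding good4_def
  proof (intro conjI allI)
    show "finite (set_pmf \<rho>)" using fin by (simp add: \<rho>)
    show "1 \<le> K1 * K2" using K mult_mono[of 1 K1 1 K2] by simp
    fix x :: "'i \<Rightarrow> real"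
    \<comment> \<open>The vector x rearranged as an I1 by I2 matrix, with zeros off the image of I.
      Injectivity of the index map makes the rearrangement preserve sums and norms.\<close>
    define X where "X p q = (if (p, q) \<in> (\<lambda>i. (h1 i, h2 i)) ` I
       then x (inv_into I (\<lambda>i. (h1 i, h2 i)) (p, q)) else 0)" for p q
    have re: "(\<Sum>p\<in>I1. \<Sum>q\<in>I2. F p q (X p q)) = (\<Sum>i\<in>I. F (h1 i) (h2 i) (x i))"
      if "\<And>p q. F p q 0 = (0::real)" for F
    proof -
      have "(\<Sum>p\<in>I1. \<Sum>q\<in>I2. F p q (X p q)) = (\<Sum>(p,q)\<in>I1\<times>I2. F p q (X p q))"
        by (simp add: sum.cartesian_product)
      also have "\<dots> = (\<Sum>(p,q)\<in>(\<lambda>i. (h1 i, h2 i)) ` I. F p q (X p q))"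
        using fin I by (intro sum.mono_neutral_right) (auto simp: X_def that)
      also have "\<dots> = (\<Sum>i\<in>I. F (h1 i) (h2 i) (X (h1 i) (h2 i)))"
        using I by (subst sum.reindex) auto
      also have "\<dots> = (\<Sum>i\<in>I. F (h1 i) (h2 i) (x i))"
        using inv_into_f_f[OF I(4)] by (intro sum.cong) (auto simp: X_def)
      finally show ?thesis .
    qed
    define Y where "Y l p = (\<Sum>q\<in>I2. sg2 l q * X p q)" for l p
    have lin: "(\<Sum>i\<in>I. sg (c l l') i * x i) = (\<Sum>p\<in>I1. sg1 l p * Y l' p)"
      if "l \<in> set_pmf \<rho>1" "l' \<in> set_pmf \<rho>2" for l l'
      using re[of "\<lambda>p q z. sg1 l p * (sg2 l' q * z)"] sg[OF that]
      by (simp add: Y_def sum_distrib_left mult.assoc)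
    have nrm: "(\<Sum>p\<in>I1. \<Sum>q\<in>I2. (X p q)\<^sup>2) = (\<Sum>i\<in>I. (x i)\<^sup>2)"
      using re[of "\<lambda>p q z. z\<^sup>2"] by simp
    have "expect \<rho> (\<lambda>l. (\<Sum>i\<in>I. sg l i * x i)\<^sup>2)
       = expect \<rho>2 (\<lambda>y. expect \<rho>1 (\<lambda>l. (\<Sum>p\<in>I1. sg1 l p * Y y p)\<^sup>2))"
      unfolding ex by (intro expect_cong) (simp add: lin)
    also have "\<dots> = expect \<rho>2 (\<lambda>y. \<Sum>p\<in>I1. (Y y p)\<^sup>2)"
      using g1 by (simp add: good4_def)
    also have "\<dots> = (\<Sum>p\<in>I1. \<Sum>q\<in>I2. (X p q)\<^sup>2)"
      using g2 by (simp add: expect_sum[OF fin(2)] good4_def Y_def)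
    finally show "expect \<rho> (\<lambda>l. (\<Sum>i\<in>I. sg l i * x i)\<^sup>2) = (\<Sum>i\<in>I. (x i)\<^sup>2)"
      by (simp add: nrm)
    have "expect \<rho> (\<lambda>l. (\<Sum>i\<in>I. sg l i * x i) ^ 4)
       = expect \<rho>2 (\<lambda>y. expect \<rho>1 (\<lambda>l. (\<Sum>p\<in>I1. sg1 l p * Y y p) ^ 4))"
      unfolding ex by (intro expect_cong) (simp add: lin)
    also have "\<dots> \<le> expect \<rho>2 (\<lambda>y. K1 * (\<Sum>p\<in>I1. (Y y p)\<^sup>2)\<^sup>2)"
      using g1 by (intro expect_mono fin) (simp add: good4_def)
    \<comment> \<open>Squaring the sum over p produces mixed moments of pairs of rows of X. Their
      bounds, K2 times the product of the squared row norms, add up to a perfect square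
      again.\<close>
    also have "\<dots> = K1 * (\<Sum>p\<in>I1. \<Sum>p'\<in>I1. expect \<rho>2 (\<lambda>y. (Y y p)\<^sup>2 * (Y y p')\<^sup>2))"
      by (simp add: power2_eq_square[of "sum _ _"] sum_product expect_sum[OF fin(2)])
    also have "\<dots> \<le> K1 * (\<Sum>p\<in>I1. \<Sum>p'\<in>I1. K2 * (\<Sum>q\<in>I2. (X p q)\<^sup>2) * (\<Sum>q\<in>I2. (X p' q)\<^sup>2))"
      using K unfolding Y_def by (intro mult_left_mono sum_mono good4_mixed[OF g2]) auto
    also have "\<dots> = K1 * K2 * (\<Sum>p\<in>I1. \<Sum>q\<in>I2. (X p q)\<^sup>2)\<^sup>2"
    proof -
      have "K1 * (\<Sum>p\<in>I1. \<Sum>p'\<in>I1. K2 * a p * a p') = K1 * K2 * (\<Sum>p\<in>I1. a p)\<^sup>2" for a :: "_ \<Rightarrow> real"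
        by (simp add: power2_eq_square sum_product sum_distrib_left mult_ac)
      then show ?thesis .
    qed
    finally show "expect \<rho> (\<lambda>l. (\<Sum>i\<in>I. sg l i * x i) ^ 4) \<le> K1 * K2 * (\<Sum>i\<in>I. (x i)\<^sup>2)\<^sup>2"
      by (simp add: nrm)
  qed (use I in auto)
qed

section \<open>Independent rows\<close>

lemma expect_replicate_prod:
  assumes "finite (set_pmf p)"
  shows "expect (replicate_pmf m p) (\<lambda>xs. prod_list (map G xs)) = expect p G ^ m"
  using assms by (induction m) (simp_all add: expect_replicate_Suc)

lemma expect_replicate_sum:
  assumes "finite (set_pmf p)"
  shows "expect (replicate_pmf m p) (\<lambda>xs. sum_list (map G xs)) = m * expect p G"
  using assms
  by (induction m) (simp_all add: expect_replicate_Suc expect_add finite_replicate_pmf algebra_simps)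

lemma expect_replicate_sum_sq:
  assumes fin: "finite (set_pmf p)" and 0: "expect p G = 0"
  shows "expect (replicate_pmf m p) (\<lambda>xs. (sum_list (map G xs))\<^sup>2) = m * expect p (\<lambda>x. (G x)\<^sup>2)"
proof (induction m)
  case (Suc m)
  let ?r = "replicate_pmf m p"
  have f: "finite (set_pmf ?r)" using fin by (rule finite_replicate_pmf)
  have "expect ?r (\<lambda>xs. (sum_list (map G (x # xs)))\<^sup>2) =
     (G x)\<^sup>2 + 2 * G x * expect ?r (\<lambda>xs. sum_list (map G xs)) + expect ?r (\<lambda>xs. (sum_list (map G xs))\<^sup>2)" for x
    by (simp add: power2_sum expect_add[OF f])
  then have "expect ?r (\<lambda>xs. (sum_list (map G (x # xs)))\<^sup>2) = (G x)\<^sup>2 + m * expect p (\<lambda>x. (G x)\<^sup>2)" for x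
    by (simp add: Suc.IH expect_replicate_sum[OF fin] 0)
  then show ?case by (simp only: expect_replicate_Suc[OF fin]) (simp add: expect_add[OF fin] algebra_simps)
qed simp

text \<open>The third-order Maclaurin remainder carries the sign of (-y)^3.\<close>

lemma exp_neg_le:
  fixes y :: real
  assumes "y \<ge> 0"
  shows "exp (- y) \<le> 1 - y + y\<^sup>2 / 2"
proof -
  have "\<exists>t. \<bar>t\<bar> \<le> \<bar>- y\<bar> \<and> exp (- y) = (\<Sum>m<3. (- y) ^ m / fact m) + exp t / fact 3 * (- y) ^ 3"
    by (rule Maclaurin_exp_le)
  then obtain t where "exp (- y) = (\<Sum>m<3. (- y) ^ m / fact m) + exp t / fact 3 * (- y) ^ 3" by blast
  moreover have "(\<Sum>m<3. (- y) ^ m / fact m) = 1 - y + y\<^sup>2 / 2"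
    by (simp add: numeral_3_eq_3 power2_eq_square)
  moreover have "exp t / fact 3 * (- y) ^ 3 \<le> 0"
    using assms by (auto intro!: mult_nonneg_nonpos simp: power3_eq_cube)
  ultimately show ?thesis by linarith
qed

text \<open>Chernoff's method applied to \<open>exp (- \<lambda> Z\<^sup>2)\<close> needs only a fourth moment, since
  \<open>exp (- y) \<le> 1 - y + y\<^sup>2 / 2\<close> for \<open>y \<ge> 0\<close>.\<close>

lemma good4_lower_tail:
  assumes g: "good4 \<rho> sg I K" and \<eta>: "0 < \<eta>" "\<eta> < 1"
  shows "measure_pmf.prob (replicate_pmf m \<rho>)
     {xs. (\<Sum>l\<leftarrow>xs. (\<Sum>i\<in>I. sg l i * x i)\<^sup>2) < (1 - \<eta>) * m * (\<Sum>i\<in>I. (x i)\<^sup>2)}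
     \<le> exp (- (\<eta>\<^sup>2 * m / (2 * K)))" (is "?P \<le> _")
proof -
  let ?a = "\<Sum>i\<in>I. (x i)\<^sup>2" and ?Z = "\<lambda>l. \<Sum>i\<in>I. sg l i * x i"
  have fin: "finite (set_pmf \<rho>)" and K: "1 \<le> K" using g by (auto simp: good4_def)
  have finr: "finite (set_pmf (replicate_pmf m \<rho>))" using fin by (rule finite_replicate_pmf)
  have nn: "?a \<ge> 0" by (auto intro: sum_nonneg)
  show ?thesis
  proof (cases "?a = 0")
    case True
    have "\<not> (\<Sum>l\<leftarrow>xs. (?Z l)\<^sup>2) < 0" for xs by (auto simp: not_less intro!: sum_list_nonneg)
    with True show ?thesis by simp
  next
    case False
    with nn have a: "?a > 0" by simp
    \<comment> \<open>With a the squared norm, this is the minimiser of - c \<eta> a + c^2 K a^2 /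
      2, the exponent contributed by one row. The minimum is - \<eta>^2 / (2 K).\<close>
    define c where "c = \<eta> / K / ?a"
    have c: "c > 0" using \<eta> K a by (simp add: c_def)
    have "expect \<rho> (\<lambda>l. exp (- c * (?Z l)\<^sup>2)) \<le> expect \<rho> (\<lambda>l. 1 - c * (?Z l)\<^sup>2 + c\<^sup>2 / 2 * ?Z l ^ 4)"
    proof (rule expect_mono[OF fin])
      fix l
      show "exp (- c * (?Z l)\<^sup>2) \<le> 1 - c * (?Z l)\<^sup>2 + c\<^sup>2 / 2 * ?Z l ^ 4"
        using exp_neg_le[of "c * (?Z l)\<^sup>2"] c by (simp add: power_mult_distrib flip: power_mult)
    qed
    also have "\<dots> = 1 - c * expect \<rho> (\<lambda>l. (?Z l)\<^sup>2) + c\<^sup>2 / 2 * expect \<rho> (\<lambda>l. ?Z l ^ 4)"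
      by (simp only: expect_add[OF fin] expect_diff[OF fin] integral_mult_right_zero) simp
    also have "\<dots> \<le> 1 - c * ?a + c\<^sup>2 / 2 * (K * ?a\<^sup>2)"
      using g c by (intro add_mono diff_mono mult_left_mono) (auto simp: good4_def)
    also have "\<dots> = 1 + (- (\<eta> / K) + \<eta>\<^sup>2 / K / 2)"
      using a K by (simp add: c_def power2_eq_square field_simps)
    also have "\<dots> \<le> exp (- (\<eta> / K) + \<eta>\<^sup>2 / K / 2)" by (rule exp_ge_add_one_self)
    finally have E: "expect \<rho> (\<lambda>l. exp (- c * (?Z l)\<^sup>2)) \<le> exp (- (\<eta> / K) + \<eta>\<^sup>2 / K / 2)" .
    define \<theta> where "\<theta> = exp (- c * ((1 - \<eta>) * m * ?a))"
    have "?P \<le> measure_pmf.prob (replicate_pmf m \<rho>) {xs. \<theta> \<le> prod_list (map (\<lambda>l. exp (- c * (?Z l)\<^sup>2)) xs)}"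
    proof (rule measure_pmf.finite_measure_mono)
      have "prod_list (map (\<lambda>l. exp (- c * (?Z l)\<^sup>2)) xs) = exp (- c * (\<Sum>l\<leftarrow>xs. (?Z l)\<^sup>2))" for xs
        by (induction xs) (simp_all add: exp_add[symmetric] algebra_simps)
      then show "{xs. (\<Sum>l\<leftarrow>xs. (?Z l)\<^sup>2) < (1 - \<eta>) * m * ?a} \<subseteq>
          {xs. \<theta> \<le> prod_list (map (\<lambda>l. exp (- c * (?Z l)\<^sup>2)) xs)}"
        using c by (auto simp: \<theta>_def)
    qed simp
    also have "\<dots> \<le> expect (replicate_pmf m \<rho>) (\<lambda>xs. prod_list (map (\<lambda>l. exp (- c * (?Z l)\<^sup>2)) xs)) / \<theta>"
      by (rule markov_pmf[OF finr]) (auto simp: \<theta>_def intro!: prod_list_nonneg)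
    also have "\<dots> = expect \<rho> (\<lambda>l. exp (- c * (?Z l)\<^sup>2)) ^ m / \<theta>"
      by (simp only: expect_replicate_prod[OF fin])
    also have "\<dots> \<le> exp (- (\<eta> / K) + \<eta>\<^sup>2 / K / 2) ^ m / \<theta>"
      using E by (intro divide_right_mono power_mono) (auto simp: \<theta>_def intro: expect_nonneg)
    also have "\<dots> = exp (m * (- (\<eta> / K) + \<eta>\<^sup>2 / K / 2) + c * ((1 - \<eta>) * m * ?a))"
      by (simp add: \<theta>_def exp_of_nat_mult[symmetric] exp_diff[symmetric])
    also have "m * (- (\<eta> / K) + \<eta>\<^sup>2 / K / 2) + c * ((1 - \<eta>) * m * ?a) = - (\<eta>\<^sup>2 * m / (2 * K))"
      using a K by (simp add: c_def power2_eq_square field_simps)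
    finally show ?thesis .
  qed
qed

text \<open>Chebyshev's inequality, with a second moment measured relative to F^2 so that scaling G
  changes nothing. If F = 0, the deviation to be detected is itself 0; then G vanishes on the
  support and the event is impossible.\<close>

lemma sum_upper_tail:
  assumes fin: "finite (set_pmf \<rho>)" and E: "expect \<rho> G = F" and E2: "expect \<rho> (\<lambda>l. (G l)\<^sup>2) \<le> K * F\<^sup>2"
    and pos: "\<And>l. l \<in> set_pmf \<rho> \<Longrightarrow> G l \<ge> 0" and m: "m > 0" and \<eta>: "\<eta> > 0" and K: "K \<ge> 0"
  shows "measure_pmf.prob (replicate_pmf m \<rho>) {xs. (\<Sum>l\<leftarrow>xs. G l) > (1 + \<eta>) * m * F} \<le> K / (m * \<eta>\<^sup>2)"
proof -
  have finr: "finite (set_pmf (replicate_pmf m \<rho>))" using fin by (rule finite_replicate_pmf)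
  have F: "F \<ge> 0" using E expect_nonneg[of \<rho> G] pos by simp
  have len: "length xs = m" if "xs \<in> set_pmf (replicate_pmf m \<rho>)" for xs
    using that by (simp add: set_replicate_pmf)
  have E2': "expect \<rho> (\<lambda>l. (G l - F)\<^sup>2) \<le> K * F\<^sup>2"
  proof -
    have "expect \<rho> (\<lambda>l. (G l - F)\<^sup>2) = expect \<rho> (\<lambda>l. (G l)\<^sup>2 - (2 * F) * G l + F\<^sup>2)"
      by (rule expect_cong) (simp add: power2_eq_square algebra_simps)
    also have "\<dots> = expect \<rho> (\<lambda>l. (G l)\<^sup>2) - F\<^sup>2"
      by (simp only: expect_add[OF fin] expect_diff[OF fin] integral_mult_right_zero E)
         (simp add: power2_eq_square)
    finally show ?thesis using E2 zero_le_power2[of F] by linarith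
  qed
  have E0: "expect \<rho> (\<lambda>l. G l - F) = 0" by (simp add: expect_diff[OF fin] E)
  show ?thesis
  proof (cases "F = 0")
    case True
    have "AE l in \<rho>. G l = 0"
      using E[unfolded True] fin pos
      by (subst (asm) integral_nonneg_eq_0_iff_AE) (auto simp: AE_measure_pmf_iff intro: integrable_measure_pmf_finite)
    then have G0: "G l = 0" if "l \<in> set_pmf \<rho>" for l using that by (simp add: AE_measure_pmf_iff)
    have "measure_pmf.prob (replicate_pmf m \<rho>) {xs. (\<Sum>l\<leftarrow>xs. G l) > (1 + \<eta>) * m * F} = 0"
    proof (subst measure_pmf_zero_iff, rule ccontr)
      assume "\<not> set_pmf (replicate_pmf m \<rho>) \<inter> {xs. (1 + \<eta>) * real m * F < sum_list (map G xs)} = {}"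
      then obtain xs where "xs \<in> set_pmf (replicate_pmf m \<rho>)" "0 < sum_list (map G xs)" using True by auto
      moreover then have "sum_list (map G xs) = 0"
        using G0 by (intro sum_list_0[THEN trans[rotated], of _ xs] arg_cong[of _ _ sum_list] map_cong) (auto simp: set_replicate_pmf)
      ultimately show False by simp
    qed
    then show ?thesis using K m \<eta> by simp
  next
    case False
    with F have F: "F > 0" by simp
    define a where "a = (\<eta> * m * F)\<^sup>2"
    have a: "a > 0" using F m \<eta> by (simp add: a_def)
    have "measure_pmf.prob (replicate_pmf m \<rho>) {xs. (\<Sum>l\<leftarrow>xs. G l) > (1 + \<eta>) * m * F}
      \<le> measure_pmf.prob (replicate_pmf m \<rho>) {xs. a \<le> (\<Sum>l\<leftarrow>xs. G l - F)\<^sup>2}"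
    proof (rule measure_pmf.finite_measure_mono_AE)
      have "a \<le> (\<Sum>l\<leftarrow>xs. G l - F)\<^sup>2"
        if xs: "xs \<in> set_pmf (replicate_pmf m \<rho>)" and gt: "(\<Sum>l\<leftarrow>xs. G l) > (1 + \<eta>) * m * F" for xs
      proof -
        have "(\<Sum>l\<leftarrow>xs. G l - F) = (\<Sum>l\<leftarrow>xs. G l) - m * F"
          by (simp add: sum_list_subtractf sum_list_triv len[OF xs])
        then show ?thesis unfolding a_def using gt F m \<eta> by (intro power_mono) (auto simp: algebra_simps)
      qed
      then show "AE xs in replicate_pmf m \<rho>. xs \<in> {xs. (\<Sum>l\<leftarrow>xs. G l) > (1 + \<eta>) * m * F} \<longrightarrow>
          xs \<in> {xs. a \<le> (\<Sum>l\<leftarrow>xs. G l - F)\<^sup>2}"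
        by (auto simp: AE_measure_pmf_iff)
    qed simp
    also have "\<dots> \<le> expect (replicate_pmf m \<rho>) (\<lambda>xs. (\<Sum>l\<leftarrow>xs. G l - F)\<^sup>2) / a"
      using a by (intro markov_pmf[OF finr]) auto
    also have "\<dots> = m * expect \<rho> (\<lambda>l. (G l - F)\<^sup>2) / a"
      by (subst expect_replicate_sum_sq[OF fin E0]) simp
    also have "\<dots> \<le> m * (K * F\<^sup>2) / a"
      using E2' a by (intro divide_right_mono mult_left_mono) auto
    also have "\<dots> = K / (m * \<eta>\<^sup>2)" using F m \<eta> by (simp add: a_def power2_eq_square field_simps)
    finally show ?thesis .
  qed
qed

section \<open>Least squares by Greville's recursion\<close>

text \<open>Column \<open>p\<close> of M minus its projection onto the earlier columns, when
  \<open>N\<close> is their pseudo-inverse. Dividing by its squared norm, as \<open>dual_row\<close>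
  does, gives the row that Greville's method appends.\<close>

definition residual :: "nat \<Rightarrow> (nat \<Rightarrow> nat \<Rightarrow> real) \<Rightarrow> (nat \<Rightarrow> nat \<Rightarrow> real) \<Rightarrow> nat \<Rightarrow> nat \<Rightarrow> real" where
  "residual s M N p x = M x p - (\<Sum>a<p. (\<Sum>y<s. N a y * M y p) * M x a)"

definition dual_row :: "nat \<Rightarrow> (nat \<Rightarrow> nat \<Rightarrow> real) \<Rightarrow> (nat \<Rightarrow> nat \<Rightarrow> real) \<Rightarrow> nat \<Rightarrow> nat \<Rightarrow> real" where
  "dual_row s M N p x = residual s M N p x / (\<Sum>y<s. residual s M N p y * residual s M N p y)"

text \<open>\<open>pinv s M p\<close> is the pseudo-inverse of the first \<open>p\<close> columns of the \<open>s\<close>-row matrix \<open>M\<close> when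
  these are independent. If the residual vanishes, division by zero yields a zero row, which still
  leaves \<open>M * pinv s M p\<close> the orthogonal projection onto the column span.\<close>

primrec pinv :: "nat \<Rightarrow> (nat \<Rightarrow> nat \<Rightarrow> real) \<Rightarrow> nat \<Rightarrow> nat \<Rightarrow> nat \<Rightarrow> real" where
  "pinv s M 0 = (\<lambda>_ _. 0)"
| "pinv s M (Suc p) = (\<lambda>a x.
     if a = p then dual_row s M (pinv s M p) p x
     else if a < p then pinv s M p a x - (\<Sum>y<s. pinv s M p a y * M y p) * dual_row s M (pinv s M p) p x
     else 0)"

text \<open>Each step adds the rank-one matrix r r^T / (r . r), where the residual r is orthogonal
  to the earlier columns. Symmetry and reproduction of the columns must be proved together:
  orthogonality of r uses the symmetry of the previous projection.\<close>

lemma pinv_projection: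
  fixes M :: "nat \<Rightarrow> nat \<Rightarrow> real" and s :: nat
  defines "Pr \<equiv> \<lambda>p x y. \<Sum>a<p. M x a * pinv s M p a y"
  shows "Pr p x y = Pr p y x \<and> (\<forall>b<p. \<forall>x<s. (\<Sum>y<s. Pr p x y * M y b) = M x b)"
proof (induction p arbitrary: x y)
  case 0
  then show ?case by (simp add: Pr_def)
next
  case (Suc p)
  define N where "N = pinv s M p"
  define r where "r = residual s M N p"
  define rr where "rr = (\<Sum>y<s. r y * r y)"
  have sym: "Pr p x y = Pr p y x" for x y using Suc.IH by blast
  have proj: "(\<Sum>y<s. Pr p x y * M y b) = M x b" if "b < p" "x < s" for b x using Suc.IH that by blast
  have Prp: "Pr p x y = (\<Sum>a<p. M x a * N a y)" for x y by (simp add: Pr_def N_def)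
  define g where "g a = (\<Sum>y<s. N a y * M y p)" for a
  have Prm: "(\<Sum>y<s. Pr p x y * M y p) = (\<Sum>a<p. (\<Sum>y<s. N a y * M y p) * M x a)" for x
    unfolding Prp sum_distrib_right by (subst sum.swap) (simp add: mult_ac)
  have r: "r x = M x p - (\<Sum>y<s. Pr p x y * M y p)" for x
    by (simp add: r_def residual_def Prm)
  have rg: "r x = M x p - (\<Sum>a<p. g a * M x a)" for x
    by (simp add: r_def residual_def g_def)
  have dual: "dual_row s M N p x = r x / rr" for x by (simp add: dual_row_def r_def rr_def)
  have step: "Pr (Suc p) x y = Pr p x y + r x * r y / rr" for x y
  proof -
    have eq: "(\<Sum>a<p. M x a * (N a y - g a * t)) = Pr p x y - (\<Sum>a<p. g a * M x a) * t" for t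
      by (simp add: Prp right_diff_distrib sum_subtractf sum_distrib_left sum_distrib_right mult_ac)
    have "Pr (Suc p) x y = (\<Sum>a<p. M x a * (N a y - g a * (r y / rr))) + M x p * (r y / rr)"
      by (simp add: Pr_def N_def[symmetric] g_def dual)
    also have "\<dots> = Pr p x y + r x * (r y / rr)"
      unfolding eq rg[of x] by (simp only: left_diff_distrib)
    finally show ?thesis by simp
  qed
  have orth: "(\<Sum>x<s. r x * M x b) = 0" if "b < p" for b
  proof -
    have "(\<Sum>x<s. \<Sum>y<s. Pr p x y * M y p * M x b) = (\<Sum>y<s. M y p * (\<Sum>x<s. Pr p y x * M x b))"
      by (subst sum.swap) (simp add: sum_distrib_left sym[of _ y for y] mult_ac)
    also have "\<dots> = (\<Sum>y<s. M y p * M y b)" using proj[OF that] by (intro sum.cong) auto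
    finally show ?thesis
      by (simp add: r left_diff_distrib sum_subtractf sum_distrib_right)
  qed
  have rm: "(\<Sum>x<s. r x * M x p) = rr"
  proof -
    have "(\<Sum>x<s. r x * (\<Sum>a<p. g a * M x a)) = (\<Sum>a<p. g a * (\<Sum>x<s. r x * M x a))"
      unfolding sum_distrib_left by (subst sum.swap) (simp add: mult_ac)
    then have "(\<Sum>x<s. r x * (\<Sum>a<p. g a * M x a)) = 0" by (simp add: orth)
    moreover have "rr = (\<Sum>x<s. r x * M x p - r x * (\<Sum>a<p. g a * M x a))"
      unfolding rr_def by (intro sum.cong refl) (subst (2) rg, simp only: right_diff_distrib)
    ultimately show ?thesis by (simp add: sum_subtractf)
  qed
  have "(\<Sum>y<s. Pr (Suc p) x y * M y b) = M x b" if b: "b < Suc p" and x: "x < s" for b x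
  proof -
    have e: "(\<Sum>y<s. Pr (Suc p) x y * M y b) = (\<Sum>y<s. Pr p x y * M y b) + r x / rr * (\<Sum>y<s. r y * M y b)"
    proof -
      have "Pr (Suc p) x y * M y b = Pr p x y * M y b + r x / rr * (r y * M y b)" for y
        by (simp add: step distrib_right)
      then show ?thesis by (simp only: sum.distrib sum_distrib_left)
    qed
    show ?thesis
    proof (cases "b = p")
      case True
      show ?thesis
      proof (cases "rr = 0")
        case True
        then have "r x = 0" using x by (simp add: rr_def sum_nonneg_eq_0_iff)
        then show ?thesis using e r[of x] \<open>b = p\<close> by simp
      next
        case False
        then show ?thesis using e r[of x] rm \<open>b = p\<close> by simp
      qed
    next
      case False
      with b have "b < p" by simp
      then show ?thesis using e orth proj x by simp
    qed
  qed
  then show ?case using sym by (auto simp: step mult_ac)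
qed

text \<open>M^T Pr = (Pr M)^T = M^T for the symmetric projection Pr. This covers dependent columns
  as well, which wrong guesses and empty clusters produce.\<close>

lemma pinv_normal_equations:
  assumes "a < k"
  shows "(\<Sum>x<s. M x a * (\<Sum>b<k. M x b * (\<Sum>y<s. pinv s M k b y * z y))) = (\<Sum>x<s. M x a * z x)"
proof -
  let ?Pr = "\<lambda>x y. \<Sum>b<k. M x b * pinv s M k b y"
  have "(\<Sum>b<k. M x b * (\<Sum>y<s. pinv s M k b y * z y)) = (\<Sum>y<s. ?Pr x y * z y)" for x
    unfolding sum_distrib_left sum_distrib_right by (subst sum.swap) (simp add: mult_ac)
  then have "(\<Sum>x<s. M x a * (\<Sum>b<k. M x b * (\<Sum>y<s. pinv s M k b y * z y)))
     = (\<Sum>y<s. z y * (\<Sum>x<s. ?Pr x y * M x a))"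
    by (simp add: sum_distrib_left sum_distrib_right mult_ac) (subst sum.swap, simp add: mult_ac)
  also have "\<dots> = (\<Sum>y<s. z y * M y a)"
  proof (intro sum.cong refl)
    fix y assume "y \<in> {..<s}"
    have "(\<Sum>x<s. ?Pr x y * M x a) = (\<Sum>x<s. ?Pr y x * M x a)"
      by (intro sum.cong refl, subst conjunct1[OF pinv_projection]) auto
    also have "\<dots> = M y a"
      using pinv_projection[where M=M and s=s and p=k and x=y] assms \<open>y \<in> _\<close> by blast
    finally show "z y * (\<Sum>x<s. ?Pr x y * M x a) = z y * M y a" by simp
  qed
  finally show ?thesis by (simp add: mult.commute)
qed

section \<open>Smallest singular values through a grid\<close>

text \<open>Write t as a convex combination of the two endpoints, with weight \<theta> on the right
  one. The same combination of the values exceeds the value at t by \<alpha> h^2 \<theta> (1 -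
  \<theta>), and some endpoint is no worse than the average. Since \<alpha> may be negative, the
  error is expressed by a nonnegative upper bound A.\<close>

lemma quadratic_rounding:
  fixes \<alpha> \<beta> \<gamma> l h t A :: real
  assumes "\<alpha> \<le> A" "0 \<le> A" "0 < h" "l \<le> t" "t \<le> l + h"
  shows "\<exists>t'\<in>{l, l + h}. \<alpha> * t'\<^sup>2 + \<beta> * t' + \<gamma> \<le> \<alpha> * t\<^sup>2 + \<beta> * t + \<gamma> + A * h\<^sup>2 / 4"
proof -
  let ?f = "\<lambda>t. \<alpha> * t\<^sup>2 + \<beta> * t + \<gamma>"
  define \<theta> where "\<theta> = (t - l) / h"
  have t: "t = l + \<theta> * h" and \<theta>: "0 \<le> \<theta>" "\<theta> \<le> 1" using assms by (auto simp: \<theta>_def field_simps)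
  have eq: "(1 - \<theta>) * ?f l + \<theta> * ?f (l + h) = ?f t + \<alpha> * h\<^sup>2 * (\<theta> * (1 - \<theta>))"
    by (simp add: t power2_eq_square algebra_simps)
  have "\<theta> * (1 - \<theta>) \<le> 1 / 4" using zero_le_power2[of "\<theta> - 1/2"] by (simp add: power2_eq_square algebra_simps)
  then have "\<alpha> * h\<^sup>2 * (\<theta> * (1 - \<theta>)) \<le> A * h\<^sup>2 * (1 / 4)"
    using assms \<theta> by (intro mult_mono mult_right_mono) auto
  with eq have le: "(1 - \<theta>) * ?f l + \<theta> * ?f (l + h) \<le> ?f t + A * h\<^sup>2 / 4" by simp
  have conv: "x \<le> z \<or> y \<le> z" if xy: "(1 - \<theta>) * x + \<theta> * y \<le> z" for x y z :: real
  proof (rule ccontr)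
    assume "\<not> ?thesis"
    then have pos: "x - z > 0" "y - z > 0" by auto
    have "0 \<le> (1 - \<theta>) * (x - z)" "0 \<le> \<theta> * (y - z)" using pos \<theta> by auto
    moreover have "(1 - \<theta>) * (x - z) + \<theta> * (y - z) \<le> 0" using xy by (simp add: algebra_simps)
    ultimately have "(1 - \<theta>) * (x - z) = 0" "\<theta> * (y - z) = 0" by linarith+
    then show False using pos by auto
  qed
  from conv[OF le] show ?thesis by blast
qed

text \<open>Rounding each coordinate of \<open>u\<close> to a neighbouring multiple of \<open>h\<close> in the better of the two
  directions increases a quadratic form by at most \<open>h\<^sup>2 / 4\<close> times the positive part of its trace.\<close>

lemma quadratic_form_rounding:
  fixes H :: "nat \<Rightarrow> nat \<Rightarrow> real" and c h :: real and w u :: "nat \<Rightarrow> real" and s k :: nat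
  defines "q \<equiv> \<lambda>u. (\<Sum>r<s. (\<Sum>a<k. H r a * u a)\<^sup>2) - c * (\<Sum>a<k. w a * (u a)\<^sup>2)"
  assumes h: "0 < h" and c: "0 \<le> c" and w: "\<And>a. 0 \<le> w a"
  shows "\<exists>z :: nat \<Rightarrow> int. (\<forall>a<k. z a = \<lfloor>u a / h\<rfloor> \<or> z a = \<lfloor>u a / h\<rfloor> + 1) \<and>
     q (\<lambda>a. h * z a) \<le> q u + (\<Sum>a<k. \<Sum>r<s. (H r a)\<^sup>2) * h\<^sup>2 / 4"
proof -
  \<comment> \<open>Hybrid vectors with the first p coordinates rounded. As a function of coordinate
    p alone the form is a quadratic polynomial, whose leading coefficient is at most the squared
    norm of column p of H.\<close>
  define zs where "zs p z = (\<lambda>a. if a < p then h * real_of_int (z a) else u a)" for p z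
  have "p \<le> k \<Longrightarrow> \<exists>z :: nat \<Rightarrow> int. (\<forall>a<p. z a = \<lfloor>u a / h\<rfloor> \<or> z a = \<lfloor>u a / h\<rfloor> + 1) \<and>
     q (zs p z) \<le> q u + (\<Sum>a<p. \<Sum>r<s. (H r a)\<^sup>2) * h\<^sup>2 / 4" for p
  proof (induction p)
    case 0
    then show ?case by (simp add: zs_def)
  next
    case (Suc p)
    then obtain z :: "nat \<Rightarrow> int" where z: "\<And>a. a < p \<Longrightarrow> z a = \<lfloor>u a / h\<rfloor> \<or> z a = \<lfloor>u a / h\<rfloor> + 1"
      and qz: "q (zs p z) \<le> q u + (\<Sum>a<p. \<Sum>r<s. (H r a)\<^sup>2) * h\<^sup>2 / 4" by auto
    let ?v = "zs p z" and ?l = "h * \<lfloor>u p / h\<rfloor>"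
    have p: "p < k" using Suc by simp
    define R where "R r = (\<Sum>a\<in>{..<k}-{p}. H r a * ?v a)" for r
    define \<alpha> where "\<alpha> = (\<Sum>r<s. (H r p)\<^sup>2) - c * w p"
    define \<beta> where "\<beta> = (\<Sum>r<s. 2 * H r p * R r)"
    define \<gamma> where "\<gamma> = (\<Sum>r<s. (R r)\<^sup>2) - c * (\<Sum>a\<in>{..<k}-{p}. w a * (?v a)\<^sup>2)"
    have quad: "q (?v(p := t)) = \<alpha> * t\<^sup>2 + \<beta> * t + \<gamma>" for t
    proof -
      have "(\<Sum>a<k. H r a * (?v(p := t)) a) = H r p * t + R r" for r
        using p by (subst sum.remove[of _ p]) (auto simp: R_def intro!: sum.cong)
      moreover have "(\<Sum>a<k. w a * ((?v(p := t)) a)\<^sup>2) = w p * t\<^sup>2 + (\<Sum>a\<in>{..<k}-{p}. w a * (?v a)\<^sup>2)"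
        using p by (subst sum.remove[of _ p]) (auto intro!: sum.cong)
      moreover have "(\<Sum>r<s. (H r p * t + R r)\<^sup>2) = (\<Sum>r<s. (H r p)\<^sup>2) * t\<^sup>2 + \<beta> * t + (\<Sum>r<s. (R r)\<^sup>2)"
        by (simp add: \<beta>_def power2_sum sum.distrib sum_distrib_left sum_distrib_right power_mult_distrib mult_ac)
      ultimately show ?thesis by (simp add: q_def \<alpha>_def \<gamma>_def algebra_simps)
    qed
    have "\<exists>t'\<in>{?l, ?l + h}. \<alpha> * t'\<^sup>2 + \<beta> * t' + \<gamma> \<le> \<alpha> * (u p)\<^sup>2 + \<beta> * u p + \<gamma> + (\<Sum>r<s. (H r p)\<^sup>2) * h\<^sup>2 / 4"
    proof (rule quadratic_rounding)
      show "\<alpha> \<le> (\<Sum>r<s. (H r p)\<^sup>2)" using c w[of p] by (simp add: \<alpha>_def)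
      have "\<lfloor>u p / h\<rfloor> \<le> u p / h" "u p / h \<le> \<lfloor>u p / h\<rfloor> + 1" by linarith+
      then have "h * \<lfloor>u p / h\<rfloor> \<le> h * (u p / h)" "h * (u p / h) \<le> h * (\<lfloor>u p / h\<rfloor> + 1)"
        using h by (intro mult_left_mono; simp)+
      then show "?l \<le> u p" "u p \<le> ?l + h" using h by (auto simp: distrib_left)
    qed (use h in \<open>auto intro: sum_nonneg\<close>)
    then obtain b where b: "b = \<lfloor>u p / h\<rfloor> \<or> b = \<lfloor>u p / h\<rfloor> + 1"
      and le: "q (?v(p := h * b)) \<le> q (?v(p := u p)) + (\<Sum>r<s. (H r p)\<^sup>2) * h\<^sup>2 / 4"
      unfolding quad by (fastforce simp: distrib_left)
    have "?v(p := u p) = ?v" "?v(p := h * b) = zs (Suc p) (z(p := b))" by (auto simp: zs_def fun_eq_iff)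
    with le qz have "q (zs (Suc p) (z(p := b))) \<le> q u + (\<Sum>a<Suc p. \<Sum>r<s. (H r a)\<^sup>2) * h\<^sup>2 / 4"
      by (simp add: distrib_right add_divide_distrib)
    moreover have "\<forall>a<Suc p. (z(p := b)) a = \<lfloor>u a / h\<rfloor> \<or> (z(p := b)) a = \<lfloor>u a / h\<rfloor> + 1"
      using z b by (auto simp: less_Suc_eq)
    ultimately show ?case by blast
  qed
  from this[of k] obtain z :: "nat \<Rightarrow> int" where z: "\<forall>a<k. z a = \<lfloor>u a / h\<rfloor> \<or> z a = \<lfloor>u a / h\<rfloor> + 1"
    "q (zs k z) \<le> q u + (\<Sum>a<k. \<Sum>r<s. (H r a)\<^sup>2) * h\<^sup>2 / 4" by auto
  moreover have "q (zs k z) = q (\<lambda>a. h * z a)" by (simp add: q_def zs_def)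
  ultimately show ?thesis by auto
qed

text \<open>These points contain every rounding of a unit vector at mesh 1 / sqrt (24 k), since 12 k
  + 3 k / 2 \<le> 14 k. The bound on the sum of the |z a| keeps their number at exp (O(k)), where
  the surrounding box alone would have about k^k points.\<close>

definition grid :: "nat \<Rightarrow> (nat \<Rightarrow> int) set" where
  "grid k = {z \<in> {..<k} \<rightarrow>\<^sub>E {- int (14 * k)..int (14 * k)}. (\<Sum>a<k. \<bar>z a\<bar>) \<le> int (14 * k)}"

lemma finite_grid: "finite (grid k)"
  unfolding grid_def by (intro finite_subset[OF _ finite_PiE[of "{..<k}" "\<lambda>_. {- int (14 * k)..int (14 * k)}"]]) auto

lemma sum_half_powers: "(\<Sum>i\<in>{- int R..int R}. (1/2 :: real) ^ nat \<bar>i\<bar>) \<le> 3"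
proof -
  have "(\<Sum>i\<in>{- int R..int R}. (1/2 :: real) ^ nat \<bar>i\<bar>) = 3 - 2 * (1/2) ^ R"
  proof (induction R)
    case (Suc R)
    have eq: "{- int (Suc R)..int (Suc R)} = insert (- int (Suc R)) (insert (int (Suc R)) {- int R..int R})" by auto
    have "(\<Sum>i\<in>{- int (Suc R)..int (Suc R)}. (1/2 :: real) ^ nat \<bar>i\<bar>)
       = 2 * (1/2) ^ Suc R + (\<Sum>i\<in>{- int R..int R}. (1/2) ^ nat \<bar>i\<bar>)"
      unfolding eq by (simp add: nat_add_distrib)
    then show ?case using Suc by simp
  qed simp
  then show ?thesis by simp
qed

text \<open>Counting with a generating function: every grid point has weight at least 2^(-14 k)
  under the product of the weights 2^(-|z a|), and the total weight of the box factorises into at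
  most 3^k. Here 3 * 2^14 = 49152 < e^11.\<close>

lemma card_grid: "real (card (grid k)) \<le> exp (11 * real k)"
proof -
  let ?R = "14 * k" and ?B = "{..<k} \<rightarrow>\<^sub>E {- int (14 * k)..int (14 * k)}"
  have "real (card (grid k)) * (1/2) ^ ?R = (\<Sum>z\<in>grid k. (1/2) ^ ?R)" by simp
  also have "\<dots> \<le> (\<Sum>z\<in>grid k. \<Prod>a<k. (1/2) ^ nat \<bar>z a\<bar>)"
  proof (rule sum_mono)
    fix z assume z: "z \<in> grid k"
    have "int (\<Sum>a<k. nat \<bar>z a\<bar>) = (\<Sum>a<k. \<bar>z a\<bar>)" by simp
    then have "(\<Sum>a<k. nat \<bar>z a\<bar>) \<le> ?R" using z unfolding grid_def by (simp del: of_nat_sum)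
    then show "(1/2 :: real) ^ ?R \<le> (\<Prod>a<k. (1/2) ^ nat \<bar>z a\<bar>)"
      by (simp only: power_sum[symmetric]) (intro power_decreasing, auto)
  qed
  also have "\<dots> \<le> (\<Sum>z\<in>?B. \<Prod>a<k. (1/2) ^ nat \<bar>z a\<bar>)"
  proof (rule sum_mono2)
    show "finite ?B" by (intro finite_PiE) auto
    show "grid k \<subseteq> ?B" unfolding grid_def by blast
    show "0 \<le> (\<Prod>a<k. (1/2 :: real) ^ nat \<bar>z a\<bar>)" for z by (intro prod_nonneg) simp
  qed
  also have "\<dots> = (\<Prod>a<k. \<Sum>i\<in>{- int (14 * k)..int (14 * k)}. (1/2) ^ nat \<bar>i\<bar>)"
    by (subst prod_sum_PiE) auto
  also have "\<dots> \<le> (\<Prod>a<k. 3)" by (intro prod_mono) (use sum_half_powers[of "14 * k"] in \<open>auto intro: sum_nonneg\<close>)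
  finally have "real (card (grid k)) \<le> 3 ^ k * 2 ^ (14 * k)" by (simp add: field_simps power_one_over)
  also have "\<dots> = 49152 ^ k" by (simp add: power_mult power_mult_distrib[symmetric])
  also have "\<dots> \<le> (exp 11) ^ k"
  proof (rule power_mono)
    have "(271/100) ^ 11 \<le> exp (1::real) ^ 11"
      using e_approx_32 by (intro power_mono) (simp_all add: abs_if split: if_splits)
    also have "exp (1::real) ^ 11 = exp (11::real)" unfolding exp_of_nat_mult[symmetric] by simp
    finally show "49152 \<le> exp (11::real)" by (simp add: power_divide)
  qed simp
  finally show ?thesis by (simp add: exp_of_nat_mult[symmetric] mult.commute)
qed

text \<open>The form |H u|^2 - (s/2) |u|_w^2 is at least 0 on the grid, and rounding a unit vector
  to the grid raises it by at most s / 4. Homogeneity then handles all u. The 0-1 weights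
  \<open>w\<close> switch off the columns of empty clusters, which are zero.\<close>

lemma singular_value_from_grid:
  fixes H :: "nat \<Rightarrow> nat \<Rightarrow> real"
  assumes k: "k \<ge> 1" and w: "\<And>a. w a = 0 \<or> w a = (1::real)"
    and fro: "(\<Sum>a<k. \<Sum>r<s. (H r a)\<^sup>2) \<le> 24 * real s * real k"
    and net: "\<And>z. z \<in> grid k \<Longrightarrow> (\<Sum>r<s. (\<Sum>a<k. H r a * z a)\<^sup>2) \<ge> real s / 2 * (\<Sum>a<k. w a * (z a)\<^sup>2)"
  shows "(\<Sum>r<s. (\<Sum>a<k. H r a * u a)\<^sup>2) \<ge> real s / 2 * (\<Sum>a<k. w a * (u a)\<^sup>2) - real s / 4 * (\<Sum>a<k. (u a)\<^sup>2)"
proof -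
  have unit: "(\<Sum>r<s. (\<Sum>a<k. H r a * u a)\<^sup>2) \<ge> real s / 2 * (\<Sum>a<k. w a * (u a)\<^sup>2) - real s / 4"
    if u: "(\<Sum>a<k. (u a)\<^sup>2) = 1" for u
  proof -
    \<comment> \<open>With this mesh the rounding loss 24 s k h^2 / 4 is exactly s / 4.\<close>
    define h where "h = sqrt (1 / (24 * real k))"
    have h: "h > 0" "h\<^sup>2 = 1 / (24 * real k)" using k by (auto simp: h_def)
    have w0: "0 \<le> w a" for a using w[of a] by auto
    obtain z :: "nat \<Rightarrow> int" where z: "\<And>a. a < k \<Longrightarrow> z a = \<lfloor>u a / h\<rfloor> \<or> z a = \<lfloor>u a / h\<rfloor> + 1"
      and q: "(\<Sum>r<s. (\<Sum>a<k. H r a * (h * z a))\<^sup>2) - real s / 2 * (\<Sum>a<k. w a * (h * z a)\<^sup>2)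
       \<le> (\<Sum>r<s. (\<Sum>a<k. H r a * u a)\<^sup>2) - real s / 2 * (\<Sum>a<k. w a * (u a)\<^sup>2)
         + (\<Sum>a<k. \<Sum>r<s. (H r a)\<^sup>2) * h\<^sup>2 / 4"
      using quadratic_form_rounding[where c="real s / 2" and h=h and w=w and s=s and H=H and k=k and u=u]
        h(1) w0 by auto
    have za: "real_of_int \<bar>z a\<bar> \<le> 12 * real k * (u a)\<^sup>2 + 3 / 2" if "a < k" for a
    proof -
      have "real_of_int \<bar>z a\<bar> \<le> \<bar>u a\<bar> / h + 1"
      proof -
        have "\<bar>real_of_int (z a) - u a / h\<bar> \<le> 1" using z[OF that] by (auto; linarith)
        moreover have "\<bar>u a / h\<bar> = \<bar>u a\<bar> / h" using h by simp
        ultimately show ?thesis by linarith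
      qed
      \<comment> \<open>The inequality v \<le> (v^2 + 1) / 2 bounds a sum of absolute values by the
        Euclidean norm, which is 1.\<close>
      also have "\<bar>u a\<bar> / h \<le> ((u a)\<^sup>2 / h\<^sup>2 + 1) / 2"
      proof -
        have "v \<le> (v\<^sup>2 + 1) / 2" for v :: real
          using zero_le_power2[of "v - 1"] by (simp add: power2_diff)
        from this[of "\<bar>u a\<bar> / h"] show ?thesis by (simp only: power_divide power2_abs)
      qed
      also have "(u a)\<^sup>2 / h\<^sup>2 = 24 * real k * (u a)\<^sup>2" using h k by simp
      finally show ?thesis by (simp add: field_simps)
    qed
    have "real_of_int (\<Sum>a<k. \<bar>z a\<bar>) \<le> (\<Sum>a<k. 12 * real k * (u a)\<^sup>2 + 3 / 2)"
      unfolding of_int_sum by (intro sum_mono za) simp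
    also have "\<dots> = 12 * real k * (\<Sum>a<k. (u a)\<^sup>2) + 3 / 2 * real k"
      by (simp add: sum.distrib sum_distrib_left)
    also have "\<dots> \<le> real (14 * k)" using u by simp
    finally have sz: "(\<Sum>a<k. \<bar>z a\<bar>) \<le> int (14 * k)" by linarith
    have "- int (14 * k) \<le> z a \<and> z a \<le> int (14 * k)" if "a < k" for a
      using member_le_sum[of a "{..<k}" "\<lambda>a. \<bar>z a\<bar>"] that sz by auto
    then have "restrict z {..<k} \<in> grid k" using sz by (simp add: grid_def)
    from net[OF this]
    have "(\<Sum>r<s. (\<Sum>a<k. H r a * z a)\<^sup>2) \<ge> real s / 2 * (\<Sum>a<k. w a * (z a)\<^sup>2)" by simp
    then have scaled: "h\<^sup>2 * (\<Sum>r<s. (\<Sum>a<k. H r a * z a)\<^sup>2) \<ge> h\<^sup>2 * (real s / 2 * (\<Sum>a<k. w a * (z a)\<^sup>2))"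
      by (intro mult_left_mono) auto
    have e1: "(\<Sum>r<s. (\<Sum>a<k. H r a * (h * z a))\<^sup>2) = h\<^sup>2 * (\<Sum>r<s. (\<Sum>a<k. H r a * z a)\<^sup>2)"
    proof -
      have "(\<Sum>a<k. H r a * (h * z a)) = h * (\<Sum>a<k. H r a * z a)" for r
        by (simp add: sum_distrib_left mult_ac)
      then show ?thesis by (simp only: power_mult_distrib sum_distrib_left[symmetric])
    qed
    have e2: "(\<Sum>a<k. w a * (h * z a)\<^sup>2) = h\<^sup>2 * (\<Sum>a<k. w a * (z a)\<^sup>2)"
      by (simp add: power_mult_distrib sum_distrib_left mult_ac)
    have "real s / 2 * (\<Sum>a<k. w a * (h * z a)\<^sup>2) \<le> (\<Sum>r<s. (\<Sum>a<k. H r a * (h * z a))\<^sup>2)"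
      unfolding e1 e2 using scaled by (simp only: mult.left_commute)
    moreover note q
    moreover have "(\<Sum>a<k. \<Sum>r<s. (H r a)\<^sup>2) * h\<^sup>2 / 4 \<le> 24 * real s * real k * h\<^sup>2 / 4"
      using fro by (intro divide_right_mono mult_right_mono) auto
    moreover have "24 * real s * real k * h\<^sup>2 / 4 = real s / 4" using h k by simp
    ultimately show ?thesis by linarith
  qed
  show ?thesis
  proof (cases "(\<Sum>a<k. (u a)\<^sup>2) = 0")
    case True
    then have "\<forall>a<k. u a = 0" by (simp add: sum_nonneg_eq_0_iff)
    then show ?thesis by simp
  next
    case False
    define g where "g = sqrt (\<Sum>a<k. (u a)\<^sup>2)"
    have g2: "g\<^sup>2 = (\<Sum>a<k. (u a)\<^sup>2)" by (simp add: g_def sum_nonneg)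
    have g: "g \<noteq> 0" using False g2 by auto
    have "(\<Sum>a<k. (u a / g)\<^sup>2) = 1" using g False by (simp add: power_divide sum_divide_distrib[symmetric] g2)
    from unit[OF this]
    have "g\<^sup>2 * (\<Sum>r<s. (\<Sum>a<k. H r a * (u a / g))\<^sup>2) \<ge> g\<^sup>2 * (real s / 2 * (\<Sum>a<k. w a * (u a / g)\<^sup>2) - real s / 4)"
      by (intro mult_left_mono) auto
    moreover have "g\<^sup>2 * (\<Sum>r<s. (\<Sum>a<k. H r a * (u a / g))\<^sup>2) = (\<Sum>r<s. (\<Sum>a<k. H r a * u a)\<^sup>2)"
    proof -
      have "(\<Sum>a<k. H r a * (u a / g)) = (\<Sum>a<k. H r a * u a) / g" for r
        by (simp add: sum_divide_distrib)
      then show ?thesis using g by (simp add: power_divide sum_divide_distrib[symmetric])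
    qed
    moreover have "g\<^sup>2 * (\<Sum>a<k. w a * (u a / g)\<^sup>2) = (\<Sum>a<k. w a * (u a)\<^sup>2)"
      using g by (simp add: sum_distrib_left power_divide)
    ultimately show ?thesis by (simp add: g2[symmetric] algebra_simps)
  qed
qed

section \<open>Cluster costs\<close>

definition csize :: "nat \<Rightarrow> (nat \<Rightarrow> nat) \<Rightarrow> nat \<Rightarrow> real" where
  "csize n f a = real (card {i. i < n \<and> f i = a})"

definition cluster_sum :: "nat \<Rightarrow> (nat \<Rightarrow> nat) \<Rightarrow> (nat \<Rightarrow> real) \<Rightarrow> nat \<Rightarrow> real" where
  "cluster_sum n f x a = (\<Sum>i<n. if f i = a then x i else 0)"

definition centroid :: "nat \<Rightarrow> (nat \<Rightarrow> nat) \<Rightarrow> (nat \<Rightarrow> nat \<Rightarrow> real) \<Rightarrow> nat \<Rightarrow> nat \<Rightarrow> real" where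
  "centroid n f A a j = cluster_sum n f (\<lambda>i. A i j) a / csize n f a"

definition kcost :: "nat \<Rightarrow> nat \<Rightarrow> (nat \<Rightarrow> nat) \<Rightarrow> (nat \<Rightarrow> nat \<Rightarrow> real) \<Rightarrow> (nat \<Rightarrow> nat \<Rightarrow> real) \<Rightarrow> real" where
  "kcost n d f C A = (\<Sum>i<n. \<Sum>j<d. (C (f i) j - A i j)\<^sup>2)"

lemma kcost_nonneg: "0 \<le> kcost n d f C A"
  by (simp add: kcost_def sum_nonneg)

lemma csize_nonneg: "0 \<le> csize n f a"
  by (simp add: csize_def)

lemma csize_eq_0_iff: "csize n f a = 0 \<longleftrightarrow> (\<forall>i<n. f i \<noteq> a)"
  by (auto simp: csize_def)

lemma cluster_sum_const: "cluster_sum n f (\<lambda>_. c) a = csize n f a * c"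
proof -
  have "cluster_sum n f (\<lambda>_. c) a = (\<Sum>i\<in>{i. i < n \<and> f i = a}. c)"
    unfolding cluster_sum_def by (subst sum.inter_filter[symmetric]) (auto intro: sum.cong)
  then show ?thesis by (simp add: csize_def)
qed

lemma cluster_sum_empty: "csize n f a = 0 \<Longrightarrow> cluster_sum n f x a = 0"
  by (simp add: csize_eq_0_iff cluster_sum_def)

lemma sum_by_cluster:
  assumes "\<And>i. i < n \<Longrightarrow> f i < k"
  shows "(\<Sum>i<n. g (f i) i) = (\<Sum>a<k. cluster_sum n f (g a) a)"
  unfolding cluster_sum_def
  by (subst sum.swap) (use assms in \<open>auto simp: sum.delta intro!: sum.cong\<close>)

lemma cluster_sum_deviation:
  "cluster_sum n f (\<lambda>i. A i j - centroid n f A (f i) j) a = 0"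
proof (cases "csize n f a = 0")
  case False
  have "cluster_sum n f (\<lambda>i. A i j - centroid n f A (f i) j) a =
     cluster_sum n f (\<lambda>i. A i j) a - cluster_sum n f (\<lambda>_. centroid n f A a j) a"
    unfolding cluster_sum_def sum_subtractf[symmetric] by (rule sum.cong) auto
  then show ?thesis using False by (simp add: cluster_sum_const centroid_def)
qed (rule cluster_sum_empty)

text \<open>Pythagoras for least squares: within each cluster the deviations from the centroid sum
  to zero, so the cross term vanishes.\<close>

lemma kcost_decomp:
  assumes f: "\<And>i. i < n \<Longrightarrow> f i < k"
  shows "kcost n d f C A = kcost n d f (centroid n f A) A
     + (\<Sum>j<d. \<Sum>a<k. csize n f a * (C a j - centroid n f A a j)\<^sup>2)"
proof -
  let ?c = "centroid n f A"
  have "(\<Sum>i<n. (C (f i) j - A i j)\<^sup>2) = (\<Sum>i<n. (?c (f i) j - A i j)\<^sup>2) + (\<Sum>a<k. csize n f a * (C a j - ?c a j)\<^sup>2)" for j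
  proof -
    have "(\<Sum>i<n. (C (f i) j - A i j)\<^sup>2) = (\<Sum>i<n. (?c (f i) j - A i j)\<^sup>2)
        + (\<Sum>i<n. (C (f i) j - ?c (f i) j)\<^sup>2) - 2 * (\<Sum>i<n. (C (f i) j - ?c (f i) j) * (A i j - ?c (f i) j))"
      by (simp add: sum.distrib[symmetric] sum_subtractf[symmetric] sum_distrib_left power2_eq_square algebra_simps)
    moreover have "(\<Sum>i<n. (C (f i) j - ?c (f i) j) * (A i j - ?c (f i) j)) = 0"
    proof -
      have "(\<Sum>i<n. (C (f i) j - ?c (f i) j) * (A i j - ?c (f i) j)) =
          (\<Sum>a<k. cluster_sum n f (\<lambda>i. (C a j - ?c a j) * (A i j - ?c (f i) j)) a)"
        using sum_by_cluster[OF f, where g="\<lambda>a i. (C a j - ?c a j) * (A i j - ?c (f i) j)"] by simp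
      also have "\<dots> = (\<Sum>a<k. (C a j - ?c a j) * cluster_sum n f (\<lambda>i. A i j - ?c (f i) j) a)"
        unfolding cluster_sum_def sum_distrib_left by (intro sum.cong) auto
      finally show ?thesis by (simp add: cluster_sum_deviation)
    qed
    moreover have "(\<Sum>i<n. (C (f i) j - ?c (f i) j)\<^sup>2) = (\<Sum>a<k. csize n f a * (C a j - ?c a j)\<^sup>2)"
      using sum_by_cluster[OF f, where g="\<lambda>a i. (C a j - ?c a j)\<^sup>2"] by (simp add: cluster_sum_const)
    ultimately show ?thesis by simp
  qed
  then show ?thesis
    unfolding kcost_def sum.swap[of _ "{..<d}" "{..<n}"] by (simp add: sum.distrib)
qed

lemma kcost_centroid_le:
  assumes "\<And>i. i < n \<Longrightarrow> f i < k"
  shows "kcost n d f (centroid n f A) A \<le> kcost n d f C A"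
  using kcost_decomp[OF assms, where d=d and C=C and A=A] by (simp add: sum_nonneg csize_nonneg)

lemma kcost_cong:
  assumes "\<And>i. i < n \<Longrightarrow> f i = g i" "\<And>i j. i < n \<Longrightarrow> j < d \<Longrightarrow> C (f i) j = D (f i) j"
    "\<And>i j. i < n \<Longrightarrow> j < d \<Longrightarrow> A i j = B i j"
  shows "kcost n d f C A = kcost n d g D B"
  unfolding kcost_def using assms by (intro sum.cong) auto

lemma frob_sq_assignment:
  assumes A: "A \<in> carrier_mat n d" and X: "X \<in> carrier_mat n k" and C: "C \<in> carrier_mat k d"
    and row: "\<And>i. i < n \<Longrightarrow> f i < k \<and> row X i = unit_vec k (f i)"
  shows "frob_sq (X * C - A) = kcost n d f (\<lambda>a j. C $$ (a, j)) (\<lambda>i j. A $$ (i, j))"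
proof -
  have "(X * C - A) $$ (i, j) = C $$ (f i, j) - A $$ (i, j)" if "i < n" "j < d" for i j
    using that A X C row[of i] by (simp add: scalar_prod_left_unit[of _ k])
  then show ?thesis using A X C by (simp add: frob_sq_def kcost_def)
qed

lemma assignment_matsE:
  assumes "X \<in> assignment_mats n k"
  obtains f where "\<And>i. i < n \<Longrightarrow> f i < k \<and> row X i = unit_vec k (f i)"
proof -
  have "\<forall>i\<in>{..<n}. \<exists>j. j < k \<and> row X i = unit_vec k j" using assms by (auto simp: assignment_mats_def)
  then obtain f where "\<forall>i\<in>{..<n}. f i < k \<and> row X i = unit_vec k (f i)" by (rule bchoice[THEN exE]) blast
  then show ?thesis using that[of f] by auto
qed

text \<open>For a fixed labeling the centroids are optimal, and restricting labelings to indices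
  below n leaves finitely many of them. A minimum over these therefore bounds the infimum from
  below.\<close>

lemma kmeans_opt_attained:
  assumes A: "A \<in> carrier_mat n d" and k: "k \<ge> 1"
  obtains f where "\<And>i. i < n \<Longrightarrow> f i < k"
    "kcost n d f (centroid n f (\<lambda>i j. A $$ (i, j))) (\<lambda>i j. A $$ (i, j)) \<le> kmeans_opt k A"
proof -
  let ?A = "\<lambda>i j. A $$ (i, j)"
  let ?F = "{..<n} \<rightarrow>\<^sub>E {..<k}" and ?c = "\<lambda>f. kcost n d f (centroid n f ?A) ?A"
  have "finite ?F" "?F \<noteq> {}" using k by (auto intro!: finite_PiE simp: PiE_eq_empty_iff lessThan_empty_iff)
  then obtain f where f: "f \<in> ?F" and min: "\<And>g. g \<in> ?F \<Longrightarrow> ?c f \<le> ?c g"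
    using ex_min_if_finite[of "?c ` ?F"] by (metis (mono_tags, lifting) arg_min_if_finite(1) arg_min_least)
  have "?c f \<le> kmeans_opt k A"
    unfolding kmeans_opt_def
  proof (rule cINF_greatest)
    have "mat n k (\<lambda>(i, j). if j = 0 then 1 else 0) \<in> assignment_mats n k"
      using k by (auto simp: assignment_mats_def intro!: exI[of _ 0])
    then show "assignment_mats (dim_row A) k \<times> carrier_mat k (dim_col A) \<noteq> {}"
      using A zero_carrier_mat[of k d] by auto
    fix XC :: "real mat \<times> real mat" assume "XC \<in> assignment_mats (dim_row A) k \<times> carrier_mat k (dim_col A)"
    then obtain X and C :: "real mat" where XC: "XC = (X, C)" "X \<in> assignment_mats n k" "C \<in> carrier_mat k d"
      using A by auto
    obtain g where g: "\<And>i. i < n \<Longrightarrow> g i < k \<and> row X i = unit_vec k (g i)"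
      using assignment_matsE[OF XC(2)] by blast
    have "X \<in> carrier_mat n k" using XC by (simp add: assignment_mats_def)
    from frob_sq_assignment[OF A this XC(3), where f=g] g
    have eq: "frob_sq (X * C - A) = kcost n d g (\<lambda>a j. C $$ (a, j)) ?A" by blast
    let ?g = "restrict g {..<n}"
    have "?c f \<le> ?c ?g" using g by (intro min) auto
    also have "\<dots> \<le> kcost n d ?g (\<lambda>a j. C $$ (a, j)) ?A" using g by (intro kcost_centroid_le) auto
    also have "\<dots> = kcost n d g (\<lambda>a j. C $$ (a, j)) ?A" by (intro kcost_cong) auto
    finally show "?c f \<le> (case XC of (X, C) \<Rightarrow> frob_sq (X * C - A))" by (simp add: XC eq)
  qed
  then show ?thesis using that[of f] f by auto
qed

section \<open>Centers from a sketch\<close>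

text \<open>Let E be the error of the sketched centers against the centroids. The normal equations
  read M^T M E = M^T S B, with B the residual of the clustering. With D = \<Sum> c E^2 and G = M^T S
  B, the grid condition gives (s/4) D \<le> |M E|^2 = E . G, and E G \<le> (s/8) c E^2 + (2/s) G^2 /
  c absorbs half of the left side. What remains is D \<le> (16/s^2) \<Sum> G^2 / c, and by
  Pythagoras D is exactly the excess cost.\<close>

lemma sketched_centers_cost:
  fixes \<phi> A :: "nat \<Rightarrow> nat \<Rightarrow> real"
  defines "B \<equiv> \<lambda>f n i j. A i j - centroid n f A (f i) j"
  assumes f: "\<And>i. i < n \<Longrightarrow> f i < k" and k: "k \<ge> 1" and s: "s \<ge> 1"
    and M: "M = (\<lambda>r a. cluster_sum n f (\<phi> r) a)"
    and fro: "(\<Sum>a<k. \<Sum>r<s. (M r a / sqrt (csize n f a))\<^sup>2) \<le> 24 * real s * real k"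
    and net: "\<And>z. z \<in> grid k \<Longrightarrow> (\<Sum>r<s. (\<Sum>a<k. M r a / sqrt (csize n f a) * z a)\<^sup>2)
        \<ge> real s / 2 * (\<Sum>a<k. (if csize n f a = 0 then 0 else 1 :: real) * (z a)\<^sup>2)"
    and amp: "(\<Sum>j<d. \<Sum>a<k. (\<Sum>r<s. M r a * (\<Sum>i<n. \<phi> r i * B f n i j))\<^sup>2 / csize n f a) \<le> \<tau>"
  shows "kcost n d f (\<lambda>a j. \<Sum>y<s. pinv s M k a y * (\<Sum>i<n. \<phi> y i * A i j)) A
     \<le> kcost n d f (centroid n f A) A + 16 / (real s)\<^sup>2 * \<tau>"
proof -
  define c where "c = csize n f"
  define \<mu> where "\<mu> = centroid n f A"
  define SA where "SA y j = (\<Sum>i<n. \<phi> y i * A i j)" for y j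
  define SB where "SB y j = (\<Sum>i<n. \<phi> y i * B f n i j)" for y j
  define C where "C a j = (\<Sum>y<s. pinv s M k a y * SA y j)" for a j
  define E where "E a j = C a j - \<mu> a j" for a j
  define G where "G a j = (\<Sum>r<s. M r a * SB r j)" for a j
  have c0: "c a \<ge> 0" for a by (simp add: c_def csize_nonneg)
  have M0: "M r a = 0" if "c a = 0" for r a using that by (simp add: M c_def cluster_sum_empty)
  have SA: "SA r j = (\<Sum>a<k. M r a * \<mu> a j) + SB r j" for r j
  proof -
    have "(\<Sum>i<n. \<phi> r i * \<mu> (f i) j) = (\<Sum>a<k. M r a * \<mu> a j)"
      using sum_by_cluster[OF f, where g="\<lambda>a i. \<phi> r i * \<mu> a j"]
      by (simp add: M cluster_sum_def sum_distrib_right if_distrib[of "\<lambda>x. x * \<mu> _ _"] cong: if_cong)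
    moreover have "SA r j = (\<Sum>i<n. \<phi> r i * \<mu> (f i) j) + SB r j"
      by (simp add: SA_def SB_def B_def \<mu>_def sum.distrib[symmetric] algebra_simps)
    ultimately show ?thesis by simp
  qed
  have normal: "(\<Sum>r<s. M r a * (\<Sum>b<k. M r b * E b j)) = G a j" if a: "a < k" for a j
  proof -
    have "(\<Sum>r<s. M r a * (\<Sum>b<k. M r b * C b j)) = (\<Sum>r<s. M r a * SA r j)"
      unfolding C_def by (rule pinv_normal_equations[OF a])
    then show ?thesis
      by (simp add: E_def G_def SA right_diff_distrib distrib_left sum_subtractf sum.distrib)
  qed
  have bound: "(\<Sum>a<k. c a * (E a j)\<^sup>2) \<le> 16 / (real s)\<^sup>2 * (\<Sum>a<k. (G a j)\<^sup>2 / c a)" for j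
  proof -
    let ?D = "\<Sum>a<k. c a * (E a j)\<^sup>2"
    \<comment> \<open>Scaling by the square root of the cluster size normalises the columns of M.
      For an empty cluster both sides are 0.\<close>
    have Hu: "M r a / sqrt (csize n f a) * (sqrt (c a) * E a j) = M r a * E a j" for r a
      using M0[of a r] by (cases "c a = 0") (auto simp: c_def[symmetric])
    have u2: "(sqrt (c a) * E a j)\<^sup>2 = c a * (E a j)\<^sup>2" for a
      using c0[of a] by (simp add: power_mult_distrib)
    have w2: "(if csize n f a = 0 then 0 else 1) * (c a * (E a j)\<^sup>2) = c a * (E a j)\<^sup>2" for a
      by (simp add: c_def)
    have w01: "(if csize n f a = 0 then 0 else 1 :: real) = 0 \<or> (if csize n f a = 0 then 0 else 1 :: real) = 1" for a
      by simp
    have "real s / 2 * ?D - real s / 4 * ?D \<le> (\<Sum>r<s. (\<Sum>a<k. M r a * E a j)\<^sup>2)"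
      using singular_value_from_grid[where u="\<lambda>a. sqrt (c a) * E a j", OF k w01 fro net]
      unfolding Hu u2 w2 by auto
    also have "\<dots> = (\<Sum>a<k. E a j * G a j)"
    proof -
      have "(\<Sum>r<s. (\<Sum>a<k. M r a * E a j)\<^sup>2) = (\<Sum>r<s. \<Sum>a<k. E a j * (M r a * (\<Sum>b<k. M r b * E b j)))"
        by (simp add: power2_eq_square sum_distrib_right mult_ac)
      also have "\<dots> = (\<Sum>a<k. E a j * (\<Sum>r<s. M r a * (\<Sum>b<k. M r b * E b j)))"
        by (subst sum.swap) (simp add: sum_distrib_left)
      finally show ?thesis by (simp add: normal)
    qed
    also have "\<dots> \<le> (\<Sum>a<k. real s / 8 * (c a * (E a j)\<^sup>2) + 2 / real s * ((G a j)\<^sup>2 / c a))"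
    proof (rule sum_mono)
      fix a
      show "E a j * G a j \<le> real s / 8 * (c a * (E a j)\<^sup>2) + 2 / real s * ((G a j)\<^sup>2 / c a)"
      proof (cases "c a = 0")
        case True
        then have "G a j = 0" by (simp add: G_def M0)
        then show ?thesis using True by simp
      next
        case False
        then have pos: "c a > 0" using c0[of a] by simp
        have "0 \<le> (real s * c a * E a j - 4 * G a j)\<^sup>2 / (8 * real s * c a)" using pos by simp
        also have "\<dots> = real s / 8 * (c a * (E a j)\<^sup>2) + 2 / real s * ((G a j)\<^sup>2 / c a) - E a j * G a j"
          using pos s by (simp add: power2_eq_square field_simps)
        finally show ?thesis by simp
      qed
    qed
    also have "\<dots> = real s / 8 * ?D + 2 / real s * (\<Sum>a<k. (G a j)\<^sup>2 / c a)"
      by (simp add: sum.distrib sum_distrib_left)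
    finally have "real s / 8 * ?D \<le> 2 / real s * (\<Sum>a<k. (G a j)\<^sup>2 / c a)" by linarith
    then have "8 / real s * (real s / 8 * ?D) \<le> 8 / real s * (2 / real s * (\<Sum>a<k. (G a j)\<^sup>2 / c a))"
      by (intro mult_left_mono) auto
    then show ?thesis using s by (simp add: power2_eq_square)
  qed
  have "(\<Sum>j<d. \<Sum>a<k. c a * (E a j)\<^sup>2) \<le> (\<Sum>j<d. 16 / (real s)\<^sup>2 * (\<Sum>a<k. (G a j)\<^sup>2 / c a))"
    by (intro sum_mono bound)
  also have "\<dots> = 16 / (real s)\<^sup>2 * (\<Sum>j<d. \<Sum>a<k. (G a j)\<^sup>2 / c a)" by (simp only: sum_distrib_left)
  also have "\<dots> \<le> 16 / (real s)\<^sup>2 * \<tau>"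
    using amp by (intro mult_left_mono) (auto simp: G_def SB_def c_def)
  finally have le: "(\<Sum>j<d. \<Sum>a<k. c a * (E a j)\<^sup>2) \<le> 16 / (real s)\<^sup>2 * \<tau>" .
  have C_eq: "(\<lambda>a j. \<Sum>y<s. pinv s M k a y * (\<Sum>i<n. \<phi> y i * A i j)) = C"
    by (simp add: C_def SA_def fun_eq_iff)
  show ?thesis
    unfolding C_eq using le kcost_decomp[where n=n and f=f and k=k and d=d and C=C and A=A, OF f] by (simp add: E_def c_def \<mu>_def)
qed

section \<open>Success probability of the sketched centers\<close>

text \<open>Markov's inequality for a strict excess, which makes it hold for F = 0 too. This case
  occurs whenever the clustering has cost 0.\<close>

lemma prob_exceeds_mean:
  assumes fin: "finite (set_pmf p)" and nn: "\<And>x. x \<in> set_pmf p \<Longrightarrow> 0 \<le> f x"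
    and F: "expect p f \<le> F" and c: "c > 0"
  shows "measure_pmf.prob p {x. c * F < f x} \<le> 1 / c"
proof -
  have E0: "0 \<le> expect p f" by (rule expect_nonneg[OF nn])
  show ?thesis
  proof (cases "F = 0")
    case True
    then have "expect p f = 0" using E0 F by simp
    then have "AE x in p. f x = 0"
      using fin nn by (subst (asm) integral_nonneg_eq_0_iff_AE)
        (auto simp: AE_measure_pmf_iff intro: integrable_measure_pmf_finite)
    then have "set_pmf p \<inter> {x. c * F < f x} = {}" using True by (auto simp: AE_measure_pmf_iff)
    then show ?thesis using c by (subst (asm) measure_pmf_zero_iff[symmetric]) simp
  next
    case False
    then have F0: "F > 0" using E0 F by simp
    have "measure_pmf.prob p {x. c * F < f x} \<le> measure_pmf.prob p {x. c * F \<le> f x}"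
      by (intro measure_pmf.finite_measure_mono) auto
    also have "\<dots> \<le> expect p f / (c * F)" using F0 c by (intro markov_pmf[OF fin nn]) auto
    also have "\<dots> \<le> F / (c * F)" using F0 c F by (intro divide_right_mono) auto
    finally show ?thesis using F0 by simp
  qed
qed

lemma prob_le_on_support:
  assumes "\<And>x. x \<in> set_pmf p \<Longrightarrow> x \<in> A \<Longrightarrow> x \<in> B"
  shows "measure_pmf.prob p A \<le> measure_pmf.prob p B"
  using assms by (intro measure_pmf.finite_measure_mono_AE) (auto simp: AE_measure_pmf_iff)

lemma prob_Un_le: "measure_pmf.prob p (A \<union> B) \<le> measure_pmf.prob p A + measure_pmf.prob p B"
  by (rule measure_Un_le) auto

lemma prob_UN_le:
  assumes "finite Z" "\<And>z. z \<in> Z \<Longrightarrow> measure_pmf.prob p (A z) \<le> q"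
  shows "measure_pmf.prob p (\<Union>z\<in>Z. A z) \<le> real (card Z) * q"
proof -
  have "measure_pmf.prob p (\<Union>z\<in>Z. A z) \<le> (\<Sum>z\<in>Z. measure_pmf.prob p (A z))"
    using assms(1) by (intro measure_pmf.finite_measure_subadditive_finite) auto
  also have "\<dots> \<le> real (card Z) * q" using assms(2) by (rule sum_bounded_above)
  finally show ?thesis .
qed

lemma sum_list_rows: "length xs = s \<Longrightarrow> (\<Sum>l\<leftarrow>xs. G l) = (\<Sum>r<s. G (xs ! r))"
  by (simp add: sum_list_sum_nth lessThan_atLeast0)

lemma length_replicate_pmf: "xs \<in> set_pmf (replicate_pmf m p) \<Longrightarrow> length xs = m"
  by (simp add: set_replicate_pmf)

text \<open>Every bad event is allotted probability 1/24, and the exponential tails are pushed to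
  exp(-4) or below.\<close>

lemma exp_minus_4: "exp (- 4 :: real) \<le> 1 / 24"
proof -
  have "(3/2) ^ 8 \<le> exp (1/2::real) ^ 8" using exp_ge_add_one_self[of "1/2::real"] by (intro power_mono) auto
  also have "\<dots> = exp 4" unfolding exp_of_nat_mult[symmetric] by simp
  finally have "24 \<le> exp (4::real)" by (simp add: power_divide)
  then show ?thesis by (simp add: exp_minus field_simps)
qed

text \<open>Three events of probability at most 1/24 each: \<open>X1\<close>, the Frobenius norm of
  the normalised M, and \<open>X3\<close>, the correlation of M with the sketched residual, are at
  most 24 times the bounds on their means, and \<open>X2\<close> is never small on the grid.\<close>

lemma sketch_centers_prob:
  assumes g: "good4 \<rho> sg {..<n} 81" and f: "\<And>i. i < n \<Longrightarrow> f i < k" and k: "k \<ge> 1"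
    and \<epsilon>: "0 < \<epsilon>" "\<epsilon> < 1" and s: "real s * \<epsilon> \<ge> 320000 * real k"
  shows "measure_pmf.prob (replicate_pmf s \<rho>) {xs. \<not> kcost n d f (\<lambda>a j. \<Sum>y<s.
       pinv s (\<lambda>r a. cluster_sum n f (sg (xs ! r)) a) k a y * (\<Sum>i<n. sg (xs ! y) i * A i j)) A
       \<le> (1 + \<epsilon> / 10) * kcost n d f (centroid n f A) A} \<le> 3 / 24"
proof -
  have fin: "finite (set_pmf \<rho>)" using g by (simp add: good4_def)
  have finr: "finite (set_pmf (replicate_pmf s \<rho>))" by (rule finite_replicate_pmf[OF fin])
  have sk: "real s \<ge> 320000 * real k"
  proof -
    have "real s * \<epsilon> \<le> real s * 1" using \<epsilon> by (intro mult_left_mono) auto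
    with s show ?thesis by simp
  qed
  then have s1: "s \<ge> 1" using k by (cases s) auto
  define c where "c = csize n f"
  define B where "B i j = A i j - centroid n f A (f i) j" for i j
  have c0: "c a \<ge> 0" for a by (simp add: c_def csize_nonneg)
  define M where "M l a = cluster_sum n f (sg l) a" for l a
  define SB where "SB l j = (\<Sum>i<n. sg l i * B i j)" for l j
  have M: "M l a = (\<Sum>i<n. sg l i * (if f i = a then 1 else 0))" for l a
    by (simp add: M_def cluster_sum_def if_distrib cong: if_cong)
  have ind: "(\<Sum>i<n. (if f i = a then 1 else 0 :: real)\<^sup>2) = c a" for a
  proof -
    have "(if P then 1 else 0 :: real)\<^sup>2 = (if P then 1 else 0)" for P by simp
    then show ?thesis using cluster_sum_const[of n f 1 a] by (simp only: cluster_sum_def c_def mult_1_right)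
  qed
  define X1 where "X1 xs = (\<Sum>l\<leftarrow>xs. \<Sum>a<k. (M l a / sqrt (c a))\<^sup>2)" for xs
  have "expect (replicate_pmf s \<rho>) X1 = real s * (\<Sum>a<k. expect \<rho> (\<lambda>l. (M l a)\<^sup>2) / c a)"
    unfolding X1_def expect_replicate_sum[OF fin] using c0
    by (simp add: expect_sum[OF fin] power_divide)
  also have "\<dots> \<le> real s * (\<Sum>a<k. 1)"
  proof (intro mult_left_mono sum_mono)
    fix a
    have "expect \<rho> (\<lambda>l. (\<Sum>i<n. sg l i * x i)\<^sup>2) = (\<Sum>i<n. (x i)\<^sup>2)" for x
      using g by (simp add: good4_def)
    then have "expect \<rho> (\<lambda>l. (M l a)\<^sup>2) = c a" unfolding M ind[symmetric] .
    then show "expect \<rho> (\<lambda>l. (M l a)\<^sup>2) / c a \<le> 1" by simp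
  qed simp
  finally have E1: "expect (replicate_pmf s \<rho>) X1 \<le> real s * real k" by simp
  have P1: "measure_pmf.prob (replicate_pmf s \<rho>) {xs. 24 * (real s * real k) < X1 xs} \<le> 1 / 24"
    by (rule prob_exceeds_mean[OF finr _ E1]) (auto simp: X1_def intro!: sum_list_nonneg sum_nonneg)
  define X2 where "X2 z xs = (\<Sum>l\<leftarrow>xs. (\<Sum>a<k. M l a / sqrt (c a) * real_of_int (z a))\<^sup>2)" for z xs
  define w where "w z = (\<Sum>a<k. (if c a = 0 then 0 else 1) * (real_of_int (z a))\<^sup>2)" for z
  have lin: "(\<Sum>a<k. M l a / sqrt (c a) * real_of_int (z a)) = (\<Sum>i<n. sg l i * (z (f i) / sqrt (c (f i))))" for l z
    using sum_by_cluster[where g="\<lambda>a i. sg l i * (z a / sqrt (c a))" and n=n and f=f and k=k, OF f]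
    by (simp add: M_def cluster_sum_def sum_distrib_right sum_divide_distrib if_distrib if_distribR cong: if_cong)
  have nrm: "(\<Sum>i<n. (z (f i) / sqrt (c (f i)))\<^sup>2) = w z" for z :: "nat \<Rightarrow> int"
  proof -
    have "(\<Sum>i<n. (z (f i) / sqrt (c (f i)))\<^sup>2) = (\<Sum>a<k. c a * (z a / sqrt (c a))\<^sup>2)"
      using sum_by_cluster[where g="\<lambda>a i. (z a / sqrt (c a))\<^sup>2" and n=n and f=f and k=k, OF f]
      by (simp add: cluster_sum_const c_def)
    also have "\<dots> = w z" unfolding w_def using c0 by (intro sum.cong) (auto simp: power_divide)
    finally show ?thesis .
  qed
  have P2: "measure_pmf.prob (replicate_pmf s \<rho>) (\<Union>z\<in>grid k. {xs. X2 z xs < (1 - 1/2) * real s * w z}) \<le> 1 / 24"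
  proof -
    have "measure_pmf.prob (replicate_pmf s \<rho>) (\<Union>z\<in>grid k. {xs. X2 z xs < (1 - 1/2) * real s * w z})
       \<le> real (card (grid k)) * exp (- ((1/2)\<^sup>2 * real s / (2 * 81)))"
    proof (rule prob_UN_le[OF finite_grid])
      fix z
      show "measure_pmf.prob (replicate_pmf s \<rho>) {xs. X2 z xs < (1 - 1/2) * real s * w z}
          \<le> exp (- ((1/2)\<^sup>2 * real s / (2 * 81)))"
        using good4_lower_tail[OF g, of "1/2" s "\<lambda>i. z (f i) / sqrt (c (f i))"]
        unfolding X2_def lin nrm by simp
    qed
    \<comment> \<open>The exponent s / 648 is at least 11 k + 4: the first summand pays for the
      number of grid points, the second leaves exp(-4).\<close>
    also have "\<dots> \<le> exp (11 * real k) * exp (- (11 * real k + 4))"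
      using card_grid sk k by (intro mult_mono) (auto simp: power2_eq_square)
    also have "\<dots> = exp (- 4)" by (simp add: exp_add[symmetric])
    finally show ?thesis using exp_minus_4 by linarith
  qed
  define F where "F = kcost n d f (centroid n f A) A"
  define X3 where "X3 xs = (\<Sum>j<d. \<Sum>a<k. (\<Sum>l\<leftarrow>xs. M l a * SB l j)\<^sup>2 / c a)" for xs
  have "expect (replicate_pmf s \<rho>) X3 = (\<Sum>j<d. \<Sum>a<k. real s * expect \<rho> (\<lambda>l. (M l a * SB l j)\<^sup>2) / c a)"
  proof -
    \<comment> \<open>The deviations in a cluster sum to zero. Hence the s rows contribute
      independent centered terms, whose squared sum grows like s and not s^2. The excess cost is
      then of order k / s, so that s is linear in 1 / \<epsilon>.\<close>
    have "expect \<rho> (\<lambda>l. M l a * SB l j) = 0" for a j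
    proof -
      have "expect \<rho> (\<lambda>l. M l a * SB l j) = (\<Sum>i<n. (if f i = a then 1 else 0) * B i j)"
        unfolding M SB_def by (rule good4_bilinear[OF g])
      also have "\<dots> = cluster_sum n f (\<lambda>i. B i j) a"
        unfolding cluster_sum_def by (intro sum.cong) auto
      finally show ?thesis by (simp add: B_def cluster_sum_deviation)
    qed
    then show ?thesis
      unfolding X3_def by (simp add: expect_sum[OF finr] expect_replicate_sum_sq[OF fin])
  qed
  also have "\<dots> \<le> (\<Sum>j<d. \<Sum>a<k. real s * 81 * (\<Sum>i<n. (B i j)\<^sup>2))"
  proof (intro sum_mono)
    fix j a
    have "expect \<rho> (\<lambda>l. (M l a * SB l j)\<^sup>2) \<le> 81 * c a * (\<Sum>i<n. (B i j)\<^sup>2)"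
      using good4_mixed[OF g, of "\<lambda>i. if f i = a then 1 else 0" "\<lambda>i. B i j"]
      unfolding power_mult_distrib M SB_def ind by simp
    then have "real s * expect \<rho> (\<lambda>l. (M l a * SB l j)\<^sup>2) / c a \<le> real s * (81 * c a * (\<Sum>i<n. (B i j)\<^sup>2)) / c a"
      using c0 by (intro divide_right_mono mult_left_mono) auto
    also have "\<dots> \<le> real s * 81 * (\<Sum>i<n. (B i j)\<^sup>2)"
      by (cases "c a = 0") (auto intro!: mult_nonneg_nonneg sum_nonneg)
    finally show "real s * expect \<rho> (\<lambda>l. (M l a * SB l j)\<^sup>2) / c a \<le> real s * 81 * (\<Sum>i<n. (B i j)\<^sup>2)" .
  qed
  also have "\<dots> = 81 * real s * real k * F"
    unfolding F_def kcost_def B_def sum.swap[of _ "{..<d}" "{..<n}"]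
    by (simp add: sum_distrib_left[symmetric] power2_commute)
  finally have E3: "expect (replicate_pmf s \<rho>) X3 \<le> 81 * real s * real k * F" .
  have P3: "measure_pmf.prob (replicate_pmf s \<rho>) {xs. 24 * (81 * real s * real k * F) < X3 xs} \<le> 1 / 24"
    using c0 by (intro prob_exceeds_mean[OF finr _ E3]) (auto simp: X3_def intro!: sum_nonneg)
  have F0: "F \<ge> 0" by (simp add: F_def kcost_nonneg)
  let ?bad = "{xs. \<not> kcost n d f (\<lambda>a j. \<Sum>y<s.
       pinv s (\<lambda>r a. cluster_sum n f (sg (xs ! r)) a) k a y * (\<Sum>i<n. sg (xs ! y) i * A i j)) A
       \<le> (1 + \<epsilon> / 10) * F}"
  have "measure_pmf.prob (replicate_pmf s \<rho>) ?bad \<le> measure_pmf.prob (replicate_pmf s \<rho>)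
     ({xs. 24 * (real s * real k) < X1 xs} \<union> ((\<Union>z\<in>grid k. {xs. X2 z xs < (1 - 1/2) * real s * w z})
      \<union> {xs. 24 * (81 * real s * real k * F) < X3 xs}))"
  proof (rule prob_le_on_support, rule ccontr)
    fix xs assume xs: "xs \<in> set_pmf (replicate_pmf s \<rho>)" and bad: "xs \<in> ?bad"
      and "xs \<notin> {xs. 24 * (real s * real k) < X1 xs} \<union> ((\<Union>z\<in>grid k. {xs. X2 z xs < (1 - 1/2) * real s * w z})
      \<union> {xs. 24 * (81 * real s * real k * F) < X3 xs})"
    then have 1: "X1 xs \<le> 24 * (real s * real k)" and 2: "\<And>z. z \<in> grid k \<Longrightarrow> X2 z xs \<ge> real s / 2 * w z"
      and 3: "X3 xs \<le> 24 * (81 * real s * real k * F)" by (auto simp: not_less)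
    have len: "length xs = s" by (rule length_replicate_pmf[OF xs])
    have "kcost n d f (\<lambda>a j. \<Sum>y<s.
       pinv s (\<lambda>r a. cluster_sum n f (sg (xs ! r)) a) k a y * (\<Sum>i<n. sg (xs ! y) i * A i j)) A
      \<le> F + 16 / (real s)\<^sup>2 * (24 * (81 * real s * real k * F))"
      unfolding F_def
    proof (rule sketched_centers_cost[OF f k s1 refl])
      show "(\<Sum>a<k. \<Sum>r<s. (cluster_sum n f (sg (xs ! r)) a / sqrt (csize n f a))\<^sup>2) \<le> 24 * real s * real k"
        using 1 unfolding X1_def sum_list_rows[OF len] M_def c_def by (subst sum.swap) simp
      show "real s / 2 * (\<Sum>a<k. (if csize n f a = 0 then 0 else 1) * real_of_int ((z a)\<^sup>2))
          \<le> (\<Sum>r<s. (\<Sum>a<k. cluster_sum n f (sg (xs ! r)) a / sqrt (csize n f a) * real_of_int (z a))\<^sup>2)"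
        if "z \<in> grid k" for z
        using 2[OF that] unfolding X2_def sum_list_rows[OF len] M_def c_def w_def by simp
      show "(\<Sum>j<d. \<Sum>a<k. (\<Sum>r<s. cluster_sum n f (sg (xs ! r)) a *
             (\<Sum>i<n. sg (xs ! r) i * (A i j - centroid n f A (f i) j)))\<^sup>2 / csize n f a)
          \<le> 24 * (81 * real s * real k * kcost n d f (centroid n f A) A)"
        using 3 unfolding X3_def sum_list_rows[OF len] M_def c_def SB_def B_def F_def .
    qed
    also have "\<dots> \<le> F + \<epsilon> / 10 * F"
    proof -
      \<comment> \<open>16 * 24 * 81 = 31104, so an excess of at most \<epsilon>/10 requires s
        \<epsilon> \<ge> 311040 k. This explains the constant 320000.\<close>
      have "16 / (real s)\<^sup>2 * (24 * (81 * real s * real k * F)) = 31104 * real k / real s * F"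
        using s1 by (simp add: power2_eq_square field_simps)
      also have "\<dots> \<le> \<epsilon> / 10 * F"
        using F0 s s1 by (intro mult_right_mono) (auto simp: field_simps)
      finally show ?thesis by simp
    qed
    finally show False using bad by (simp add: distrib_right)
  qed
  also have "\<dots> \<le> 1 / 24 + (1 / 24 + 1 / 24)"
    using P1 P2 P3 by (intro order_trans[OF prob_Un_le] add_mono) auto
  finally show ?thesis by (simp add: F_def)
qed

section \<open>Comparing costs through a sketch\<close>

text \<open>Only the competitors need a two-sided guarantee: all vectors of \<open>V\<close> must not shrink,
  while the reference family \<open>x\<close> must merely not grow in total, for which Chebyshev suffices.\<close>

lemma sketch_compare_prob:
  fixes x :: "'j \<Rightarrow> 'i \<Rightarrow> real"
  assumes g: "good4 \<rho> sg I 81" and \<epsilon>: "0 < \<epsilon>" "\<epsilon> < 1"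
    and V: "finite V" "real (card V) \<le> N" "N \<ge> 1" and m: "real m * \<epsilon>\<^sup>2 \<ge> 16200 * (ln N + 12)"
    and J: "finite J"
  shows "measure_pmf.prob (replicate_pmf m \<rho>) {xs. \<not> (
      (\<forall>v\<in>V. (\<Sum>r<m. (\<Sum>i\<in>I. sg (xs ! r) i * v i)\<^sup>2) \<ge> (1 - \<epsilon> / 10) * real m * (\<Sum>i\<in>I. (v i)\<^sup>2)) \<and>
      (\<Sum>r<m. \<Sum>j\<in>J. (\<Sum>i\<in>I. sg (xs ! r) i * x j i)\<^sup>2) \<le> (1 + \<epsilon> / 10) * real m * (\<Sum>j\<in>J. \<Sum>i\<in>I. (x j i)\<^sup>2))}
     \<le> 2 / 24"
proof -
  let ?Z = "\<lambda>l v. \<Sum>i\<in>I. sg l i * v i"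
  let ?G = "\<lambda>l. \<Sum>j\<in>J. (?Z l (x j))\<^sup>2" and ?F = "\<Sum>j\<in>J. \<Sum>i\<in>I. (x j i)\<^sup>2"
  have fin: "finite (set_pmf \<rho>)" using g by (simp add: good4_def)
  have lnN: "ln N \<ge> 0" using V by simp
  have m0: "m > 0" using m lnN \<epsilon> by (cases m) auto
  have P1: "measure_pmf.prob (replicate_pmf m \<rho>)
      (\<Union>v\<in>V. {xs. (\<Sum>l\<leftarrow>xs. (?Z l v)\<^sup>2) < (1 - \<epsilon> / 10) * m * (\<Sum>i\<in>I. (v i)\<^sup>2)}) \<le> 1 / 24"
  proof -
    have "measure_pmf.prob (replicate_pmf m \<rho>)
      (\<Union>v\<in>V. {xs. (\<Sum>l\<leftarrow>xs. (?Z l v)\<^sup>2) < (1 - \<epsilon> / 10) * m * (\<Sum>i\<in>I. (v i)\<^sup>2)})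
      \<le> real (card V) * exp (- ((\<epsilon> / 10)\<^sup>2 * m / (2 * 81)))"
      using \<epsilon> by (intro prob_UN_le V good4_lower_tail[OF g]) auto
    \<comment> \<open>The constant 16200 is 100 * 2 * 81: the square of the 10 in \<epsilon>/10,
      times the denominator 2 K of the lower tail.\<close>
    also have "\<dots> \<le> N * exp (- (ln N + 12))"
      using V m by (intro mult_mono) (auto simp: power_divide mult.commute)
    also have "\<dots> = exp (- 12)" using V by (simp add: exp_diff exp_minus field_simps)
    also have "\<dots> \<le> exp (- 4)" by simp
    finally show ?thesis using exp_minus_4 by linarith
  qed
  have P2: "measure_pmf.prob (replicate_pmf m \<rho>) {xs. (\<Sum>l\<leftarrow>xs. ?G l) > (1 + \<epsilon> / 10) * m * ?F} \<le> 1 / 24"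
  proof -
    have E: "expect \<rho> ?G = ?F" using g by (simp add: expect_sum[OF fin] good4_def)
    have "expect \<rho> (\<lambda>l. (?G l)\<^sup>2) = (\<Sum>j\<in>J. \<Sum>j'\<in>J. expect \<rho> (\<lambda>l. (?Z l (x j))\<^sup>2 * (?Z l (x j'))\<^sup>2))"
      by (simp add: power2_eq_square[of "sum _ J"] sum_product expect_sum[OF fin])
    also have "\<dots> \<le> (\<Sum>j\<in>J. \<Sum>j'\<in>J. 81 * (\<Sum>i\<in>I. (x j i)\<^sup>2) * (\<Sum>i\<in>I. (x j' i)\<^sup>2))"
      by (intro sum_mono good4_mixed[OF g])
    also have "\<dots> = 81 * ?F\<^sup>2"
    proof -
      have "(\<Sum>j\<in>J. \<Sum>j'\<in>J. 81 * q j * q j') = 81 * (\<Sum>j\<in>J. q j)\<^sup>2" for q :: "'j \<Rightarrow> real"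
        by (simp add: power2_eq_square sum_product sum_distrib_left sum_distrib_right mult_ac)
      then show ?thesis .
    qed
    finally have "measure_pmf.prob (replicate_pmf m \<rho>) {xs. (\<Sum>l\<leftarrow>xs. ?G l) > (1 + \<epsilon> / 10) * m * ?F}
        \<le> 81 / (m * (\<epsilon> / 10)\<^sup>2)"
      using \<epsilon> m0 by (intro sum_upper_tail[OF fin E]) (auto intro: sum_nonneg)
    also have "\<dots> \<le> 1 / 24"
    proof -
      \<comment> \<open>194400 = 16200 * 12 = 81 * 100 * 24, so the summand 12 is what Chebyshev's
        tail needs to drop to 1/24.\<close>
      have "194400 \<le> real m * \<epsilon>\<^sup>2" using m lnN by simp
      then show ?thesis using m0 \<epsilon> by (simp add: power_divide field_simps)
    qed
    finally show ?thesis .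
  qed
  have "measure_pmf.prob (replicate_pmf m \<rho>) {xs. \<not> (
      (\<forall>v\<in>V. (\<Sum>r<m. (?Z (xs ! r) v)\<^sup>2) \<ge> (1 - \<epsilon> / 10) * real m * (\<Sum>i\<in>I. (v i)\<^sup>2)) \<and>
      (\<Sum>r<m. ?G (xs ! r)) \<le> (1 + \<epsilon> / 10) * real m * ?F)}
   \<le> measure_pmf.prob (replicate_pmf m \<rho>)
     ((\<Union>v\<in>V. {xs. (\<Sum>l\<leftarrow>xs. (?Z l v)\<^sup>2) < (1 - \<epsilon> / 10) * m * (\<Sum>i\<in>I. (v i)\<^sup>2)})
      \<union> {xs. (\<Sum>l\<leftarrow>xs. ?G l) > (1 + \<epsilon> / 10) * m * ?F})"
    by (rule prob_le_on_support) (auto simp: sum_list_rows[OF length_replicate_pmf] not_le)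
  also have "\<dots> \<le> 1 / 24 + 1 / 24"
    using P1 P2 by (intro order_trans[OF prob_Un_le] add_mono)
  finally show ?thesis by simp
qed

section \<open>Exhaustive search over sketched assignments\<close>

text \<open>The base 2 n + 1 digits of one number hold all entries, shifted by n into {-n..n}. A
  single counter therefore runs through all guesses, and an entry is recovered by \<open>div\<close>
  and \<open>mod\<close>.\<close>

definition guess :: "nat \<Rightarrow> nat \<Rightarrow> nat \<Rightarrow> nat \<Rightarrow> nat \<Rightarrow> real" where
  "guess n k m r a = real (m div (2 * n + 1) ^ (r * k + a) mod (2 * n + 1)) - real n"

definition sk_centers :: "nat \<Rightarrow> nat \<Rightarrow> (nat \<Rightarrow> nat \<Rightarrow> real) \<Rightarrow> (nat \<Rightarrow> nat \<Rightarrow> real) \<Rightarrow> nat \<Rightarrow> nat \<Rightarrow> real" where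
  "sk_centers s k M SA a j = (\<Sum>y<s. pinv s M k a y * SA y j)"

definition sk_dist :: "nat \<Rightarrow> nat \<Rightarrow> (nat \<Rightarrow> nat \<Rightarrow> real) \<Rightarrow> (nat \<Rightarrow> nat \<Rightarrow> real) \<Rightarrow> (nat \<Rightarrow> nat \<Rightarrow> real) \<Rightarrow>
    nat \<Rightarrow> nat \<Rightarrow> real" where
  "sk_dist d t Tf C AT i a = (\<Sum>y<t. ((\<Sum>j<d. C a j * Tf j y) - AT i y)\<^sup>2)"

text \<open>Ties go to the smallest index, in agreement with a left-to-right scan that replaces its
  current choice only on strict improvement.\<close>

definition nearest :: "nat \<Rightarrow> (nat \<Rightarrow> real) \<Rightarrow> nat" where
  "nearest k D = (LEAST a. a < k \<and> (\<forall>b<k. D a \<le> D b))"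

definition sk_cost :: "nat \<Rightarrow> nat \<Rightarrow> nat \<Rightarrow> (nat \<Rightarrow> nat \<Rightarrow> real) \<Rightarrow> (nat \<Rightarrow> nat \<Rightarrow> real) \<Rightarrow> (nat \<Rightarrow> nat) \<Rightarrow>
    (nat \<Rightarrow> real) \<Rightarrow> real" where
  "sk_cost n d w Wf C lab Wa = (\<Sum>r<w. ((\<Sum>l<n * d. Wf r l * C (lab (l div d)) (l mod d)) - Wa r)\<^sup>2)"

lemma nearest:
  assumes "k \<ge> 1"
  shows "nearest k D < k" "b < k \<Longrightarrow> D (nearest k D) \<le> D b"
proof -
  have "\<exists>a. a < k \<and> (\<forall>b<k. D a \<le> D b)"
    using arg_min_if_finite[of "{..<k}" D] assms by (auto simp: lessThan_empty_iff not_less intro!: exI[of _ "arg_min_on D {..<k}"])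
  then have "nearest k D < k \<and> (\<forall>b<k. D (nearest k D) \<le> D b)"
    unfolding nearest_def by (rule LeastI_ex)
  then show "nearest k D < k" "b < k \<Longrightarrow> D (nearest k D) \<le> D b" by auto
qed

text \<open>A guess agrees with the sketched assignment only at positions inside the s by k matrix,
  so the pseudo-inverse must be seen not to depend on other values.\<close>

lemma pinv_cong:
  assumes "\<And>x a. x < s \<Longrightarrow> a < p \<Longrightarrow> M x a = M' x a" "y < s"
  shows "pinv s M p a y = pinv s M' p a y"
  using assms
proof (induction p arbitrary: a y)
  case (Suc p)
  have IH: "pinv s M p a y = pinv s M' p a y" if "y < s" for a y using Suc.IH Suc.prems(1) that by simp
  have Mp: "M y a = M' y a" if "y < s" "a \<le> p" for y a using Suc.prems(1) that by simp
  have "residual s M (pinv s M p) p y = residual s M' (pinv s M' p) p y" if "y < s" for y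
    unfolding residual_def using that by (simp add: IH Mp)
  then have "dual_row s M (pinv s M p) p y = dual_row s M' (pinv s M' p) p y" if "y < s" for y
    unfolding dual_row_def using that by simp
  then show ?case using Suc.prems(2) by (simp add: IH Mp)
qed simp

lemma digits_exist:
  fixes z :: "nat \<Rightarrow> nat"
  assumes "\<And>l. l < L \<Longrightarrow> z l < B"
  shows "\<exists>m<B ^ L. \<forall>l<L. m div B ^ l mod B = z l"
  using assms
proof (induction L arbitrary: z)
  case (Suc L)
  obtain m where m: "m < B ^ L" "\<And>l. l < L \<Longrightarrow> m div B ^ l mod B = z (Suc l)"
    using Suc.IH[of "\<lambda>l. z (Suc l)"] Suc.prems by auto
  have z0: "z 0 < B" using Suc.prems by simp
  let ?m = "z 0 + B * m"
  have "?m < B ^ Suc L"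
  proof -
    have "?m < B + B * m" using z0 by simp
    also have "\<dots> = B * Suc m" by simp
    also have "\<dots> \<le> B * B ^ L" using m(1) by (intro mult_left_mono) auto
    finally show ?thesis by simp
  qed
  moreover have "?m div B ^ l mod B = z l" if "l < Suc L" for l
    using that z0 m(2) by (cases l) (auto simp: div_mult2_eq)
  ultimately show ?case by blast
qed simp

text \<open>The one place where the entries of S have to be signs: the sketched assignment becomes
  an integer matrix with a bounded range of entries, hence one of finitely many guesses.\<close>

lemma cluster_sum_signs:
  assumes "\<And>i. i < n \<Longrightarrow> \<phi> i = 1 \<or> \<phi> i = (-1::real)"
  shows "\<exists>z::nat. z \<le> 2 * n \<and> cluster_sum n f \<phi> a = real z - real n"
  using assms
proof (induction n)
  case 0
  then show ?case by (simp add: cluster_sum_def)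
next
  case (Suc n)
  then obtain z :: nat where z: "z \<le> 2 * n" "cluster_sum n f \<phi> a = real z - real n" by auto
  have eq: "cluster_sum (Suc n) f \<phi> a = cluster_sum n f \<phi> a + (if f n = a then \<phi> n else 0)"
    by (simp add: cluster_sum_def)
  consider "f n = a" "\<phi> n = 1" | "f n = a" "\<phi> n = -1" | "f n \<noteq> a" using Suc.prems[of n] by auto
  then show ?case
  proof cases
    case 1
    \<comment> \<open>The offset n grows by one as well, so a new sign +1, -1 or no contribution
      moves z by 2, 0 or 1.\<close>
    then show ?thesis using z eq by (intro exI[of _ "z + 2"]) auto
  next
    case 2
    then show ?thesis using z eq by (intro exI[of _ "z"]) auto
  next
    case 3
    then show ?thesis using z eq by (intro exI[of _ "z + 1"]) auto
  qed
qed

lemma sum_row_major: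
  fixes F :: "nat \<Rightarrow> nat \<Rightarrow> 'a::comm_monoid_add"
  shows "(\<Sum>i<n. \<Sum>j<d. F i j) = (\<Sum>l<n * d. F (l div d) (l mod d))"
proof -
  have row: "(\<Sum>l\<in>{i * d..<i * d + d}. F (l div d) (l mod d)) = (\<Sum>j<d. F i j)" for i :: nat
    using sum.shift_bounds_nat_ivl[of "\<lambda>l. F (l div d) (l mod d)" 0 "i * d" d]
    by (simp add: add.commute lessThan_atLeast0)
  have "(\<Sum>l<n * d. F (l div d) (l mod d)) = (\<Sum>i<n. \<Sum>l\<in>{i * d..<i * d + d}. F (l div d) (l mod d))"
    by (rule sum.nat_group[symmetric])
  then show ?thesis by (simp add: row)
qed

lemma kcost_flat: "kcost n d g C A = (\<Sum>l<n * d. (C (g (l div d)) (l mod d) - A (l div d) (l mod d))\<^sup>2)"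
  unfolding kcost_def by (rule sum_row_major)

section \<open>Independence of the sketches\<close>

lemma expect_pair:
  assumes "finite (set_pmf p)" "finite (set_pmf q)"
  shows "expect (pair_pmf p q) h = expect p (\<lambda>x. expect q (\<lambda>y. h (x, y)))"
  using assms by (simp add: pair_pmf_def expect_bind)

text \<open>Fubini: a bound that holds conditionally on the other component. It allows the vectors
  in a union bound to depend on the sketches drawn separately.\<close>

lemma prob_pair_le_snd:
  assumes "finite (set_pmf p)" "finite (set_pmf q)"
    and "\<And>x. x \<in> set_pmf p \<Longrightarrow> measure_pmf.prob q {y. P x y} \<le> c"
  shows "measure_pmf.prob (pair_pmf p q) {(x, y). P x y} \<le> c"
proof -
  have "measure_pmf.prob (pair_pmf p q) {(x, y). P x y} = expect (pair_pmf p q) (indicator {(x, y). P x y})"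
    by simp
  also have "\<dots> = expect p (\<lambda>x. expect q (indicator {y. P x y}))"
    unfolding expect_pair[OF assms(1,2)] by (intro arg_cong2[of _ _ _ _ measure_pmf.expectation] refl ext) (simp add: indicator_def)
  also have "\<dots> \<le> expect p (\<lambda>_. c)" using assms(3) by (intro expect_mono[OF assms(1)]) simp
  finally show ?thesis by simp
qed

lemma prob_pair_le_fst:
  assumes "finite (set_pmf p)" "finite (set_pmf q)"
    and "\<And>y. y \<in> set_pmf q \<Longrightarrow> measure_pmf.prob p {x. P x y} \<le> c"
  shows "measure_pmf.prob (pair_pmf p q) {(x, y). P x y} \<le> c"
proof -
  have "measure_pmf.prob (pair_pmf p q) {(x, y). P x y} = measure_pmf.prob (pair_pmf q p) {(y, x). P x y}"
    by (subst pair_commute_pmf) (auto intro!: arg_cong2[of _ _ _ _ measure_pmf.prob] simp: vimage_def)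
  then show ?thesis using prob_pair_le_snd[of q p "\<lambda>y x. P x y" c] assms by simp
qed

text \<open>The sketching matrices enter as functions, so that the search can be instantiated with
  explicit matrices as well as with signs computed from tables.\<close>

locale sketch_search =
  fixes n d k s t w :: nat and Tf Wf SA AT :: "nat \<Rightarrow> nat \<Rightarrow> real" and Wa :: "nat \<Rightarrow> real"
begin

definition cand_centers :: "nat \<Rightarrow> nat \<Rightarrow> nat \<Rightarrow> real" where
  "cand_centers m = sk_centers s k (guess n k m) SA"

definition cand_labels :: "nat \<Rightarrow> nat \<Rightarrow> nat" where
  "cand_labels m i = nearest k (sk_dist d t Tf (cand_centers m) AT i)"

definition cand_cost :: "nat \<Rightarrow> real" where
  "cand_cost m = sk_cost n d w Wf (cand_centers m) (cand_labels m) Wa"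

text \<open>Correctness is shown for every minimiser, so it does not matter which one the program
  finds.\<close>

definition best :: "nat \<Rightarrow> bool" where
  "best m \<longleftrightarrow> m < (2 * n + 1) ^ (s * k) \<and> (\<forall>m'<(2 * n + 1) ^ (s * k). cand_cost m \<le> cand_cost m')"

end

text \<open>With \<eta> = \<epsilon>/10 the accumulated factor is (1 + \<eta>)^3 / (1 - \<eta>)^2.
  The bound 1 + 10 \<eta> has slack \<eta> (5 - 22 \<eta> + 9 \<eta>^2), which is nonnegative as
  \<eta> < 1/10.\<close>

lemma final_ratio:
  fixes \<epsilon> X Y Z O' :: real
  assumes \<epsilon>: "0 < \<epsilon>" "\<epsilon> < 1" and O': "0 \<le> O'"
    and 1: "(1 - \<epsilon> / 10) * X \<le> (1 + \<epsilon> / 10) * Y" and 2: "(1 - \<epsilon> / 10) * Y \<le> (1 + \<epsilon> / 10) * Z"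
    and 3: "Z \<le> (1 + \<epsilon> / 10) * O'"
  shows "X \<le> (1 + \<epsilon>) * O'"
proof -
  define \<eta> where "\<eta> = \<epsilon> / 10"
  have \<eta>: "0 < \<eta>" "\<eta> < 1 / 10" "\<epsilon> = 10 * \<eta>" using \<epsilon> by (auto simp: \<eta>_def)
  have "(1 - \<eta>)\<^sup>2 * X = (1 - \<eta>) * ((1 - \<eta>) * X)" by (simp add: power2_eq_square)
  also have "\<dots> \<le> (1 - \<eta>) * ((1 + \<eta>) * Y)" using 1 \<eta> by (intro mult_left_mono) auto
  also have "\<dots> = (1 + \<eta>) * ((1 - \<eta>) * Y)" by simp
  also have "\<dots> \<le> (1 + \<eta>) * ((1 + \<eta>) * ((1 + \<eta>) * O'))"
  proof (intro mult_left_mono)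
    show "(1 - \<eta>) * Y \<le> (1 + \<eta>) * ((1 + \<eta>) * O')"
      using 2 mult_left_mono[OF 3, of "1 + \<epsilon> / 10"] \<epsilon> unfolding \<eta>_def by linarith
  qed (use \<eta> in auto)
  also have "\<dots> = (1 + \<eta>) ^ 3 * O'" by (simp add: power3_eq_cube)
  also have "\<dots> \<le> ((1 - \<eta>)\<^sup>2 * (1 + 10 * \<eta>)) * O'"
  proof (rule mult_right_mono[OF _ O'])
    have "0 \<le> \<eta> * (5 - 22 * \<eta> + 9 * \<eta>\<^sup>2)" using \<eta> by (intro mult_nonneg_nonneg) (auto intro!: add_nonneg_nonneg)
    also have "\<dots> = (1 - \<eta>)\<^sup>2 * (1 + 10 * \<eta>) - (1 + \<eta>) ^ 3"
      by (simp add: power2_eq_square power3_eq_cube algebra_simps)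
    finally show "(1 + \<eta>) ^ 3 \<le> (1 - \<eta>)\<^sup>2 * (1 + 10 * \<eta>)" by simp
  qed
  finally have "(1 - \<eta>)\<^sup>2 * X \<le> (1 - \<eta>)\<^sup>2 * ((1 + 10 * \<eta>) * O')" by (simp only: mult.assoc)
  then show ?thesis using \<eta> by (subst (asm) mult_le_cancel_left_pos) auto
qed

text \<open>One of the guesses equals the sketched optimal assignment.\<close>

lemma search_prob:
  fixes A :: "nat \<Rightarrow> nat \<Rightarrow> real" and \<rho>S :: "'s pmf" and \<rho>T :: "'t pmf" and \<rho>W :: "'w pmf"
  defines "cen \<equiv> \<lambda>(ss :: 's list) s sgS k n. sketch_search.cand_centers n k s (\<lambda>y j. \<Sum>i<n. sgS (ss ! y) i * A i j)"
    and "lab \<equiv> \<lambda>(ts :: 't list) (ss :: 's list) s t sgS sgT k n d. sketch_search.cand_labels n d k s t (\<lambda>j y. sgT (ts ! y) j)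
        (\<lambda>y j. \<Sum>i<n. sgS (ss ! y) i * A i j) (\<lambda>i y. \<Sum>j<d. A i j * sgT (ts ! y) j)"
  assumes gS: "good4 \<rho>S sgS {..<n} 81" and gT: "good4 \<rho>T sgT {..<d} 81" and gW: "good4 \<rho>W sgW {..<n * d} 81"
    and sgn: "\<And>l i. l \<in> set_pmf \<rho>S \<Longrightarrow> i < n \<Longrightarrow> sgS l i = 1 \<or> sgS l i = -1"
    and f: "\<And>i. i < n \<Longrightarrow> f i < k" and opt: "kcost n d f (centroid n f A) A \<le> opt"
    and n: "n \<ge> 1" and k: "k \<ge> 1" and \<epsilon>: "0 < \<epsilon>" "\<epsilon> < 1"
    and s: "real s * \<epsilon> \<ge> 320000 * real k"
    and t: "real t * \<epsilon>\<^sup>2 \<ge> 16200 * (ln (real n * real k) + 12)"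
    and w: "real w * \<epsilon>\<^sup>2 \<ge> 16200 * (real (s * k) * ln (2 * real n + 1) + 12)"
  shows "measure_pmf.prob (pair_pmf (replicate_pmf t \<rho>T) (pair_pmf (replicate_pmf s \<rho>S) (replicate_pmf w \<rho>W)))
     {(ts, ss, ws). \<forall>m. sketch_search.best n d k s t w (\<lambda>j y. sgT (ts ! y) j) (\<lambda>r l. sgW (ws ! r) l)
        (\<lambda>y j. \<Sum>i<n. sgS (ss ! y) i * A i j) (\<lambda>i y. \<Sum>j<d. A i j * sgT (ts ! y) j)
        (\<lambda>r. \<Sum>l<n * d. sgW (ws ! r) l * A (l div d) (l mod d)) m \<longrightarrow>
        kcost n d (lab ts ss s t sgS sgT k n d m) (cen ss s sgS k n m) A \<le> (1 + \<epsilon>) * opt} \<ge> 2 / 3"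
proof -
  let ?PT = "replicate_pmf t \<rho>T" and ?PS = "replicate_pmf s \<rho>S" and ?PW = "replicate_pmf w \<rho>W"
  let ?P = "pair_pmf ?PT (pair_pmf ?PS ?PW)"
  let ?Q = "(2 * n + 1) ^ (s * k)"
  have fin: "finite (set_pmf ?PT)" "finite (set_pmf ?PS)" "finite (set_pmf ?PW)"
    using gS gT gW by (auto intro!: finite_replicate_pmf simp: good4_def)
  have opt0: "opt \<ge> 0" using opt kcost_nonneg[of n d f "centroid n f A" A] by linarith
  define SA where "SA ss = (\<lambda>y j. \<Sum>i<n. sgS (ss ! y) i * A i j)" for ss
  define AT where "AT ts = (\<lambda>i y. \<Sum>j<d. A i j * sgT (ts ! y) j)" for ts
  define Wa where "Wa ws = (\<lambda>r. \<Sum>l<n * d. sgW (ws ! r) l * A (l div d) (l mod d))" for ws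
  define Tf where "Tf ts = (\<lambda>j y. sgT (ts ! y) j)" for ts
  define Wf where "Wf ws = (\<lambda>r l. sgW (ws ! r) l)" for ws
  define C where "C ss = sketch_search.cand_centers n k s (SA ss)" for ss
  define L where "L ts ss = sketch_search.cand_labels n d k s t (Tf ts) (SA ss) (AT ts)" for ts ss
  define M where "M ss = (\<lambda>r a. cluster_sum n f (sgS (ss ! r)) a)" for ss
  define C' where "C' ss = (\<lambda>a j. \<Sum>y<s. pinv s (M ss) k a y * SA ss y j)" for ss
  have "\<exists>m<?Q. \<forall>r<s. \<forall>a<k. guess n k m r a = M ss r a" if ss: "ss \<in> set_pmf ?PS" for ss
  proof -
    have "\<exists>z::nat. z \<le> 2 * n \<and> M ss r a = real z - real n" if "r < s" for r a
    proof -
      have "ss ! r \<in> set_pmf \<rho>S" using ss that by (auto simp: set_replicate_pmf)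
      then show ?thesis unfolding M_def using sgn by (intro cluster_sum_signs) auto
    qed
    then obtain z where z: "\<And>r a. r < s \<Longrightarrow> z r a \<le> 2 * n \<and> M ss r a = real (z r a :: nat) - real n" by metis
    obtain m where m: "m < ?Q" "\<And>l. l < s * k \<Longrightarrow> m div (2 * n + 1) ^ l mod (2 * n + 1) = z (l div k) (l mod k)"
      using digits_exist[of "s * k" "\<lambda>l. z (l div k) (l mod k)" "2 * n + 1"] z
      by (auto simp: less_mult_imp_div_less less_Suc_eq_le)
    have "guess n k m r a = M ss r a" if "r < s" "a < k" for r a
    proof -
      have "r * k + a < s * k" using that mult_le_mono1[of "Suc r" s k] by simp
      from m(2)[OF this] show ?thesis using that z by (simp add: guess_def)
    qed
    then show ?thesis using m(1) by blast
  qed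
  \<comment> \<open>The right guess is a function of S alone, so fixing S fixes the centers against
    which T is tested.\<close>
  then obtain m0 where m0: "\<And>ss. ss \<in> set_pmf ?PS \<Longrightarrow> m0 ss < ?Q"
    "\<And>ss r a. ss \<in> set_pmf ?PS \<Longrightarrow> r < s \<Longrightarrow> a < k \<Longrightarrow> guess n k (m0 ss) r a = M ss r a" by metis
  have C_m0: "C ss (m0 ss) = C' ss" if "ss \<in> set_pmf ?PS" for ss
    unfolding C_def C'_def sketch_search.cand_centers_def sk_centers_def
    by (intro ext sum.cong refl arg_cong2[of _ _ _ _ "(*)"] pinv_cong) (auto simp: m0(2)[OF that])
  have Lk: "L ts ss m i < k" for ts ss m i
    unfolding L_def sketch_search.cand_labels_def by (rule nearest(1)[OF k])
  define GS where "GS ss \<longleftrightarrow> kcost n d f (C' ss) A \<le> (1 + \<epsilon> / 10) * kcost n d f (centroid n f A) A" for ss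
  define GT where "GT ts ss \<longleftrightarrow> (1 - \<epsilon> / 10) * kcost n d (L ts ss (m0 ss)) (C' ss) A
       \<le> (1 + \<epsilon> / 10) * kcost n d f (C' ss) A" for ts ss
  define GW where "GW ts ss ws \<longleftrightarrow> (\<forall>m. sketch_search.best n d k s t w (Tf ts) (Wf ws) (SA ss) (AT ts) (Wa ws) m \<longrightarrow>
       (1 - \<epsilon> / 10) * kcost n d (L ts ss m) (C ss m) A
       \<le> (1 + \<epsilon> / 10) * kcost n d (L ts ss (m0 ss)) (C ss (m0 ss)) A)" for ts ss ws
  have PS: "measure_pmf.prob ?PS {ss. \<not> GS ss} \<le> 3 / 24"
    unfolding GS_def C'_def M_def SA_def by (rule sketch_centers_prob[OF gS f k \<epsilon> s])
  have PT: "measure_pmf.prob ?PT {ts. \<not> GT ts ss} \<le> 2 / 24" if ss: "ss \<in> set_pmf ?PS" for ss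
  proof -
    \<comment> \<open>Labels are analysed only for the right guess; for it, each of the n points is
      compared with k centers, which gives n k differences.\<close>
    define V where "V = (\<lambda>(i, a) j. C' ss a j - A i j) ` ({..<n} \<times> {..<k})"
    define x where "x i j = C' ss (f i) j - A i j" for i j
    have V: "finite V" "real (card V) \<le> real n * real k"
      using card_image_le[of "{..<n} \<times> {..<k}" "\<lambda>(i, a) j. C' ss a j - A i j"]
      by (auto simp: V_def simp flip: of_nat_mult)
    have nk: "real n * real k \<ge> 1" using n k mult_mono[of 1 "real n" 1 "real k"] by simp
    have lnt: "t > 0" using t ln_ge_zero[OF nk] by (cases t) (auto simp: not_le add_pos_nonneg)
    have "measure_pmf.prob ?PT {ts. \<not> GT ts ss} \<le> measure_pmf.prob ?PT {ts. \<not> (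
      (\<forall>v\<in>V. (\<Sum>y<t. (\<Sum>j<d. sgT (ts ! y) j * v j)\<^sup>2) \<ge> (1 - \<epsilon> / 10) * real t * (\<Sum>j<d. (v j)\<^sup>2)) \<and>
      (\<Sum>y<t. \<Sum>i<n. (\<Sum>j<d. sgT (ts ! y) j * x i j)\<^sup>2) \<le> (1 + \<epsilon> / 10) * real t * (\<Sum>i<n. \<Sum>j<d. (x i j)\<^sup>2))}"
    proof (rule prob_le_on_support, rule CollectI, rule notI)
      fix ts assume bad: "ts \<in> {ts. \<not> GT ts ss}"
        and "(\<forall>v\<in>V. (\<Sum>y<t. (\<Sum>j<d. sgT (ts ! y) j * v j)\<^sup>2) \<ge> (1 - \<epsilon> / 10) * real t * (\<Sum>j<d. (v j)\<^sup>2)) \<and>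
      (\<Sum>y<t. \<Sum>i<n. (\<Sum>j<d. sgT (ts ! y) j * x i j)\<^sup>2) \<le> (1 + \<epsilon> / 10) * real t * (\<Sum>i<n. \<Sum>j<d. (x i j)\<^sup>2)"
      then have lo: "\<forall>v\<in>V. (1 - \<epsilon> / 10) * real t * (\<Sum>j<d. (v j)\<^sup>2) \<le> (\<Sum>y<t. (\<Sum>j<d. sgT (ts ! y) j * v j)\<^sup>2)"
        and hi: "(\<Sum>y<t. \<Sum>i<n. (\<Sum>j<d. sgT (ts ! y) j * x i j)\<^sup>2) \<le> (1 + \<epsilon> / 10) * real t * (\<Sum>i<n. \<Sum>j<d. (x i j)\<^sup>2)"
        by auto
      let ?D = "sk_dist d t (Tf ts) (C' ss) (AT ts)" and ?g = "L ts ss (m0 ss)"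
      have D: "?D i a = (\<Sum>y<t. (\<Sum>j<d. sgT (ts ! y) j * (C' ss a j - A i j))\<^sup>2)" for i a
        by (simp add: sk_dist_def Tf_def AT_def right_diff_distrib sum_subtractf mult.commute)
      have g: "?g i = nearest k (?D i)" for i
        using C_m0[OF ss] by (simp add: L_def C_def sketch_search.cand_labels_def)
      have "real t * ((1 - \<epsilon> / 10) * kcost n d ?g (C' ss) A) = (\<Sum>i<n. (1 - \<epsilon> / 10) * real t * (\<Sum>j<d. (C' ss (?g i) j - A i j)\<^sup>2))"
        by (simp add: kcost_def sum_distrib_left mult_ac)
      also have "\<dots> \<le> (\<Sum>i<n. ?D i (?g i))"
      proof (rule sum_mono)
        fix i assume "i \<in> {..<n}"
        then have "(\<lambda>j. C' ss (?g i) j - A i j) \<in> V" using Lk[of ts ss "m0 ss" i] by (auto simp: V_def)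
        from lo[rule_format, OF this]
        show "(1 - \<epsilon> / 10) * real t * (\<Sum>j<d. (C' ss (?g i) j - A i j)\<^sup>2) \<le> ?D i (?g i)" by (simp add: D)
      qed
      also have "\<dots> \<le> (\<Sum>i<n. ?D i (f i))"
        unfolding g by (intro sum_mono nearest(2)[OF k] f) simp
      also have "\<dots> = (\<Sum>y<t. \<Sum>i<n. (\<Sum>j<d. sgT (ts ! y) j * x i j)\<^sup>2)"
        unfolding D x_def by (rule sum.swap)
      also note hi
      also have "(1 + \<epsilon> / 10) * real t * (\<Sum>i<n. \<Sum>j<d. (x i j)\<^sup>2) = real t * ((1 + \<epsilon> / 10) * kcost n d f (C' ss) A)"
        by (simp add: kcost_def x_def)
      finally have "GT ts ss" using lnt unfolding GT_def by (subst (asm) mult_le_cancel_left_pos) auto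
      with bad show False by simp
    qed
    also have "\<dots> \<le> 2 / 24" using t by (intro sketch_compare_prob[OF gT \<epsilon> V nk]) auto
    finally show ?thesis .
  qed
  have PW: "measure_pmf.prob ?PW {ws. \<not> GW ts ss ws} \<le> 2 / 24" if ss: "ss \<in> set_pmf ?PS" for ts ss
  proof -
    define x where "x m l = C ss m (L ts ss m (l div d)) (l mod d) - A (l div d) (l mod d)" for m l
    \<comment> \<open>One error vector per guess: for fixed S and T both the centers and the labels
      are functions of the guess.\<close>
    define V where "V = x ` {..<?Q}"
    have V: "finite V" "real (card V) \<le> real ?Q"
      using card_image_le[of "{..<?Q}" x] by (auto simp: V_def simp del: of_nat_power)
    have Q1: "real ?Q \<ge> 1" using one_le_power[of "2 * n + 1" "s * k"] by linarith
    have lnQ: "ln (real ?Q) = real (s * k) * ln (2 * real n + 1)" by (simp add: ln_realpow add.commute)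
    have w': "real w * \<epsilon>\<^sup>2 \<ge> 16200 * (ln (real ?Q) + 12)" using w unfolding lnQ .
    have "0 < 16200 * (ln (real ?Q) + 12)"
      using ln_ge_zero[OF Q1] by (intro mult_pos_pos add_nonneg_pos) (simp_all del: of_nat_power)
    then have "real w * \<epsilon>\<^sup>2 > 0" using w' by (rule less_le_trans)
    then have w0: "w > 0" by (cases w) (auto simp: not_le add_pos_nonneg simp del: of_nat_power)
    have "measure_pmf.prob ?PW {ws. \<not> GW ts ss ws} \<le> measure_pmf.prob ?PW {ws. \<not> (
      (\<forall>v\<in>V. (\<Sum>r<w. (\<Sum>l<n * d. sgW (ws ! r) l * v l)\<^sup>2) \<ge> (1 - \<epsilon> / 10) * real w * (\<Sum>l<n * d. (v l)\<^sup>2)) \<and>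
      (\<Sum>r<w. \<Sum>m\<in>{m0 ss}. (\<Sum>l<n * d. sgW (ws ! r) l * x m l)\<^sup>2) \<le> (1 + \<epsilon> / 10) * real w * (\<Sum>m\<in>{m0 ss}. \<Sum>l<n * d. (x m l)\<^sup>2))}"
    proof (rule prob_le_on_support, rule CollectI, rule notI)
      fix ws assume bad: "ws \<in> {ws. \<not> GW ts ss ws}"
        and ev: "(\<forall>v\<in>V. (\<Sum>r<w. (\<Sum>l<n * d. sgW (ws ! r) l * v l)\<^sup>2) \<ge> (1 - \<epsilon> / 10) * real w * (\<Sum>l<n * d. (v l)\<^sup>2)) \<and>
      (\<Sum>r<w. \<Sum>m\<in>{m0 ss}. (\<Sum>l<n * d. sgW (ws ! r) l * x m l)\<^sup>2) \<le> (1 + \<epsilon> / 10) * real w * (\<Sum>m\<in>{m0 ss}. \<Sum>l<n * d. (x m l)\<^sup>2)"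
      let ?E = "sketch_search.cand_cost n d k s t w (Tf ts) (Wf ws) (SA ss) (AT ts) (Wa ws)"
      have E: "?E m = (\<Sum>r<w. (\<Sum>l<n * d. sgW (ws ! r) l * x m l)\<^sup>2)" for m
        by (simp add: sketch_search.cand_cost_def sk_cost_def Wf_def Wa_def x_def C_def[symmetric] L_def[symmetric]
            right_diff_distrib sum_subtractf)
      have K: "kcost n d (L ts ss m) (C ss m) A = (\<Sum>l<n * d. (x m l)\<^sup>2)" for m
        unfolding kcost_flat x_def ..
      have "GW ts ss ws" unfolding GW_def
      proof (intro allI impI)
        fix m assume "sketch_search.best n d k s t w (Tf ts) (Wf ws) (SA ss) (AT ts) (Wa ws) m"
        then have m: "m < ?Q" and le: "?E m \<le> ?E (m0 ss)" using m0(1)[OF ss] by (auto simp: sketch_search.best_def)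
        have "real w * ((1 - \<epsilon> / 10) * kcost n d (L ts ss m) (C ss m) A) \<le> ?E m"
          unfolding E K using ev m by (auto simp: V_def mult_ac)
        also note le
        also have "?E (m0 ss) \<le> real w * ((1 + \<epsilon> / 10) * kcost n d (L ts ss (m0 ss)) (C ss (m0 ss)) A)"
          unfolding E K using ev by (auto simp: mult_ac)
        finally show "(1 - \<epsilon> / 10) * kcost n d (L ts ss m) (C ss m) A
          \<le> (1 + \<epsilon> / 10) * kcost n d (L ts ss (m0 ss)) (C ss (m0 ss)) A"
          using w0 by (subst (asm) mult_le_cancel_left_pos) auto
      qed
      with bad show False by simp
    qed
    also have "\<dots> \<le> 2 / 24" by (intro sketch_compare_prob[OF gW \<epsilon> V Q1 w']) auto
    finally show ?thesis .
  qed
  let ?good = "{(ts, ss, ws). \<forall>m. sketch_search.best n d k s t w (Tf ts) (Wf ws) (SA ss) (AT ts) (Wa ws) m \<longrightarrow>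
        kcost n d (L ts ss m) (C ss m) A \<le> (1 + \<epsilon>) * opt}"
  have "measure_pmf.prob ?P (- ?good) \<le> measure_pmf.prob ?P ({(ts, ss, ws). \<not> GS ss} \<union>
     ({(ts, ss, ws). \<not> GT ts ss} \<union> {(ts, ss, ws). \<not> GW ts ss ws}))"
  proof (rule prob_le_on_support, rule ccontr)
    fix z
    assume z: "z \<in> set_pmf ?P" "z \<in> - ?good" "z \<notin> {(ts, ss, ws). \<not> GS ss} \<union>
     ({(ts, ss, ws). \<not> GT ts ss} \<union> {(ts, ss, ws). \<not> GW ts ss ws})"
    obtain ts ss ws where z_eq: "z = (ts, ss, ws)" by (cases z) auto
    have ss: "ss \<in> set_pmf ?PS" and g: "GS ss" "GT ts ss" "GW ts ss ws" using z by (auto simp: z_eq)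
    have "kcost n d (L ts ss m) (C ss m) A \<le> (1 + \<epsilon>) * opt"
      if "sketch_search.best n d k s t w (Tf ts) (Wf ws) (SA ss) (AT ts) (Wa ws) m" for m
    proof (rule final_ratio[OF \<epsilon> opt0])
      show "(1 - \<epsilon> / 10) * kcost n d (L ts ss m) (C ss m) A \<le> (1 + \<epsilon> / 10) * kcost n d (L ts ss (m0 ss)) (C' ss) A"
        using g(3) that unfolding GW_def C_m0[OF ss] by blast
      show "(1 - \<epsilon> / 10) * kcost n d (L ts ss (m0 ss)) (C' ss) A \<le> (1 + \<epsilon> / 10) * kcost n d f (C' ss) A"
        using g(2) unfolding GT_def .
      have "(1 + \<epsilon> / 10) * kcost n d f (centroid n f A) A \<le> (1 + \<epsilon> / 10) * opt"
        using opt \<epsilon> by (intro mult_left_mono) auto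
      then show "kcost n d f (C' ss) A \<le> (1 + \<epsilon> / 10) * opt" using g(1) unfolding GS_def by linarith
    qed
    with z(2) show False by (simp add: z_eq)
  qed
  also have "\<dots> \<le> 3 / 24 + (2 / 24 + 2 / 24)"
  proof (intro order_trans[OF prob_Un_le] add_mono)
    show "measure_pmf.prob ?P {(ts, ss, ws). \<not> GS ss} \<le> 3 / 24"
    proof (rule prob_pair_le_snd[where P="\<lambda>ts (ss, ws). \<not> GS ss", simplified])
      show "measure_pmf.prob (pair_pmf ?PS ?PW) {y. case y of (ss, ws) \<Rightarrow> \<not> GS ss} \<le> 3 / 24"
        by (rule prob_pair_le_fst[OF fin(2,3)]) (rule PS)
    qed (use fin in auto)
    show "measure_pmf.prob ?P {(ts, ss, ws). \<not> GT ts ss} \<le> 2 / 24"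
      by (rule prob_pair_le_fst[where P="\<lambda>ts (ss, ws). \<not> GT ts ss", simplified]) (use fin PT in auto)
    show "measure_pmf.prob ?P {(ts, ss, ws). \<not> GW ts ss ws} \<le> 2 / 24"
    proof (rule prob_pair_le_snd[where P="\<lambda>ts (ss, ws). \<not> GW ts ss ws", simplified])
      fix ts
      show "measure_pmf.prob (pair_pmf ?PS ?PW) {y. case y of (ss, ws) \<Rightarrow> \<not> GW ts ss ws} \<le> 2 / 24"
        by (rule prob_pair_le_snd[OF fin(2,3)]) (rule PW)
    qed (use fin in auto)
  qed
  finally have "measure_pmf.prob ?P ?good \<ge> 2 / 3"
    using measure_pmf.prob_compl[of ?good ?P] by (simp add: Compl_eq_Diff_UNIV)
  then show ?thesis
    by (simp add: cen_def lab_def C_def[abs_def] L_def[abs_def] SA_def AT_def Wa_def Tf_def Wf_def)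
qed

section \<open>Reasoning about the random access machine\<close>

lemma steps_Halt: "steps m (Halt, s) = return_pmf (Halt, s)"
  by (induction m) (simp_all add: bind_return_pmf)

lemma steps_add: "steps (a + b) cfg = bind_pmf (steps a cfg) (steps b)"
proof (induction a arbitrary: cfg)
  case (Suc a)
  then have "steps (a + b) = (\<lambda>cfg. bind_pmf (steps a cfg) (steps b))" by blast
  then show ?case by (simp add: bind_assoc_pmf)
qed (simp add: bind_return_pmf)

lemma steps_halted:
  assumes "steps T cfg = map_pmf (Pair Halt) D" "T \<le> m"
  shows "steps m cfg = map_pmf (Pair Halt) D"
proof -
  have "steps m cfg = bind_pmf (steps T cfg) (steps (m - T))"
    using assms(2) steps_add[of T "m - T" cfg] by simp
  then show ?thesis
    by (simp add: assms(1) bind_map_pmf steps_Halt map_pmf_def[symmetric])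
qed

text \<open>The invariant is demanded after every number of steps, because the space bound concerns
  the whole run. The second part describes the exact final distribution; T may be any sufficiently
  large time, since halted configurations do not change.\<close>

definition runs :: "(state \<Rightarrow> bool) \<Rightarrow> com \<Rightarrow> state \<Rightarrow> nat \<Rightarrow> state pmf \<Rightarrow> bool" where
  "runs P c s T D \<longleftrightarrow> (\<forall>m. \<forall>cfg\<in>set_pmf (steps m (c, s)). P (snd cfg)) \<and>
     steps T (c, s) = map_pmf (Pair Halt) D"

lemma runs_init: "runs P c s T D \<Longrightarrow> P s"
  unfolding runs_def by (auto dest: spec[of _ 0])

lemma runs_final: "runs P c s T D \<Longrightarrow> s' \<in> set_pmf D \<Longrightarrow> P s'"
  unfolding runs_def by (auto dest: spec[of _ T])

lemma runs_mono: "runs P c s T D \<Longrightarrow> T \<le> T' \<Longrightarrow> runs P c s T' D"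
  unfolding runs_def by (auto intro: steps_halted)

lemma runs_Halt: "P s \<Longrightarrow> runs P Halt s T (return_pmf s)"
  unfolding runs_def by (simp add: steps_Halt)

lemma runs_step:
  assumes "P s" "\<And>c' s'. (c', s') \<in> set_pmf (step c s) \<Longrightarrow> runs P c' s' T (F (c', s'))"
  shows "runs P c s (Suc T) (bind_pmf (step c s) F)"
  unfolding runs_def
proof (intro conjI allI ballI)
  fix m cfg assume "cfg \<in> set_pmf (steps m (c, s))"
  then show "P (snd cfg)"
    using assms by (cases m) (auto simp: runs_def)
next
  show "steps (Suc T) (c, s) = map_pmf (Pair Halt) (bind_pmf (step c s) F)"
    using assms(2) by (auto simp: map_bind_pmf runs_def intro!: bind_pmf_cong)
qed

text \<open>The additional step discards the finished first command. If that command halts before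
  time T, the time left over is absorbed by \<open>runs_mono\<close>.\<close>

lemma runs_Seq:
  assumes "runs P c s T D" "\<And>s'. s' \<in> set_pmf D \<Longrightarrow> runs P c' s' T' (F s')"
  shows "runs P (Seq c c') s (T + T' + 1) (bind_pmf D F)"
  using assms
proof (induction T arbitrary: c s D)
  case 0
  from 0(1) have eq: "return_pmf (c, s) = map_pmf (Pair Halt) D" by (simp add: runs_def)
  then have "map_pmf snd (return_pmf (c, s)) = D" by (simp add: map_pmf_comp)
  then have D: "D = return_pmf s" by simp
  with eq have c: "c = Halt" by simp
  have "runs P (Seq c c') s (Suc T') (bind_pmf (step (Seq c c') s) (\<lambda>_. F s))"
    using 0 by (intro runs_step) (auto simp: c D runs_init[OF 0(1)])
  then show ?case by (simp add: c D bind_return_pmf)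
next
  case (Suc T)
  show ?case
  proof (cases "c = Halt")
    case True
    with Suc.prems(1) have "return_pmf (Halt, s) = map_pmf (Pair Halt) D"
      by (simp add: runs_def steps_Halt del: steps.simps)
    then have "map_pmf snd (return_pmf (Halt, s)) = D" by (simp add: map_pmf_comp)
    then have D: "D = return_pmf s" by simp
    have "runs P (Seq c c') s (Suc T') (bind_pmf (step (Seq c c') s) (\<lambda>_. F s))"
      using Suc.prems by (intro runs_step) (auto simp: True D runs_init[OF Suc.prems(1)])
    then have "runs P (Seq c c') s (Suc T') (bind_pmf D F)" by (simp add: True D bind_return_pmf)
    then show ?thesis by (rule runs_mono) simp
  next
    case False
    define D1 where "D1 cfg = map_pmf snd (steps T cfg)" for cfg
    have st: "bind_pmf (step c s) (steps T) = map_pmf (Pair Halt) D"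
      using Suc.prems(1) by (simp add: runs_def)
    have runs1: "runs P c1 s1 T (D1 (c1, s1))" if "(c1, s1) \<in> set_pmf (step c s)" for c1 s1
      unfolding runs_def
    proof (intro conjI allI ballI)
      fix m cfg assume "cfg \<in> set_pmf (steps m (c1, s1))"
      then have "cfg \<in> set_pmf (steps (Suc m) (c, s))" using that by auto
      then show "P (snd cfg)" using Suc.prems(1) unfolding runs_def by blast
    next
      have "fst cfg = Halt" if "cfg \<in> set_pmf (steps T (c1, s1))" for cfg
      proof -
        have "cfg \<in> set_pmf (bind_pmf (step c s) (steps T))" using that \<open>(c1, s1) \<in> _\<close> by auto
        then show ?thesis unfolding st by auto
      qed
      then have "map_pmf (Pair Halt \<circ> snd) (steps T (c1, s1)) = map_pmf id (steps T (c1, s1))"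
        by (intro map_pmf_cong) (auto simp: prod_eq_iff)
      then show "steps T (c1, s1) = map_pmf (Pair Halt) (D1 (c1, s1))"
        by (simp add: D1_def map_pmf_comp o_def)
    qed
    have D: "D = bind_pmf (step c s) D1"
    proof -
      have "map_pmf snd (map_pmf (Pair Halt) D) = bind_pmf (step c s) D1"
        by (simp add: st[symmetric] map_bind_pmf D1_def[abs_def])
      then show ?thesis by (simp add: map_pmf_comp)
    qed
    \<comment> \<open>One step of the composition yields a command of the form
      \<open>Seq c1 c'\<close>; matching on it recovers c1, from which the induction hypothesis
      continues.\<close>
    define G where "G = (\<lambda>(q, s1). case q of Seq c1 _ \<Rightarrow> bind_pmf (D1 (c1, s1)) F | _ \<Rightarrow> return_pmf s1)"
    have "runs P (Seq c c') s (Suc (T + T' + 1)) (bind_pmf (step (Seq c c') s) G)"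
    proof (rule runs_step)
      show "P s" by (rule runs_init[OF Suc.prems(1)])
      fix q s1 assume "(q, s1) \<in> set_pmf (step (Seq c c') s)"
      then obtain c1 where q: "q = Seq c1 c'" and c1: "(c1, s1) \<in> set_pmf (step c s)" using False by auto
      have "runs P (Seq c1 c') s1 (T + T' + 1) (bind_pmf (D1 (c1, s1)) F)"
      proof (rule Suc.IH[OF runs1[OF c1]])
        fix s' assume "s' \<in> set_pmf (D1 (c1, s1))"
        then show "runs P c' s' T' (F s')" using c1 by (intro Suc.prems(2)) (auto simp: D)
      qed
      then show "runs P q s1 (T + T' + 1) (G (q, s1))" by (simp add: G_def q)
    qed
    moreover have "bind_pmf (step (Seq c c') s) G = bind_pmf D F"
      using False by (auto simp: D bind_map_pmf bind_assoc_pmf G_def intro!: bind_pmf_cong)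
    ultimately show ?thesis by simp
  qed
qed

text \<open>A total-correctness triple for deterministic runs. Randomness occurs only while the bits
  are drawn, so every other piece of the programs is verified with this predicate.\<close>

definition ok :: "(state \<Rightarrow> bool) \<Rightarrow> com \<Rightarrow> state \<Rightarrow> nat \<Rightarrow> (state \<Rightarrow> bool) \<Rightarrow> bool" where
  "ok P c s T Q \<longleftrightarrow> (\<exists>s'. runs P c s T (return_pmf s') \<and> Q s')"

lemma ok_mono: "ok P c s T Q \<Longrightarrow> T \<le> T' \<Longrightarrow> (\<And>s'. P s' \<Longrightarrow> Q s' \<Longrightarrow> Q' s') \<Longrightarrow> ok P c s T' Q'"
  unfolding ok_def using runs_mono runs_final by fastforce

lemma ok_Seq:
  assumes "ok P c s T Q" "\<And>s'. P s' \<Longrightarrow> Q s' \<Longrightarrow> ok P c' s' T' Q'"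
  shows "ok P (Seq c c') s (T + T' + 1) Q'"
proof -
  obtain s1 where s1: "runs P c s T (return_pmf s1)" "Q s1" using assms(1) by (auto simp: ok_def)
  then have "P s1" by (auto dest: runs_final)
  then obtain s2 where s2: "runs P c' s1 T' (return_pmf s2)" "Q' s2"
    using assms(2)[of s1] s1 by (auto simp: ok_def)
  from runs_Seq[OF s1(1), of c' T' "\<lambda>_. return_pmf s2"] s2
  show ?thesis unfolding ok_def by (auto simp: bind_return_pmf)
qed

lemma ok_first_step:
  assumes "step c s = return_pmf (c', s')" "P s" "ok P c' s' T Q"
  shows "ok P c s (Suc T) Q"
proof -
  obtain s2 where "runs P c' s' T (return_pmf s2)" "Q s2" using assms by (auto simp: ok_def)
  then show ?thesis
    using runs_step[of P s c T "\<lambda>_. return_pmf s2"] assms by (auto simp: ok_def bind_return_pmf)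
qed

lemma ok_Halt: "P s \<Longrightarrow> Q s \<Longrightarrow> ok P Halt s T Q"
  unfolding ok_def using runs_Halt by blast

lemma ok_atom:
  assumes "step c s = return_pmf (Halt, s')" "P s" "P s'" "Q s'"
  and T: "0 < T"
  shows "ok P c s T Q"
proof -
  have "ok P Halt s' 0 Q" using assms by (intro ok_Halt)
  from ok_first_step[OF assms(1,2) this] show ?thesis using T by (auto elim: ok_mono)
qed

lemma ok_Cond:
  assumes "P s" "bval b s \<Longrightarrow> ok P c1 s T Q" "\<not> bval b s \<Longrightarrow> ok P c2 s T Q"
  shows "ok P (Cond b c1 c2) s (Suc T) Q"
proof (cases "bval b s")
  case True
  then show ?thesis using assms by (intro ok_first_step[where c'=c1 and s'=s]) auto
next
  case False
  then show ?thesis using assms by (intro ok_first_step[where c'=c2 and s'=s]) auto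
qed

text \<open>The guard decides exactly whether i < B, which fixes the number of rounds. Each round
  costs two extra steps, for the test and for leaving \<open>Seq\<close>, and the final test costs
  one more.\<close>

lemma ok_Loop:
  assumes J0: "J 0 s" "P s"
    and b: "\<And>i s. i \<le> B \<Longrightarrow> P s \<Longrightarrow> J i s \<Longrightarrow> bval b s \<longleftrightarrow> i < B"
    and c: "\<And>i s. i < B \<Longrightarrow> P s \<Longrightarrow> J i s \<Longrightarrow> ok P c s Tb (J (Suc i))"
  shows "ok P (Loop b c) s (B * (Tb + 2) + 1) (J B)"
proof -
  have "i \<le> B \<Longrightarrow> J (B - i) s \<Longrightarrow> P s \<Longrightarrow> ok P (Loop b c) s (i * (Tb + 2) + 1) (J B)" for i s
  proof (induction i arbitrary: s)
    case 0
    then have "\<not> bval b s" using b[of B s] by simp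
    then show ?case using 0 ok_first_step[of "Loop b c" s Halt s P 0 "J B"] by (auto intro: ok_Halt)
  next
    case (Suc i)
    then have bs: "bval b s" using b[of "B - Suc i" s] by simp
    have "ok P (Seq c (Loop b c)) s (Tb + (i * (Tb + 2) + 1) + 1) (J B)"
    proof (rule ok_Seq)
      show "ok P c s Tb (J (B - i))"
        using c[of "B - Suc i" s] Suc.prems by (simp add: Suc_diff_Suc)
    qed (use Suc in auto)
    from ok_first_step[OF _ Suc.prems(3) this] bs
    show ?case by (simp add: algebra_simps)
  qed
  from this[of B s] J0 show ?thesis by simp
qed

subsection \<open>Views of the memory\<close>

definition nv :: "state \<Rightarrow> nat \<Rightarrow> nat \<Rightarrow> nat" where "nv s a i = fetch (nats s a) i"
definition rv :: "state \<Rightarrow> nat \<Rightarrow> nat \<Rightarrow> real" where "rv s a i = fetch (reals s a) i"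

lemma fetch_store: "fetch (store xs i v) j = (if j = i then v else fetch xs j)"
  by (auto simp: fetch_def store_def nth_append nth_Cons split: nat.splits)

lemma views_put [simp]:
  "nv (put_nat a i v s) b j = (if b = a \<and> j = i then v else nv s b j)"
  "rv (put_nat a i v s) b j = rv s b j"
  "nv (put_real a i x s) b j = nv s b j"
  "rv (put_real a i x s) b j = (if b = a \<and> j = i then x else rv s b j)"
  "input (put_nat a i v s) = input s" "input (put_real a i x s) = input s"
  by (auto simp: nv_def rv_def put_nat_def put_real_def fetch_store)

lemma views_val [simp]:
  "nval (NGet a e) s = nv s a (nval e s)" "rval (RGet a e) s = rv s a (nval e s)"
  by (simp_all add: nv_def rv_def)

declare nval.simps(2)[simp del] rval.simps(2)[simp del]

text \<open>A frame condition: only the listed arrays may change. It compares the values read and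
  not the underlying lists, so that padding an array with zeros is invisible.\<close>

definition same :: "nat set \<Rightarrow> nat set \<Rightarrow> state \<Rightarrow> state \<Rightarrow> bool" where
  "same NU RU s s' \<longleftrightarrow> (\<forall>a i. a \<notin> NU \<longrightarrow> nv s' a i = nv s a i) \<and>
     (\<forall>a i. a \<notin> RU \<longrightarrow> rv s' a i = rv s a i) \<and> input s' = input s"

lemma same_refl [simp]: "same NU RU s s"
  by (simp add: same_def)

lemma same_trans: "same NU RU s s' \<Longrightarrow> same NU' RU' s' s'' \<Longrightarrow> NU \<subseteq> NU2 \<Longrightarrow> RU \<subseteq> RU2 \<Longrightarrow>
    NU' \<subseteq> NU2 \<Longrightarrow> RU' \<subseteq> RU2 \<Longrightarrow> same NU2 RU2 s s''"
  unfolding same_def by (metis subsetD)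

lemma same_mono: "same NU RU s s' \<Longrightarrow> NU \<subseteq> NU2 \<Longrightarrow> RU \<subseteq> RU2 \<Longrightarrow> same NU2 RU2 s s'"
  unfolding same_def by blast

lemma same_nv: "same NU RU s s' \<Longrightarrow> a \<notin> NU \<Longrightarrow> nv s' a i = nv s a i"
  and same_rv: "same NU RU s s' \<Longrightarrow> a \<notin> RU \<Longrightarrow> rv s' a i = rv s a i"
  and same_input: "same NU RU s s' \<Longrightarrow> input s' = input s"
  by (auto simp: same_def)

lemma same_put_nat: "same NU RU s s' \<Longrightarrow> a \<in> NU \<Longrightarrow> same NU RU s (put_nat a i v s')"
  by (auto simp: same_def)

lemma same_put_real: "same NU RU s s' \<Longrightarrow> a \<in> RU \<Longrightarrow> same NU RU s (put_real a i x s')"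
  by (auto simp: same_def)

subsection \<open>Memory bounds\<close>

text \<open>Capacities per array. Unlike \<open>mem_size\<close>, these bounds can be checked
  locally at each assignment, and \<open>mem_size_le\<close> turns them into a bound on the
  memory.\<close>

definition fits :: "(nat \<Rightarrow> nat) \<Rightarrow> (nat \<Rightarrow> nat) \<Rightarrow> (nat \<Rightarrow> nat) \<Rightarrow> state \<Rightarrow> bool" where
  "fits LN VN LR s \<longleftrightarrow>
     (\<forall>a. length (nats s a) \<le> LN a \<and> (\<forall>v\<in>set (nats s a). v \<le> VN a) \<and> length (reals s a) \<le> LR a)"

lemma length_store: "length (store xs i v) = max (length xs) (Suc i)"
  by (auto simp: store_def)

lemma set_store: "set (store xs i v) \<subseteq> insert v (insert 0 (set xs))"
  unfolding store_def using set_update_subset_insert[of xs i v] by auto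

lemma fits_put_nat: "fits LN VN LR s \<Longrightarrow> i < LN a \<Longrightarrow> v \<le> VN a \<Longrightarrow> fits LN VN LR (put_nat a i v s)"
  unfolding fits_def put_nat_def using set_store[of "nats s a" i v] by (auto simp: length_store)

lemma fits_put_real: "fits LN VN LR s \<Longrightarrow> i < LR a \<Longrightarrow> fits LN VN LR (put_real a i x s)"
  unfolding fits_def put_real_def by (auto simp: length_store)

lemma mem_size_le:
  assumes fit: "fits LN VN LR s" and NA: "finite NA" "\<And>a. a \<notin> NA \<Longrightarrow> LN a = 0"
    and RA: "finite RA" "\<And>a. a \<notin> RA \<Longrightarrow> LR a = 0"
  shows "mem_size s \<le> (\<Sum>a\<in>NA. LN a * (1 + floorlog 2 (VN a))) + (\<Sum>a\<in>RA. LR a)"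
proof -
  have "nats s a = []" if "a \<notin> NA" for a using fit NA(2)[OF that] by (auto simp: fits_def dest: spec[of _ a])
  then have N: "{a. nats s a \<noteq> []} \<subseteq> NA" by auto
  have "reals s a = []" if "a \<notin> RA" for a using fit RA(2)[OF that] by (auto simp: fits_def dest: spec[of _ a])
  then have R: "{a. reals s a \<noteq> []} \<subseteq> RA" by auto
  have "(\<Sum>v\<leftarrow>nats s a. 1 + floorlog 2 v) \<le> LN a * (1 + floorlog 2 (VN a))" for a
  proof -
    have "(\<Sum>v\<leftarrow>nats s a. 1 + floorlog 2 v) \<le> (\<Sum>v\<leftarrow>nats s a. 1 + floorlog 2 (VN a))"
      using fit by (intro sum_list_mono add_left_mono floorlog_mono) (auto simp: fits_def)
    also have "\<dots> = length (nats s a) * (1 + floorlog 2 (VN a))" by (simp add: sum_list_triv)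
    also have "\<dots> \<le> LN a * (1 + floorlog 2 (VN a))" using fit by (intro mult_right_mono) (auto simp: fits_def)
    finally show ?thesis .
  qed
  then have "(\<Sum>a\<in>NA. \<Sum>v\<leftarrow>nats s a. 1 + floorlog 2 v) \<le> (\<Sum>a\<in>NA. LN a * (1 + floorlog 2 (VN a)))"
    by (rule sum_mono)
  moreover have "(\<Sum>a | nats s a \<noteq> []. \<Sum>v\<leftarrow>nats s a. 1 + floorlog 2 v) \<le> (\<Sum>a\<in>NA. \<Sum>v\<leftarrow>nats s a. 1 + floorlog 2 v)"
    by (rule sum_mono2[OF NA(1) N]) simp
  moreover have "(\<Sum>a | reals s a \<noteq> []. length (reals s a)) \<le> (\<Sum>a\<in>RA. length (reals s a))"
    by (rule sum_mono2[OF RA(1) R]) simp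
  moreover have "(\<Sum>a\<in>RA. length (reals s a)) \<le> (\<Sum>a\<in>RA. LR a)"
    using fit by (intro sum_mono) (simp add: fits_def)
  ultimately show ?thesis unfolding mem_size_def by linarith
qed

lemma ok_NPut:
  assumes "fits LN VN LR s" "nval e s < LN a" "nval f s \<le> VN a" "Q (put_nat a (nval e s) (nval f s) s)" "0 < T"
  shows "ok (fits LN VN LR) (NPut a e f) s T Q"
  using assms by (intro ok_atom) (auto intro: fits_put_nat)

lemma ok_RPut:
  assumes "fits LN VN LR s" "nval e s < LR a" "Q (put_real a (nval e s) (rval f s) s)" "0 < T"
  shows "ok (fits LN VN LR) (RPut a e f) s T Q"
  using assms by (intro ok_atom) (auto intro: fits_put_real)

subsection \<open>Counting loops\<close>

abbreviation NVar :: "nat \<Rightarrow> nexp" where "NVar a \<equiv> NGet a (NLit 0)"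
abbreviation RVar :: "nat \<Rightarrow> rexp" where "RVar a \<equiv> RGet a (NLit 0)"

definition For :: "nat \<Rightarrow> nexp \<Rightarrow> com \<Rightarrow> com" where
  "For c bnd body = Seq (NPut c (NLit 0) (NLit 0))
     (Loop (NLess (NVar c) bnd) (Seq body (NPut c (NLit 0) (NAdd (NVar c) (NLit 1)))))"

text \<open>The bound expression is evaluated anew in every round, so its value has to follow from
  the invariant. The invariant must survive writing the counter, and the body must leave the counter
  alone.\<close>

lemma ok_For:
  assumes s: "fits LN VN LR s" "J 0 s" and c: "LN c \<ge> 1" "VN c \<ge> B"
    and stable: "\<And>i s v. J i s \<Longrightarrow> J i (put_nat c 0 v s)"
    and bnd: "\<And>i s. i \<le> B \<Longrightarrow> J i s \<Longrightarrow> nval bnd s = B"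
    and body: "\<And>i s. i < B \<Longrightarrow> fits LN VN LR s \<Longrightarrow> J i s \<Longrightarrow> nv s c 0 = i \<Longrightarrow>
      ok (fits LN VN LR) body s Tb (\<lambda>s'. J (Suc i) s' \<and> nv s' c 0 = i)"
  shows "ok (fits LN VN LR) (For c bnd body) s (B * (Tb + 4) + 3) (J B)"
proof -
  have "ok (fits LN VN LR) (For c bnd body) s (1 + (B * ((Tb + 1 + 1) + 2) + 1) + 1) (\<lambda>s'. J B s' \<and> nv s' c 0 = B)"
    unfolding For_def
  proof (rule ok_Seq)
    show "ok (fits LN VN LR) (NPut c (NLit 0) (NLit 0)) s 1 (\<lambda>s'. J 0 s' \<and> nv s' c 0 = 0)"
      using s c by (intro ok_NPut) (auto intro: stable)
    fix s' assume s': "fits LN VN LR s'" "J 0 s' \<and> nv s' c 0 = 0"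
    show "ok (fits LN VN LR) (Loop (NLess (NVar c) bnd) (Seq body (NPut c (NLit 0) (NAdd (NVar c) (NLit 1))))) s'
      (B * ((Tb + 1 + 1) + 2) + 1) (\<lambda>s'. J B s' \<and> nv s' c 0 = B)"
    proof (rule ok_Loop[where J="\<lambda>i s. J i s \<and> nv s c 0 = i"])
      fix i s assume "i < B" "fits LN VN LR s" "J i s \<and> nv s c 0 = i"
      then show "ok (fits LN VN LR) (Seq body (NPut c (NLit 0) (NAdd (NVar c) (NLit 1)))) s (Tb + 1 + 1)
          (\<lambda>s. J (Suc i) s \<and> nv s c 0 = Suc i)"
        using c by (intro ok_Seq[OF body]) (auto intro!: ok_NPut stable)
    qed (use s' bnd in auto)
  qed
  then show ?thesis by (rule ok_mono) (auto simp: algebra_simps)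
qed

definition RSum :: "nat \<Rightarrow> nat \<Rightarrow> nexp \<Rightarrow> rexp \<Rightarrow> com" where
  "RSum acc c bnd e = Seq (RPut acc (NLit 0) (ROfNat (NLit 0))) (For c bnd (RPut acc (NLit 0) (RAdd (RVar acc) e)))"

lemma ok_RSum:
  assumes s: "fits LN VN LR s" and c: "LN c \<ge> 1" "VN c \<ge> B" "LR acc \<ge> 1"
    and bnd: "\<And>s'. same {c} {acc} s s' \<Longrightarrow> nval bnd s' = B"
    and e: "\<And>s' i. same {c} {acc} s s' \<Longrightarrow> nv s' c 0 = i \<Longrightarrow> i < B \<Longrightarrow> rval e s' = v i"
  shows "ok (fits LN VN LR) (RSum acc c bnd e) s (B * 5 + 5) (\<lambda>s'. same {c} {acc} s s' \<and> rv s' acc 0 = (\<Sum>i<B. v i))"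
proof -
  have "ok (fits LN VN LR) (RSum acc c bnd e) s (1 + (B * (1 + 4) + 3) + 1)
     (\<lambda>s'. same {c} {acc} s s' \<and> rv s' acc 0 = (\<Sum>i<B. v i))"
    unfolding RSum_def
  proof (rule ok_Seq)
    show "ok (fits LN VN LR) (RPut acc (NLit 0) (ROfNat (NLit 0))) s 1 (\<lambda>s'. same {c} {acc} s s' \<and> rv s' acc 0 = 0)"
      using s c by (intro ok_RPut) (auto intro: same_put_real)
    fix s' assume s': "fits LN VN LR s'" "same {c} {acc} s s' \<and> rv s' acc 0 = 0"
    show "ok (fits LN VN LR) (For c bnd (RPut acc (NLit 0) (RAdd (RVar acc) e))) s' (B * (1 + 4) + 3)
      (\<lambda>s'. same {c} {acc} s s' \<and> rv s' acc 0 = (\<Sum>i<B. v i))"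
    proof (rule ok_For[where J="\<lambda>i s'. same {c} {acc} s s' \<and> rv s' acc 0 = (\<Sum>j<i. v j)"])
      fix i s' assume *: "i < B" "fits LN VN LR s'" "same {c} {acc} s s' \<and> rv s' acc 0 = (\<Sum>j<i. v j)" "nv s' c 0 = i"
      then have "rval e s' = v i" using e by blast
      with * c show "ok (fits LN VN LR) (RPut acc (NLit 0) (RAdd (RVar acc) e)) s' 1
         (\<lambda>s'. (same {c} {acc} s s' \<and> rv s' acc 0 = (\<Sum>j<Suc i. v j)) \<and> nv s' c 0 = i)"
        by (intro ok_RPut) (auto intro: same_put_real)
    qed (use s' c bnd in \<open>auto intro: same_put_nat\<close>)
  qed
  then show ?thesis by (rule ok_mono) auto
qed

definition FillMap :: "nat \<Rightarrow> nat \<Rightarrow> nexp \<Rightarrow> nexp \<Rightarrow> rexp \<Rightarrow> com" where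
  "FillMap a c bnd off e = For c bnd (RPut a (NAdd off (NVar c)) e)"

text \<open>The condition on the expression describes the partly overwritten target array, which
  allows the in-place update in the Greville step.\<close>

lemma ok_FillMap:
  assumes s: "fits LN VN LR s" and c: "LN c \<ge> 1" "VN c \<ge> B" "LR a \<ge> o' + B"
    and bnd: "\<And>s'. same {c} {a} s s' \<Longrightarrow> nval bnd s' = B" "\<And>s'. same {c} {a} s s' \<Longrightarrow> nval off s' = o'"
    and e: "\<And>s' i. same {c} {a} s s' \<Longrightarrow> nv s' c 0 = i \<Longrightarrow> i < B \<Longrightarrow>
       (\<And>j. rv s' a j = (if o' \<le> j \<and> j < o' + i then v (j - o') else rv s a j)) \<Longrightarrow> rval e s' = v i"
  shows "ok (fits LN VN LR) (FillMap a c bnd off e) s (B * 5 + 3) (\<lambda>s'. same {c} {a} s s' \<and>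
     (\<forall>j. rv s' a j = (if o' \<le> j \<and> j < o' + B then v (j - o') else rv s a j)))"
proof -
  have "ok (fits LN VN LR) (FillMap a c bnd off e) s (B * (1 + 4) + 3) (\<lambda>s'. same {c} {a} s s' \<and>
     (\<forall>j. rv s' a j = (if o' \<le> j \<and> j < o' + B then v (j - o') else rv s a j)))"
    unfolding FillMap_def
  proof (rule ok_For[where J="\<lambda>i s'. same {c} {a} s s' \<and>
     (\<forall>j. rv s' a j = (if o' \<le> j \<and> j < o' + i then v (j - o') else rv s a j))"])
    fix i s' assume *: "i < B" "fits LN VN LR s'" "nv s' c 0 = i" and J: "same {c} {a} s s' \<and>
     (\<forall>j. rv s' a j = (if o' \<le> j \<and> j < o' + i then v (j - o') else rv s a j))"
    have "rval e s' = v i" using e[of s' i] * J by blast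
    moreover have "nval off s' = o'" using bnd(2) J by blast
    ultimately show "ok (fits LN VN LR) (RPut a (NAdd off (NVar c)) e) s' 1 (\<lambda>s'. (same {c} {a} s s' \<and>
     (\<forall>j. rv s' a j = (if o' \<le> j \<and> j < o' + Suc i then v (j - o') else rv s a j))) \<and> nv s' c 0 = i)"
      using * J c by (intro ok_RPut) (auto intro: same_put_real)
  qed (use s c bnd in \<open>auto intro: same_put_nat\<close>)
  then show ?thesis by simp
qed

definition FillSum :: "nat \<Rightarrow> nat \<Rightarrow> nexp \<Rightarrow> nat \<Rightarrow> nat \<Rightarrow> nexp \<Rightarrow> rexp \<Rightarrow> rexp \<Rightarrow> com" where
  "FillSum a c bnd acc c2 bnd2 e post = For c bnd (Seq (RSum acc c2 bnd2 e) (RPut a (NVar c) post))"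

lemma ok_FillSum:
  assumes s: "fits LN VN LR s" and c: "LN c \<ge> 1" "VN c \<ge> B" "LN c2 \<ge> 1" "VN c2 \<ge> Bi" "LR a \<ge> B" "LR acc \<ge> 1" "c \<noteq> c2" "a \<noteq> acc"
    and bnd: "\<And>s'. same {c, c2} {a, acc} s s' \<Longrightarrow> nval bnd s' = B" "\<And>s'. same {c, c2} {a, acc} s s' \<Longrightarrow> nval bnd2 s' = Bi"
    and e: "\<And>s' i x. same {c, c2} {a, acc} s s' \<Longrightarrow> nv s' c 0 = i \<Longrightarrow> i < B \<Longrightarrow> nv s' c2 0 = x \<Longrightarrow> x < Bi \<Longrightarrow> rval e s' = v i x"
    and post: "\<And>s' i. same {c, c2} {a, acc} s s' \<Longrightarrow> nv s' c 0 = i \<Longrightarrow> i < B \<Longrightarrow>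
       rv s' acc 0 = (\<Sum>x<Bi. v i x) \<Longrightarrow> rval post s' = g i"
  shows "ok (fits LN VN LR) (FillSum a c bnd acc c2 bnd2 e post) s (B * (Bi * 5 + 11) + 3)
     (\<lambda>s'. same {c, c2} {a, acc} s s' \<and> (\<forall>j<B. rv s' a j = g j))"
proof -
  have "ok (fits LN VN LR) (FillSum a c bnd acc c2 bnd2 e post) s (B * (((Bi * 5 + 5) + 1 + 1) + 4) + 3)
     (\<lambda>s'. same {c, c2} {a, acc} s s' \<and> (\<forall>j<B. rv s' a j = g j))"
    unfolding FillSum_def
  proof (rule ok_For[where J="\<lambda>i s'. same {c, c2} {a, acc} s s' \<and> (\<forall>j<i. rv s' a j = g j)"])
    fix i s' assume *: "i < B" "fits LN VN LR s'" "nv s' c 0 = i"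
      and J: "same {c, c2} {a, acc} s s' \<and> (\<forall>j<i. rv s' a j = g j)"
    have tr: "same {c, c2} {a, acc} s s''" if "same {c2} {acc} s' s''" for s''
      using J that by (elim conjE same_trans) auto
    show "ok (fits LN VN LR) (Seq (RSum acc c2 bnd2 e) (RPut a (NVar c) post)) s' ((Bi * 5 + 5) + 1 + 1)
       (\<lambda>s'. (same {c, c2} {a, acc} s s' \<and> (\<forall>j<Suc i. rv s' a j = g j)) \<and> nv s' c 0 = i)"
    proof (rule ok_Seq)
      show "ok (fits LN VN LR) (RSum acc c2 bnd2 e) s' (Bi * 5 + 5)
        (\<lambda>s''. same {c2} {acc} s' s'' \<and> rv s'' acc 0 = (\<Sum>x<Bi. v i x))"
      proof (rule ok_RSum)
        fix s'' x assume "same {c2} {acc} s' s''" "nv s'' c2 0 = x" "x < Bi"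
        then show "rval e s'' = v i x" using e[OF tr, of s'' i x] * c same_nv[of "{c2}" "{acc}" s' s'' c 0] by auto
      qed (use * c bnd tr in auto)
      fix s'' assume s'': "fits LN VN LR s''" "same {c2} {acc} s' s'' \<and> rv s'' acc 0 = (\<Sum>x<Bi. v i x)"
      then have ci: "nv s'' c 0 = i" using * c same_nv[of "{c2}" "{acc}" s' s'' c 0] by auto
      then have "rval post s'' = g i" using post[OF tr, of s'' i] s'' * by auto
      moreover have "rv s'' a j = rv s' a j" for j using s'' c same_rv[of "{c2}" "{acc}" s' s'' a j] by auto
      ultimately show "ok (fits LN VN LR) (RPut a (NVar c) post) s'' 1
         (\<lambda>s'. (same {c, c2} {a, acc} s s' \<and> (\<forall>j<Suc i. rv s' a j = g j)) \<and> nv s' c 0 = i)"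
        using * J c s'' tr[of s''] ci by (intro ok_RPut) (auto intro: same_put_real simp: less_Suc_eq)
    qed
  qed (use s c bnd in \<open>auto intro: same_put_nat\<close>)
  then show ?thesis by (rule ok_mono) auto
qed

section \<open>The search program\<close>

text \<open>Array \<open>0\<close> of naturals holds \<open>n, d, k, t, s, w\<close>, and arrays \<open>5\<close>, \<open>6\<close>, \<open>7\<close> of reals hold the
  sketches. Work space: naturals \<open>30\<close>--\<open>33\<close>, \<open>35\<close> are counters, \<open>34\<close> the nearest center, \<open>36\<close> the guess,
  \<open>37\<close> its remaining digits, \<open>38\<close> the number of guesses, \<open>40\<close> the labels; reals \<open>30\<close> and \<open>35\<close> are
  accumulators, \<open>31\<close> the guessed matrix, \<open>32\<close> its pseudo-inverse, \<open>33\<close> coefficients, \<open>34\<close> a residual,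
  \<open>36\<close> and \<open>37\<close> the centers and their sketches, \<open>38\<close> and \<open>39\<close> squared distances, \<open>40\<close> and \<open>41\<close> the
  current and the least cost.\<close>

abbreviation "Nn \<equiv> NGet 0 (NLit 0)"
abbreviation "Dn \<equiv> NGet 0 (NLit 1)"
abbreviation "Kn \<equiv> NGet 0 (NLit 2)"
abbreviation "Tn \<equiv> NGet 0 (NLit 3)"
abbreviation "Sn \<equiv> NGet 0 (NLit 4)"
abbreviation "Wn \<equiv> NGet 0 (NLit 5)"
abbreviation "Bn \<equiv> NAdd (NMul (NLit 2) Nn) (NLit 1)"
abbreviation "idx a e f g \<equiv> RGet a (NAdd (NMul e f) g)"

definition decode_guess :: com where
  "decode_guess = Seq (NPut 37 (NLit 0) (NVar 36)) (For 30 (NMul Sn Kn)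
     (Seq (RPut 31 (NVar 30) (RSub (ROfNat (NMod (NVar 37) Bn)) (ROfNat Nn)))
          (NPut 37 (NLit 0) (NDiv (NVar 37) Bn))))"

text \<open>The new row \<open>p\<close> is written before the old rows are corrected: the
  correction reads it, and lies entirely in front of it.\<close>

definition greville_step :: com where
  "greville_step =
     Seq (FillSum 33 30 (NVar 32) 30 31 Sn (RMul (idx 32 (NVar 30) Sn (NVar 31)) (idx 31 (NVar 31) Kn (NVar 32))) (RVar 30))
    (Seq (FillSum 34 30 Sn 30 31 (NVar 32) (RMul (RGet 33 (NVar 31)) (idx 31 (NVar 30) Kn (NVar 31)))
            (RSub (idx 31 (NVar 30) Kn (NVar 32)) (RVar 30)))
    (Seq (RSum 35 30 Sn (RMul (RGet 34 (NVar 30)) (RGet 34 (NVar 30))))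
    (Seq (FillMap 32 30 Sn (NMul (NVar 32) Sn) (RDiv (RGet 34 (NVar 30)) (RVar 35)))
         (FillMap 32 30 (NMul (NVar 32) Sn) (NLit 0) (RSub (RGet 32 (NVar 30))
            (RMul (RGet 33 (NDiv (NVar 30) Sn)) (idx 32 (NVar 32) Sn (NMod (NVar 30) Sn))))))))"

definition compute_centers :: com where
  "compute_centers = FillSum 36 30 (NMul Kn Dn) 30 31 Sn
     (RMul (idx 32 (NDiv (NVar 30) Dn) Sn (NVar 31)) (idx 5 (NVar 31) Dn (NMod (NVar 30) Dn))) (RVar 30)"

definition sketch_centers :: "(nexp \<Rightarrow> nexp \<Rightarrow> rexp) \<Rightarrow> com" where
  "sketch_centers tx = FillSum 37 30 (NMul Kn Tn) 30 31 Dn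
     (RMul (idx 36 (NDiv (NVar 30) Tn) Dn (NVar 31)) (tx (NVar 31) (NMod (NVar 30) Tn))) (RVar 30)"

abbreviation "diff_ct \<equiv> RSub (idx 37 (NVar 30) Tn (NVar 31)) (idx 6 (NVar 33) Tn (NVar 31))"

definition compute_labels :: com where
  "compute_labels = For 33 Nn
     (Seq (FillSum 38 30 Kn 30 31 Tn (RMul diff_ct diff_ct) (RVar 30))
     (Seq (NPut 34 (NLit 0) (NLit 0))
     (Seq (For 35 Kn (Cond (RLess (RGet 38 (NVar 35)) (RGet 38 (NVar 34))) (NPut 34 (NLit 0) (NVar 35)) Halt))
          (NPut 40 (NVar 33) (NVar 34)))))"

definition compute_cost :: "(nexp \<Rightarrow> nexp \<Rightarrow> rexp) \<Rightarrow> com" where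
  "compute_cost wx =
     Seq (FillSum 39 30 Wn 30 31 (NMul Nn Dn)
           (RMul (wx (NVar 30) (NVar 31)) (idx 36 (NGet 40 (NDiv (NVar 31) Dn)) Dn (NMod (NVar 31) Dn)))
           (RMul (RSub (RVar 30) (RGet 7 (NVar 30))) (RSub (RVar 30) (RGet 7 (NVar 30)))))
         (RSum 40 30 Wn (RGet 39 (NVar 30)))"

text \<open>The first candidate is stored unconditionally, because the cell for the least cost may
  still hold 0, which no cost undercuts.\<close>

definition keep_best :: com where
  "keep_best = Cond (BAnd (BNot (NLess (NVar 36) (NLit 1))) (BNot (RLess (RVar 40) (RVar 41)))) Halt
     (Seq (RPut 41 (NLit 0) (RVar 40))
     (Seq (For 30 Nn (NPut 1 (NVar 30) (NGet 40 (NVar 30))))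
          (FillMap 1 30 (NMul Kn Dn) (NLit 0) (RGet 36 (NVar 30)))))"

definition search :: "(nexp \<Rightarrow> nexp \<Rightarrow> rexp) \<Rightarrow> (nexp \<Rightarrow> nexp \<Rightarrow> rexp) \<Rightarrow> com" where
  "search tx wx =
     Seq (NPut 38 (NLit 0) (NLit 1))
    (Seq (For 30 (NMul Sn Kn) (NPut 38 (NLit 0) (NMul (NVar 38) Bn)))
         (For 36 (NVar 38)
           (Seq decode_guess
           (Seq (For 32 Kn greville_step)
           (Seq compute_centers
           (Seq (sketch_centers tx)
           (Seq compute_labels
           (Seq (compute_cost wx) keep_best))))))))"

definition workN :: "nat set" where "workN = insert 1 {30..40}"
definition workR :: "nat set" where "workR = insert 1 {30..41}"

lemma pow_chain:
  assumes "(1::nat) \<le> H"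
  shows "H \<le> H\<^sup>2" "H\<^sup>2 \<le> H ^ 3"
  using assms by (simp_all add: power2_eq_square power3_eq_cube)

text \<open>The interface between program and sketches: \<open>tx\<close> and \<open>wx\<close> are
  expressions that produce entries of T and W, by reading a stored matrix or by evaluating sign
  tables, and \<open>data\<close> is a state predicate that survives all changes to the work space.
  H dominates all dimensions and measures the time; the capacities stay separate, so that the
  streaming half can bound them sharply.\<close>

locale ram_search = sketch_search n d k s t w Tf Wf SA AT Wa
  for n d k s t w :: nat and Tf Wf SA AT :: "nat \<Rightarrow> nat \<Rightarrow> real" and Wa :: "nat \<Rightarrow> real" +
  fixes tx wx :: "nexp \<Rightarrow> nexp \<Rightarrow> rexp" and data :: "state \<Rightarrow> bool" and H :: nat and LN VN LR :: "nat \<Rightarrow> nat"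
  assumes data: "data \<sigma> \<Longrightarrow> nv \<sigma> 0 0 = n" "data \<sigma> \<Longrightarrow> nv \<sigma> 0 (Suc 0) = d" "data \<sigma> \<Longrightarrow> nv \<sigma> 0 2 = k"
      "data \<sigma> \<Longrightarrow> nv \<sigma> 0 3 = t" "data \<sigma> \<Longrightarrow> nv \<sigma> 0 4 = s" "data \<sigma> \<Longrightarrow> nv \<sigma> 0 5 = w"
    and data_SA: "data \<sigma> \<Longrightarrow> y < s \<Longrightarrow> j < d \<Longrightarrow> rv \<sigma> 5 (y * d + j) = SA y j"
    and data_AT: "data \<sigma> \<Longrightarrow> i < n \<Longrightarrow> y < t \<Longrightarrow> rv \<sigma> 6 (i * t + y) = AT i y"
    and data_Wa: "data \<sigma> \<Longrightarrow> r < w \<Longrightarrow> rv \<sigma> 7 r = Wa r"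
    and data_tx: "data \<sigma> \<Longrightarrow> nval e \<sigma> < d \<Longrightarrow> nval f \<sigma> < t \<Longrightarrow> rval (tx e f) \<sigma> = Tf (nval e \<sigma>) (nval f \<sigma>)"
    and data_wx: "data \<sigma> \<Longrightarrow> nval e \<sigma> < w \<Longrightarrow> nval f \<sigma> < n * d \<Longrightarrow> rval (wx e f) \<sigma> = Wf (nval e \<sigma>) (nval f \<sigma>)"
    and data_frame: "data \<sigma> \<Longrightarrow> same workN workR \<sigma> \<sigma>' \<Longrightarrow> data \<sigma>'"
    and pos: "n \<ge> 1" "d \<ge> 1" "k \<ge> 1"
    and H: "n \<le> H" "d \<le> H" "k \<le> H" "t \<le> H" "s \<le> H" "w \<le> H" "n * d \<le> H" "s * k \<le> H" "k * d \<le> H" "k * t \<le> H"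
    and LN: "\<And>a. a \<in> {30..38} \<Longrightarrow> LN a \<ge> 1" "LN 40 \<ge> n" "LN 1 \<ge> n"
    and VN: "\<And>a. a \<in> {30..35} \<Longrightarrow> VN a \<ge> H" "\<And>a. a \<in> {36..38} \<Longrightarrow> VN a \<ge> (2 * n + 1) ^ (s * k)" "VN 40 \<ge> k" "VN 1 \<ge> k"
    and LR: "LR 30 \<ge> 1" "LR 31 \<ge> s * k" "LR 32 \<ge> k * s" "LR 33 \<ge> k" "LR 34 \<ge> s" "LR 35 \<ge> 1" "LR 36 \<ge> k * d"
      "LR 37 \<ge> k * t" "LR 38 \<ge> k" "LR 39 \<ge> w" "LR 40 \<ge> 1" "LR 41 \<ge> 1" "LR 1 \<ge> k * d"
begin

abbreviation "memok \<equiv> fits LN VN LR"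

lemma data_same: "data \<sigma> \<Longrightarrow> same NU RU \<sigma> \<sigma>' \<Longrightarrow> NU \<subseteq> workN \<Longrightarrow> RU \<subseteq> workR \<Longrightarrow> data \<sigma>'"
  by (rule data_frame[OF _ same_mono])

lemma H1: "1 \<le> H" using pos H by linarith

lemma time_For: "B \<le> H \<Longrightarrow> B * (c * H ^ p + 4) + 3 \<le> (c + 7) * H ^ Suc p"
proof -
  assume "B \<le> H"
  then have "B * (c * H ^ p + 4) + 3 \<le> H * (c * H ^ p + 4) + 3" by simp
  also have "\<dots> = c * H ^ Suc p + 4 * H + 3" by (simp add: algebra_simps)
  also have "\<dots> \<le> c * H ^ Suc p + 4 * H ^ Suc p + 3 * H ^ Suc p"
    using H1 self_le_power[of H "Suc p"] one_le_power[of H "Suc p"] by (intro add_mono mult_left_mono) simp_all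
  also have "\<dots> = (c + 7) * H ^ Suc p" by (simp only: distrib_right)
  finally show ?thesis .
qed

lemma time_FillSum:
  assumes "B \<le> H" "B2 \<le> H"
  shows "B * (B2 * 5 + 11) + 3 \<le> 19 * H\<^sup>2"
proof -
  have "B * (B2 * 5 + 11) \<le> H * (H * 5 + 11)" using assms by (intro mult_mono) auto
  also have "\<dots> = 5 * H\<^sup>2 + 11 * H" by (simp add: power2_eq_square algebra_simps)
  finally show ?thesis using pow_chain[OF H1] H1 by linarith
qed

lemma ok_decode_guess:
  assumes f: "memok \<sigma>" and D: "data \<sigma>" and m: "nv \<sigma> 36 0 = m" "m \<le> (2 * n + 1) ^ (s * k)"
  shows "ok memok decode_guess \<sigma> (12 * H) (\<lambda>\<sigma>'. same {30, 37} {31} \<sigma> \<sigma>' \<and>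
     (\<forall>r<s. \<forall>a<k. rv \<sigma>' 31 (r * k + a) = guess n k m r a))"
proof -
  let ?B = "2 * n + 1"
  let ?J = "\<lambda>i \<sigma>'. same {30, 37} {31} \<sigma> \<sigma>' \<and> nv \<sigma>' 37 0 = m div ?B ^ i \<and>
     (\<forall>l<i. rv \<sigma>' 31 l = real (m div ?B ^ l mod ?B) - real n)"
  have "ok memok decode_guess \<sigma> (1 + (s * k * ((1 + 1 + 1) + 4) + 3) + 1) (?J (s * k))"
    unfolding decode_guess_def
  proof (rule ok_Seq)
    show "ok memok (NPut 37 (NLit 0) (NVar 36)) \<sigma> 1 (?J 0)"
      using f LN(1)[of 37] VN(2)[of 37] m by (intro ok_NPut) (auto intro: same_put_nat)
    fix \<sigma>1 assume \<sigma>1: "memok \<sigma>1" "?J 0 \<sigma>1"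
    show "ok memok (For 30 (NMul Sn Kn)
     (Seq (RPut 31 (NVar 30) (RSub (ROfNat (NMod (NVar 37) Bn)) (ROfNat Nn)))
          (NPut 37 (NLit 0) (NDiv (NVar 37) Bn)))) \<sigma>1 (s * k * ((1 + 1 + 1) + 4) + 3) (?J (s * k))"
    proof (rule ok_For[where J="?J"])
      fix i \<sigma>2 assume i: "i < s * k" "memok \<sigma>2" "?J i \<sigma>2" "nv \<sigma>2 30 0 = i"
      then have D2: "data \<sigma>2" using data_same[OF D] by (auto simp: workN_def workR_def)
      have le: "m div ?B ^ i div ?B \<le> VN 37"
      proof -
        have "m div ?B ^ i div ?B \<le> m div ?B ^ i" by (rule div_le_dividend)
        also have "\<dots> \<le> m" by (rule div_le_dividend)
        finally show ?thesis using m VN(2)[of 37] by simp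
      qed
      show "ok memok (Seq (RPut 31 (NVar 30) (RSub (ROfNat (NMod (NVar 37) Bn)) (ROfNat Nn)))
          (NPut 37 (NLit 0) (NDiv (NVar 37) Bn))) \<sigma>2 (1 + 1 + 1) (\<lambda>\<sigma>'. ?J (Suc i) \<sigma>' \<and> nv \<sigma>' 30 0 = i)"
      proof (rule ok_Seq)
        let ?R = "\<lambda>\<sigma>'. same {30, 37} {31} \<sigma> \<sigma>' \<and> nv \<sigma>' 37 0 = m div ?B ^ i \<and>
           (\<forall>l<Suc i. rv \<sigma>' 31 l = real (m div ?B ^ l mod ?B) - real n) \<and> nv \<sigma>' 30 0 = i"
        show "ok memok (RPut 31 (NVar 30) (RSub (ROfNat (NMod (NVar 37) Bn)) (ROfNat Nn))) \<sigma>2 1 ?R"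
          using i LR(2) data(1)[OF D2] by (intro ok_RPut) (auto intro: same_put_real simp: less_Suc_eq)
        fix \<sigma>3 assume \<sigma>3: "memok \<sigma>3" "?R \<sigma>3"
        then have D3: "data \<sigma>3" using data_same[OF D] by (auto simp: workN_def workR_def)
        have "m div ?B ^ i div ?B = m div ?B ^ Suc i" by (simp only: power_Suc2 div_mult2_eq)
        then show "ok memok (NPut 37 (NLit 0) (NDiv (NVar 37) Bn)) \<sigma>3 1 (\<lambda>\<sigma>'. ?J (Suc i) \<sigma>' \<and> nv \<sigma>' 30 0 = i)"
          using \<sigma>3 LN(1)[of 37] data(1)[OF D3] le
          by (intro ok_NPut) (auto intro: same_put_nat simp del: power_Suc)
      qed
    next
      fix i \<sigma>2 assume "?J i \<sigma>2"
      then have "data \<sigma>2" using data_same[OF D] by (auto simp: workN_def workR_def)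
      then show "nval (NMul Sn Kn) \<sigma>2 = s * k" by (simp add: data)
    qed (use \<sigma>1 LN(1)[of 30] VN(1)[of 30] H in \<open>auto intro: same_put_nat\<close>)
  qed
  then show ?thesis
  proof (rule ok_mono)
    show "1 + (s * k * ((1 + 1 + 1) + 4) + 3) + 1 \<le> 12 * H" using H H1 by simp
    fix \<sigma>' assume J: "?J (s * k) \<sigma>'"
    have "r * k + a < s * k" if "r < s" "a < k" for r a
      using that mult_le_mono1[of "Suc r" s k] by simp
    with J show "same {30, 37} {31} \<sigma> \<sigma>' \<and> (\<forall>r<s. \<forall>a<k. rv \<sigma>' 31 (r * k + a) = guess n k m r a)"
      by (auto simp: guess_def)
  qed
qed

lemma ok_greville_step:
  assumes f: "memok \<sigma>" and D: "data \<sigma>" and p: "nv \<sigma> 32 0 = p" "p < k"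
    and M: "\<And>r a. r < s \<Longrightarrow> a < k \<Longrightarrow> rv \<sigma> 31 (r * k + a) = M r a"
    and N: "\<And>a x. a < p \<Longrightarrow> x < s \<Longrightarrow> rv \<sigma> 32 (a * s + x) = pinv s M p a x"
  shows "ok memok greville_step \<sigma> (68 * H\<^sup>2) (\<lambda>\<sigma>'. same {30, 31} {30, 32, 33, 34, 35} \<sigma> \<sigma>' \<and>
     (\<forall>a<Suc p. \<forall>x<s. rv \<sigma>' 32 (a * s + x) = pinv s M (Suc p) a x))"
proof -
  let ?N = "pinv s M p"
  define g where "g a = (\<Sum>y<s. ?N a y * M y p)" for a
  define r where "r = residual s M ?N p"
  define rr where "rr = (\<Sum>y<s. r y * r y)"
  have r: "r x = M x p - (\<Sum>a<p. g a * M x a)" for x by (simp add: r_def residual_def g_def)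
  have L: "LN 30 \<ge> 1" "LN 31 \<ge> 1" "VN 30 \<ge> H" "VN 31 \<ge> H" using LN(1) VN(1) by simp_all
  have ps: "p * s \<le> H" 
    by (rule order_trans[OF mult_le_mono1[OF less_imp_le[OF p(2)]]]) (use H(8) in \<open>simp add: mult.commute\<close>)
  have S: "same {30, 31} {30, 32, 33, 34, 35} \<sigma> \<sigma>2"
    if "same {30, 31} {30, 32, 33, 34, 35} \<sigma> \<sigma>1" "same NU RU \<sigma>1 \<sigma>2" "NU \<subseteq> {30, 31}" "RU \<subseteq> {30, 32, 33, 34, 35}" for NU RU \<sigma>1 \<sigma>2
    using same_trans[OF that(1,2) _ _ that(3,4)] by simp
  have base: "nv \<sigma>' 32 0 = p \<and> nv \<sigma>' 0 2 = k \<and> nv \<sigma>' 0 4 = s \<and> (\<forall>r<s. \<forall>a<k. rv \<sigma>' 31 (r * k + a) = M r a)"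
    if "same {30, 31} {30, 32, 33, 34, 35} \<sigma> \<sigma>'" for \<sigma>'
    using same_nv[OF that] same_rv[OF that] data[OF D] p M by simp
  let ?S = "same {30, 31} {30, 32, 33, 34, 35} \<sigma>"
  let ?N1 = "\<lambda>\<sigma>'. \<forall>a<p. \<forall>x<s. rv \<sigma>' 32 (a * s + x) = ?N a x"
  let ?G = "\<lambda>\<sigma>'. \<forall>a<p. rv \<sigma>' 33 a = g a"
  let ?R = "\<lambda>\<sigma>'. \<forall>x<s. rv \<sigma>' 34 x = r x"
  let ?Q1 = "\<lambda>\<sigma>'. ?S \<sigma>' \<and> ?N1 \<sigma>' \<and> ?G \<sigma>'"
  let ?Q2 = "\<lambda>\<sigma>'. ?Q1 \<sigma>' \<and> ?R \<sigma>'"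
  let ?Q3 = "\<lambda>\<sigma>'. ?Q2 \<sigma>' \<and> rv \<sigma>' 35 0 = rr"
  let ?Q4 = "\<lambda>\<sigma>'. ?Q3 \<sigma>' \<and> (\<forall>x<s. rv \<sigma>' 32 (p * s + x) = r x / rr)"
  let ?Q5 = "\<lambda>\<sigma>'. ?S \<sigma>' \<and> (\<forall>a<Suc p. \<forall>x<s. rv \<sigma>' 32 (a * s + x) = pinv s M (Suc p) a x)"
  have 1: "ok memok (FillSum 33 30 (NVar 32) 30 31 Sn (RMul (idx 32 (NVar 30) Sn (NVar 31)) (idx 31 (NVar 31) Kn (NVar 32))) (RVar 30))
     \<sigma> (p * (s * 5 + 11) + 3) ?Q1"
  proof (rule ok_mono[OF ok_FillSum[where B=p and Bi=s and v="\<lambda>a y. ?N a y * M y p" and g=g]])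
    fix \<sigma>' assume sm: "same {30, 31} {33, 30} \<sigma> \<sigma>'"
    note E = same_nv[OF sm] same_rv[OF sm]
    show "nval (NVar 32) \<sigma>' = p" "nval Sn \<sigma>' = s" by (simp_all add: E p data[OF D])
    { fix i x assume "nv \<sigma>' 30 0 = i" "i < p" "nv \<sigma>' 31 0 = x" "x < s"
      then show "rval (RMul (idx 32 (NVar 30) Sn (NVar 31)) (idx 31 (NVar 31) Kn (NVar 32))) \<sigma>' = ?N i x * M x p"
        using N p M by (simp add: E data[OF D]) }
    { fix i assume "rv \<sigma>' 30 0 = (\<Sum>x<s. ?N i x * M x p)"
      then show "rval (RVar 30) \<sigma>' = g i" by (simp add: g_def) }
  next
    fix \<sigma>' assume "same {30, 31} {33, 30} \<sigma> \<sigma>' \<and> (\<forall>j<p. rv \<sigma>' 33 j = g j)"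
    moreover then have "?S \<sigma>'" by (intro S[OF same_refl conjunct1]) auto
    ultimately show "?Q1 \<sigma>'" using N same_rv[of "{30, 31}" "{33, 30}" \<sigma> \<sigma>'] by simp
  qed (use f L LR H p in auto)
  have 2: "ok memok (FillSum 34 30 Sn 30 31 (NVar 32) (RMul (RGet 33 (NVar 31)) (idx 31 (NVar 30) Kn (NVar 31)))
            (RSub (idx 31 (NVar 30) Kn (NVar 32)) (RVar 30))) \<sigma>1 (s * (p * 5 + 11) + 3) ?Q2"
    if f1: "memok \<sigma>1" and Q1: "?Q1 \<sigma>1" for \<sigma>1
  proof (rule ok_mono[OF ok_FillSum[where B=s and Bi=p and v="\<lambda>x a. g a * M x a" and g=r]])
    fix \<sigma>' assume sm: "same {30, 31} {34, 30} \<sigma>1 \<sigma>'"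
    note E = same_rv[OF sm]
    have B: "?S \<sigma>'" by (rule S[OF _ sm]) (use Q1 in auto)
    note B = base[OF B]
    show "nval (NVar 32) \<sigma>' = p" "nval Sn \<sigma>' = s" using B by simp_all
    { fix i x assume "nv \<sigma>' 30 0 = i" "i < s" "nv \<sigma>' 31 0 = x" "x < p"
      then show "rval (RMul (RGet 33 (NVar 31)) (idx 31 (NVar 30) Kn (NVar 31))) \<sigma>' = g x * M i x"
        using B Q1 p by (simp add: E) }
    { fix i assume "nv \<sigma>' 30 0 = i" "i < s" "rv \<sigma>' 30 0 = (\<Sum>x<p. g x * M i x)"
      then show "rval (RSub (idx 31 (NVar 30) Kn (NVar 32)) (RVar 30)) \<sigma>' = r i" using B p by (simp add: r) }
  next
    fix \<sigma>' assume *: "same {30, 31} {34, 30} \<sigma>1 \<sigma>' \<and> (\<forall>j<s. rv \<sigma>' 34 j = r j)"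
    have "?S \<sigma>'" by (rule S[OF _ conjunct1[OF *]]) (use Q1 in auto)
    with * Q1 show "?Q2 \<sigma>'" using same_rv[of "{30, 31}" "{34, 30}" \<sigma>1 \<sigma>'] by simp
  qed (use f1 L LR H p in auto)
  have 3: "ok memok (RSum 35 30 Sn (RMul (RGet 34 (NVar 30)) (RGet 34 (NVar 30)))) \<sigma>2 (s * 5 + 5) ?Q3"
    if f2: "memok \<sigma>2" and Q2: "?Q2 \<sigma>2" for \<sigma>2
  proof (rule ok_mono[OF ok_RSum[where B=s and v="\<lambda>x. r x * r x"]])
    fix \<sigma>' assume sm: "same {30} {35} \<sigma>2 \<sigma>'"
    have B: "?S \<sigma>'" by (rule S[OF _ sm]) (use Q2 in auto)
    note B = base[OF B]
    show "nval Sn \<sigma>' = s" using B by simp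
    { fix i assume "nv \<sigma>' 30 0 = i" "i < s"
      then show "rval (RMul (RGet 34 (NVar 30)) (RGet 34 (NVar 30))) \<sigma>' = r i * r i"
        using Q2 by (simp add: same_rv[OF sm]) }
  next
    fix \<sigma>' assume *: "same {30} {35} \<sigma>2 \<sigma>' \<and> rv \<sigma>' 35 0 = (\<Sum>i<s. r i * r i)"
    have "?S \<sigma>'" by (rule S[OF _ conjunct1[OF *]]) (use Q2 in auto)
    with * Q2 show "?Q3 \<sigma>'" using same_rv[of "{30}" "{35}" \<sigma>2 \<sigma>'] by (simp add: rr_def)
  qed (use f2 L LR H in auto)
  have 4: "ok memok (FillMap 32 30 Sn (NMul (NVar 32) Sn) (RDiv (RGet 34 (NVar 30)) (RVar 35))) \<sigma>3 (s * 5 + 3) ?Q4"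
    if f3: "memok \<sigma>3" and Q3: "?Q3 \<sigma>3" for \<sigma>3
  proof (rule ok_mono[OF ok_FillMap[where B=s and o'="p * s" and v="\<lambda>x. r x / rr"]])
    show "p * s + s \<le> LR 32" using LR p mult_le_mono1[of "Suc p" k s] by simp
    fix \<sigma>' assume sm: "same {30} {32} \<sigma>3 \<sigma>'"
    have B: "?S \<sigma>'" by (rule S[OF _ sm]) (use Q3 in auto)
    note B = base[OF B]
    show "nval Sn \<sigma>' = s" "nval (NMul (NVar 32) Sn) \<sigma>' = p * s" using B by simp_all
    { fix i assume "nv \<sigma>' 30 0 = i" "i < s"
      then show "rval (RDiv (RGet 34 (NVar 30)) (RVar 35)) \<sigma>' = r i / rr"
        using Q3 by (simp add: same_rv[OF sm]) }
  next
    fix \<sigma>' assume *: "same {30} {32} \<sigma>3 \<sigma>' \<and>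
       (\<forall>j. rv \<sigma>' 32 j = (if p * s \<le> j \<and> j < p * s + s then r (j - p * s) / rr else rv \<sigma>3 32 j))"
    have "?S \<sigma>'" by (rule S[OF _ conjunct1[OF *]]) (use Q3 in auto)
    \<comment> \<open>Earlier rows lie in front of block p, so appending the new row leaves them
      intact.\<close>
    moreover have "\<not> p * s \<le> a * s + x" if "a < p" "x < s" for a x
      using that mult_le_mono1[of "Suc a" p s] by simp
    ultimately show "?Q4 \<sigma>'" using * Q3 same_rv[of "{30}" "{32}" \<sigma>3 \<sigma>'] by simp
  qed (use f3 L H in auto)
  have 5: "ok memok (FillMap 32 30 (NMul (NVar 32) Sn) (NLit 0) (RSub (RGet 32 (NVar 30))
            (RMul (RGet 33 (NDiv (NVar 30) Sn)) (idx 32 (NVar 32) Sn (NMod (NVar 30) Sn))))) \<sigma>4 (p * s * 5 + 3) ?Q5"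
    if f4: "memok \<sigma>4" and Q4: "?Q4 \<sigma>4" for \<sigma>4
  proof (rule ok_mono[OF ok_FillMap[where B="p * s" and o'=0 and v="\<lambda>l. ?N (l div s) (l mod s) - g (l div s) * (r (l mod s) / rr)"]])
    show "0 + p * s \<le> LR 32" using order_trans[OF mult_le_mono1[OF less_imp_le[OF p(2)]] LR(3)] by simp
    fix \<sigma>' assume sm: "same {30} {32} \<sigma>4 \<sigma>'"
    have B: "?S \<sigma>'" by (rule S[OF _ sm]) (use Q4 in auto)
    note B = base[OF B]
    show "nval (NMul (NVar 32) Sn) \<sigma>' = p * s" "nval (NLit 0) \<sigma>' = 0" using B by simp_all
    { fix i assume i: "nv \<sigma>' 30 0 = i" "i < p * s"
        and c: "\<And>j. rv \<sigma>' 32 j = (if 0 \<le> j \<and> j < 0 + i then ?N ((j - 0) div s) ((j - 0) mod s) - g ((j - 0) div s) * (r ((j - 0) mod s) / rr)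
             else rv \<sigma>4 32 j)"
      have s0: "s > 0" using i by (cases s) auto
      have di: "i div s < p" "i mod s < s" using i s0 by (auto simp: less_mult_imp_div_less)
      \<comment> \<open>Cell i has not been overwritten yet, and row p lies beyond the range of this
        loop, so both operands still have their old values.\<close>
      have "rv \<sigma>4 32 (i div s * s + i mod s) = ?N (i div s) (i mod s)" using Q4 di by blast
      then have "rv \<sigma>' 32 i = ?N (i div s) (i mod s)" using c[of i] by simp
      moreover have "rv \<sigma>' 32 (p * s + i mod s) = r (i mod s) / rr"
        using c[of "p * s + i mod s"] Q4 di i by auto
      ultimately show "rval (RSub (RGet 32 (NVar 30))
            (RMul (RGet 33 (NDiv (NVar 30) Sn)) (idx 32 (NVar 32) Sn (NMod (NVar 30) Sn)))) \<sigma>'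
          = ?N (i div s) (i mod s) - g (i div s) * (r (i mod s) / rr)"
        using B i di Q4 by (simp add: same_rv[OF sm]) }
  next
    fix \<sigma>' assume *: "same {30} {32} \<sigma>4 \<sigma>' \<and>
       (\<forall>j. rv \<sigma>' 32 j = (if 0 \<le> j \<and> j < 0 + p * s then ?N ((j - 0) div s) ((j - 0) mod s) - g ((j - 0) div s) * (r ((j - 0) mod s) / rr)
          else rv \<sigma>4 32 j))"
    have "rv \<sigma>' 32 (a * s + x) = pinv s M (Suc p) a x" if "a < Suc p" "x < s" for a x
    proof (cases "a = p")
      case True
      then show ?thesis using * Q4 that by (simp add: dual_row_def r_def[symmetric] rr_def)
    next
      case False
      then have "a < p" using that by simp
      moreover then have "a * s + x < p * s" using that mult_le_mono1[of "Suc a" p s] by simp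
      ultimately show ?thesis using * that by (simp add: dual_row_def r_def[symmetric] rr_def g_def)
    qed
    moreover have "?S \<sigma>'" by (rule S[OF _ conjunct1[OF *]]) (use Q4 in auto)
    ultimately show "?Q5 \<sigma>'" by auto
  qed (use f4 L H ps in auto)
  have "ok memok greville_step \<sigma> ((p * (s * 5 + 11) + 3) + ((s * (p * 5 + 11) + 3) + ((s * 5 + 5) + ((s * 5 + 3) + (p * s * 5 + 3) + 1) + 1) + 1) + 1) ?Q5"
    unfolding greville_step_def by (intro ok_Seq[OF 1] ok_Seq[OF 2] ok_Seq[OF 3] ok_Seq[OF 4] 5)
  then show ?thesis
  proof (rule ok_mono)
    have "p \<le> H" using p H by simp
    then show "(p * (s * 5 + 11) + 3) + ((s * (p * 5 + 11) + 3) + ((s * 5 + 5) + ((s * 5 + 3) + (p * s * 5 + 3) + 1) + 1) + 1) + 1 \<le> 68 * H\<^sup>2"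
      using time_FillSum[of p s] time_FillSum[of s p] H(5) ps pow_chain[OF H1] H1 by linarith
  qed
qed

end

section \<open>Correctness of the running minimum and of the search\<close>

lemma nearestI:
  fixes D :: "nat \<Rightarrow> real"
  assumes "b < k" "\<And>c. c < k \<Longrightarrow> D b \<le> D c" "\<And>c. c < b \<Longrightarrow> D b < D c"
  shows "nearest k D = b"
  unfolding nearest_def
proof (rule Least_equality)
  show "b < k \<and> (\<forall>c<k. D b \<le> D c)" using assms by auto
  fix y assume "y < k \<and> (\<forall>c<k. D y \<le> D c)"
  then show "b \<le> y" using assms(1,3) by (meson leD not_le)
qed

lemma nearest_first:
  fixes D :: "nat \<Rightarrow> real"
  assumes k: "k \<ge> 1" and c: "c < nearest k D"
  shows "D (nearest k D) < D c"
proof (rule ccontr)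
  assume "\<not> ?thesis"
  then have "D c \<le> D (nearest k D)" by simp
  then have "c < k \<and> (\<forall>b<k. D c \<le> D b)"
    using c nearest(1)[OF k, of D] nearest(2)[OF k, where D=D] by (meson less_trans order_trans)
  then have "nearest k D \<le> c" unfolding nearest_def by (rule Least_le)
  with c show False by simp
qed

text \<open>One step of the scan. The range must be nonempty beforehand, since
  \<open>nearest 0\<close> is the \<open>LEAST\<close> of an unsatisfiable condition; for this
  reason the loop invariant of the scan treats its start separately.\<close>

lemma nearest_Suc:
  fixes D :: "nat \<Rightarrow> real"
  assumes "k \<ge> 1"
  shows "nearest (Suc k) D = (if D k < D (nearest k D) then k else nearest k D)"
proof (cases "D k < D (nearest k D)")
  case True
  then have "nearest (Suc k) D = k"
    using nearest(2)[OF assms, where D=D] by (intro nearestI) (fastforce simp: less_Suc_eq)+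
  then show ?thesis using True by simp
next
  case False
  then have "nearest (Suc k) D = nearest k D"
    using nearest(2)[OF assms, where D=D] nearest(1)[OF assms, of D] nearest_first[OF assms, where D=D]
    by (intro nearestI) (auto simp: less_Suc_eq)
  then show ?thesis using False by simp
qed

lemma nearest_1: "nearest (Suc 0) D = 0"
  by (rule nearestI) auto

context ram_search
begin

lemma ok_greville:
  assumes f: "memok \<sigma>" and D: "data \<sigma>"
    and M: "\<And>r a. r < s \<Longrightarrow> a < k \<Longrightarrow> rv \<sigma> 31 (r * k + a) = M r a"
  shows "ok memok (For 32 Kn greville_step) \<sigma> (75 * H ^ 3) (\<lambda>\<sigma>'. same {30, 31, 32} {30, 32, 33, 34, 35} \<sigma> \<sigma>' \<and>
     (\<forall>a<k. \<forall>x<s. rv \<sigma>' 32 (a * s + x) = pinv s M k a x))"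
proof -
  let ?J = "\<lambda>p \<sigma>'. same {30, 31, 32} {30, 32, 33, 34, 35} \<sigma> \<sigma>' \<and>
     (\<forall>a<p. \<forall>x<s. rv \<sigma>' 32 (a * s + x) = pinv s M p a x)"
  have D': "data \<sigma>'" if "same {30, 31, 32} {30, 32, 33, 34, 35} \<sigma> \<sigma>'" for \<sigma>'
    by (rule data_same[OF D that]) (auto simp: workN_def workR_def)
  have "ok memok (For 32 Kn greville_step) \<sigma> (k * (68 * H\<^sup>2 + 4) + 3) (?J k)"
  proof (rule ok_For[where J="?J"])
    show "1 \<le> LN 32" "k \<le> VN 32" using LN(1)[of 32] VN(1)[of 32] H by auto
    fix p \<sigma>1 assume p: "p < k" "memok \<sigma>1" "?J p \<sigma>1" "nv \<sigma>1 32 0 = p"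
    then have sm: "same {30, 31, 32} {30, 32, 33, 34, 35} \<sigma> \<sigma>1" by simp
    show "ok memok greville_step \<sigma>1 (68 * H\<^sup>2) (\<lambda>\<sigma>'. ?J (Suc p) \<sigma>' \<and> nv \<sigma>' 32 0 = p)"
    proof (rule ok_mono[OF ok_greville_step[where p=p and M=M]])
      show "rv \<sigma>1 31 (r * k + a) = M r a" if "r < s" "a < k" for r a
        using M[OF that] same_rv[OF sm] by simp
      fix \<sigma>2 assume *: "same {30, 31} {30, 32, 33, 34, 35} \<sigma>1 \<sigma>2 \<and>
        (\<forall>a<Suc p. \<forall>x<s. rv \<sigma>2 32 (a * s + x) = pinv s M (Suc p) a x)"
      have "same {30, 31, 32} {30, 32, 33, 34, 35} \<sigma> \<sigma>2" by (rule same_trans[OF sm conjunct1[OF *]]) auto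
      moreover have "nv \<sigma>2 32 0 = p" using same_nv[OF conjunct1[OF *], of 32 0] p by simp
      ultimately show "?J (Suc p) \<sigma>2 \<and> nv \<sigma>2 32 0 = p" using * by blast
    qed (use p D'[OF sm] in auto)
  next
    fix p \<sigma>1 assume "?J p \<sigma>1"
    then show "nval Kn \<sigma>1 = k" using data(3)[OF D'] by simp
  qed (use f in \<open>auto intro: same_put_nat\<close>)
  then show ?thesis by (rule ok_mono) (use time_For[of k 68 2] H in \<open>auto simp: eval_nat_numeral\<close>)
qed

lemma ok_compute_centers:
  assumes f: "memok \<sigma>" and D: "data \<sigma>"
    and N: "\<And>a x. a < k \<Longrightarrow> x < s \<Longrightarrow> rv \<sigma> 32 (a * s + x) = pinv s M k a x"
  shows "ok memok compute_centers \<sigma> (19 * H\<^sup>2) (\<lambda>\<sigma>'. same {30, 31} {30, 36} \<sigma> \<sigma>' \<and>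
     (\<forall>a<k. \<forall>j<d. rv \<sigma>' 36 (a * d + j) = sk_centers s k M SA a j))"
  unfolding compute_centers_def
proof (rule ok_mono[OF ok_FillSum[where B="k * d" and Bi=s and
     v="\<lambda>l y. pinv s M k (l div d) y * SA y (l mod d)" and g="\<lambda>l. sk_centers s k M SA (l div d) (l mod d)"]])
  fix \<sigma>' assume sm: "same {30, 31} {36, 30} \<sigma> \<sigma>'"
  have D': "data \<sigma>'" by (rule data_same[OF D sm]) (auto simp: workN_def workR_def)
  note E = same_rv[OF sm]
  show "nval (NMul Kn Dn) \<sigma>' = k * d" "nval Sn \<sigma>' = s" by (simp_all add: data[OF D'])
  { fix l y assume "nv \<sigma>' 30 0 = l" "l < k * d" "nv \<sigma>' 31 0 = y" "y < s"
    moreover then have "l div d < k" "l mod d < d" using pos by (auto simp: less_mult_imp_div_less)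
    ultimately show "rval (RMul (idx 32 (NDiv (NVar 30) Dn) Sn (NVar 31)) (idx 5 (NVar 31) Dn (NMod (NVar 30) Dn))) \<sigma>'
        = pinv s M k (l div d) y * SA y (l mod d)"
      using N data_SA[OF D', of y "l mod d"] by (simp add: data[OF D'] E) }
  { fix l assume "rv \<sigma>' 30 0 = (\<Sum>y<s. pinv s M k (l div d) y * SA y (l mod d))"
    then show "rval (RVar 30) \<sigma>' = sk_centers s k M SA (l div d) (l mod d)" by (simp add: sk_centers_def) }
next
  fix \<sigma>' assume *: "same {30, 31} {36, 30} \<sigma> \<sigma>' \<and> (\<forall>l<k * d. rv \<sigma>' 36 l = sk_centers s k M SA (l div d) (l mod d))"
  have "a * d + j < k * d" if "a < k" "j < d" for a j using that mult_le_mono1[of "Suc a" k d] by simp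
  then have "rv \<sigma>' 36 (a * d + j) = sk_centers s k M SA a j" if "a < k" "j < d" for a j
    using that * by simp
  moreover have "same {30, 31} {30, 36} \<sigma> \<sigma>'" by (rule same_mono[OF conjunct1[OF *]]) auto
  ultimately show "same {30, 31} {30, 36} \<sigma> \<sigma>' \<and> (\<forall>a<k. \<forall>j<d. rv \<sigma>' 36 (a * d + j) = sk_centers s k M SA a j)" by blast
next
  show "k * d * (s * 5 + 11) + 3 \<le> 19 * H\<^sup>2" using time_FillSum[of "k * d" s] H by simp
qed (use f LN(1)[of 30] LN(1)[of 31] VN(1)[of 30] VN(1)[of 31] H LR in auto)

lemma ok_sketch_centers:
  assumes f: "memok \<sigma>" and D: "data \<sigma>"
    and C: "\<And>a j. a < k \<Longrightarrow> j < d \<Longrightarrow> rv \<sigma> 36 (a * d + j) = C a j"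
  shows "ok memok (sketch_centers tx) \<sigma> (19 * H\<^sup>2) (\<lambda>\<sigma>'. same {30, 31} {30, 37} \<sigma> \<sigma>' \<and>
     (\<forall>a<k. \<forall>y<t. rv \<sigma>' 37 (a * t + y) = (\<Sum>j<d. C a j * Tf j y)))"
  unfolding sketch_centers_def
proof (rule ok_mono[OF ok_FillSum[where B="k * t" and Bi=d and
     v="\<lambda>l j. C (l div t) j * Tf j (l mod t)" and g="\<lambda>l. \<Sum>j<d. C (l div t) j * Tf j (l mod t)"]])
  fix \<sigma>' assume sm: "same {30, 31} {37, 30} \<sigma> \<sigma>'"
  have D': "data \<sigma>'" by (rule data_same[OF D sm]) (auto simp: workN_def workR_def)
  note E = same_rv[OF sm]
  show "nval (NMul Kn Tn) \<sigma>' = k * t" "nval Dn \<sigma>' = d" by (simp_all add: data[OF D'])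
  { fix l j assume l: "nv \<sigma>' 30 0 = l" "l < k * t" "nv \<sigma>' 31 0 = j" "j < d"
    then have "t > 0" by (cases t) auto
    with l have "l div t < k" "l mod t < t" by (auto simp: less_mult_imp_div_less)
    then show "rval (RMul (idx 36 (NDiv (NVar 30) Tn) Dn (NVar 31)) (tx (NVar 31) (NMod (NVar 30) Tn))) \<sigma>'
        = C (l div t) j * Tf j (l mod t)"
      using l C data_tx[OF D', of "NVar 31" "NMod (NVar 30) Tn"] by (simp add: data[OF D'] E) }
next
  fix \<sigma>' assume *: "same {30, 31} {37, 30} \<sigma> \<sigma>' \<and> (\<forall>l<k * t. rv \<sigma>' 37 l = (\<Sum>j<d. C (l div t) j * Tf j (l mod t)))"
  have "a * t + y < k * t" if "a < k" "y < t" for a y using that mult_le_mono1[of "Suc a" k t] by simp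
  then have "rv \<sigma>' 37 (a * t + y) = (\<Sum>j<d. C a j * Tf j y)" if "a < k" "y < t" for a y
    using that * by simp
  moreover have "same {30, 31} {30, 37} \<sigma> \<sigma>'" by (rule same_mono[OF conjunct1[OF *]]) auto
  ultimately show "same {30, 31} {30, 37} \<sigma> \<sigma>' \<and> (\<forall>a<k. \<forall>y<t. rv \<sigma>' 37 (a * t + y) = (\<Sum>j<d. C a j * Tf j y))" by blast
next
  show "k * t * (d * 5 + 11) + 3 \<le> 19 * H\<^sup>2" using time_FillSum[of "k * t" d] H by simp
qed (use f LN(1)[of 30] LN(1)[of 31] VN(1)[of 30] VN(1)[of 31] H LR in auto)

lemma ok_argmin:
  assumes f: "memok \<sigma>" and D: "data \<sigma>" and b: "nv \<sigma> 34 0 = 0" and Ds: "\<And>a. a < k \<Longrightarrow> rv \<sigma> 38 a = Ds a"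
  shows "ok memok (For 35 Kn (Cond (RLess (RGet 38 (NVar 35)) (RGet 38 (NVar 34))) (NPut 34 (NLit 0) (NVar 35)) Halt)) \<sigma>
     (k * (2 + 4) + 3) (\<lambda>\<sigma>'. same {34, 35} {} \<sigma> \<sigma>' \<and> nv \<sigma>' 34 0 = nearest k Ds)"
proof -
  let ?J = "\<lambda>a \<sigma>'. same {34, 35} {} \<sigma> \<sigma>' \<and> nv \<sigma>' 34 0 = (if a = 0 then 0 else nearest a Ds)"
  have "ok memok (For 35 Kn (Cond (RLess (RGet 38 (NVar 35)) (RGet 38 (NVar 34))) (NPut 34 (NLit 0) (NVar 35)) Halt)) \<sigma>
     (k * (2 + 4) + 3) (?J k)"
  proof (rule ok_For[where J="?J"])
    show "1 \<le> LN 35" "k \<le> VN 35" using LN(1)[of 35] VN(1)[of 35] H by auto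
    fix a \<sigma>1 assume a: "a < k" "memok \<sigma>1" "?J a \<sigma>1" "nv \<sigma>1 35 0 = a"
    then have sm: "same {34, 35} {} \<sigma> \<sigma>1" by simp
    have next': "(if Suc a = 0 then 0 else nearest (Suc a) Ds) =
        (if Ds a < Ds (nv \<sigma>1 34 0) then a else nv \<sigma>1 34 0)"
      using a by (cases "a = 0") (auto simp: nearest_Suc nearest_1)
    have "nv \<sigma>1 34 0 < k" using a nearest(1)[of a Ds] by (cases "a = 0") auto
    then have v: "rv \<sigma>1 38 a = Ds a" "rv \<sigma>1 38 (nv \<sigma>1 34 0) = Ds (nv \<sigma>1 34 0)"
      using same_rv[OF sm] Ds a by auto
    have L: "LN 34 \<ge> 1" "a \<le> VN 34" using LN(1)[of 34] VN(1)[of 34] H a by auto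
    have "ok memok (Cond (RLess (RGet 38 (NVar 35)) (RGet 38 (NVar 34))) (NPut 34 (NLit 0) (NVar 35)) Halt) \<sigma>1 (Suc 1)
       (\<lambda>\<sigma>'. ?J (Suc a) \<sigma>' \<and> nv \<sigma>' 35 0 = a)"
    proof (rule ok_Cond)
      show "memok \<sigma>1" by (rule a(2))
    next
      assume "bval (RLess (RGet 38 (NVar 35)) (RGet 38 (NVar 34))) \<sigma>1"
      then have "Ds a < Ds (nv \<sigma>1 34 0)" using a v by simp
      then show "ok memok (NPut 34 (NLit 0) (NVar 35)) \<sigma>1 1 (\<lambda>\<sigma>'. ?J (Suc a) \<sigma>' \<and> nv \<sigma>' 35 0 = a)"
        using a L sm unfolding next' by (intro ok_NPut) (auto intro: same_put_nat)
    next
      assume "\<not> bval (RLess (RGet 38 (NVar 35)) (RGet 38 (NVar 34))) \<sigma>1"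
      then have "\<not> Ds a < Ds (nv \<sigma>1 34 0)" using a v by simp
      then show "ok memok Halt \<sigma>1 1 (\<lambda>\<sigma>'. ?J (Suc a) \<sigma>' \<and> nv \<sigma>' 35 0 = a)"
        using a sm unfolding next' by (intro ok_Halt) auto
    qed
    then show "ok memok (Cond (RLess (RGet 38 (NVar 35)) (RGet 38 (NVar 34))) (NPut 34 (NLit 0) (NVar 35)) Halt) \<sigma>1 2
       (\<lambda>\<sigma>'. ?J (Suc a) \<sigma>' \<and> nv \<sigma>' 35 0 = a)" by (simp add: numeral_2_eq_2)
  next
    fix a \<sigma>1 assume "?J a \<sigma>1"
    then show "nval Kn \<sigma>1 = k" using same_nv[of "{34, 35}" "{}" \<sigma> \<sigma>1 0 2] data(3)[OF D] by simp
  qed (use f b in \<open>auto intro: same_put_nat\<close>)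
  then show ?thesis by (rule ok_mono) (use pos in auto)
qed

lemma ok_compute_labels:
  assumes f: "memok \<sigma>" and D: "data \<sigma>"
    and CT: "\<And>a y. a < k \<Longrightarrow> y < t \<Longrightarrow> rv \<sigma> 37 (a * t + y) = (\<Sum>j<d. C a j * Tf j y)"
  shows "ok memok compute_labels \<sigma> (40 * H ^ 3) (\<lambda>\<sigma>'. same {30, 31, 33, 34, 35, 40} {30, 38} \<sigma> \<sigma>' \<and>
     (\<forall>i<n. nv \<sigma>' 40 i = nearest k (sk_dist d t Tf C AT i)))"
proof -
  let ?S = "same {30, 31, 33, 34, 35, 40} {30, 38}"
  let ?J = "\<lambda>i \<sigma>'. ?S \<sigma> \<sigma>' \<and> (\<forall>i'<i. nv \<sigma>' 40 i' = nearest k (sk_dist d t Tf C AT i'))"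
  have D': "data \<sigma>'" if "?S \<sigma> \<sigma>'" for \<sigma>'
    by (rule data_same[OF D that]) (auto simp: workN_def workR_def)
  have "ok memok compute_labels \<sigma> (n * (33 * H\<^sup>2 + 4) + 3) (?J n)"
    unfolding compute_labels_def
  proof (rule ok_For[where J="?J"])
    show "1 \<le> LN 33" "n \<le> VN 33" using LN(1)[of 33] VN(1)[of 33] H by auto
    fix i \<sigma>1 assume i: "i < n" "memok \<sigma>1" "?J i \<sigma>1" "nv \<sigma>1 33 0 = i"
    then have sm1: "?S \<sigma> \<sigma>1" by simp
    let ?D = "sk_dist d t Tf C AT i"
    let ?Q1 = "\<lambda>\<sigma>'. ?S \<sigma> \<sigma>' \<and> (\<forall>i'<i. nv \<sigma>' 40 i' = nearest k (sk_dist d t Tf C AT i')) \<and> nv \<sigma>' 33 0 = i \<and>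
        (\<forall>a<k. rv \<sigma>' 38 a = ?D a)"
    let ?Q2 = "\<lambda>\<sigma>'. ?Q1 \<sigma>' \<and> nv \<sigma>' 34 0 = 0"
    let ?Q3 = "\<lambda>\<sigma>'. ?Q1 \<sigma>' \<and> nv \<sigma>' 34 0 = nearest k ?D"
    have 1: "ok memok (FillSum 38 30 Kn 30 31 Tn (RMul diff_ct diff_ct) (RVar 30)) \<sigma>1 (k * (t * 5 + 11) + 3) ?Q1"
    proof (rule ok_mono[OF ok_FillSum[where B=k and Bi=t and
        v="\<lambda>a y. ((\<Sum>j<d. C a j * Tf j y) - AT i y) * ((\<Sum>j<d. C a j * Tf j y) - AT i y)" and g="?D"]])
      fix \<sigma>' assume sm: "same {30, 31} {38, 30} \<sigma>1 \<sigma>'"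
      have sm': "?S \<sigma> \<sigma>'" by (rule same_trans[OF sm1 sm]) auto
      note D2 = D'[OF sm']
      show "nval Kn \<sigma>' = k" "nval Tn \<sigma>' = t" by (simp_all add: data[OF D2])
      { fix a y assume "nv \<sigma>' 30 0 = a" "a < k" "nv \<sigma>' 31 0 = y" "y < t"
        moreover have "nv \<sigma>' 33 0 = i" using same_nv[OF sm, of 33 0] i by simp
        moreover have "rv \<sigma>' 37 l = rv \<sigma> 37 l" for l using same_rv[OF sm', of 37] by simp
        ultimately show "rval (RMul diff_ct diff_ct) \<sigma>' =
           ((\<Sum>j<d. C a j * Tf j y) - AT i y) * ((\<Sum>j<d. C a j * Tf j y) - AT i y)"
          using CT[of a y] data_AT[OF D2, of i y] i by (simp add: data[OF D2]) }
      { fix a assume "rv \<sigma>' 30 0 = (\<Sum>y<t. ((\<Sum>j<d. C a j * Tf j y) - AT i y) * ((\<Sum>j<d. C a j * Tf j y) - AT i y))"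
        then show "rval (RVar 30) \<sigma>' = ?D a" by (simp add: sk_dist_def power2_eq_square) }
    next
      fix \<sigma>' assume *: "same {30, 31} {38, 30} \<sigma>1 \<sigma>' \<and> (\<forall>a<k. rv \<sigma>' 38 a = ?D a)"
      have "?S \<sigma> \<sigma>'" by (rule same_trans[OF sm1 conjunct1[OF *]]) auto
      then show "?Q1 \<sigma>'" using * i same_nv[OF conjunct1[OF *]] by simp
    qed (use i LN(1)[of 30] LN(1)[of 31] VN(1)[of 30] VN(1)[of 31] H LR in auto)
    have 2: "ok memok (NPut 34 (NLit 0) (NLit 0)) \<sigma>2 1 ?Q2" if "memok \<sigma>2" "?Q1 \<sigma>2" for \<sigma>2
      using that LN(1)[of 34] by (intro ok_NPut) (auto intro: same_put_nat)
    have 3: "ok memok (For 35 Kn (Cond (RLess (RGet 38 (NVar 35)) (RGet 38 (NVar 34))) (NPut 34 (NLit 0) (NVar 35)) Halt)) \<sigma>3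
       (k * (2 + 4) + 3) ?Q3" if f3: "memok \<sigma>3" and Q2: "?Q2 \<sigma>3" for \<sigma>3
    proof (rule ok_mono[OF ok_argmin[OF f3 D'[OF conjunct1[OF conjunct1[OF Q2]]], of ?D]])
      fix \<sigma>' assume *: "same {34, 35} {} \<sigma>3 \<sigma>' \<and> nv \<sigma>' 34 0 = nearest k ?D"
      have "?S \<sigma> \<sigma>'" by (rule same_trans[OF conjunct1[OF conjunct1[OF Q2]] conjunct1[OF *]]) auto
      then show "?Q3 \<sigma>'" using * Q2 same_nv[OF conjunct1[OF *]] same_rv[OF conjunct1[OF *]] by simp
    qed (use Q2 in auto)
    have 4: "ok memok (NPut 40 (NVar 33) (NVar 34)) \<sigma>4 1 (\<lambda>\<sigma>'. ?J (Suc i) \<sigma>' \<and> nv \<sigma>' 33 0 = i)"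
      if "memok \<sigma>4" "?Q3 \<sigma>4" for \<sigma>4
      using that i LN(2) VN(3) nearest(1)[OF pos(3), of ?D] by (intro ok_NPut) (auto intro: same_put_nat simp: less_Suc_eq)
    have "ok memok (Seq (FillSum 38 30 Kn 30 31 Tn (RMul diff_ct diff_ct) (RVar 30))
     (Seq (NPut 34 (NLit 0) (NLit 0))
     (Seq (For 35 Kn (Cond (RLess (RGet 38 (NVar 35)) (RGet 38 (NVar 34))) (NPut 34 (NLit 0) (NVar 35)) Halt))
          (NPut 40 (NVar 33) (NVar 34))))) \<sigma>1 ((k * (t * 5 + 11) + 3) + (1 + ((k * (2 + 4) + 3) + 1 + 1) + 1) + 1)
       (\<lambda>\<sigma>'. ?J (Suc i) \<sigma>' \<and> nv \<sigma>' 33 0 = i)"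
      by (intro ok_Seq[OF 1] ok_Seq[OF 2] ok_Seq[OF 3] 4)
    then show "ok memok (Seq (FillSum 38 30 Kn 30 31 Tn (RMul diff_ct diff_ct) (RVar 30))
     (Seq (NPut 34 (NLit 0) (NLit 0))
     (Seq (For 35 Kn (Cond (RLess (RGet 38 (NVar 35)) (RGet 38 (NVar 34))) (NPut 34 (NLit 0) (NVar 35)) Halt))
          (NPut 40 (NVar 33) (NVar 34))))) \<sigma>1 (33 * H\<^sup>2) (\<lambda>\<sigma>'. ?J (Suc i) \<sigma>' \<and> nv \<sigma>' 33 0 = i)"
    proof (rule ok_mono)
      have e: "k * (2 + 4) = 6 * k" by simp
      show "(k * (t * 5 + 11) + 3) + (1 + ((k * (2 + 4) + 3) + 1 + 1) + 1) + 1 \<le> 33 * H\<^sup>2"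
        unfolding e using time_FillSum[OF H(3,4)] H(3) pow_chain[OF H1] H1 by linarith
    qed
  next
    fix i \<sigma>1 assume "?J i \<sigma>1"
    then show "nval Nn \<sigma>1 = n" using data(1)[OF D'] by simp
  qed (use f in \<open>auto intro: same_put_nat\<close>)
  then show ?thesis by (rule ok_mono) (use time_For[of n 33 2] H in \<open>auto simp: eval_nat_numeral\<close>)
qed

lemma ok_compute_cost:
  assumes f: "memok \<sigma>" and D: "data \<sigma>"
    and C: "\<And>a j. a < k \<Longrightarrow> j < d \<Longrightarrow> rv \<sigma> 36 (a * d + j) = C a j"
    and lab: "\<And>i. i < n \<Longrightarrow> nv \<sigma> 40 i = lab i" "\<And>i. i < n \<Longrightarrow> lab i < k"
  shows "ok memok (compute_cost wx) \<sigma> (30 * H\<^sup>2) (\<lambda>\<sigma>'. same {30, 31} {30, 39, 40} \<sigma> \<sigma>' \<and>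
     rv \<sigma>' 40 0 = sk_cost n d w Wf C lab Wa)"
proof -
  let ?v = "\<lambda>r l. Wf r l * C (lab (l div d)) (l mod d)"
  let ?g = "\<lambda>r. ((\<Sum>l<n * d. ?v r l) - Wa r) * ((\<Sum>l<n * d. ?v r l) - Wa r)"
  let ?Q = "\<lambda>\<sigma>'. same {30, 31} {39, 30} \<sigma> \<sigma>' \<and> (\<forall>r<w. rv \<sigma>' 39 r = ?g r)"
  have D': "data \<sigma>'" if "same {30, 31} {39, 30} \<sigma> \<sigma>'" for \<sigma>'
    by (rule data_same[OF D that]) (auto simp: workN_def workR_def)
  have L: "LN 30 \<ge> 1" "LN 31 \<ge> 1" "VN 30 \<ge> H" "VN 31 \<ge> H" using LN(1) VN(1) by simp_all
  have "ok memok (compute_cost wx) \<sigma> ((w * (n * d * 5 + 11) + 3) + (w * 5 + 5) + 1)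
     (\<lambda>\<sigma>'. same {30, 31} {30, 39, 40} \<sigma> \<sigma>' \<and> rv \<sigma>' 40 0 = (\<Sum>r<w. ?g r))"
    unfolding compute_cost_def
  proof (rule ok_Seq)
    show "ok memok (FillSum 39 30 Wn 30 31 (NMul Nn Dn)
           (RMul (wx (NVar 30) (NVar 31)) (idx 36 (NGet 40 (NDiv (NVar 31) Dn)) Dn (NMod (NVar 31) Dn)))
           (RMul (RSub (RVar 30) (RGet 7 (NVar 30))) (RSub (RVar 30) (RGet 7 (NVar 30)))))
         \<sigma> (w * (n * d * 5 + 11) + 3) ?Q"
    proof (rule ok_FillSum[where v="?v"])
      fix \<sigma>' assume sm: "same {30, 31} {39, 30} \<sigma> \<sigma>'"
      note D2 = D'[OF sm]
      show "nval Wn \<sigma>' = w" "nval (NMul Nn Dn) \<sigma>' = n * d" by (simp_all add: data[OF D2])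
      { fix r l assume "nv \<sigma>' 30 0 = r" "r < w" "nv \<sigma>' 31 0 = l" "l < n * d"
        moreover then have "l div d < n" "l mod d < d" using pos by (auto simp: less_mult_imp_div_less)
        ultimately show "rval (RMul (wx (NVar 30) (NVar 31)) (idx 36 (NGet 40 (NDiv (NVar 31) Dn)) Dn (NMod (NVar 31) Dn))) \<sigma>' = ?v r l"
          using lab[of "l div d"] C[of "lab (l div d)" "l mod d"] data_wx[OF D2, of "NVar 30" "NVar 31"]
          by (simp add: data[OF D2] same_rv[OF sm] same_nv[OF sm]) }
      { fix r assume "nv \<sigma>' 30 0 = r" "r < w" "rv \<sigma>' 30 0 = (\<Sum>l<n * d. ?v r l)"
        then show "rval (RMul (RSub (RVar 30) (RGet 7 (NVar 30))) (RSub (RVar 30) (RGet 7 (NVar 30)))) \<sigma>' = ?g r"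
          using data_Wa[OF D2, of r] by simp }
    qed (use f L H LR in auto)
    fix \<sigma>1 assume f1: "memok \<sigma>1" and Q: "?Q \<sigma>1"
    show "ok memok (RSum 40 30 Wn (RGet 39 (NVar 30))) \<sigma>1 (w * 5 + 5)
       (\<lambda>\<sigma>'. same {30, 31} {30, 39, 40} \<sigma> \<sigma>' \<and> rv \<sigma>' 40 0 = (\<Sum>r<w. ?g r))"
    proof (rule ok_mono[OF ok_RSum[where B=w and v="?g"]])
      fix \<sigma>' assume sm: "same {30} {40} \<sigma>1 \<sigma>'"
      show "nval Wn \<sigma>' = w" using same_nv[OF sm] data[OF D'[OF conjunct1[OF Q]]] by simp
      show "rval (RGet 39 (NVar 30)) \<sigma>' = ?g r" if "nv \<sigma>' 30 0 = r" "r < w" for r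
        using that Q same_rv[OF sm] by simp
    next
      fix \<sigma>' assume *: "same {30} {40} \<sigma>1 \<sigma>' \<and> rv \<sigma>' 40 0 = (\<Sum>r<w. ?g r)"
      have "same {30, 31} {30, 39, 40} \<sigma> \<sigma>'" by (rule same_trans[OF conjunct1[OF Q] conjunct1[OF *]]) auto
      with * show "same {30, 31} {30, 39, 40} \<sigma> \<sigma>' \<and> rv \<sigma>' 40 0 = (\<Sum>r<w. ?g r)" by blast
    qed (use f1 L H LR in auto)
  qed
  then show ?thesis
  proof (rule ok_mono)
    show "(w * (n * d * 5 + 11) + 3) + (w * 5 + 5) + 1 \<le> 30 * H\<^sup>2"
      using time_FillSum[of w "n * d"] H pow_chain[OF H1] H1 by linarith
  qed (auto simp: sk_cost_def power2_eq_square)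
qed

definition stored :: "(nat \<Rightarrow> nat \<Rightarrow> real) \<Rightarrow> (nat \<Rightarrow> nat) \<Rightarrow> state \<Rightarrow> bool" where
  "stored C lab \<sigma> \<longleftrightarrow> (\<forall>i<n. nv \<sigma> 1 i = lab i) \<and> (\<forall>a<k. \<forall>j<d. rv \<sigma> 1 (a * d + j) = C a j)"

lemma ok_keep_best:
  assumes f: "memok \<sigma>" and D: "data \<sigma>"
    and C: "\<And>a j. a < k \<Longrightarrow> j < d \<Longrightarrow> rv \<sigma> 36 (a * d + j) = C a j"
    and lab: "\<And>i. i < n \<Longrightarrow> nv \<sigma> 40 i = lab i" "\<And>i. i < n \<Longrightarrow> lab i < k"
  shows "ok memok keep_best \<sigma> (20 * H) (\<lambda>\<sigma>'. same {1, 30} {1, 41} \<sigma> \<sigma>' \<and>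
     (if nv \<sigma> 36 0 \<ge> 1 \<and> rv \<sigma> 41 0 \<le> rv \<sigma> 40 0 then same {} {} \<sigma> \<sigma>' else stored C lab \<sigma>' \<and> rv \<sigma>' 41 0 = rv \<sigma> 40 0))"
    (is "ok memok keep_best \<sigma> _ (\<lambda>\<sigma>'. ?Post \<sigma>')")
proof -
  let ?S = "same {1, 30} {1, 41} \<sigma>"
  have D': "data \<sigma>'" if "?S \<sigma>'" for \<sigma>'
    by (rule data_same[OF D that]) (auto simp: workN_def workR_def)
  have L: "LN 30 \<ge> 1" "VN 30 \<ge> H" using LN(1) VN(1) by simp_all
  have "ok memok keep_best \<sigma> (Suc (1 + ((n * (1 + 4) + 3) + (k * d * 5 + 3) + 1) + 1)) ?Post"
    unfolding keep_best_def
  proof (rule ok_Cond)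
    show "memok \<sigma>" by (rule f)
  next
    assume "bval (BAnd (BNot (NLess (NVar 36) (NLit 1))) (BNot (RLess (RVar 40) (RVar 41)))) \<sigma>"
    then show "ok memok Halt \<sigma> (1 + ((n * (1 + 4) + 3) + (k * d * 5 + 3) + 1) + 1) ?Post"
      using f by (intro ok_Halt) (auto simp: not_less)
  next
    assume nb: "\<not> bval (BAnd (BNot (NLess (NVar 36) (NLit 1))) (BNot (RLess (RVar 40) (RVar 41)))) \<sigma>"
    let ?Q1 = "\<lambda>\<sigma>'. ?S \<sigma>' \<and> rv \<sigma>' 41 0 = rv \<sigma> 40 0"
    let ?Q2 = "\<lambda>i \<sigma>'. ?Q1 \<sigma>' \<and> (\<forall>i'<i. nv \<sigma>' 1 i' = lab i')"
    have 1: "ok memok (RPut 41 (NLit 0) (RVar 40)) \<sigma> 1 ?Q1"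
      using f LR(12) by (intro ok_RPut) (auto intro: same_put_real)
    have 2: "ok memok (For 30 Nn (NPut 1 (NVar 30) (NGet 40 (NVar 30)))) \<sigma>1 (n * (1 + 4) + 3) (?Q2 n)"
      if "memok \<sigma>1" "?Q1 \<sigma>1" for \<sigma>1
    proof (rule ok_For[where J="?Q2"])
      fix i \<sigma>2 assume i: "i < n" "memok \<sigma>2" "?Q2 i \<sigma>2" "nv \<sigma>2 30 0 = i"
      then have "nv \<sigma>2 40 i = lab i" using lab(1) same_nv[of "{1, 30}" "{1, 41}" \<sigma> \<sigma>2] by simp
      moreover have "lab i \<le> VN 1" using lab(2)[OF i(1)] VN(4) by simp
      ultimately show "ok memok (NPut 1 (NVar 30) (NGet 40 (NVar 30))) \<sigma>2 1 (\<lambda>\<sigma>'. ?Q2 (Suc i) \<sigma>' \<and> nv \<sigma>' 30 0 = i)"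
        using i LN(3) by (intro ok_NPut) (auto intro: same_put_nat simp: less_Suc_eq)
    next
      fix i \<sigma>2 assume "?Q2 i \<sigma>2"
      then show "nval Nn \<sigma>2 = n" using data(1)[OF D'] by simp
    qed (use that L H in \<open>auto intro: same_put_nat\<close>)
    have 3: "ok memok (FillMap 1 30 (NMul Kn Dn) (NLit 0) (RGet 36 (NVar 30))) \<sigma>2 (k * d * 5 + 3) ?Post"
      if f2: "memok \<sigma>2" and Q2: "?Q2 n \<sigma>2" for \<sigma>2
    proof (rule ok_mono[OF ok_FillMap[where B="k * d" and o'=0 and v="\<lambda>l. rv \<sigma> 36 l"]])
      fix \<sigma>' assume sm: "same {30} {1} \<sigma>2 \<sigma>'"
      have sm': "?S \<sigma>'" by (rule same_trans[OF conjunct1[OF conjunct1[OF Q2]] sm]) auto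
      show "nval (NMul Kn Dn) \<sigma>' = k * d" "nval (NLit 0) \<sigma>' = 0" by (simp_all add: data[OF D'[OF sm']])
      show "rval (RGet 36 (NVar 30)) \<sigma>' = rv \<sigma> 36 i" if "nv \<sigma>' 30 0 = i" for i
        using that same_rv[OF sm', of 36] by simp
    next
      fix \<sigma>' assume *: "same {30} {1} \<sigma>2 \<sigma>' \<and>
        (\<forall>j. rv \<sigma>' 1 j = (if 0 \<le> j \<and> j < 0 + k * d then rv \<sigma> 36 (j - 0) else rv \<sigma>2 1 j))"
      have sm': "?S \<sigma>'" by (rule same_trans[OF conjunct1[OF conjunct1[OF Q2]] conjunct1[OF *]]) auto
      have "a * d + j < k * d" if "a < k" "j < d" for a j using that mult_le_mono1[of "Suc a" k d] by simp
      then have "rv \<sigma>' 1 (a * d + j) = C a j" if "a < k" "j < d" for a j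
        using that * C by simp
      moreover have "nv \<sigma>' 1 i = lab i" if "i < n" for i
        using that Q2 same_nv[OF conjunct1[OF *], of 1 i] by simp
      ultimately have "stored C lab \<sigma>'" by (simp add: stored_def)
      moreover have "rv \<sigma>' 41 0 = rv \<sigma> 40 0" using Q2 same_rv[OF conjunct1[OF *], of 41 0] by simp
      ultimately show "?Post \<sigma>'" using sm' nb by (auto simp: not_less)
    qed (use f2 L H LR in auto)
    show "ok memok (Seq (RPut 41 (NLit 0) (RVar 40)) (Seq (For 30 Nn (NPut 1 (NVar 30) (NGet 40 (NVar 30))))
          (FillMap 1 30 (NMul Kn Dn) (NLit 0) (RGet 36 (NVar 30))))) \<sigma>
        (1 + ((n * (1 + 4) + 3) + (k * d * 5 + 3) + 1) + 1) ?Post"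
      by (intro ok_Seq[OF 1] ok_Seq[OF 2] 3)
  qed
  then show ?thesis by (rule ok_mono) (use H H1 in auto)
qed

end

context ram_search
begin

lemma ok_candidate:
  assumes f: "memok \<sigma>" and D: "data \<sigma>" and m: "nv \<sigma> 36 0 = m" "m \<le> (2 * n + 1) ^ (s * k)"
  shows "ok memok (Seq decode_guess (Seq (For 32 Kn greville_step) (Seq compute_centers
       (Seq (sketch_centers tx) (Seq compute_labels (Seq (compute_cost wx) keep_best)))))) \<sigma> (221 * H ^ 3)
     (\<lambda>\<sigma>'. same (workN - {36, 38}) workR \<sigma> \<sigma>' \<and>
        (if m \<ge> 1 \<and> rv \<sigma> 41 0 \<le> cand_cost m then same (workN - {1, 36, 38}) (workR - {1, 41}) \<sigma> \<sigma>'
         else stored (cand_centers m) (cand_labels m) \<sigma>' \<and> rv \<sigma>' 41 0 = cand_cost m))"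
    (is "ok memok _ \<sigma> _ ?Post")
proof -
  let ?C = "cand_centers m" and ?L = "cand_labels m"
  let ?NW = "workN - {1, 36, 38}" and ?RW = "workR - {1, 41}"
  let ?S = "same ?NW ?RW \<sigma>"
  have trans: "?S \<sigma>2" if "?S \<sigma>1" "same NU RU \<sigma>1 \<sigma>2" "NU \<subseteq> ?NW" "RU \<subseteq> ?RW" for \<sigma>1 \<sigma>2 NU RU
    by (rule same_trans[OF that(1,2) _ _ that(3,4)]) auto
  have D': "data \<sigma>'" if "?S \<sigma>'" for \<sigma>' by (rule data_same[OF D that]) auto
  let ?Q1 = "\<lambda>\<sigma>'. ?S \<sigma>' \<and> (\<forall>r<s. \<forall>a<k. rv \<sigma>' 31 (r * k + a) = guess n k m r a)"
  let ?Q2 = "\<lambda>\<sigma>'. ?S \<sigma>' \<and> (\<forall>a<k. \<forall>x<s. rv \<sigma>' 32 (a * s + x) = pinv s (guess n k m) k a x)"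
  let ?Q3 = "\<lambda>\<sigma>'. ?S \<sigma>' \<and> (\<forall>a<k. \<forall>j<d. rv \<sigma>' 36 (a * d + j) = ?C a j)"
  let ?Q4 = "\<lambda>\<sigma>'. ?Q3 \<sigma>' \<and> (\<forall>a<k. \<forall>y<t. rv \<sigma>' 37 (a * t + y) = (\<Sum>j<d. ?C a j * Tf j y))"
  let ?Q5 = "\<lambda>\<sigma>'. ?Q3 \<sigma>' \<and> (\<forall>i<n. nv \<sigma>' 40 i = ?L i)"
  let ?Q6 = "\<lambda>\<sigma>'. ?Q5 \<sigma>' \<and> rv \<sigma>' 40 0 = cand_cost m"
  have 1: "ok memok decode_guess \<sigma> (12 * H) ?Q1"
    by (rule ok_mono[OF ok_decode_guess[OF f D m]]) (auto elim!: same_mono simp: workN_def workR_def)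
  have 2: "ok memok (For 32 Kn greville_step) \<sigma>1 (75 * H ^ 3) ?Q2" if "memok \<sigma>1" and Q: "?Q1 \<sigma>1" for \<sigma>1
  proof (rule ok_mono[OF ok_greville[where M="guess n k m"]])
    fix \<sigma>' assume *: "same {30, 31, 32} {30, 32, 33, 34, 35} \<sigma>1 \<sigma>' \<and>
     (\<forall>a<k. \<forall>x<s. rv \<sigma>' 32 (a * s + x) = pinv s (guess n k m) k a x)"
    have "?S \<sigma>'" by (rule trans[OF conjunct1[OF Q] conjunct1[OF *]]) (auto simp: workN_def workR_def)
    with * show "?Q2 \<sigma>'" by blast
  qed (use that D' in auto)
  have 3: "ok memok compute_centers \<sigma>2 (19 * H\<^sup>2) ?Q3" if "memok \<sigma>2" and Q: "?Q2 \<sigma>2" for \<sigma>2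
  proof (rule ok_mono[OF ok_compute_centers[where M="guess n k m"]])
    fix \<sigma>' assume *: "same {30, 31} {30, 36} \<sigma>2 \<sigma>' \<and>
     (\<forall>a<k. \<forall>j<d. rv \<sigma>' 36 (a * d + j) = sk_centers s k (guess n k m) SA a j)"
    have "?S \<sigma>'" by (rule trans[OF conjunct1[OF Q] conjunct1[OF *]]) (auto simp: workN_def workR_def)
    with * show "?Q3 \<sigma>'" by (simp add: cand_centers_def)
  qed (use that D' in auto)
  have 4: "ok memok (sketch_centers tx) \<sigma>3 (19 * H\<^sup>2) ?Q4" if "memok \<sigma>3" and Q: "?Q3 \<sigma>3" for \<sigma>3
  proof (rule ok_mono[OF ok_sketch_centers[where C="?C"]])
    fix \<sigma>' assume *: "same {30, 31} {30, 37} \<sigma>3 \<sigma>' \<and> (\<forall>a<k. \<forall>y<t. rv \<sigma>' 37 (a * t + y) = (\<Sum>j<d. ?C a j * Tf j y))"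
    have "?S \<sigma>'" by (rule trans[OF conjunct1[OF Q] conjunct1[OF *]]) (auto simp: workN_def workR_def)
    with * Q show "?Q4 \<sigma>'" using same_rv[OF conjunct1[OF *], of 36] by simp
  qed (use that D' in auto)
  have 5: "ok memok compute_labels \<sigma>4 (40 * H ^ 3) ?Q5" if "memok \<sigma>4" and Q: "?Q4 \<sigma>4" for \<sigma>4
  proof (rule ok_mono[OF ok_compute_labels[where C="?C"]])
    fix \<sigma>' assume *: "same {30, 31, 33, 34, 35, 40} {30, 38} \<sigma>4 \<sigma>' \<and> (\<forall>i<n. nv \<sigma>' 40 i = nearest k (sk_dist d t Tf ?C AT i))"
    have "?S \<sigma>'" by (rule trans[OF conjunct1[OF conjunct1[OF Q]] conjunct1[OF *]]) (auto simp: workN_def workR_def)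
    with * Q show "?Q5 \<sigma>'" using same_rv[OF conjunct1[OF *], of 36] by (simp add: cand_labels_def)
  qed (use that D' in auto)
  have L: "?L i < k" for i unfolding cand_labels_def by (rule nearest(1)[OF pos(3)])
  have 6: "ok memok (compute_cost wx) \<sigma>5 (30 * H\<^sup>2) ?Q6" if "memok \<sigma>5" and Q: "?Q5 \<sigma>5" for \<sigma>5
  proof (rule ok_mono[OF ok_compute_cost[where C="?C" and lab="?L"]])
    fix \<sigma>' assume *: "same {30, 31} {30, 39, 40} \<sigma>5 \<sigma>' \<and> rv \<sigma>' 40 0 = sk_cost n d w Wf ?C ?L Wa"
    have "?S \<sigma>'" by (rule trans[OF conjunct1[OF conjunct1[OF Q]] conjunct1[OF *]]) (auto simp: workN_def workR_def)
    with * Q show "?Q6 \<sigma>'"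
      using same_rv[OF conjunct1[OF *], of 36] same_nv[OF conjunct1[OF *], of 40] by (simp add: cand_cost_def)
  qed (use that D' L in auto)
  have 7: "ok memok keep_best \<sigma>6 (20 * H) ?Post" if "memok \<sigma>6" and Q: "?Q6 \<sigma>6" for \<sigma>6
  proof (rule ok_mono[OF ok_keep_best[where C="?C" and lab="?L"]])
    fix \<sigma>' assume *: "same {1, 30} {1, 41} \<sigma>6 \<sigma>' \<and>
     (if nv \<sigma>6 36 0 \<ge> 1 \<and> rv \<sigma>6 41 0 \<le> rv \<sigma>6 40 0 then same {} {} \<sigma>6 \<sigma>' else stored ?C ?L \<sigma>' \<and> rv \<sigma>' 41 0 = rv \<sigma>6 40 0)"
    have S6: "?S \<sigma>6" using Q by blast
    have c: "nv \<sigma>6 36 0 = m" "rv \<sigma>6 41 0 = rv \<sigma> 41 0" "rv \<sigma>6 40 0 = cand_cost m"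
      using same_nv[OF S6, of 36 0] same_rv[OF S6, of 41 0] Q m by (auto simp: workN_def workR_def)
    have "same (workN - {36, 38}) workR \<sigma> \<sigma>'"
      by (rule same_trans[OF S6 conjunct1[OF *]]) (auto simp: workN_def workR_def)
    moreover have "?S \<sigma>'" if "same {} {} \<sigma>6 \<sigma>'" by (rule trans[OF S6 that]) auto
    ultimately show "?Post \<sigma>'" using conjunct2[OF *] unfolding c by (auto split: if_splits)
  qed (use that D' L in auto)
  have "ok memok (Seq decode_guess (Seq (For 32 Kn greville_step) (Seq compute_centers
       (Seq (sketch_centers tx) (Seq compute_labels (Seq (compute_cost wx) keep_best)))))) \<sigma>
      (12 * H + (75 * H ^ 3 + (19 * H\<^sup>2 + (19 * H\<^sup>2 + (40 * H ^ 3 + (30 * H\<^sup>2 + 20 * H + 1) + 1) + 1) + 1) + 1) + 1) ?Post"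
    by (intro ok_Seq[OF 1] ok_Seq[OF 2] ok_Seq[OF 3] ok_Seq[OF 4] ok_Seq[OF 5] ok_Seq[OF 6] 7)
  then show ?thesis
    by (rule ok_mono) (use pow_chain[OF H1] H1 in auto)
qed

lemma ok_search:
  assumes f: "memok \<sigma>" and D: "data \<sigma>"
  shows "ok memok (search tx wx) \<sigma> (250 * H ^ 3 * (2 * n + 1) ^ (s * k))
     (\<lambda>\<sigma>'. \<exists>m. best m \<and> stored (cand_centers m) (cand_labels m) \<sigma>')"
proof -
  let ?Q = "(2 * n + 1) ^ (s * k)"
  have Q1: "1 \<le> ?Q" by (rule one_le_power) simp
  have D': "data \<sigma>'" if "same workN workR \<sigma> \<sigma>'" for \<sigma>' by (rule data_same[OF D that]) auto
  let ?J1 = "\<lambda>i \<sigma>'. same workN workR \<sigma> \<sigma>' \<and> nv \<sigma>' 38 0 = (2 * n + 1) ^ i"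
  \<comment> \<open>Nothing is known about the output arrays before the first candidate, hence the
    guard m \<ge> 1.\<close>
  let ?J2 = "\<lambda>m \<sigma>'. same workN workR \<sigma> \<sigma>' \<and> nv \<sigma>' 38 0 = ?Q \<and> (m \<ge> 1 \<longrightarrow> (\<exists>m0<m. (\<forall>m'<m. cand_cost m0 \<le> cand_cost m') \<and>
     stored (cand_centers m0) (cand_labels m0) \<sigma>' \<and> rv \<sigma>' 41 0 = cand_cost m0))"
  have 1: "ok memok (NPut 38 (NLit 0) (NLit 1)) \<sigma> 1 (?J1 0)"
  proof (rule ok_NPut[OF f])
    show "nval (NLit 0) \<sigma> < LN 38" using LN(1)[of 38] by simp
    show "nval (NLit 1) \<sigma> \<le> VN 38" using order_trans[OF Q1 VN(2)[of 38]] by simp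
  qed (auto simp: workN_def intro!: same_put_nat)
  have 2: "ok memok (For 30 (NMul Sn Kn) (NPut 38 (NLit 0) (NMul (NVar 38) Bn))) \<sigma>1 (s * k * (1 + 4) + 3) (?J1 (s * k))"
    if "memok \<sigma>1" "?J1 0 \<sigma>1" for \<sigma>1
  proof (rule ok_For[where J="?J1"])
    fix i \<sigma>2 assume i: "i < s * k" "memok \<sigma>2" "?J1 i \<sigma>2" "nv \<sigma>2 30 0 = i"
    have v: "nval (NMul (NVar 38) Bn) \<sigma>2 = (2 * n + 1) ^ Suc i" using i data(1)[OF D'] by simp
    show "ok memok (NPut 38 (NLit 0) (NMul (NVar 38) Bn)) \<sigma>2 1 (\<lambda>\<sigma>'. ?J1 (Suc i) \<sigma>' \<and> nv \<sigma>' 30 0 = i)"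
    proof (rule ok_NPut[OF i(2)])
      show "nval (NLit 0) \<sigma>2 < LN 38" using LN(1)[of 38] by simp
      have "(2 * n + 1) ^ Suc i \<le> ?Q" using i(1) by (intro power_increasing) auto
      then show "nval (NMul (NVar 38) Bn) \<sigma>2 \<le> VN 38" unfolding v using VN(2)[of 38] by simp
      show "?J1 (Suc i) (put_nat 38 (nval (NLit 0) \<sigma>2) (nval (NMul (NVar 38) Bn) \<sigma>2) \<sigma>2) \<and>
         nv (put_nat 38 (nval (NLit 0) \<sigma>2) (nval (NMul (NVar 38) Bn) \<sigma>2) \<sigma>2) 30 0 = i"
        unfolding v using i by (auto simp: workN_def intro!: same_put_nat)
    qed simp
  next
    fix i \<sigma>2 assume "?J1 i \<sigma>2"
    then show "nval (NMul Sn Kn) \<sigma>2 = s * k" using data[OF D'] by simp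
  qed (use that LN(1)[of 30] VN(1)[of 30] H in \<open>auto simp: workN_def intro!: same_put_nat\<close>)
  have 3: "ok memok (For 36 (NVar 38) (Seq decode_guess (Seq (For 32 Kn greville_step) (Seq compute_centers
       (Seq (sketch_centers tx) (Seq compute_labels (Seq (compute_cost wx) keep_best))))))) \<sigma>1 (?Q * (221 * H ^ 3 + 4) + 3) (?J2 ?Q)"
    if f1: "memok \<sigma>1" and J1: "?J1 (s * k) \<sigma>1" for \<sigma>1
  proof (rule ok_For[where J="?J2"])
    fix m \<sigma>2 assume m: "m < ?Q" "memok \<sigma>2" "?J2 m \<sigma>2" "nv \<sigma>2 36 0 = m"
    then have sm: "same workN workR \<sigma> \<sigma>2" by blast
    show "ok memok (Seq decode_guess (Seq (For 32 Kn greville_step) (Seq compute_centers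
       (Seq (sketch_centers tx) (Seq compute_labels (Seq (compute_cost wx) keep_best)))))) \<sigma>2 (221 * H ^ 3)
       (\<lambda>\<sigma>'. ?J2 (Suc m) \<sigma>' \<and> nv \<sigma>' 36 0 = m)"
    proof (rule ok_mono[OF ok_candidate[OF m(2) D'[OF sm] m(4)]])
      fix \<sigma>3 assume *: "same (workN - {36, 38}) workR \<sigma>2 \<sigma>3 \<and>
        (if m \<ge> 1 \<and> rv \<sigma>2 41 0 \<le> cand_cost m then same (workN - {1, 36, 38}) (workR - {1, 41}) \<sigma>2 \<sigma>3
         else stored (cand_centers m) (cand_labels m) \<sigma>3 \<and> rv \<sigma>3 41 0 = cand_cost m)"
      have a: "same workN workR \<sigma> \<sigma>3" by (rule same_trans[OF sm conjunct1[OF *]]) auto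
      have b: "nv \<sigma>3 38 0 = ?Q" "nv \<sigma>3 36 0 = m" using same_nv[OF conjunct1[OF *]] m by auto
      have "\<exists>m0<Suc m. (\<forall>m'<Suc m. cand_cost m0 \<le> cand_cost m') \<and>
         stored (cand_centers m0) (cand_labels m0) \<sigma>3 \<and> rv \<sigma>3 41 0 = cand_cost m0"
      proof (cases "m \<ge> 1 \<and> rv \<sigma>2 41 0 \<le> cand_cost m")
        case True
        then obtain m0 where m0: "m0 < m" "\<forall>m'<m. cand_cost m0 \<le> cand_cost m'"
          "stored (cand_centers m0) (cand_labels m0) \<sigma>2" "rv \<sigma>2 41 0 = cand_cost m0" using m(3) by blast
        have sm3: "same (workN - {1, 36, 38}) (workR - {1, 41}) \<sigma>2 \<sigma>3" using * True by simp
        have "stored (cand_centers m0) (cand_labels m0) \<sigma>3" "rv \<sigma>3 41 0 = cand_cost m0"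
          using m0 same_nv[OF sm3, of 1] same_rv[OF sm3, of 1] same_rv[OF sm3, of 41] by (auto simp: stored_def)
        then show ?thesis using m0 True by (intro exI[of _ m0]) (auto simp: less_Suc_eq)
      next
        case False
        then have st: "stored (cand_centers m) (cand_labels m) \<sigma>3" "rv \<sigma>3 41 0 = cand_cost m" using * by auto
        have "cand_cost m \<le> cand_cost m'" if "m' < m" for m'
        proof -
          have "m \<ge> 1" using that by simp
          then obtain m0 where "\<forall>m'<m. cand_cost m0 \<le> cand_cost m'" "rv \<sigma>2 41 0 = cand_cost m0" using m(3) by blast
          then show ?thesis using False that \<open>m \<ge> 1\<close> by force
        qed
        then show ?thesis using st by (intro exI[of _ m]) (auto simp: less_Suc_eq)
      qed
      with a b show "?J2 (Suc m) \<sigma>3 \<and> nv \<sigma>3 36 0 = m" by blast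
    qed (use m(1) in auto)
  next
    show "1 \<le> LN 36" "?Q \<le> VN 36" using LN(1)[of 36] VN(2)[of 36] by auto
  qed (use f1 J1 in \<open>auto simp: workN_def stored_def intro!: same_put_nat\<close>)
  have "ok memok (search tx wx) \<sigma> (1 + ((s * k * (1 + 4) + 3) + (?Q * (221 * H ^ 3 + 4) + 3) + 1) + 1) (?J2 ?Q)"
    unfolding search_def by (intro ok_Seq[OF 1] ok_Seq[OF 2] 3)
  then show ?thesis
  proof (rule ok_mono)
    have h: "1 \<le> H ^ 3" using H1 by simp
    have a: "H ^ 3 \<le> H ^ 3 * ?Q" "?Q \<le> H ^ 3 * ?Q" using Q1 h by simp_all
    have "s * k * (1 + 4) = 5 * (s * k)" by simp
    then have "(s * k * (1 + 4) + 3) \<le> 8 * H ^ 3" using H(8) pow_chain[OF H1] H1 by linarith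
    moreover have "?Q * (221 * H ^ 3 + 4) = 221 * (H ^ 3 * ?Q) + 4 * ?Q" by (simp only: distrib_left mult_ac)
    moreover have "250 * H ^ 3 * ?Q = 250 * (H ^ 3 * ?Q)" by (simp only: mult.assoc)
    ultimately show "1 + ((s * k * (1 + 4) + 3) + (?Q * (221 * H ^ 3 + 4) + 3) + 1) + 1 \<le> 250 * H ^ 3 * ?Q"
      using a h by linarith
    fix \<sigma>' assume "?J2 ?Q \<sigma>'"
    then show "\<exists>m. best m \<and> stored (cand_centers m) (cand_labels m) \<sigma>'"
      using Q1 by (auto simp: best_def simp del: One_nat_def)
  qed
qed

end

section \<open>Sign tables\<close>

text \<open>The sign of index \<open>i < b\<^sup>2\<close> is a product of two table entries, one for each base-\<open>b\<close> digit.
  Such signs have bounded fourth moments although only \<open>2 b\<close> random bits are stored.\<close>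

definition bit_sign :: "nat list \<Rightarrow> nat \<Rightarrow> real" where
  "bit_sign l q = 1 - 2 * real (l ! q)"

definition table_sign :: "nat \<Rightarrow> nat \<Rightarrow> nat list \<Rightarrow> nat \<Rightarrow> real" where
  "table_sign o' b l i = bit_sign l (o' + i div b) * bit_sign l (o' + b + i mod b)"

text \<open>A row of W is the outer product of two vectors of table signs, one for the row index and
  one for the column index of A. A sign thus combines four bits, which live in tables of size bn and
  bd.\<close>

definition entry_sign :: "nat \<Rightarrow> nat \<Rightarrow> nat \<Rightarrow> nat list \<Rightarrow> nat \<Rightarrow> real" where
  "entry_sign bn bd d l i = table_sign 0 bn l (i div d) * table_sign (2 * bn) bd l (i mod d)"

lemma set_coins: "l \<in> set_pmf (replicate_pmf m coin) \<Longrightarrow> length l = m \<and> (\<forall>x\<in>set l. x \<le> 1)"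
  by (auto simp: set_replicate_pmf coin_def)

lemma bit_sign_cases:
  assumes "l \<in> set_pmf (replicate_pmf m coin)" "q < m"
  shows "bit_sign l q = 1 \<or> bit_sign l q = -1"
proof -
  have "l ! q \<in> set l" using set_coins[OF assms(1)] assms(2) by simp
  then have "l ! q \<le> 1" using set_coins[OF assms(1)] by simp
  then have "l ! q = 0 \<or> l ! q = 1" by linarith
  then show ?thesis by (auto simp: bit_sign_def)
qed

lemma table_sign_cases:
  assumes "l \<in> set_pmf (replicate_pmf (2 * b) coin)" "i < b * b"
  shows "table_sign 0 b l i = 1 \<or> table_sign 0 b l i = -1"
proof -
  have b: "i div b < b" "i mod b < b" using assms(2) by (cases b; auto simp: less_mult_imp_div_less)+
  have "bit_sign l (i div b) = 1 \<or> bit_sign l (i div b) = -1"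
    using bit_sign_cases[OF assms(1), of "i div b"] b by simp
  moreover have "bit_sign l (b + i mod b) = 1 \<or> bit_sign l (b + i mod b) = -1"
    using bit_sign_cases[OF assms(1), of "b + i mod b"] b by simp
  ultimately show ?thesis unfolding table_sign_def add_0 by auto
qed

lemma good4_table:
  assumes "n \<le> b * b"
  shows "good4 (replicate_pmf (2 * b) coin) (table_sign 0 b) {..<n} 9"
proof -
  have "good4 (replicate_pmf (2 * b) coin) (table_sign 0 b) {..<n} (3 * 3)"
  proof (rule good4_tensor[OF good4_coins[of b] good4_coins[of b], where ?h1.0="\<lambda>i. i div b" and ?h2.0="\<lambda>i. i mod b" and c="(@)"])
    show "replicate_pmf (2 * b) coin = do {x \<leftarrow> replicate_pmf b coin; y \<leftarrow> replicate_pmf b coin; return_pmf (x @ y)}"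
      by (simp add: mult_2 replicate_pmf_distrib)
    have lt: "i div b < b \<and> i mod b < b" if "i \<in> {..<n}" for i
      using that assms by (cases b) (auto simp: less_mult_imp_div_less)
    then show "(\<lambda>i. i div b) ` {..<n} \<subseteq> {..<b}" "(\<lambda>i. i mod b) ` {..<n} \<subseteq> {..<b}" by auto
    show "inj_on (\<lambda>i. (i div b, i mod b)) {..<n}" by (rule inj_onI) (metis div_mult_mod_eq prod.inject)
    fix x y i assume "x \<in> set_pmf (replicate_pmf b coin)" "y \<in> set_pmf (replicate_pmf b coin)" "i \<in> {..<n}"
    then show "table_sign 0 b (x @ y) i = (1 - 2 * real (x ! (i div b))) * (1 - 2 * real (y ! (i mod b)))"
      using lt[of i] set_coins[of x b] by (simp add: table_sign_def bit_sign_def nth_append)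
  qed simp
  then show ?thesis by simp
qed

text \<open>Every tensor product multiplies the constants: 3 for independent signs, 9 for a table,
  and 81 for a pair of tables. The analysis uses 81 for all three sketches.\<close>

lemma good4_entry:
  assumes "n \<le> bn * bn" "d \<le> bd * bd"
  shows "good4 (replicate_pmf (2 * bn + 2 * bd) coin) (entry_sign bn bd d) {..<n * d} 81"
proof -
  have "good4 (replicate_pmf (2 * bn + 2 * bd) coin) (entry_sign bn bd d) {..<n * d} (9 * 9)"
  proof (rule good4_tensor[OF good4_table[OF assms(1)] good4_table[OF assms(2)],
        where ?h1.0="\<lambda>i. i div d" and ?h2.0="\<lambda>i. i mod d" and c="(@)"])
    show "replicate_pmf (2 * bn + 2 * bd) coin =
        do {x \<leftarrow> replicate_pmf (2 * bn) coin; y \<leftarrow> replicate_pmf (2 * bd) coin; return_pmf (x @ y)}"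
      by (rule replicate_pmf_distrib)
    have lt: "i div d < n \<and> i mod d < d" if "i \<in> {..<n * d}" for i
      using that by (cases d) (auto simp: less_mult_imp_div_less)
    then show "(\<lambda>i. i div d) ` {..<n * d} \<subseteq> {..<n}" "(\<lambda>i. i mod d) ` {..<n * d} \<subseteq> {..<d}" by auto
    show "inj_on (\<lambda>i. (i div d, i mod d)) {..<n * d}" by (rule inj_onI) (metis div_mult_mod_eq prod.inject)
    fix x y i assume x: "x \<in> set_pmf (replicate_pmf (2 * bn) coin)" and i: "i \<in> {..<n * d}"
    have "(i div d) div bn < bn \<and> (i div d) mod bn < bn"
      using lt[OF i] assms(1) by (cases bn) (auto simp: less_mult_imp_div_less)
    then show "entry_sign bn bd d (x @ y) i = table_sign 0 bn x (i div d) * table_sign 0 bd y (i mod d)"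
      using set_coins[OF x] by (simp add: entry_sign_def table_sign_def bit_sign_def nth_append)
  qed simp
  then show ?thesis by simp
qed

section \<open>Reading off the output\<close>

lemma fetch_flatten_list:
  assumes "i < dim_row A" "j < dim_col A"
  shows "fetch (flatten_list A) (i * dim_col A + j) = A $$ (i, j)"
proof -
  have "i * dim_col A + j < dim_row A * dim_col A"
    using assms mult_le_mono1[of "Suc i" "dim_row A" "dim_col A"] by simp
  then show ?thesis using assms by (simp add: fetch_def flatten_list_def)
qed

lemma flatten_index: "l < dim_row A * dim_col A \<Longrightarrow> flatten A $ l = A $$ (l div dim_col A, l mod dim_col A)"
  by (simp add: flatten_def vec_of_list_index flatten_list_def)

lemma dim_flatten: "dim_vec (flatten A) = dim_row A * dim_col A"
  by (simp add: flatten_def flatten_list_def)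

lemma stored_outputs_approx:
  assumes A: "A \<in> carrier_mat n d" and st: "\<And>i. i < n \<Longrightarrow> nv \<sigma> 1 i = lab i"
      "\<And>a j. a < k \<Longrightarrow> j < d \<Longrightarrow> rv \<sigma> 1 (a * d + j) = C a j"
    and lab: "\<And>i. i < n \<Longrightarrow> lab i < k"
    and cost: "kcost n d lab C (\<lambda>i j. A $$ (i, j)) \<le> (1 + \<epsilon>) * kmeans_opt k A"
  shows "(Halt, \<sigma>) \<in> outputs_approx \<epsilon> k A"
proof -
  let ?X = "out_assignment n k \<sigma>" and ?C = "out_centers k d \<sigma>"
  have X: "?X \<in> carrier_mat n k" and C: "?C \<in> carrier_mat k d"
    by (simp_all add: out_assignment_def out_centers_def)
  have row: "row ?X i = unit_vec k (lab i)" if "i < n" for i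
    using that st(1)[OF that] lab[OF that]
    by (intro eq_vecI) (auto simp: out_assignment_def nv_def unit_vec_def)
  have "frob_sq (?X * ?C - A) = kcost n d lab (\<lambda>a j. ?C $$ (a, j)) (\<lambda>i j. A $$ (i, j))"
    by (rule frob_sq_assignment[OF A X C]) (simp add: row lab)
  also have "\<dots> = kcost n d lab C (\<lambda>i j. A $$ (i, j))"
    using st(2) lab by (intro kcost_cong) (auto simp: out_centers_def rv_def)
  finally have "frob_sq (?X * ?C - A) \<le> (1 + \<epsilon>) * kmeans_opt k A" using cost by simp
  moreover have "?X \<in> assignment_mats n k" using X row lab by (auto simp: assignment_mats_def)
  ultimately show ?thesis using A C by (auto simp: outputs_approx_def approx_kmeans_def)
qed

lemma kmeans_opt_nonneg:
  assumes "A \<in> carrier_mat n d" "k \<ge> 1"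
  shows "0 \<le> kmeans_opt k A"
  using kmeans_opt_attained[OF assms] kcost_nonneg by (meson order_trans)

section \<open>Recovery from the sketches\<close>

definition tx_matrix :: "nexp \<Rightarrow> nexp \<Rightarrow> rexp" where "tx_matrix e f = idx 2 e Tn f"
definition wx_matrix :: "nexp \<Rightarrow> nexp \<Rightarrow> rexp" where "wx_matrix e f = idx 4 e (NMul Nn Dn) f"

text \<open>For \<open>n = 1\<close> the bounds force \<open>w = 0\<close>, but then \<open>S\<close> may be the identity.\<close>

definition recover :: com where
  "recover = Cond (NLess Nn (NLit 2)) (FillMap 1 30 Dn (NLit 0) (RGet 5 (NVar 30))) (search tx_matrix wx_matrix)"

lemma ok_recover:
  assumes A: "A \<in> carrier_mat n d" and T: "T \<in> carrier_mat d t" and S: "S \<in> carrier_mat s n" and W: "W \<in> carrier_mat w (n * d)"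
    and pos: "n \<ge> 2" "d \<ge> 1" "k \<ge> 1"
    and Tf: "\<And>j y. j < d \<Longrightarrow> y < t \<Longrightarrow> T $$ (j, y) = Tf j y" and Sf: "\<And>y i. y < s \<Longrightarrow> i < n \<Longrightarrow> S $$ (y, i) = Sf y i"
    and Wf: "\<And>r l. r < w \<Longrightarrow> l < n * d \<Longrightarrow> W $$ (r, l) = Wf r l"
  defines "SA \<equiv> \<lambda>y j. \<Sum>i<n. Sf y i * A $$ (i, j)" and "AT \<equiv> \<lambda>i y. \<Sum>j<d. A $$ (i, j) * Tf j y"
    and "Wa \<equiv> \<lambda>r. \<Sum>l<n * d. Wf r l * A $$ (l div d, l mod d)"
    and "H \<equiv> n + d + k + t + s + w + n * d + s * k + k * d + k * t"
  shows "ok (\<lambda>_. True) recover (sketch_input n d k \<epsilon> T S W (S * A) (A * T) (W *\<^sub>v flatten A))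
     (Suc (250 * H ^ 3 * (2 * n + 1) ^ (s * k)))
     (\<lambda>\<sigma>'. \<exists>m. sketch_search.best n d k s t w Tf Wf SA AT Wa m \<and>
        (\<forall>i<n. nv \<sigma>' 1 i = sketch_search.cand_labels n d k s t Tf SA AT m i) \<and>
        (\<forall>a<k. \<forall>j<d. rv \<sigma>' 1 (a * d + j) = sketch_search.cand_centers n k s SA m a j))"
proof -
  note n2 = pos(1)
  define \<sigma>0 where "\<sigma>0 = sketch_input n d k \<epsilon> T S W (S * A) (A * T) (W *\<^sub>v flatten A)"
  \<comment> \<open>The first half bounds no memory, so one crude capacity serves for all arrays and
    values. It is dropped again in the conclusion.\<close>
  define big where "big = 6 + (H + (2 * n + 1) ^ (s * k) + d * t + s * n + w * (n * d) + s * d + n * t)"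
  let ?L = "\<lambda>_::nat. big"
  have dims: "dim_row A = n" "dim_col A = d" "dim_row T = d" "dim_col T = t" "dim_row S = s" "dim_col S = n"
    "dim_row W = w" "dim_col W = n * d" using A T S W by auto
  have nv0: "nv \<sigma>0 0 0 = n" "nv \<sigma>0 0 (Suc 0) = d" "nv \<sigma>0 0 2 = k" "nv \<sigma>0 0 3 = t" "nv \<sigma>0 0 4 = s" "nv \<sigma>0 0 5 = w"
    by (simp_all add: \<sigma>0_def sketch_input_def nv_def fetch_def dims)
  have r2: "rv \<sigma>0 2 (j * t + y) = Tf j y" if "j < d" "y < t" for j y
    using fetch_flatten_list[of j T y] that by (simp add: \<sigma>0_def sketch_input_def rv_def dims Tf)
  have r4: "rv \<sigma>0 4 (r * (n * d) + l) = Wf r l" if "r < w" "l < n * d" for r l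
    using fetch_flatten_list[of r W l] that by (simp add: \<sigma>0_def sketch_input_def rv_def dims Wf)
  have r5: "rv \<sigma>0 5 (y * d + j) = SA y j" if "y < s" "j < d" for y j
    using fetch_flatten_list[of y "S * A" j] that
    by (simp add: \<sigma>0_def sketch_input_def rv_def dims SA_def Sf scalar_prod_def lessThan_atLeast0)
  have r6: "rv \<sigma>0 6 (i * t + y) = AT i y" if "i < n" "y < t" for i y
    using fetch_flatten_list[of i "A * T" y] that
    by (simp add: \<sigma>0_def sketch_input_def rv_def dims AT_def Tf scalar_prod_def lessThan_atLeast0)
  have r7: "rv \<sigma>0 7 r = Wa r" if "r < w" for r
  proof -
    have "fetch (list_of_vec (W *\<^sub>v flatten A)) r = (W *\<^sub>v flatten A) $ r"
      using that by (simp add: fetch_def list_of_vec_index dims)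
    also have "\<dots> = Wa r"
      using that by (simp add: Wa_def scalar_prod_def lessThan_atLeast0 dims Wf flatten_index dim_flatten)
    finally show ?thesis by (simp add: \<sigma>0_def sketch_input_def rv_def)
  qed
  have fit: "fits ?L ?L ?L \<sigma>0"
    unfolding fits_def \<sigma>0_def sketch_input_def
    using pos by (auto simp: dims flatten_list_def big_def H_def)
  interpret ram_search n d k s t w Tf Wf SA AT Wa tx_matrix wx_matrix "same workN workR \<sigma>0" H ?L ?L ?L
  proof
    fix \<sigma> assume sm: "same workN workR \<sigma>0 \<sigma>"
    have nvs: "nv \<sigma> 0 i = nv \<sigma>0 0 i" for i using same_nv[OF sm, of 0] by (simp add: workN_def)
    have rvs: "rv \<sigma> a i = rv \<sigma>0 a i" if "a \<in> {2, 4, 5, 6, 7}" for a i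
      using same_rv[OF sm, of a] that by (auto simp: workR_def)
    show "nv \<sigma> 0 0 = n" "nv \<sigma> 0 (Suc 0) = d" "nv \<sigma> 0 2 = k" "nv \<sigma> 0 3 = t" "nv \<sigma> 0 4 = s" "nv \<sigma> 0 5 = w"
      unfolding nvs using nv0 by auto
    show "y < s \<Longrightarrow> j < d \<Longrightarrow> rv \<sigma> 5 (y * d + j) = SA y j" for y j using r5 by (simp add: rvs)
    show "i < n \<Longrightarrow> y < t \<Longrightarrow> rv \<sigma> 6 (i * t + y) = AT i y" for i y using r6 by (simp add: rvs)
    show "r < w \<Longrightarrow> rv \<sigma> 7 r = Wa r" for r using r7 by (simp add: rvs)
    show "nval e \<sigma> < d \<Longrightarrow> nval f \<sigma> < t \<Longrightarrow> rval (tx_matrix e f) \<sigma> = Tf (nval e \<sigma>) (nval f \<sigma>)" for e f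
      using r2 by (simp add: tx_matrix_def rvs nvs nv0)
    show "nval e \<sigma> < w \<Longrightarrow> nval f \<sigma> < n * d \<Longrightarrow> rval (wx_matrix e f) \<sigma> = Wf (nval e \<sigma>) (nval f \<sigma>)" for e f
      using r4 by (simp add: wx_matrix_def rvs nvs nv0)
    show "same workN workR \<sigma>0 \<sigma>'" if "same workN workR \<sigma> \<sigma>'" for \<sigma>' by (rule same_trans[OF sm that]) auto
  qed (use pos in \<open>auto simp: H_def big_def mult.commute\<close>)
  have "ok memok (search tx_matrix wx_matrix) \<sigma>0 (250 * H ^ 3 * (2 * n + 1) ^ (s * k))
     (\<lambda>\<sigma>'. \<exists>m. best m \<and> stored (cand_centers m) (cand_labels m) \<sigma>')"
    by (rule ok_search[OF fit same_refl])
  then have "ok memok recover \<sigma>0 (Suc (250 * H ^ 3 * (2 * n + 1) ^ (s * k)))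
     (\<lambda>\<sigma>'. \<exists>m. best m \<and> stored (cand_centers m) (cand_labels m) \<sigma>')"
    unfolding recover_def using n2 fit by (intro ok_Cond) (auto simp: nv0)
  then show ?thesis
    unfolding ok_def runs_def \<sigma>0_def[symmetric] stored_def by blast
qed

text \<open>Here S A = A, and its only row is copied as the first center. The label array is never
  written and reads as 0, the index of this center.\<close>

lemma ok_recover_single:
  assumes A: "A \<in> carrier_mat 1 d" and T: "dim_col T = 0" and S: "S = 1\<^sub>m 1" and W: "dim_row W = 0"
  shows "ok (\<lambda>_. True) recover (sketch_input 1 d k \<epsilon> T S W (S * A) (A * T) (W *\<^sub>v flatten A)) (Suc (d * 5 + 3))
     (\<lambda>\<sigma>'. nv \<sigma>' 1 0 = 0 \<and> (\<forall>j<d. rv \<sigma>' 1 j = A $$ (0, j)))"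
proof -
  define \<sigma>0 where "\<sigma>0 = sketch_input 1 d k \<epsilon> T S W (S * A) (A * T) (W *\<^sub>v flatten A)"
  let ?L = "\<lambda>_::nat. 6 + d + k"
  have SA: "S * A = A" using A S by simp
  have nv0: "nv \<sigma>0 0 0 = 1" "nv \<sigma>0 0 (Suc 0) = d" "nv \<sigma>0 1 0 = 0"
    by (simp_all add: \<sigma>0_def sketch_input_def nv_def fetch_def)
  have r5: "rv \<sigma>0 5 j = A $$ (0, j)" if "j < d" for j
    using fetch_flatten_list[of 0 A j] that A by (simp add: \<sigma>0_def sketch_input_def rv_def SA)
  have fit: "fits (\<lambda>_. 6 + d + k) (\<lambda>_. 6 + d + k) (\<lambda>_. 6 + d + k) \<sigma>0"
    unfolding fits_def \<sigma>0_def sketch_input_def using A T S W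
    by (auto simp: flatten_list_def SA)
  have "ok (fits ?L ?L ?L) recover \<sigma>0 (Suc (d * 5 + 3)) (\<lambda>\<sigma>'. nv \<sigma>' 1 0 = 0 \<and> (\<forall>j<d. rv \<sigma>' 1 j = A $$ (0, j)))"
    unfolding recover_def
  proof (rule ok_Cond)
    show "ok (fits ?L ?L ?L) (FillMap 1 30 Dn (NLit 0) (RGet 5 (NVar 30))) \<sigma>0 (d * 5 + 3)
       (\<lambda>\<sigma>'. nv \<sigma>' 1 0 = 0 \<and> (\<forall>j<d. rv \<sigma>' 1 j = A $$ (0, j)))"
    proof (rule ok_mono[OF ok_FillMap[where B=d and o'=0 and v="\<lambda>j. A $$ (0, j)"]])
      fix \<sigma>' assume sm: "same {30} {1} \<sigma>0 \<sigma>'"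
      show "nval Dn \<sigma>' = d" using same_nv[OF sm, of 0] nv0 by simp
      show "rval (RGet 5 (NVar 30)) \<sigma>' = A $$ (0, j)" if "nv \<sigma>' 30 0 = j" "j < d" for j
        using same_rv[OF sm, of 5] r5 that by simp
    next
      fix \<sigma>' assume *: "same {30} {1} \<sigma>0 \<sigma>' \<and> (\<forall>j. rv \<sigma>' 1 j = (if 0 \<le> j \<and> j < 0 + d then A $$ (0, j - 0) else rv \<sigma>0 1 j))"
      then show "nv \<sigma>' 1 0 = 0 \<and> (\<forall>j<d. rv \<sigma>' 1 j = A $$ (0, j))"
        using same_nv[OF conjunct1[OF *], of 1] nv0 by simp
    qed (use fit in auto)
  qed (use fit nv0 in auto)
  then show ?thesis unfolding ok_def runs_def \<sigma>0_def[symmetric] by blast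
qed

text \<open>Once the sketches are drawn the run is deterministic, so the success probability is that
  of a set of sketches.\<close>

lemma prob_deterministic_steps:
  assumes det: "\<And>x. x \<in> set_pmf D \<Longrightarrow> ok P c (\<sigma> x) N (Q x)"
    and out: "\<And>x s'. x \<in> set_pmf D \<Longrightarrow> x \<in> G \<Longrightarrow> Q x s' \<Longrightarrow> (Halt, s') \<in> O'"
    and G: "measure_pmf.prob D G \<ge> q"
  shows "measure_pmf.prob (bind_pmf D (\<lambda>x. steps N (c, \<sigma> x))) O' \<ge> q"
proof -
  have "\<forall>x. \<exists>s'. x \<in> set_pmf D \<longrightarrow> steps N (c, \<sigma> x) = return_pmf (Halt, s') \<and> Q x s'"
    using det by (auto simp: ok_def runs_def)
  then obtain F where F: "\<And>x. x \<in> set_pmf D \<Longrightarrow> steps N (c, \<sigma> x) = return_pmf (Halt, F x) \<and> Q x (F x)" by metis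
  have "bind_pmf D (\<lambda>x. steps N (c, \<sigma> x)) = map_pmf (\<lambda>x. (Halt, F x)) D"
    unfolding map_pmf_def using F by (intro bind_pmf_cong) auto
  then have "measure_pmf.prob (bind_pmf D (\<lambda>x. steps N (c, \<sigma> x))) O' = measure_pmf.prob D ((\<lambda>x. (Halt, F x)) -` O')"
    by simp
  also have "\<dots> \<ge> measure_pmf.prob D G" using F out by (intro prob_le_on_support) auto
  finally show ?thesis using G by linarith
qed

lemma nat_ceiling_bounds: "0 \<le> x \<Longrightarrow> x \<le> real (nat \<lceil>x\<rceil>) \<and> real (nat \<lceil>x\<rceil>) \<le> x + 1"
  by linarith

lemma ln_twice_succ_le:
  assumes "n \<ge> 2"
  shows "ln (2 * real n + 1) \<le> 3 * ln (real n)"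
proof -
  have "2 * real n + 1 \<le> real n * (real n * real n)"
  proof -
    have "2 * 2 \<le> real n * real n" using assms by (intro mult_mono) auto
    then have "real n * 4 \<le> real n * (real n * real n)" by (intro mult_left_mono) auto
    then show ?thesis using assms by linarith
  qed
  then have "ln (2 * real n + 1) \<le> ln (real n ^ 3)" using assms by (simp add: power3_eq_cube)
  also have "\<dots> = 3 * ln (real n)" using assms by (simp add: ln_realpow)
  finally show ?thesis .
qed

text \<open>For n \<ge> 2 both logarithms are at least 2/3, and this absorbs the additive constants
  and the rounding up. The largest constant belongs to w: 16200 * 320001 * 3 is below 2 *
  10^10.\<close>

lemma sketch_sizes:
  assumes n: "n \<ge> 2" and k: "k \<ge> 1" and \<epsilon>: "0 < \<epsilon>" "\<epsilon> < 1"
  obtains s t w :: nat where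
    "real s * \<epsilon> \<ge> 320000 * real k" "real s \<le> 320001 * (real k / \<epsilon>)"
    "real t * \<epsilon>\<^sup>2 \<ge> 16200 * (ln (real n * real k) + 12)" "real t \<le> 500000 * (ln (real n * real k) / \<epsilon>\<^sup>2)"
    "real w * \<epsilon>\<^sup>2 \<ge> 16200 * (real (s * k) * ln (2 * real n + 1) + 12)"
    "real w \<le> 2 * 10 ^ 10 * ((real k)\<^sup>2 / \<epsilon> ^ 3 * ln (real n))"
proof -
  define L where "L = ln (real n * real k)"
  define \<kappa> where "\<kappa> = (real k)\<^sup>2 / \<epsilon>"
  have \<epsilon>2: "0 < \<epsilon>\<^sup>2" "\<epsilon>\<^sup>2 \<le> 1" using \<epsilon> by (auto simp: power_le_one)
  have ln2: "2 / 3 \<le> ln (real n)" using ln2_ge_two_thirds ln_mono[of 2 "real n"] n by linarith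
  have "real n * 1 \<le> real n * real k" using k by (intro mult_left_mono) auto
  then have "ln (real n) \<le> L" unfolding L_def using n by (intro ln_mono) auto
  then have L: "2 / 3 \<le> L" using ln2 by linarith
  have \<kappa>: "1 \<le> \<kappa>"
  proof -
    have "\<epsilon> * 1 \<le> 1 * (real k)\<^sup>2" using \<epsilon> k by (intro mult_mono) auto
    then show ?thesis using \<epsilon> by (simp add: \<kappa>_def field_simps)
  qed
  define s where "s = nat \<lceil>320000 * real k / \<epsilon>\<rceil>"
  define t where "t = nat \<lceil>16200 * (L + 12) / \<epsilon>\<^sup>2\<rceil>"
  define w where "w = nat \<lceil>16200 * (real (s * k) * ln (2 * real n + 1) + 12) / \<epsilon>\<^sup>2\<rceil>"
  have s: "320000 * real k / \<epsilon> \<le> real s" "real s \<le> 320000 * real k / \<epsilon> + 1"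
    using nat_ceiling_bounds[of "320000 * real k / \<epsilon>"] \<epsilon> by (auto simp: s_def)
  have t: "16200 * (L + 12) / \<epsilon>\<^sup>2 \<le> real t" "real t \<le> 16200 * (L + 12) / \<epsilon>\<^sup>2 + 1"
    using nat_ceiling_bounds[of "16200 * (L + 12) / \<epsilon>\<^sup>2"] \<epsilon>2 L by (auto simp: t_def)
  have wn: "0 \<le> 16200 * (real (s * k) * ln (2 * real n + 1) + 12) / \<epsilon>\<^sup>2" by simp
  have w: "16200 * (real (s * k) * ln (2 * real n + 1) + 12) / \<epsilon>\<^sup>2 \<le> real w"
      "real w \<le> 16200 * (real (s * k) * ln (2 * real n + 1) + 12) / \<epsilon>\<^sup>2 + 1"
    using nat_ceiling_bounds[OF wn] by (auto simp: w_def)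
  have s': "real s \<le> 320001 * (real k / \<epsilon>)"
  proof -
    have "1 \<le> real k / \<epsilon>" using \<epsilon> k by (simp add: field_simps)
    with s(2) show ?thesis by simp
  qed
  show ?thesis
  proof
    show "real s * \<epsilon> \<ge> 320000 * real k" using s(1) \<epsilon> by (simp add: field_simps)
    show "real s \<le> 320001 * (real k / \<epsilon>)" by (rule s')
    show "real t * \<epsilon>\<^sup>2 \<ge> 16200 * (ln (real n * real k) + 12)" using t(1) \<epsilon>2 by (simp add: L_def field_simps)
    show "real t \<le> 500000 * (ln (real n * real k) / \<epsilon>\<^sup>2)"
    proof -
      have "1 \<le> 1 / \<epsilon>\<^sup>2" using \<epsilon>2 by simp
      moreover have "16200 * (L + 12) / \<epsilon>\<^sup>2 + 1 / \<epsilon>\<^sup>2 = (16200 * L + 194401) / \<epsilon>\<^sup>2"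
        by (simp add: add_divide_distrib[symmetric])
      moreover have "(16200 * L + 194401) / \<epsilon>\<^sup>2 \<le> 500000 * L / \<epsilon>\<^sup>2"
        using L \<epsilon>2 by (intro divide_right_mono) auto
      ultimately show ?thesis using t(2) by (simp add: L_def)
    qed
    show "real w * \<epsilon>\<^sup>2 \<ge> 16200 * (real (s * k) * ln (2 * real n + 1) + 12)" using w(1) \<epsilon>2 by (simp add: pos_divide_le_eq)
    show "real w \<le> 2 * 10 ^ 10 * ((real k)\<^sup>2 / \<epsilon> ^ 3 * ln (real n))"
    proof -
      have "real (s * k) \<le> 320001 * \<kappa>"
        using mult_right_mono[OF s', of "real k"] by (simp add: \<kappa>_def power2_eq_square)
      then have "real (s * k) * ln (2 * real n + 1) \<le> 320001 * \<kappa> * (3 * ln (real n))"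
        using ln_twice_succ_le[OF n] \<kappa> by (intro mult_mono) auto
      moreover have "2 / 3 \<le> \<kappa> * ln (real n)" using mult_mono[OF \<kappa> ln2] ln2 \<kappa> by simp
      ultimately have "16200 * (real (s * k) * ln (2 * real n + 1) + 12) + 1 \<le> 2 * 10 ^ 10 * (\<kappa> * ln (real n))"
        by simp
      then have "(16200 * (real (s * k) * ln (2 * real n + 1) + 12) + 1) / \<epsilon>\<^sup>2 \<le> 2 * 10 ^ 10 * (\<kappa> * ln (real n)) / \<epsilon>\<^sup>2"
        using \<epsilon>2 by (intro divide_right_mono) auto
      moreover have "1 \<le> 1 / \<epsilon>\<^sup>2" using \<epsilon>2 by simp
      ultimately have "real w \<le> 2 * 10 ^ 10 * (\<kappa> * ln (real n)) / \<epsilon>\<^sup>2" using w(2) by (simp add: add_divide_distrib)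
      also have "\<dots> = 2 * 10 ^ 10 * ((real k)\<^sup>2 / \<epsilon> ^ 3 * ln (real n))"
        by (simp add: \<kappa>_def power3_eq_cube power2_eq_square)
      finally show ?thesis .
    qed
  qed
qed

lemma sketching_part:
  "\<exists>(c::real) (recover::com). c > 0 \<and>
       (\<forall>(n::nat) (d::nat) (k::nat) (\<epsilon>::real).
          n \<ge> 1 \<and> d \<ge> 1 \<and> k \<ge> 1 \<and> 0 < \<epsilon> \<and> \<epsilon> < 1 \<longrightarrow>
          (\<exists>(t::nat) (s::nat) (w::nat)
             (DT::real mat pmf) (DS::real mat pmf) (DW::real mat pmf).
             set_pmf DT \<subseteq> carrier_mat d t \<and>
             set_pmf DS \<subseteq> carrier_mat s n \<and>
             set_pmf DW \<subseteq> carrier_mat w (n * d) \<and>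
             real t \<le> c * (ln (real n * real k) / \<epsilon>\<^sup>2) \<and>
             real s \<le> c * (real k / \<epsilon>) \<and>
             real w \<le> c * ((real k)\<^sup>2 / \<epsilon> ^ 3 * ln (real n)) \<and>
             (\<forall>A \<in> carrier_mat n d. \<exists>N.
                measure_pmf.prob
                  (bind_pmf (pair_pmf DT (pair_pmf DS DW))
                     (\<lambda>(T, S, W). steps N
                        (recover, sketch_input n d k \<epsilon> T S W (S * A) (A * T) (W *\<^sub>v flatten A))))
                  (outputs_approx \<epsilon> k A) \<ge> 2 / 3)))"
proof (intro exI[of _ "2 * 10 ^ 10 :: real"] exI[of _ recover] conjI allI impI)
  fix n d k :: nat and \<epsilon> :: real
  assume asm: "n \<ge> 1 \<and> d \<ge> 1 \<and> k \<ge> 1 \<and> 0 < \<epsilon> \<and> \<epsilon> < 1"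
  then have pos: "n \<ge> 1" "d \<ge> 1" "k \<ge> 1" and \<epsilon>: "0 < \<epsilon>" "\<epsilon> < 1" by auto
  let ?c = "2 * 10 ^ 10 :: real"
  let ?goal = "\<lambda>t s w DT DS DW. set_pmf DT \<subseteq> carrier_mat d t \<and> set_pmf DS \<subseteq> carrier_mat s n \<and>
     set_pmf DW \<subseteq> carrier_mat w (n * d) \<and> real t \<le> ?c * (ln (real n * real k) / \<epsilon>\<^sup>2) \<and>
     real s \<le> ?c * (real k / \<epsilon>) \<and> real w \<le> ?c * ((real k)\<^sup>2 / \<epsilon> ^ 3 * ln (real n)) \<and>
     (\<forall>A \<in> carrier_mat n d. \<exists>N. measure_pmf.prob (bind_pmf (pair_pmf DT (pair_pmf DS DW))
          (\<lambda>(T, S, W). steps N (recover, sketch_input n d k \<epsilon> T S W (S * A) (A * T) (W *\<^sub>v flatten A))))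
             (outputs_approx \<epsilon> k A) \<ge> 2 / 3)"
  show "\<exists>t s w DT DS DW. ?goal t s w DT DS DW"
  proof (cases "n = 1")
    case True
    let ?T = "0\<^sub>m d 0 :: real mat" and ?S = "1\<^sub>m 1 :: real mat" and ?W = "0\<^sub>m 0 (n * d) :: real mat"
    have "?goal 0 1 0 (return_pmf ?T) (return_pmf ?S) (return_pmf ?W)"
    proof (intro conjI ballI)
      have "1 \<le> real k / \<epsilon>" using \<epsilon> pos by (simp add: field_simps)
      then show "real 1 \<le> ?c * (real k / \<epsilon>)" by simp
      show "real 0 \<le> ?c * (ln (real n * real k) / \<epsilon>\<^sup>2)" using pos True by simp
      show "real 0 \<le> ?c * ((real k)\<^sup>2 / \<epsilon> ^ 3 * ln (real n))" using True by simp
      fix A :: "real mat" assume A: "A \<in> carrier_mat n d"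
      then have A1: "A \<in> carrier_mat 1 d" using True by simp
      let ?\<sigma> = "sketch_input n d k \<epsilon> ?T ?S ?W (?S * A) (A * ?T) (?W *\<^sub>v flatten A)"
      have "ok (\<lambda>_. True) recover ?\<sigma> (Suc (d * 5 + 3)) (\<lambda>\<sigma>'. nv \<sigma>' 1 0 = 0 \<and> (\<forall>j<d. rv \<sigma>' 1 j = A $$ (0, j)))"
        unfolding True by (rule ok_recover_single[OF A1 _ refl]) auto
      then obtain \<sigma>' where st: "steps (Suc (d * 5 + 3)) (recover, ?\<sigma>) = return_pmf (Halt, \<sigma>')"
        and out: "nv \<sigma>' 1 0 = 0" "\<And>j. j < d \<Longrightarrow> rv \<sigma>' 1 j = A $$ (0, j)"
        unfolding ok_def runs_def map_return_pmf by blast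
      have "(Halt, \<sigma>') \<in> outputs_approx \<epsilon> k A"
      proof (rule stored_outputs_approx[OF A])
        show "nv \<sigma>' 1 i = (\<lambda>i. nv \<sigma>' 1 i) i" "rv \<sigma>' 1 (a * d + j) = (\<lambda>a j. rv \<sigma>' 1 (a * d + j)) a j" for i a j by simp_all
        show "nv \<sigma>' 1 i < k" if "i < n" for i using that True out pos by simp
        show "kcost n d (\<lambda>i. nv \<sigma>' 1 i) (\<lambda>a j. rv \<sigma>' 1 (a * d + j)) (\<lambda>i j. A $$ (i, j)) \<le> (1 + \<epsilon>) * kmeans_opt k A"
          using kmeans_opt_nonneg[OF A pos(3)] \<epsilon> by (simp add: kcost_def True out[unfolded One_nat_def])
      qed
      then have "measure_pmf.prob (bind_pmf (pair_pmf (return_pmf ?T) (pair_pmf (return_pmf ?S) (return_pmf ?W)))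
          (\<lambda>(T, S, W). steps (Suc (d * 5 + 3)) (recover, sketch_input n d k \<epsilon> T S W (S * A) (A * T) (W *\<^sub>v flatten A))))
             (outputs_approx \<epsilon> k A) = 1"
        by (simp only: pair_return_pmf1 map_return_pmf bind_return_pmf prod.case st) simp
      then show "\<exists>N. measure_pmf.prob (bind_pmf (pair_pmf (return_pmf ?T) (pair_pmf (return_pmf ?S) (return_pmf ?W)))
          (\<lambda>(T, S, W). steps N (recover, sketch_input n d k \<epsilon> T S W (S * A) (A * T) (W *\<^sub>v flatten A))))
             (outputs_approx \<epsilon> k A) \<ge> 2 / 3"
        by (intro exI[of _ "Suc (d * 5 + 3)"]) simp
    qed (use True in auto)
    then show ?thesis by blast
  next
    case False
    with pos have n2: "n \<ge> 2" by simp
    obtain s t w :: nat where s: "real s * \<epsilon> \<ge> 320000 * real k" "real s \<le> 320001 * (real k / \<epsilon>)"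
      and t: "real t * \<epsilon>\<^sup>2 \<ge> 16200 * (ln (real n * real k) + 12)" "real t \<le> 500000 * (ln (real n * real k) / \<epsilon>\<^sup>2)"
      and w: "real w * \<epsilon>\<^sup>2 \<ge> 16200 * (real (s * k) * ln (2 * real n + 1) + 12)"
        "real w \<le> 2 * 10 ^ 10 * ((real k)\<^sup>2 / \<epsilon> ^ 3 * ln (real n))"
      using sketch_sizes[OF n2 pos(3) \<epsilon>] by metis
    \<comment> \<open>The sketching matrices are given here at no cost, so the table bases may be as
      large as d and n themselves.\<close>
    define PT where "PT = replicate_pmf t (replicate_pmf (2 * d) coin)"
    define PS where "PS = replicate_pmf s (replicate_pmf (2 * n) coin)"
    define PW where "PW = replicate_pmf w (replicate_pmf (2 * n + 2 * d) coin)"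
    define MT where "MT ts = mat d t (\<lambda>(j, y). table_sign 0 d (ts ! y) j)" for ts
    define MS where "MS ss = mat s n (\<lambda>(y, i). table_sign 0 n (ss ! y) i)" for ss
    define MW where "MW ws = mat w (n * d) (\<lambda>(r, l). entry_sign n d d (ws ! r) l)" for ws
    have "?goal t s w (map_pmf MT PT) (map_pmf MS PS) (map_pmf MW PW)"
    proof (intro conjI ballI)
      have "0 \<le> ln (real n * real k) / \<epsilon>\<^sup>2"
        using mult_mono[of 1 "real n" 1 "real k"] pos by (intro divide_nonneg_nonneg ln_ge_zero) auto
      then show "real t \<le> ?c * (ln (real n * real k) / \<epsilon>\<^sup>2)" by (intro order_trans[OF t(2)] mult_right_mono) simp_all
      have "0 \<le> real k / \<epsilon>" using \<epsilon> by simp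
      then show "real s \<le> ?c * (real k / \<epsilon>)" by (intro order_trans[OF s(2)] mult_right_mono) simp_all
      show "real w \<le> ?c * ((real k)\<^sup>2 / \<epsilon> ^ 3 * ln (real n))" by (rule w(2))
      fix A :: "real mat" assume A: "A \<in> carrier_mat n d"
      let ?A = "\<lambda>i j. A $$ (i, j)"
      obtain f where f: "\<And>i. i < n \<Longrightarrow> f i < k" and opt: "kcost n d f (centroid n f ?A) ?A \<le> kmeans_opt k A"
        using kmeans_opt_attained[OF A pos(3)] by blast
      have gT: "good4 (replicate_pmf (2 * d) coin) (table_sign 0 d) {..<d} 81"
        by (rule good4_mono[OF good4_table]) auto
      have gS: "good4 (replicate_pmf (2 * n) coin) (table_sign 0 n) {..<n} 81"
        by (rule good4_mono[OF good4_table]) auto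
      have gW: "good4 (replicate_pmf (2 * n + 2 * d) coin) (entry_sign n d d) {..<n * d} 81"
        by (rule good4_entry) auto
      have sgn: "table_sign 0 n l i = 1 \<or> table_sign 0 n l i = - 1" if "l \<in> set_pmf (replicate_pmf (2 * n) coin)" "i < n" for l i
      proof (rule table_sign_cases[OF that(1)])
        have "n \<le> n * n" by simp
        then show "i < n * n" using that(2) by linarith
      qed
      define SA where "SA ss = (\<lambda>y j. \<Sum>i<n. table_sign 0 n (ss ! y) i * ?A i j)" for ss
      define AT where "AT ts = (\<lambda>i y. \<Sum>j<d. ?A i j * table_sign 0 d (ts ! y) j)" for ts
      define Wa where "Wa ws = (\<lambda>r. \<Sum>l<n * d. entry_sign n d d (ws ! r) l * ?A (l div d) (l mod d))" for ws
      let ?best = "\<lambda>ts ss ws. sketch_search.best n d k s t w (\<lambda>j y. table_sign 0 d (ts ! y) j)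
          (\<lambda>r l. entry_sign n d d (ws ! r) l) (SA ss) (AT ts) (Wa ws)"
      let ?lab = "\<lambda>ts ss. sketch_search.cand_labels n d k s t (\<lambda>j y. table_sign 0 d (ts ! y) j) (SA ss) (AT ts)"
      let ?cen = "\<lambda>ss. sketch_search.cand_centers n k s (SA ss)"
      define G where "G = {(ts, ss, ws). \<forall>m. ?best ts ss ws m \<longrightarrow> kcost n d (?lab ts ss m) (?cen ss m) ?A \<le> (1 + \<epsilon>) * kmeans_opt k A}"
      have G: "measure_pmf.prob (pair_pmf PT (pair_pmf PS PW)) G \<ge> 2 / 3"
        unfolding G_def PT_def PS_def PW_def SA_def AT_def Wa_def
        using search_prob[OF gS gT gW sgn f opt pos(1,3) \<epsilon> s(1) t(1) w(1)] by simp
      let ?H = "n + d + k + t + s + w + n * d + s * k + k * d + k * t"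
      let ?N = "Suc (250 * ?H ^ 3 * (2 * n + 1) ^ (s * k))"
      define \<sigma> where "\<sigma> = (\<lambda>(ts, ss, ws). sketch_input n d k \<epsilon> (MT ts) (MS ss) (MW ws) (MS ss * A) (A * MT ts) (MW ws *\<^sub>v flatten A))"
      define Q where "Q = (\<lambda>(ts, ss, ws) \<sigma>'. \<exists>m. ?best ts ss ws m \<and>
        (\<forall>i<n. nv \<sigma>' 1 i = ?lab ts ss m i) \<and> (\<forall>a<k. \<forall>j<d. rv \<sigma>' 1 (a * d + j) = ?cen ss m a j))"
      have "measure_pmf.prob (bind_pmf (pair_pmf PT (pair_pmf PS PW)) (\<lambda>x. steps ?N (recover, \<sigma> x))) (outputs_approx \<epsilon> k A) \<ge> 2 / 3"
      proof (rule prob_deterministic_steps[where P="\<lambda>_. True" and Q=Q, OF _ _ G])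
        fix x assume "x \<in> set_pmf (pair_pmf PT (pair_pmf PS PW))"
        obtain ts ss ws where x: "x = (ts, ss, ws)" by (cases x) auto
        show "ok (\<lambda>_. True) recover (\<sigma> x) ?N (Q x)"
          unfolding x \<sigma>_def Q_def prod.case SA_def AT_def Wa_def
          by (rule ok_recover[OF A _ _ _ n2 pos(2,3)]) (auto simp: MT_def MS_def MW_def)
      next
        fix x \<sigma>' assume "x \<in> G" "Q x \<sigma>'"
        moreover obtain ts ss ws where x: "x = (ts, ss, ws)" by (cases x) auto
        ultimately obtain m where m: "kcost n d (?lab ts ss m) (?cen ss m) ?A \<le> (1 + \<epsilon>) * kmeans_opt k A"
          "\<And>i. i < n \<Longrightarrow> nv \<sigma>' 1 i = ?lab ts ss m i" "\<And>a j. a < k \<Longrightarrow> j < d \<Longrightarrow> rv \<sigma>' 1 (a * d + j) = ?cen ss m a j"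
          unfolding G_def Q_def by auto
        show "(Halt, \<sigma>') \<in> outputs_approx \<epsilon> k A"
          by (rule stored_outputs_approx[OF A m(2,3) _ m(1)])
            (auto simp: sketch_search.cand_labels_def intro: nearest(1)[OF pos(3)])
      qed
      moreover have "bind_pmf (pair_pmf (map_pmf MT PT) (pair_pmf (map_pmf MS PS) (map_pmf MW PW)))
          (\<lambda>(T, S, W). steps ?N (recover, sketch_input n d k \<epsilon> T S W (S * A) (A * T) (W *\<^sub>v flatten A)))
        = bind_pmf (pair_pmf PT (pair_pmf PS PW)) (\<lambda>x. steps ?N (recover, \<sigma> x))"
        unfolding map_pair[symmetric] bind_map_pmf
        by (intro bind_pmf_cong refl) (auto simp: \<sigma>_def)
      ultimately show "\<exists>N. measure_pmf.prob (bind_pmf (pair_pmf (map_pmf MT PT) (pair_pmf (map_pmf MS PS) (map_pmf MW PW)))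
          (\<lambda>(T, S, W). steps N (recover, sketch_input n d k \<epsilon> T S W (S * A) (A * T) (W *\<^sub>v flatten A))))
             (outputs_approx \<epsilon> k A) \<ge> 2 / 3"
        by (intro exI[of _ ?N]) simp
    qed (auto simp: MT_def MS_def MW_def)
    then show ?thesis by blast
  qed
qed simp

section \<open>The streaming program\<close>

text \<open>Further arrays: naturals \<open>10\<close>--\<open>12\<close> and real \<open>10\<close> receive the updates, \<open>20\<close> holds the random
  bits, \<open>21\<close> and \<open>22\<close> the bases of the sign tables, \<open>23\<close> is \<open>\<lceil>log\<^sub>2 n\<rceil>\<close>, computed with the powers
  of two in \<open>24\<close>, and \<open>28\<close> counts the bits.\<close>

abbreviation "BNn \<equiv> NVar 21"
abbreviation "BDn \<equiv> NVar 22"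
abbreviation "offS \<equiv> NMul Tn (NMul (NLit 2) BDn)"
abbreviation "offW \<equiv> NAdd offS (NMul Sn (NMul (NLit 2) BNn))"
abbreviation "blockW \<equiv> NAdd (NMul (NLit 2) BNn) (NMul (NLit 2) BDn)"
abbreviation "bitsN \<equiv> NAdd offW (NMul Wn blockW)"

definition bit_expr :: "nexp \<Rightarrow> rexp" where
  "bit_expr e = RSub (ROfNat (NLit 1)) (ROfNat (NMul (NLit 2) (NGet 20 e)))"

definition table_expr :: "nexp \<Rightarrow> nexp \<Rightarrow> nexp \<Rightarrow> rexp" where
  "table_expr o' b i = RMul (bit_expr (NAdd o' (NDiv i b))) (bit_expr (NAdd (NAdd o' b) (NMod i b)))"

definition tx_bits :: "nexp \<Rightarrow> nexp \<Rightarrow> rexp" where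
  "tx_bits j y = table_expr (NMul y (NMul (NLit 2) BDn)) BDn j"

definition sx_bits :: "nexp \<Rightarrow> nexp \<Rightarrow> rexp" where
  "sx_bits y i = table_expr (NAdd offS (NMul y (NMul (NLit 2) BNn))) BNn i"

definition wx_bits :: "nexp \<Rightarrow> nexp \<Rightarrow> rexp" where
  "wx_bits r l = RMul (table_expr (NAdd offW (NMul r blockW)) BNn (NDiv l Dn))
     (table_expr (NAdd (NAdd offW (NMul r blockW)) (NMul (NLit 2) BNn)) BDn (NMod l Dn))"

text \<open>The machine cannot round a real to a natural. Sizes such as \<lceil>y\<rceil> are
  therefore found by counting, with the division by \<epsilon> multiplied out.\<close>

definition Incr :: "nat \<Rightarrow> nat \<Rightarrow> bexp \<Rightarrow> com" where
  "Incr a i b = Loop b (NPut a (NLit i) (NAdd (NGet a (NLit i)) (NLit 1)))"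

definition set_sizes :: com where
  "set_sizes =
     Seq (Incr 21 0 (NLess (NMul BNn BNn) Nn))
    (Seq (Incr 22 0 (NLess (NMul BDn BDn) Dn))
    (Seq (NPut 24 (NLit 0) (NLit 1))
    (Seq (Loop (NLess (NVar 24) Nn) (Seq (NPut 24 (NLit 0) (NMul (NLit 2) (NVar 24))) (NPut 23 (NLit 0) (NAdd (NVar 23) (NLit 1)))))
    (Seq (Incr 0 3 (RLess (RMul (ROfNat Tn) (RMul (RVar 0) (RVar 0))) (ROfNat (NMul (NLit 226800) (NVar 23)))))
    (Seq (Incr 0 4 (RLess (RMul (ROfNat Sn) (RVar 0)) (ROfNat (NMul (NLit 320000) Kn))))
         (Incr 0 5 (RLess (RMul (ROfNat Wn) (RMul (RVar 0) (RVar 0))) (ROfNat (NMul (NLit 243000) (NMul Sn (NMul Kn (NVar 23))))))))))))"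

definition draw_bits :: com where
  "draw_bits = For 28 bitsN (NRand 20 (NVar 28) (NLit 1))"

definition AddLoop :: "nat \<Rightarrow> nexp \<Rightarrow> nexp \<Rightarrow> rexp \<Rightarrow> com" where
  "AddLoop a bnd ix e = For 30 bnd (RPut a ix (RAdd (RGet a ix) e))"

definition apply_to_sketches :: com where
  "apply_to_sketches =
     Seq (AddLoop 5 Sn (NAdd (NMul (NVar 30) Dn) (NVar 12)) (RMul (sx_bits (NVar 30) (NVar 11)) (RVar 10)))
    (Seq (AddLoop 6 Tn (NAdd (NMul (NVar 11) Tn) (NVar 30)) (RMul (tx_bits (NVar 12) (NVar 30)) (RVar 10)))
         (AddLoop 7 Wn (NVar 30) (RMul (wx_bits (NVar 30) (NAdd (NMul (NVar 11) Dn) (NVar 12))) (RVar 10))))"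

definition read_stream :: com where
  "read_stream = Seq (Next 10 11 12 10) (Loop (NLess (NLit 0) (NVar 10)) (Seq apply_to_sketches (Next 10 11 12 10)))"

definition stream_kmeans :: com where
  "stream_kmeans = Seq set_sizes (Seq draw_bits (Seq read_stream (search tx_bits wx_bits)))"

subsection \<open>Sizes\<close>

definition nat_upd :: "nat \<Rightarrow> nat \<Rightarrow> nat \<Rightarrow> state \<Rightarrow> state \<Rightarrow> bool" where
  "nat_upd a i x \<sigma> \<sigma>' \<longleftrightarrow> (\<forall>b j. nv \<sigma>' b j = (if b = a \<and> j = i then x else nv \<sigma> b j)) \<and>
     (\<forall>b j. rv \<sigma>' b j = rv \<sigma> b j) \<and> input \<sigma>' = input \<sigma>"

lemma ok_Incr:
  assumes f: "fits LN VN LR \<sigma>" and 0: "nv \<sigma> a i = 0" "i < LN a" "B \<le> VN a"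
    and b: "\<And>x \<sigma>'. x \<le> B \<Longrightarrow> nat_upd a i x \<sigma> \<sigma>' \<Longrightarrow> bval b \<sigma>' \<longleftrightarrow> x < B"
  shows "ok (fits LN VN LR) (Incr a i b) \<sigma> (B * 3 + 1) (nat_upd a i B \<sigma>)"
proof -
  have "ok (fits LN VN LR) (Incr a i b) \<sigma> (B * (1 + 2) + 1) (nat_upd a i B \<sigma>)"
    unfolding Incr_def
  proof (rule ok_Loop[where J="\<lambda>x. nat_upd a i x \<sigma>"])
    show "nat_upd a i 0 \<sigma> \<sigma>" using 0 by (auto simp: nat_upd_def)
    fix x \<sigma>' assume "x < B" "fits LN VN LR \<sigma>'" "nat_upd a i x \<sigma> \<sigma>'"
    then show "ok (fits LN VN LR) (NPut a (NLit i) (NAdd (NGet a (NLit i)) (NLit 1))) \<sigma>' 1 (nat_upd a i (Suc x) \<sigma>)"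
      using 0 by (intro ok_NPut) (auto simp: nat_upd_def)
  qed (use f b in auto)
  then show ?thesis by (simp add: numeral_3_eq_3)
qed

lemma runs_first_step:
  assumes "step c s = return_pmf (c', s')" "P s" "runs P c' s' T D"
  shows "runs P c s (Suc T) D"
  using runs_step[of P s c T "\<lambda>_. D"] assms by (simp add: bind_return_pmf)

lemma less_nat_ceiling: "x < nat \<lceil>y\<rceil> \<longleftrightarrow> real x < y"
  by linarith

locale stream_sizes =
  fixes n d k :: nat and \<epsilon> :: real
  assumes pos: "n \<ge> 2" "d \<ge> 1" "k \<ge> 1" and \<epsilon>: "0 < \<epsilon>" "\<epsilon> < 1"
begin

definition bn :: nat where "bn = (LEAST b. n \<le> b * b)"
definition bd :: nat where "bd = (LEAST b. d \<le> b * b)"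
definition lg :: nat where "lg = (LEAST x. n \<le> 2 ^ x)"
definition t :: nat where "t = nat \<lceil>real (226800 * lg) / \<epsilon>\<^sup>2\<rceil>"
definition s :: nat where "s = nat \<lceil>real (320000 * k) / \<epsilon>\<rceil>"
definition w :: nat where "w = nat \<lceil>real (243000 * (s * (k * lg))) / \<epsilon>\<^sup>2\<rceil>"
definition len :: nat where "len = t * (2 * bd) + s * (2 * bn) + w * (2 * bn + 2 * bd)"
definition H :: nat where "H = n + d + k + t + s + w + n * d + s * k + k * d + k * t + 2 * n + bn + bd + lg + len"

definition LN :: "nat \<Rightarrow> nat" where
  "LN a = (if a = 0 then 6 else if a = 1 \<or> a = 40 then n else if a = 20 then len
     else if a \<in> {10, 11, 12, 21, 22, 23, 24, 28} \<union> {30..38} then 1 else 0)"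

text \<open>Numbers as large as the count of guesses are confined to arrays 36 to 38, with one cell
  each, and cost O(s k log n) bits. The table bits have value at most 1, so a bit costs constant
  space and not the length of a general index.\<close>

definition VN :: "nat \<Rightarrow> nat" where
  "VN a = (if a = 20 then 1 else if a = 1 \<or> a = 40 then k
     else if a \<in> {36..38} then (2 * n + 1) ^ (s * k) else H)"

definition LR :: "nat \<Rightarrow> nat" where
  "LR a = (if a \<in> {0, 10, 30, 35, 40, 41} then 1 else if a \<in> {1, 36} then k * d else if a = 5 then s * d
     else if a = 6 then n * t else if a \<in> {7, 39} then w else if a \<in> {31, 32} then s * k
     else if a \<in> {33, 38} then k else if a = 34 then s else if a = 37 then k * t else 0)"

abbreviation "memok \<equiv> fits LN VN LR"

lemma bn: "n \<le> bn * bn" "x < bn \<Longrightarrow> x * x < n"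
proof -
  have "n \<le> n * n" by simp
  then show "n \<le> bn * bn" unfolding bn_def by (rule LeastI)
  show "x < bn \<Longrightarrow> x * x < n" unfolding bn_def using not_less_Least not_le by blast
qed

lemma bd: "d \<le> bd * bd" "x < bd \<Longrightarrow> x * x < d"
proof -
  have "d \<le> d * d" by simp
  then show "d \<le> bd * bd" unfolding bd_def by (rule LeastI)
  show "x < bd \<Longrightarrow> x * x < d" unfolding bd_def using not_less_Least not_le by blast
qed

lemma lg: "n \<le> 2 ^ lg" "x < lg \<Longrightarrow> 2 ^ x < n"
proof -
  have "n \<le> 2 ^ n" by (simp add: less_imp_le)
  then show "n \<le> 2 ^ lg" unfolding lg_def by (rule LeastI)
  show "x < lg \<Longrightarrow> 2 ^ x < n" unfolding lg_def using not_less_Least not_le by blast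
qed

lemma below_iff:
  "x \<le> bn \<Longrightarrow> x * x < n \<longleftrightarrow> x < bn" "x \<le> bd \<Longrightarrow> x * x < d \<longleftrightarrow> x < bd" "x \<le> lg \<Longrightarrow> 2 ^ x < n \<longleftrightarrow> x < lg"
  using bn bd lg by (metis le_neq_implies_less not_le)+

text \<open>The capacities of the other arrays are left open, so that the caller can force the bit
  table and its counter to be still empty afterwards.\<close>

lemma ok_set_sizes:
  assumes f: "fits LN' VN LR \<sigma>" and L: "LN' 0 = 6" "\<And>a. a \<in> {21..24} \<Longrightarrow> LN' a = 1"
    and init: "nv \<sigma> 0 0 = n" "nv \<sigma> 0 1 = d" "nv \<sigma> 0 2 = k" "nv \<sigma> 0 3 = 0" "nv \<sigma> 0 4 = 0" "nv \<sigma> 0 5 = 0"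
      "\<And>a. a \<in> {21..24} \<Longrightarrow> nv \<sigma> a 0 = 0" "rv \<sigma> 0 0 = \<epsilon>"
  shows "ok (fits LN' VN LR) set_sizes \<sigma> (40 * H) (\<lambda>\<sigma>'. same {0, 21, 22, 23, 24} {} \<sigma> \<sigma>' \<and>
     nv \<sigma>' 0 0 = n \<and> nv \<sigma>' 0 1 = d \<and> nv \<sigma>' 0 2 = k \<and> nv \<sigma>' 0 3 = t \<and> nv \<sigma>' 0 4 = s \<and> nv \<sigma>' 0 5 = w \<and>
     nv \<sigma>' 21 0 = bn \<and> nv \<sigma>' 22 0 = bd)"
proof -
  have VNs: "VN 0 = H" "VN 21 = H" "VN 22 = H" "VN 23 = H" "VN 24 = H" by (simp_all add: VN_def)
  have LNs: "LN' 21 = 1" "LN' 22 = 1" "LN' 23 = 1" "LN' 24 = 1" using L(2) by simp_all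
  define vals where "vals \<sigma>' vt vs vw v1 v2 v3 \<longleftrightarrow> same {0, 21, 22, 23, 24} {} \<sigma> \<sigma>' \<and>
     nv \<sigma>' 0 0 = n \<and> nv \<sigma>' 0 1 = d \<and> nv \<sigma>' 0 2 = k \<and> nv \<sigma>' 0 3 = vt \<and> nv \<sigma>' 0 4 = vs \<and> nv \<sigma>' 0 5 = vw \<and>
     nv \<sigma>' 21 0 = v1 \<and> nv \<sigma>' 22 0 = v2 \<and> nv \<sigma>' 23 0 = v3 \<and> rv \<sigma>' 0 0 = \<epsilon>" for \<sigma>' vt vs vw v1 v2 v3
  let ?I = "fits LN' VN LR"
  have same_upd: "same {0, 21, 22, 23, 24} {} \<sigma> \<sigma>2"
    if "same {0, 21, 22, 23, 24} {} \<sigma> \<sigma>1" "nat_upd a i x \<sigma>1 \<sigma>2" "a \<in> {0, 21, 22, 23, 24}" for \<sigma>1 \<sigma>2 a i x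
    using that by (auto simp: same_def nat_upd_def)
  have 1: "ok ?I (Incr 21 0 (NLess (NMul BNn BNn) Nn)) \<sigma> (bn * 3 + 1) (\<lambda>\<sigma>'. vals \<sigma>' 0 0 0 bn 0 0)"
  proof (rule ok_mono[OF ok_Incr[where B=bn]])
    fix \<sigma>' assume u: "nat_upd 21 0 bn \<sigma> \<sigma>'"
    then show "vals \<sigma>' 0 0 0 bn 0 0" using init same_upd[OF same_refl u] by (simp add: vals_def nat_upd_def)
  qed (use f init LNs VNs in \<open>auto simp: nat_upd_def below_iff H_def\<close>)
  have 2: "ok ?I (Incr 22 0 (NLess (NMul BDn BDn) Dn)) \<sigma>1 (bd * 3 + 1) (\<lambda>\<sigma>'. vals \<sigma>' 0 0 0 bn bd 0)"
    if f1: "?I \<sigma>1" and v: "vals \<sigma>1 0 0 0 bn 0 0" for \<sigma>1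
  proof (rule ok_mono[OF ok_Incr[where B=bd]])
    fix \<sigma>' assume u: "nat_upd 22 0 bd \<sigma>1 \<sigma>'"
    then show "vals \<sigma>' 0 0 0 bn bd 0" using v same_upd[OF _ u] by (simp add: vals_def nat_upd_def)
  qed (use f1 v LNs VNs in \<open>auto simp: vals_def nat_upd_def below_iff H_def\<close>)
  have 3: "ok ?I (NPut 24 (NLit 0) (NLit 1)) \<sigma>1 1 (\<lambda>\<sigma>'. vals \<sigma>' 0 0 0 bn bd 0 \<and> nv \<sigma>' 24 0 = 2 ^ 0)"
    if f1: "?I \<sigma>1" and v: "vals \<sigma>1 0 0 0 bn bd 0" for \<sigma>1
    using f1 v LNs VNs pos by (intro ok_NPut) (auto simp: vals_def H_def intro!: same_put_nat)
  have 4: "ok ?I (Loop (NLess (NVar 24) Nn) (Seq (NPut 24 (NLit 0) (NMul (NLit 2) (NVar 24))) (NPut 23 (NLit 0) (NAdd (NVar 23) (NLit 1))))) \<sigma>1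
      (lg * ((1 + 1 + 1) + 2) + 1) (\<lambda>\<sigma>'. vals \<sigma>' 0 0 0 bn bd lg \<and> nv \<sigma>' 24 0 = 2 ^ lg)"
    if f1: "?I \<sigma>1" and v: "vals \<sigma>1 0 0 0 bn bd 0 \<and> nv \<sigma>1 24 0 = 2 ^ 0" for \<sigma>1
  proof (rule ok_Loop[where J="\<lambda>x \<sigma>'. vals \<sigma>' 0 0 0 bn bd x \<and> nv \<sigma>' 24 0 = 2 ^ x"])
    fix x \<sigma>2 assume x: "x < lg" "?I \<sigma>2" and v2: "vals \<sigma>2 0 0 0 bn bd x \<and> nv \<sigma>2 24 0 = 2 ^ x"
    have le: "2 * 2 ^ x \<le> H" "Suc x \<le> H" using lg(2)[OF x(1)] x(1) by (auto simp: H_def)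
    show "ok ?I (Seq (NPut 24 (NLit 0) (NMul (NLit 2) (NVar 24))) (NPut 23 (NLit 0) (NAdd (NVar 23) (NLit 1)))) \<sigma>2 (1 + 1 + 1)
        (\<lambda>\<sigma>'. vals \<sigma>' 0 0 0 bn bd (Suc x) \<and> nv \<sigma>' 24 0 = 2 ^ Suc x)"
    proof (rule ok_Seq)
      show "ok ?I (NPut 24 (NLit 0) (NMul (NLit 2) (NVar 24))) \<sigma>2 1 (\<lambda>\<sigma>'. vals \<sigma>' 0 0 0 bn bd x \<and> nv \<sigma>' 24 0 = 2 ^ Suc x)"
        using x v2 LNs VNs le by (intro ok_NPut) (auto simp: vals_def intro!: same_put_nat)
      fix \<sigma>3 assume "?I \<sigma>3" "vals \<sigma>3 0 0 0 bn bd x \<and> nv \<sigma>3 24 0 = 2 ^ Suc x"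
      then show "ok ?I (NPut 23 (NLit 0) (NAdd (NVar 23) (NLit 1))) \<sigma>3 1 (\<lambda>\<sigma>'. vals \<sigma>' 0 0 0 bn bd (Suc x) \<and> nv \<sigma>' 24 0 = 2 ^ Suc x)"
        using LNs VNs le by (intro ok_NPut) (auto simp: vals_def intro!: same_put_nat)
    qed
  qed (use f1 v in \<open>auto simp: vals_def below_iff\<close>)
  have 5: "ok ?I (Incr 0 3 (RLess (RMul (ROfNat Tn) (RMul (RVar 0) (RVar 0))) (ROfNat (NMul (NLit 226800) (NVar 23))))) \<sigma>1
     (t * 3 + 1) (\<lambda>\<sigma>'. vals \<sigma>' t 0 0 bn bd lg)" if f1: "?I \<sigma>1" and v: "vals \<sigma>1 0 0 0 bn bd lg \<and> nv \<sigma>1 24 0 = 2 ^ lg" for \<sigma>1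
  proof (rule ok_mono[OF ok_Incr[where B=t]])
    fix \<sigma>' assume u: "nat_upd 0 3 t \<sigma>1 \<sigma>'"
    then show "vals \<sigma>' t 0 0 bn bd lg" using v same_upd[OF _ u] by (simp add: vals_def nat_upd_def)
  next
    fix x \<sigma>' assume u: "nat_upd 0 3 x \<sigma>1 \<sigma>'"
    show "bval (RLess (RMul (ROfNat Tn) (RMul (RVar 0) (RVar 0))) (ROfNat (NMul (NLit 226800) (NVar 23)))) \<sigma>' \<longleftrightarrow> x < t"
      unfolding t_def less_nat_ceiling using u v \<epsilon> by (simp add: vals_def nat_upd_def pos_less_divide_eq power2_eq_square)
  qed (use f1 v L VNs in \<open>auto simp: vals_def H_def\<close>)
  have 6: "ok ?I (Incr 0 4 (RLess (RMul (ROfNat Sn) (RVar 0)) (ROfNat (NMul (NLit 320000) Kn)))) \<sigma>1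
     (s * 3 + 1) (\<lambda>\<sigma>'. vals \<sigma>' t s 0 bn bd lg)" if f1: "?I \<sigma>1" and v: "vals \<sigma>1 t 0 0 bn bd lg" for \<sigma>1
  proof (rule ok_mono[OF ok_Incr[where B=s]])
    fix \<sigma>' assume u: "nat_upd 0 4 s \<sigma>1 \<sigma>'"
    then show "vals \<sigma>' t s 0 bn bd lg" using v same_upd[OF _ u] by (simp add: vals_def nat_upd_def)
  next
    fix x \<sigma>' assume u: "nat_upd 0 4 x \<sigma>1 \<sigma>'"
    show "bval (RLess (RMul (ROfNat Sn) (RVar 0)) (ROfNat (NMul (NLit 320000) Kn))) \<sigma>' \<longleftrightarrow> x < s"
      unfolding s_def less_nat_ceiling using u v \<epsilon> by (simp add: vals_def nat_upd_def pos_less_divide_eq)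
  qed (use f1 v L VNs in \<open>auto simp: vals_def H_def\<close>)
  have 7: "ok ?I (Incr 0 5 (RLess (RMul (ROfNat Wn) (RMul (RVar 0) (RVar 0))) (ROfNat (NMul (NLit 243000) (NMul Sn (NMul Kn (NVar 23))))))) \<sigma>1
     (w * 3 + 1) (\<lambda>\<sigma>'. vals \<sigma>' t s w bn bd lg)" if f1: "?I \<sigma>1" and v: "vals \<sigma>1 t s 0 bn bd lg" for \<sigma>1
  proof (rule ok_mono[OF ok_Incr[where B=w]])
    fix \<sigma>' assume u: "nat_upd 0 5 w \<sigma>1 \<sigma>'"
    then show "vals \<sigma>' t s w bn bd lg" using v same_upd[OF _ u] by (simp add: vals_def nat_upd_def)
  next
    fix x \<sigma>' assume u: "nat_upd 0 5 x \<sigma>1 \<sigma>'"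
    show "bval (RLess (RMul (ROfNat Wn) (RMul (RVar 0) (RVar 0))) (ROfNat (NMul (NLit 243000) (NMul Sn (NMul Kn (NVar 23)))))) \<sigma>' \<longleftrightarrow> x < w"
      unfolding w_def less_nat_ceiling using u v \<epsilon> by (simp add: vals_def nat_upd_def pos_less_divide_eq power2_eq_square)
  qed (use f1 v L VNs in \<open>auto simp: vals_def H_def\<close>)
  have "ok ?I set_sizes \<sigma> ((bn * 3 + 1) + ((bd * 3 + 1) + (1 + ((lg * ((1 + 1 + 1) + 2) + 1) + ((t * 3 + 1) + ((s * 3 + 1) + (w * 3 + 1) + 1) + 1) + 1) + 1) + 1) + 1)
     (\<lambda>\<sigma>'. vals \<sigma>' t s w bn bd lg)"
    unfolding set_sizes_def by (intro ok_Seq[OF 1] ok_Seq[OF 2] ok_Seq[OF 3] ok_Seq[OF 4] ok_Seq[OF 5] ok_Seq[OF 6] 7)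
  then show ?thesis by (rule ok_mono) (use pos in \<open>auto simp: vals_def H_def\<close>)
qed

subsection \<open>Random bits\<close>

text \<open>The final state is described as an exact record, and not through its views, because the
  distribution of states has to be the image of a distribution of bit lists. Starting from empty
  arrays makes the stored list equal to the list of draws.\<close>

lemma runs_draw_bits:
  assumes f: "memok \<sigma>" and e: "nats \<sigma> 20 = []" "nats \<sigma> 28 = []"
    and v: "nv \<sigma> 0 3 = t" "nv \<sigma> 0 4 = s" "nv \<sigma> 0 5 = w" "nv \<sigma> 21 0 = bn" "nv \<sigma> 22 0 = bd"
  shows "runs memok draw_bits \<sigma> (len * 5 + 3)
     (map_pmf (\<lambda>l. \<sigma>\<lparr>nats := (nats \<sigma>)(20 := l, 28 := [len])\<rparr>) (replicate_pmf len coin))"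
proof -
  define st where "st c l = \<sigma>\<lparr>nats := (nats \<sigma>)(20 := l, 28 := [c])\<rparr>" for c l
  let ?L = "Loop (NLess (NVar 28) bitsN) (Seq (NRand 20 (NVar 28) (NLit 1)) (NPut 28 (NLit 0) (NAdd (NVar 28) (NLit 1))))"
  have st_nv: "nv (st c l) a j = (if a = 20 then fetch l j else if a = 28 then fetch [c] j else nv \<sigma> a j)" for c l a j
    by (simp add: st_def nv_def)
  have c28: "nv (st c l) 28 0 = c" for c l by (simp add: st_nv fetch_def)
  have step_L: "step ?L (st c l) = return_pmf (if c < len then Seq (Seq (NRand 20 (NVar 28) (NLit 1))
      (NPut 28 (NLit 0) (NAdd (NVar 28) (NLit 1)))) ?L else Halt, st c l)" for c l
    using v by (simp add: st_nv len_def c28 fetch_def)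
  have inv: "memok (st c l)" if "c \<le> len" "length l \<le> len" "\<forall>x\<in>set l. x \<le> 1" for c l
    unfolding fits_def
  proof
    fix a
    have fa: "length (nats \<sigma> a) \<le> LN a" "\<forall>x\<in>set (nats \<sigma> a). x \<le> VN a" "length (reals \<sigma> a) \<le> LR a"
      using f by (auto simp: fits_def)
    consider "a = 20" | "a = 28" | "a \<noteq> 20" "a \<noteq> 28" by blast
    then show "length (nats (st c l) a) \<le> LN a \<and> (\<forall>x\<in>set (nats (st c l) a). x \<le> VN a) \<and> length (reals (st c l) a) \<le> LR a"
    proof cases
      case 1
      then show ?thesis using that fa by (simp add: st_def LN_def VN_def)
    next
      case 2
      then show ?thesis using that fa by (simp add: st_def LN_def VN_def H_def)
    next
      case 3
      then show ?thesis using fa by (simp add: st_def)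
    qed
  qed
  \<comment> \<open>Generalised over the prefix already drawn; the induction is on the number of
    bits still to come.\<close>
  have loop: "runs memok ?L (st c l) (i * 5 + 1) (map_pmf (\<lambda>l'. st len (l @ l')) (replicate_pmf i coin))"
    if "c + i = len" "length l = c" "\<forall>x\<in>set l. x \<le> 1" for c l i
    using that
  proof (induction i arbitrary: c l)
    case 0
    then have I: "memok (st c l)" by (intro inv) auto
    have "runs memok ?L (st c l) (Suc 0) (return_pmf (st c l))"
      by (rule runs_first_step[where P=memok, OF step_L I]) (use 0 I in \<open>auto intro: runs_Halt\<close>)
    then show ?case using 0 by simp
  next
    case (Suc i)
    have I: "memok (st c l)" using Suc.prems by (intro inv) auto
    have bit: "x \<le> 1" if "x \<in> set_pmf coin" for x using that by (auto simp: coin_def)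
    have r1: "runs memok (NRand 20 (NVar 28) (NLit 1)) (st c l) 1 (map_pmf (\<lambda>x. st c (l @ [x])) coin)"
    proof -
      let ?F = "\<lambda>cfg :: com \<times> state. return_pmf (snd cfg)"
      have put: "put_nat 20 c x (st c l) = st c (l @ [x])" for x
        using Suc.prems by (simp add: put_nat_def st_def store_def fun_eq_iff fun_upd_twist)
      have "runs memok (NRand 20 (NVar 28) (NLit 1)) (st c l) (Suc 0) (bind_pmf (step (NRand 20 (NVar 28) (NLit 1)) (st c l)) ?F)"
      proof (rule runs_step)
        show "memok (st c l)" by (rule I)
        fix c' s' assume "(c', s') \<in> set_pmf (step (NRand 20 (NVar 28) (NLit 1)) (st c l))"
        then have "c' = Halt" "\<exists>x\<le>1. s' = st c (l @ [x])" by (auto simp: c28 put)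
        then show "runs memok c' s' 0 (?F (c', s'))" using Suc.prems inv[of c] by (auto intro!: runs_Halt)
      qed
      then show ?thesis
        by (simp add: c28 put coin_def map_pmf_def[symmetric] pmf.map_comp o_def)
    qed
    have r2: "runs memok (NPut 28 (NLit 0) (NAdd (NVar 28) (NLit 1))) (st c (l @ [x])) 1 (return_pmf (st (Suc c) (l @ [x])))"
      if "x \<in> set_pmf coin" for x
    proof -
      have "put_nat 28 0 (Suc c) (st c (l @ [x])) = st (Suc c) (l @ [x])"
        by (simp add: put_nat_def st_def store_def fun_eq_iff)
      moreover have "memok (st (Suc c) (l @ [x]))" "memok (st c (l @ [x]))"
        using Suc.prems bit[OF that] by (auto intro!: inv)
      ultimately have "ok memok (NPut 28 (NLit 0) (NAdd (NVar 28) (NLit 1))) (st c (l @ [x])) 1 (\<lambda>s'. s' = st (Suc c) (l @ [x]))"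
        by (intro ok_atom[where s'="st (Suc c) (l @ [x])"]) (auto simp: c28)
      then show ?thesis by (auto simp: ok_def)
    qed
    let ?B = "Seq (NRand 20 (NVar 28) (NLit 1)) (NPut 28 (NLit 0) (NAdd (NVar 28) (NLit 1)))"
    have rB: "runs memok ?B (st c l) (1 + 1 + 1) (map_pmf (\<lambda>x. st (Suc c) (l @ [x])) coin)"
    proof -
      \<comment> \<open>The continuation has to be a function of the state, so the bit just drawn is
        read back from array 20.\<close>
      have "runs memok ?B (st c l) (1 + 1 + 1) (bind_pmf (map_pmf (\<lambda>x. st c (l @ [x])) coin)
          (\<lambda>s'. return_pmf (st (Suc c) (nats s' 20))))"
        by (rule runs_Seq[OF r1]) (use r2 in \<open>auto simp: st_def\<close>)
      then show ?thesis by (simp add: map_pmf_def[symmetric] st_def pmf.map_comp o_def)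
    qed
    have "runs memok (Seq ?B ?L) (st c l) ((1 + 1 + 1) + (i * 5 + 1) + 1) (bind_pmf (map_pmf (\<lambda>x. st (Suc c) (l @ [x])) coin)
       (\<lambda>s'. map_pmf (\<lambda>l'. st len (nats s' 20 @ l')) (replicate_pmf i coin)))"
    proof (rule runs_Seq[OF rB])
      fix s' assume "s' \<in> set_pmf (map_pmf (\<lambda>x. st (Suc c) (l @ [x])) coin)"
      then obtain x where x: "x \<in> set_pmf coin" "s' = st (Suc c) (l @ [x])" by auto
      have "nats s' 20 = l @ [x]" by (simp add: x st_def)
      then show "runs memok ?L s' (i * 5 + 1) (map_pmf (\<lambda>l'. st len (nats s' 20 @ l')) (replicate_pmf i coin))"
        using Suc.IH[of "Suc c" "l @ [x]"] Suc.prems bit[OF x(1)] by (simp add: x)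
    qed
    also have "bind_pmf (map_pmf (\<lambda>x. st (Suc c) (l @ [x])) coin) (\<lambda>s'. map_pmf (\<lambda>l'. st len (nats s' 20 @ l')) (replicate_pmf i coin))
       = map_pmf (\<lambda>l'. st len (l @ l')) (replicate_pmf (Suc i) coin)"
      by (simp add: replicate_pmf.simps(2) st_def map_pmf_def bind_assoc_pmf bind_return_pmf)
    finally have R: "runs memok (Seq ?B ?L) (st c l) ((1 + 1 + 1) + (i * 5 + 1) + 1) (map_pmf (\<lambda>l'. st len (l @ l')) (replicate_pmf (Suc i) coin))" .
    have lt: "c < len" using Suc.prems by simp
    have "runs memok ?L (st c l) (Suc ((1 + 1 + 1) + (i * 5 + 1) + 1))
       (map_pmf (\<lambda>l'. st len (l @ l')) (replicate_pmf (Suc i) coin))"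
      by (rule runs_first_step[where P=memok, OF step_L I]) (simp only: lt if_True R)
    then show ?case by (rule runs_mono) simp
  qed
  have "runs memok (NPut 28 (NLit 0) (NLit 0)) \<sigma> 1 (return_pmf (st 0 []))"
  proof -
    have "put_nat 28 0 0 \<sigma> = st 0 []" using e by (auto simp: put_nat_def st_def store_def fun_eq_iff intro!: state.equality)
    then have "ok memok (NPut 28 (NLit 0) (NLit 0)) \<sigma> 1 (\<lambda>s'. s' = st 0 [])"
      using f inv[of 0 "[]"] by (intro ok_atom[where s'="st 0 []"]) auto
    then show ?thesis by (auto simp: ok_def)
  qed
  then have "runs memok draw_bits \<sigma> (1 + (len * 5 + 1) + 1) (bind_pmf (return_pmf (st 0 []))
      (\<lambda>_. map_pmf (\<lambda>l'. st len ([] @ l')) (replicate_pmf len coin)))"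
    unfolding draw_bits_def For_def by (rule runs_Seq) (use loop[of 0 len "[]"] in auto)
  then show ?thesis by (simp add: bind_return_pmf st_def numeral_3_eq_3)
qed

end

section \<open>Cutting one random string into sign tables\<close>

lemma nth_concat_blocks:
  assumes "\<And>x. x \<in> set xs \<Longrightarrow> length x = b" "y < length xs" "q < b"
  shows "concat xs ! (y * b + q) = xs ! y ! q"
  using assms
proof (induction xs arbitrary: y)
  case (Cons x xs)
  have lx: "length x = b" using Cons.prems by simp
  show ?case
  proof (cases y)
    case 0
    then show ?thesis using Cons.prems lx by (simp add: nth_append)
  next
    case (Suc y')
    have "concat (x # xs) ! (y * b + q) = concat xs ! (y' * b + q)"
      using lx by (simp add: Suc nth_append)
    then show ?thesis using Cons by (simp add: Suc)
  qed
qed simp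

lemma length_concat_blocks: "(\<And>x. x \<in> set xs \<Longrightarrow> length x = b) \<Longrightarrow> length (concat xs) = length xs * b"
  by (induction xs) auto

lemma replicate_blocks:
  "map_pmf concat (replicate_pmf m (replicate_pmf b p)) = replicate_pmf (m * b) p"
proof (induction m)
  case (Suc m)
  have "map_pmf concat (replicate_pmf (Suc m) (replicate_pmf b p)) =
      bind_pmf (replicate_pmf b p) (\<lambda>x. bind_pmf (map_pmf concat (replicate_pmf m (replicate_pmf b p))) (\<lambda>y. return_pmf (x @ y)))"
    by (simp add: replicate_pmf.simps(2) map_bind_pmf bind_map_pmf)
  also have "\<dots> = replicate_pmf (Suc m * b) p"
    by (simp add: Suc replicate_pmf_distrib)
  finally show ?case .
qed (simp add: map_pmf_def bind_return_pmf)

text \<open>The program draws a single string of bits, whereas the analysis wants independent rows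
  for three sketches. The two views have the same distribution.\<close>

lemma replicate_three_blocks:
  "map_pmf (\<lambda>(x, y, z). concat x @ concat y @ concat z) (pair_pmf (replicate_pmf m1 (replicate_pmf b1 p))
     (pair_pmf (replicate_pmf m2 (replicate_pmf b2 p)) (replicate_pmf m3 (replicate_pmf b3 p))))
   = replicate_pmf (m1 * b1 + m2 * b2 + m3 * b3) p" (is "map_pmf _ (pair_pmf ?X (pair_pmf ?Y ?Z)) = _")
proof -
  have "map_pmf (\<lambda>(x, y, z). concat x @ concat y @ concat z) (pair_pmf ?X (pair_pmf ?Y ?Z)) =
     bind_pmf (map_pmf concat ?X) (\<lambda>x. bind_pmf (map_pmf concat ?Y) (\<lambda>y. bind_pmf (map_pmf concat ?Z) (\<lambda>z. return_pmf (x @ y @ z))))"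
    by (simp add: pair_pmf_def map_bind_pmf bind_map_pmf bind_assoc_pmf bind_return_pmf)
  also have "\<dots> = replicate_pmf (m1 * b1 + (m2 * b2 + m3 * b3)) p"
    by (simp add: replicate_blocks replicate_pmf_distrib bind_assoc_pmf bind_return_pmf)
  finally show ?thesis by (simp add: add.assoc)
qed

text \<open>Summing over all rounds that hit a cell avoids any injectivity condition on the index
  function; the callers simplify the sum for their layout.\<close>

lemma ok_AddLoop:
  assumes s: "fits LN VN LR \<sigma>" and c: "LN 30 \<ge> 1" "VN 30 \<ge> B"
    and bnd: "\<And>\<sigma>'. same {30} {a} \<sigma> \<sigma>' \<Longrightarrow> nval bnd \<sigma>' = B"
    and ix: "\<And>\<sigma>' i. same {30} {a} \<sigma> \<sigma>' \<Longrightarrow> nv \<sigma>' 30 0 = i \<Longrightarrow> i < B \<Longrightarrow> nval ix \<sigma>' = h i \<and> h i < LR a"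
    and e: "\<And>\<sigma>' i. same {30} {a} \<sigma> \<sigma>' \<Longrightarrow> nv \<sigma>' 30 0 = i \<Longrightarrow> i < B \<Longrightarrow> rval e \<sigma>' = v i"
  shows "ok (fits LN VN LR) (AddLoop a bnd ix e) \<sigma> (B * 5 + 3) (\<lambda>\<sigma>'. same {30} {a} \<sigma> \<sigma>' \<and>
     (\<forall>m. rv \<sigma>' a m = rv \<sigma> a m + (\<Sum>i<B. if h i = m then v i else 0)))"
proof -
  have "ok (fits LN VN LR) (AddLoop a bnd ix e) \<sigma> (B * (1 + 4) + 3) (\<lambda>\<sigma>'. same {30} {a} \<sigma> \<sigma>' \<and>
     (\<forall>m. rv \<sigma>' a m = rv \<sigma> a m + (\<Sum>i<B. if h i = m then v i else 0)))"
    unfolding AddLoop_def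
  proof (rule ok_For[where J="\<lambda>i \<sigma>'. same {30} {a} \<sigma> \<sigma>' \<and>
     (\<forall>m. rv \<sigma>' a m = rv \<sigma> a m + (\<Sum>i<i. if h i = m then v i else 0))"])
    fix i \<sigma>' assume i: "i < B" "fits LN VN LR \<sigma>'" "nv \<sigma>' 30 0 = i" and J: "same {30} {a} \<sigma> \<sigma>' \<and>
     (\<forall>m. rv \<sigma>' a m = rv \<sigma> a m + (\<Sum>i<i. if h i = m then v i else 0))"
    have "nval ix \<sigma>' = h i \<and> h i < LR a" "rval e \<sigma>' = v i" using ix e J i by blast+
    then show "ok (fits LN VN LR) (RPut a ix (RAdd (RGet a ix) e)) \<sigma>' 1 (\<lambda>\<sigma>'. (same {30} {a} \<sigma> \<sigma>' \<and>
     (\<forall>m. rv \<sigma>' a m = rv \<sigma> a m + (\<Sum>i<Suc i. if h i = m then v i else 0))) \<and> nv \<sigma>' 30 0 = i)"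
      using J i by (intro ok_RPut) (auto intro: same_put_real)
  qed (use s c bnd in \<open>auto intro: same_put_nat\<close>)
  then show ?thesis by simp
qed

lemma fits_input [simp]: "fits LN VN LR (\<sigma>\<lparr>input := x\<rparr>) = fits LN VN LR \<sigma>"
  by (simp add: fits_def)

lemma views_input [simp]: "nv (\<sigma>\<lparr>input := x\<rparr>) a i = nv \<sigma> a i" "rv (\<sigma>\<lparr>input := x\<rparr>) a i = rv \<sigma> a i"
  by (simp_all add: nv_def rv_def)

lemma sum_entry_update:
  fixes x :: "'a \<Rightarrow> real"
  assumes "finite I" "p \<in> I"
  shows "(\<Sum>i\<in>I. x i * (a i + (if i = p \<and> P then \<delta> else 0))) = (\<Sum>i\<in>I. x i * a i) + (if P then x p * \<delta> else 0)"
proof (cases P)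
  case True
  then show ?thesis using assms by (simp add: distrib_left sum.distrib if_distrib[of "\<lambda>z. x _ * z"] sum.delta cong: if_cong)
qed simp

context stream_sizes
begin

definition bits_ok :: "nat list list \<Rightarrow> nat list list \<Rightarrow> nat list list \<Rightarrow> state \<Rightarrow> bool" where
  "bits_ok ts ss ws \<sigma> \<longleftrightarrow> nv \<sigma> 0 0 = n \<and> nv \<sigma> 0 (Suc 0) = d \<and> nv \<sigma> 0 2 = k \<and> nv \<sigma> 0 3 = t \<and> nv \<sigma> 0 4 = s \<and> nv \<sigma> 0 5 = w \<and>
     nv \<sigma> 21 0 = bn \<and> nv \<sigma> 22 0 = bd \<and>
     (\<forall>y<t. \<forall>q<2 * bd. nv \<sigma> 20 (y * (2 * bd) + q) = ts ! y ! q) \<and>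
     (\<forall>y<s. \<forall>q<2 * bn. nv \<sigma> 20 (t * (2 * bd) + y * (2 * bn) + q) = ss ! y ! q) \<and>
     (\<forall>r<w. \<forall>q<2 * bn + 2 * bd. nv \<sigma> 20 (t * (2 * bd) + s * (2 * bn) + r * (2 * bn + 2 * bd) + q) = ws ! r ! q)"

lemma bits_ok_cong: "bits_ok ts ss ws \<sigma> \<Longrightarrow> (\<And>a i. a \<in> {0, 20, 21, 22} \<Longrightarrow> nv \<sigma>' a i = nv \<sigma> a i) \<Longrightarrow> bits_ok ts ss ws \<sigma>'"
  by (simp add: bits_ok_def)

lemma bits_ok_same: "bits_ok ts ss ws \<sigma> \<Longrightarrow> same NU RU \<sigma> \<sigma>' \<Longrightarrow> NU \<inter> {0, 20, 21, 22} = {} \<Longrightarrow> bits_ok ts ss ws \<sigma>'"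
  by (erule bits_ok_cong) (rule same_nv; auto)

lemma digits:
  "i < n \<Longrightarrow> i div bn < bn" "i < n \<Longrightarrow> i mod bn < bn" "j < d \<Longrightarrow> j div bd < bd" "j < d \<Longrightarrow> j mod bd < bd"
proof -
  show "i < n \<Longrightarrow> i div bn < bn" using bn(1) by (intro less_mult_imp_div_less) linarith
  show "j < d \<Longrightarrow> j div bd < bd" using bd(1) by (intro less_mult_imp_div_less) linarith
  show "i < n \<Longrightarrow> i mod bn < bn" using bn(1) by (cases bn) auto
  show "j < d \<Longrightarrow> j mod bd < bd" using bd(1) by (cases bd) auto
qed

lemma tx_bits:
  assumes "bits_ok ts ss ws \<sigma>" "nval e \<sigma> < d" "nval f \<sigma> < t"
  shows "rval (tx_bits e f) \<sigma> = table_sign 0 bd (ts ! nval f \<sigma>) (nval e \<sigma>)"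
  using assms digits(3,4)[OF assms(2)]
  by (simp add: tx_bits_def table_expr_def bit_expr_def bits_ok_def table_sign_def bit_sign_def add.assoc)

lemma sx_bits:
  assumes "bits_ok ts ss ws \<sigma>" "nval e \<sigma> < s" "nval f \<sigma> < n"
  shows "rval (sx_bits e f) \<sigma> = table_sign 0 bn (ss ! nval e \<sigma>) (nval f \<sigma>)"
  using assms digits(1,2)[OF assms(3)]
  by (simp add: sx_bits_def table_expr_def bit_expr_def bits_ok_def table_sign_def bit_sign_def add.assoc)

lemma wx_bits:
  assumes b: "bits_ok ts ss ws \<sigma>" and r: "nval e \<sigma> < w" and l: "nval f \<sigma> < n * d"
  shows "rval (wx_bits e f) \<sigma> = entry_sign bn bd d (ws ! nval e \<sigma>) (nval f \<sigma>)"
proof -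
  have ij: "nval f \<sigma> div d < n" "nval f \<sigma> mod d < d" using l pos by (auto simp: less_mult_imp_div_less)
  define q1 where "q1 = nval f \<sigma> div d div bn"
  define q2 where "q2 = bn + nval f \<sigma> div d mod bn"
  define q3 where "q3 = 2 * bn + nval f \<sigma> mod d div bd"
  define q4 where "q4 = 2 * bn + (bd + nval f \<sigma> mod d mod bd)"
  have q: "q1 < 2 * bn + 2 * bd" "q2 < 2 * bn + 2 * bd" "q3 < 2 * bn + 2 * bd" "q4 < 2 * bn + 2 * bd"
    using digits(1,2)[OF ij(1)] digits(3,4)[OF ij(2)] unfolding q1_def q2_def q3_def q4_def by linarith+
  have W: "nv \<sigma> 20 (t * (2 * bd) + (s * (2 * bn) + (nval e \<sigma> * (2 * bn + 2 * bd) + q))) = ws ! nval e \<sigma> ! q"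
    if "q < 2 * bn + 2 * bd" for q
    using b r that by (simp add: bits_ok_def add.assoc)
  note W4 = W[OF q(1)] W[OF q(2)] W[OF q(3)] W[OF q(4)]
  show ?thesis
    using b W4 unfolding q1_def q2_def q3_def q4_def
    by (simp add: wx_bits_def table_expr_def bit_expr_def bits_ok_def entry_sign_def table_sign_def bit_sign_def add.assoc)
qed

definition SAf :: "nat list list \<Rightarrow> real mat \<Rightarrow> nat \<Rightarrow> nat \<Rightarrow> real" where
  "SAf ss A = (\<lambda>y j. \<Sum>i<n. table_sign 0 bn (ss ! y) i * A $$ (i, j))"
definition ATf :: "nat list list \<Rightarrow> real mat \<Rightarrow> nat \<Rightarrow> nat \<Rightarrow> real" where
  "ATf ts A = (\<lambda>i y. \<Sum>j<d. A $$ (i, j) * table_sign 0 bd (ts ! y) j)"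
definition Waf :: "nat list list \<Rightarrow> real mat \<Rightarrow> nat \<Rightarrow> real" where
  "Waf ws A = (\<lambda>r. \<Sum>l<n * d. entry_sign bn bd d (ws ! r) l * A $$ (l div d, l mod d))"

definition sketched :: "nat list list \<Rightarrow> nat list list \<Rightarrow> nat list list \<Rightarrow> real mat \<Rightarrow> state \<Rightarrow> bool" where
  "sketched ts ss ws A \<sigma> \<longleftrightarrow> bits_ok ts ss ws \<sigma> \<and> (\<forall>y<s. \<forall>j<d. rv \<sigma> 5 (y * d + j) = SAf ss A y j) \<and>
     (\<forall>i<n. \<forall>y<t. rv \<sigma> 6 (i * t + y) = ATf ts A i y) \<and> (\<forall>r<w. rv \<sigma> 7 r = Waf ws A r)"

lemma sketched_cong:
  assumes "sketched ts ss ws A \<sigma>" "\<And>a i. a \<in> {0, 20, 21, 22} \<Longrightarrow> nv \<sigma>' a i = nv \<sigma> a i"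
    "\<And>a i. a \<in> {5, 6, 7} \<Longrightarrow> rv \<sigma>' a i = rv \<sigma> a i"
  shows "sketched ts ss ws A \<sigma>'"
  using assms(1,3) bits_ok_cong[OF _ assms(2)] by (simp add: sketched_def)

lemma mult_add_eq_iff:
  fixes b :: nat
  assumes "q < b" "q' < b"
  shows "y * b + q = y' * b + q' \<longleftrightarrow> y = y' \<and> q = q'"
proof
  assume *: "y * b + q = y' * b + q'"
  have "(y * b + q) div b = y" "(y * b + q) mod b = q" "(y' * b + q') div b = y'" "(y' * b + q') mod b = q'"
    using assms by auto
  with * show "y = y' \<and> q = q'" by simp
qed simp

text \<open>The sketches are linear in A. An update of one entry adds \<delta> times a column of S
  to one column of S A, \<delta> times a row of T to one row of A T, and \<delta> times a column of
  W to W vec(A), so H bounds the work of all three loops up to a constant.\<close>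

lemma ok_apply_to_sketches:
  assumes f: "memok \<sigma>" and sk: "sketched ts ss ws A \<sigma>" and A: "A \<in> carrier_mat n d"
    and u: "nv \<sigma> 11 0 = p" "nv \<sigma> 12 0 = q" "rv \<sigma> 10 0 = \<delta>" "p < n" "q < d"
  shows "ok memok apply_to_sketches \<sigma> (30 * H) (\<lambda>\<sigma>'. same {30} {5, 6, 7} \<sigma> \<sigma>' \<and> sketched ts ss ws (apply_update (p, q, \<delta>) A) \<sigma>')"
proof -
  let ?A = "apply_update (p, q, \<delta>) A"
  let ?S = "\<lambda>y i. table_sign 0 bn (ss ! y) i" and ?T = "\<lambda>j y. table_sign 0 bd (ts ! y) j" and ?W = "\<lambda>r l. entry_sign bn bd d (ws ! r) l"
  have b: "bits_ok ts ss ws \<sigma>" using sk by (simp add: sketched_def)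
  have ent: "?A $$ (i, j) = A $$ (i, j) + (if i = p \<and> j = q then \<delta> else 0)" if "i < n" "j < d" for i j
    using that A by (simp add: apply_update_def)
  have SA': "SAf ss ?A y j = SAf ss A y j + (if j = q then ?S y p * \<delta> else 0)" if "j < d" for y j
  proof -
    have "SAf ss ?A y j = (\<Sum>i<n. ?S y i * (A $$ (i, j) + (if i = p \<and> j = q then \<delta> else 0)))"
      unfolding SAf_def using that by (intro sum.cong refl arg_cong2[of _ _ _ _ "(*)"] ent) auto
    then show ?thesis using u(4) sum_entry_update[of "{..<n}" p "?S y" "\<lambda>i. A $$ (i, j)" "j = q" \<delta>] by (simp add: SAf_def)
  qed
  have AT': "ATf ts ?A i y = ATf ts A i y + (if i = p then ?T q y * \<delta> else 0)" if "i < n" for i y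
  proof -
    have "ATf ts ?A i y = (\<Sum>j<d. ?T j y * (A $$ (i, j) + (if j = q \<and> i = p then \<delta> else 0)))"
      unfolding ATf_def using that by (intro sum.cong refl) (auto simp: ent)
    then show ?thesis using u(5) sum_entry_update[of "{..<d}" q "\<lambda>j. ?T j y" "\<lambda>j. A $$ (i, j)" "i = p" \<delta>]
      by (simp add: ATf_def mult.commute)
  qed
  have pq: "p * d + q < n * d" using u(4,5) mult_le_mono1[of "Suc p" n d] by simp
  have Wa': "Waf ws ?A r = Waf ws A r + ?W r (p * d + q) * \<delta>" for r
  proof -
    have "l div d = p \<and> l mod d = q \<longleftrightarrow> l = p * d + q" for l using u(5) by auto
    then have "?A $$ (l div d, l mod d) = A $$ (l div d, l mod d) + (if l = p * d + q \<and> True then \<delta> else 0)" if "l < n * d" for l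
      using ent[of "l div d" "l mod d"] that pos by (simp add: less_mult_imp_div_less)
    then have "Waf ws ?A r = (\<Sum>l<n * d. ?W r l * (A $$ (l div d, l mod d) + (if l = p * d + q \<and> True then \<delta> else 0)))"
      unfolding Waf_def by (intro sum.cong refl arg_cong2[of _ _ _ _ "(*)"]) auto
    then show ?thesis
      using pq sum_entry_update[of "{..<n * d}" "p * d + q" "?W r" "\<lambda>l. A $$ (l div d, l mod d)" True \<delta>]
      by (simp add: Waf_def)
  qed
  have B: "bits_ok ts ss ws \<sigma>' \<and> nv \<sigma>' 11 0 = p \<and> nv \<sigma>' 12 0 = q \<and> rv \<sigma>' 10 0 = \<delta>" if "same {30} {5, 6, 7} \<sigma> \<sigma>'" for \<sigma>'
    using bits_ok_same[OF b that] same_nv[OF that] same_rv[OF that] u by simp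
  have sizes: "nval Sn \<sigma>' = s" "nval Tn \<sigma>' = t" "nval Wn \<sigma>' = w" "nval Dn \<sigma>' = d" if "bits_ok ts ss ws \<sigma>'" for \<sigma>'
    using that by (simp_all add: bits_ok_def)
  have L: "1 \<le> LN 30" "VN 30 = H" by (simp_all add: LN_def VN_def)
  have tr: "same {30} {5, 6, 7} \<sigma> \<sigma>2" if "same {30} {5, 6, 7} \<sigma> \<sigma>1" "same {30} {a} \<sigma>1 \<sigma>2" "a \<in> {5, 6, 7}" for a \<sigma>1 \<sigma>2
    by (rule same_trans[OF that(1,2)]) (use that(3) in auto)
  let ?SAp = "\<lambda>\<sigma>'. same {30} {5, 6, 7} \<sigma> \<sigma>' \<and> (\<forall>y<s. \<forall>j<d. rv \<sigma>' 5 (y * d + j) = SAf ss ?A y j)"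
  let ?Q1 = "\<lambda>\<sigma>'. ?SAp \<sigma>' \<and> (\<forall>a\<in>{6, 7}. \<forall>i. rv \<sigma>' a i = rv \<sigma> a i)"
  let ?Q2 = "\<lambda>\<sigma>'. ?SAp \<sigma>' \<and> (\<forall>i<n. \<forall>y<t. rv \<sigma>' 6 (i * t + y) = ATf ts ?A i y) \<and> (\<forall>i. rv \<sigma>' 7 i = rv \<sigma> 7 i)"
  have 1: "ok memok (AddLoop 5 Sn (NAdd (NMul (NVar 30) Dn) (NVar 12)) (RMul (sx_bits (NVar 30) (NVar 11)) (RVar 10))) \<sigma> (s * 5 + 3) ?Q1"
  proof (rule ok_mono[OF ok_AddLoop[where B=s and h="\<lambda>y. y * d + q" and v="\<lambda>y. ?S y p * \<delta>"]])
    fix \<sigma>' assume sm: "same {30} {5} \<sigma> \<sigma>'"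
    note B' = B[OF tr[OF same_refl sm]]
    show "nval Sn \<sigma>' = s" using B' sizes by simp
    { fix y assume y: "nv \<sigma>' 30 0 = y" "y < s"
      have "y * d + q < s * d" using y u(5) mult_le_mono1[of "Suc y" s d] by simp
      then show "nval (NAdd (NMul (NVar 30) Dn) (NVar 12)) \<sigma>' = y * d + q \<and> y * d + q < LR 5"
        using y B' sizes by (simp add: LR_def)
      show "rval (RMul (sx_bits (NVar 30) (NVar 11)) (RVar 10)) \<sigma>' = ?S y p * \<delta>"
        using y B' u(4) sx_bits[of ts ss ws \<sigma>' "NVar 30" "NVar 11"] by simp }
  next
    fix \<sigma>' assume *: "same {30} {5} \<sigma> \<sigma>' \<and> (\<forall>m. rv \<sigma>' 5 m = rv \<sigma> 5 m + (\<Sum>y<s. if y * d + q = m then ?S y p * \<delta> else 0))"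
    have "rv \<sigma>' 5 (y * d + j) = SAf ss ?A y j" if "y < s" "j < d" for y j
    proof -
      have "(\<Sum>y'<s. if y' * d + q = y * d + j then ?S y' p * \<delta> else 0) = (\<Sum>y'<s. if y' = y then if j = q then ?S y p * \<delta> else 0 else 0)"
        using u(5) that by (intro sum.cong refl) (auto simp: mult_add_eq_iff)
      then show ?thesis using * sk that by (simp add: sketched_def SA')
    qed
    then show "?Q1 \<sigma>'" using tr[OF same_refl conjunct1[OF *]] same_rv[OF conjunct1[OF *]] by simp
  qed (use f L in \<open>auto simp: H_def\<close>)
  have 2: "ok memok (AddLoop 6 Tn (NAdd (NMul (NVar 11) Tn) (NVar 30)) (RMul (tx_bits (NVar 12) (NVar 30)) (RVar 10))) \<sigma>1 (t * 5 + 3) ?Q2"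
    if f1: "memok \<sigma>1" and Q1: "?Q1 \<sigma>1" for \<sigma>1
  proof (rule ok_mono[OF ok_AddLoop[where B=t and h="\<lambda>y. p * t + y" and v="\<lambda>y. ?T q y * \<delta>"]])
    fix \<sigma>' assume sm: "same {30} {6} \<sigma>1 \<sigma>'"
    have "same {30} {5, 6, 7} \<sigma> \<sigma>'" by (rule tr[OF _ sm]) (use Q1 in auto)
    note B' = B[OF this]
    show "nval Tn \<sigma>' = t" using B' sizes by simp
    { fix y assume y: "nv \<sigma>' 30 0 = y" "y < t"
      have "p * t + y < n * t" using y u(4) mult_le_mono1[of "Suc p" n t] by simp
      then show "nval (NAdd (NMul (NVar 11) Tn) (NVar 30)) \<sigma>' = p * t + y \<and> p * t + y < LR 6"
        using y B' sizes by (simp add: LR_def)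
      show "rval (RMul (tx_bits (NVar 12) (NVar 30)) (RVar 10)) \<sigma>' = ?T q y * \<delta>"
        using y B' u(5) tx_bits[of ts ss ws \<sigma>' "NVar 12" "NVar 30"] by simp }
  next
    fix \<sigma>' assume *: "same {30} {6} \<sigma>1 \<sigma>' \<and> (\<forall>m. rv \<sigma>' 6 m = rv \<sigma>1 6 m + (\<Sum>y<t. if p * t + y = m then ?T q y * \<delta> else 0))"
    have "rv \<sigma>' 6 (i * t + y) = ATf ts ?A i y" if "i < n" "y < t" for i y
    proof -
      have "(\<Sum>y'<t. if p * t + y' = i * t + y then ?T q y' * \<delta> else 0) = (\<Sum>y'<t. if y' = y then if i = p then ?T q y * \<delta> else 0 else 0)"
        using that by (intro sum.cong refl) (auto simp: mult_add_eq_iff)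
      then show ?thesis using * sk Q1 that by (simp add: sketched_def AT')
    qed
    moreover have "same {30} {5, 6, 7} \<sigma> \<sigma>'" by (rule tr[OF _ conjunct1[OF *]]) (use Q1 in auto)
    ultimately show "?Q2 \<sigma>'" using Q1 same_rv[OF conjunct1[OF *]] by simp
  qed (use f1 L in \<open>auto simp: H_def\<close>)
  have 3: "ok memok (AddLoop 7 Wn (NVar 30) (RMul (wx_bits (NVar 30) (NAdd (NMul (NVar 11) Dn) (NVar 12))) (RVar 10))) \<sigma>2 (w * 5 + 3)
     (\<lambda>\<sigma>'. same {30} {5, 6, 7} \<sigma> \<sigma>' \<and> sketched ts ss ws ?A \<sigma>')" if f2: "memok \<sigma>2" and Q2: "?Q2 \<sigma>2" for \<sigma>2
  proof (rule ok_mono[OF ok_AddLoop[where B=w and h="\<lambda>r. r" and v="\<lambda>r. ?W r (p * d + q) * \<delta>"]])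
    fix \<sigma>' assume sm: "same {30} {7} \<sigma>2 \<sigma>'"
    have "same {30} {5, 6, 7} \<sigma> \<sigma>'" by (rule tr[OF _ sm]) (use Q2 in auto)
    note B' = B[OF this]
    show "nval Wn \<sigma>' = w" using B' sizes by simp
    { fix r assume r: "nv \<sigma>' 30 0 = r" "r < w"
      show "nval (NVar 30) \<sigma>' = r \<and> r < LR 7" using r by (simp add: LR_def)
      show "rval (RMul (wx_bits (NVar 30) (NAdd (NMul (NVar 11) Dn) (NVar 12))) (RVar 10)) \<sigma>' = ?W r (p * d + q) * \<delta>"
        using r B' pq sizes[of \<sigma>'] wx_bits[of ts ss ws \<sigma>' "NVar 30" "NAdd (NMul (NVar 11) Dn) (NVar 12)"] by simp }
  next
    fix \<sigma>' assume *: "same {30} {7} \<sigma>2 \<sigma>' \<and> (\<forall>m. rv \<sigma>' 7 m = rv \<sigma>2 7 m + (\<Sum>r<w. if r = m then ?W r (p * d + q) * \<delta> else 0))"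
    have "rv \<sigma>' 7 r = Waf ws ?A r" if "r < w" for r
      using * sk Q2 that by (simp add: sketched_def Wa')
    moreover have sm: "same {30} {5, 6, 7} \<sigma> \<sigma>'" by (rule tr[OF _ conjunct1[OF *]]) (use Q2 in auto)
    ultimately show "same {30} {5, 6, 7} \<sigma> \<sigma>' \<and> sketched ts ss ws ?A \<sigma>'"
      using Q2 same_rv[OF conjunct1[OF *]] B[OF sm] by (simp add: sketched_def)
  qed (use f2 L in \<open>auto simp: H_def\<close>)
  have "ok memok apply_to_sketches \<sigma> ((s * 5 + 3) + ((t * 5 + 3) + (w * 5 + 3) + 1) + 1)
     (\<lambda>\<sigma>'. same {30} {5, 6, 7} \<sigma> \<sigma>' \<and> sketched ts ss ws ?A \<sigma>')"
    unfolding apply_to_sketches_def by (intro ok_Seq[OF 1] ok_Seq[OF 2] 3)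
  then show ?thesis by (rule ok_mono) (use pos in \<open>auto simp: H_def\<close>)
qed

lemma ok_read_stream:
  assumes f: "memok \<sigma>" and b: "sketched ts ss ws (0\<^sub>m n d) \<sigma>" and us: "valid_stream n d us" and inp: "input \<sigma> = us"
  shows "ok memok read_stream \<sigma> ((length us + 1) * (40 * H)) (sketched ts ss ws (stream_mat n d us))"
proof -
  let ?A = "\<lambda>i. stream_mat n d (take i us)"
  have carrier: "?A i \<in> carrier_mat n d" for i
  proof -
    have upd: "apply_update u M \<in> carrier_mat n d" if "M \<in> carrier_mat n d" for u M
      using that by (cases u) (simp add: apply_update_def)
    have "M \<in> carrier_mat n d \<Longrightarrow> fold apply_update vs M \<in> carrier_mat n d" for vs M
      by (induction vs arbitrary: M) (simp_all add: upd)
    then show ?thesis by (simp add: stream_mat_def)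
  qed
  \<comment> \<open>The loop reads one update ahead: the first i updates have been applied, and
    update i has been fetched but not applied.\<close>
  let ?J = "\<lambda>i \<sigma>'. sketched ts ss ws (?A i) \<sigma>' \<and> (if i < length us
     then nv \<sigma>' 10 0 = 1 \<and> (nv \<sigma>' 11 0, nv \<sigma>' 12 0, rv \<sigma>' 10 0) = us ! i \<and> input \<sigma>' = drop (Suc i) us
     else nv \<sigma>' 10 0 = 0)"
  have nxt: "ok memok (Next 10 11 12 10) \<sigma>1 1 (?J i)"
    if f1: "memok \<sigma>1" and sk: "sketched ts ss ws (?A i) \<sigma>1" and i: "i \<le> length us" "input \<sigma>1 = drop i us" for \<sigma>1 i
  proof (rule ok_atom)
    show "step (Next 10 11 12 10) \<sigma>1 = return_pmf (Halt, read_next 10 11 12 10 \<sigma>1)" by simp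
    have L: "0 < LN 10" "0 < LN 11" "0 < LN 12" "0 < LR 10" "VN 10 = H" "VN 11 = H" "VN 12 = H"
      by (simp_all add: LN_def LR_def VN_def)
    show "memok (read_next 10 11 12 10 \<sigma>1)" "?J i (read_next 10 11 12 10 \<sigma>1)"
    proof (atomize (full), cases "i < length us")
      case True
      obtain p q \<delta> where u: "us ! i = (p, q, \<delta>)" by (cases "us ! i") auto
      then have "(p, q, \<delta>) \<in> set us" using True by (metis nth_mem)
      then have pq: "p < n" "q < d" using us by (auto simp: valid_stream_def)
      have inp1: "input \<sigma>1 = (p, q, \<delta>) # drop (Suc i) us" using True i u by (simp add: Cons_nth_drop_Suc[symmetric])
      have rn: "read_next 10 11 12 10 \<sigma>1 = put_nat 10 0 1 (put_nat 11 0 p (put_nat 12 0 q (put_real 10 0 \<delta> (\<sigma>1\<lparr>input := drop (Suc i) us\<rparr>))))"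
        by (simp add: read_next_def inp1)
      have "p \<le> H" "q \<le> H" "1 \<le> H" using pq pos by (auto simp: H_def)
      then have "memok (read_next 10 11 12 10 \<sigma>1)"
        unfolding rn using f1 L by (intro fits_put_nat fits_put_real) auto
      moreover have "sketched ts ss ws (?A i) (read_next 10 11 12 10 \<sigma>1)"
        unfolding rn by (rule sketched_cong[OF sk]) auto
      ultimately show "memok (read_next 10 11 12 10 \<sigma>1) \<and> ?J i (read_next 10 11 12 10 \<sigma>1)"
        using True u unfolding rn by simp
    next
      case False
      then have rn: "read_next 10 11 12 10 \<sigma>1 = put_nat 10 0 0 \<sigma>1" using i by (simp add: read_next_def)
      have "memok (put_nat 10 0 0 \<sigma>1)" using f1 L by (intro fits_put_nat) auto
      moreover have "sketched ts ss ws (?A i) (put_nat 10 0 0 \<sigma>1)" by (rule sketched_cong[OF sk]) auto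
      ultimately show "memok (read_next 10 11 12 10 \<sigma>1) \<and> ?J i (read_next 10 11 12 10 \<sigma>1)"
        using False unfolding rn by simp
    qed
  qed (use f1 in auto)
  have "ok memok read_stream \<sigma> (1 + (length us * ((30 * H + 1 + 1) + 2) + 1) + 1) (?J (length us))"
    unfolding read_stream_def
  proof (rule ok_Seq)
    show "ok memok (Next 10 11 12 10) \<sigma> 1 (?J 0)"
      using f b inp by (intro nxt) (auto simp: stream_mat_def)
    fix \<sigma>1 assume f1: "memok \<sigma>1" and J0: "?J 0 \<sigma>1"
    show "ok memok (Loop (NLess (NLit 0) (NVar 10)) (Seq apply_to_sketches (Next 10 11 12 10))) \<sigma>1
       (length us * ((30 * H + 1 + 1) + 2) + 1) (?J (length us))"
    proof (rule ok_Loop[where J="?J"])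
      fix i \<sigma>2 assume "i \<le> length us" "?J i \<sigma>2"
      then show "bval (NLess (NLit 0) (NVar 10)) \<sigma>2 \<longleftrightarrow> i < length us" by (auto split: if_splits)
    next
      fix i \<sigma>2 assume i: "i < length us" "memok \<sigma>2" "?J i \<sigma>2"
      obtain p q \<delta> where u: "us ! i = (p, q, \<delta>)" by (cases "us ! i") auto
      then have "(p, q, \<delta>) \<in> set us" using i by (metis nth_mem)
      then have pq: "p < n" "q < d" using us by (auto simp: valid_stream_def)
      have step: "?A (Suc i) = apply_update (p, q, \<delta>) (?A i)"
        using i by (simp add: stream_mat_def take_Suc_conv_app_nth u)
      show "ok memok (Seq apply_to_sketches (Next 10 11 12 10)) \<sigma>2 (30 * H + 1 + 1) (?J (Suc i))"
      proof (rule ok_Seq)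
        show "ok memok apply_to_sketches \<sigma>2 (30 * H) (\<lambda>\<sigma>'. same {30} {5, 6, 7} \<sigma>2 \<sigma>' \<and> sketched ts ss ws (?A (Suc i)) \<sigma>')"
          unfolding step by (rule ok_apply_to_sketches[OF i(2) _ carrier]) (use i u pq in auto)
        fix \<sigma>3 assume "memok \<sigma>3" "same {30} {5, 6, 7} \<sigma>2 \<sigma>3 \<and> sketched ts ss ws (?A (Suc i)) \<sigma>3"
        then show "ok memok (Next 10 11 12 10) \<sigma>3 1 (?J (Suc i))"
          using i by (intro nxt) (auto simp: same_input)
      qed
    qed (use f1 J0 in auto)
  qed
  then show ?thesis
  proof (rule ok_mono)
    have "length us * (30 * H + 1 + 1 + 2) \<le> length us * (40 * H)" using pos by (intro mult_le_mono2) (auto simp: H_def)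
    moreover have "3 \<le> 40 * H" using pos by (auto simp: H_def)
    ultimately show "1 + (length us * ((30 * H + 1 + 1) + 2) + 1) + 1 \<le> (length us + 1) * (40 * H)"
      unfolding add_mult_distrib by linarith
  qed auto
qed

end

context stream_sizes
begin

definition total_time :: "nat \<Rightarrow> nat" where
  "total_time m = 40 * H + (len * 5 + 3 + ((m + 1) * (40 * H) + 250 * H ^ 3 * (2 * n + 1) ^ (s * k) + 1) + 1) + 1"

text \<open>Cells that were never written read as 0, which is also the sketch of the zero matrix, so
  the sketches need no initialisation.\<close>

lemma sketched_start:
  assumes \<sigma>1: "nv \<sigma>1 0 0 = n" "nv \<sigma>1 0 1 = d" "nv \<sigma>1 0 2 = k" "nv \<sigma>1 0 3 = t" "nv \<sigma>1 0 4 = s" "nv \<sigma>1 0 5 = w"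
      "nv \<sigma>1 21 0 = bn" "nv \<sigma>1 22 0 = bd" "\<And>a i. a \<in> {5, 6, 7} \<Longrightarrow> rv \<sigma>1 a i = 0"
    and ts: "ts \<in> set_pmf (replicate_pmf t (replicate_pmf (2 * bd) coin))"
    and ss: "ss \<in> set_pmf (replicate_pmf s (replicate_pmf (2 * bn) coin))"
    and ws: "ws \<in> set_pmf (replicate_pmf w (replicate_pmf (2 * bn + 2 * bd) coin))"
  shows "sketched ts ss ws (0\<^sub>m n d) (\<sigma>1\<lparr>nats := (nats \<sigma>1)(20 := concat ts @ concat ss @ concat ws, 28 := [len])\<rparr>)"
    (is "sketched _ _ _ _ ?\<sigma>")
proof -
  have T: "length ts = t" "\<And>x. x \<in> set ts \<Longrightarrow> length x = 2 * bd"
    and S: "length ss = s" "\<And>x. x \<in> set ss \<Longrightarrow> length x = 2 * bn"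
    and W: "length ws = w" "\<And>x. x \<in> set ws \<Longrightarrow> length x = 2 * bn + 2 * bd"
    using ts ss ws by (auto simp: set_replicate_pmf)
  have lT: "length (concat ts) = t * (2 * bd)" using length_concat_blocks[of ts "2 * bd"] T by simp
  have lS: "length (concat ss) = s * (2 * bn)" using length_concat_blocks[of ss "2 * bn"] S by simp
  have lW: "length (concat ws) = w * (2 * bn + 2 * bd)" using length_concat_blocks[of ws "2 * bn + 2 * bd"] W by simp
  have nvs: "nv ?\<sigma> a i = nv \<sigma>1 a i" if "a \<noteq> 20" "a \<noteq> 28" for a i using that by (simp add: nv_def)
  have nv20: "nv ?\<sigma> 20 i = fetch (concat ts @ concat ss @ concat ws) i" for i by (simp add: nv_def)
  have rvs: "rv ?\<sigma> a i = rv \<sigma>1 a i" for a i by (simp add: rv_def)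
  have block: "y * b + q < m * b" if "y < m" "q < b" for y q m b :: nat
    using that mult_le_mono1[of "Suc y" m b] by simp
  have left: "fetch (xs @ ys) i = xs ! i" if "i < length xs" for xs ys :: "nat list" and i
    using that by (simp add: fetch_def nth_append)
  have right: "fetch (xs @ ys) (length xs + i) = fetch ys i" for xs ys :: "nat list" and i
    by (simp add: fetch_def nth_append)
  have b1: "nv ?\<sigma> 20 (y * (2 * bd) + q) = ts ! y ! q" if "y < t" "q < 2 * bd" for y q
  proof -
    have "y * (2 * bd) + q < length (concat ts)" using block[OF that] lT by simp
    moreover have "concat ts ! (y * (2 * bd) + q) = ts ! y ! q"
      by (rule nth_concat_blocks) (use T that in auto)
    ultimately show ?thesis by (simp add: nv20 left)
  qed
  have b2: "nv ?\<sigma> 20 (t * (2 * bd) + y * (2 * bn) + q) = ss ! y ! q" if "y < s" "q < 2 * bn" for y q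
  proof -
    have "y * (2 * bn) + q < length (concat ss)" using block[OF that] lS by simp
    moreover have "concat ss ! (y * (2 * bn) + q) = ss ! y ! q"
      by (rule nth_concat_blocks) (use S that in auto)
    ultimately show ?thesis unfolding nv20 lT[symmetric] by (simp add: add.assoc right left)
  qed
  have b3: "nv ?\<sigma> 20 (t * (2 * bd) + s * (2 * bn) + r * (2 * bn + 2 * bd) + q) = ws ! r ! q" if "r < w" "q < 2 * bn + 2 * bd" for r q
  proof -
    have "r * (2 * bn + 2 * bd) + q < length (concat ws)" using block[OF that] lW by simp
    moreover have "concat ws ! (r * (2 * bn + 2 * bd) + q) = ws ! r ! q"
      by (rule nth_concat_blocks) (use W that in auto)
    ultimately show ?thesis unfolding nv20 lT[symmetric] lS[symmetric] by (simp add: add.assoc right fetch_def)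
  qed
  have "bits_ok ts ss ws ?\<sigma>" unfolding bits_ok_def using b1 b2 b3 \<sigma>1(1-8) by (simp add: nvs)
  moreover have "SAf ss (0\<^sub>m n d) y j = 0" if "j < d" for y j using that by (simp add: SAf_def)
  moreover have "ATf ts (0\<^sub>m n d) i y = 0" if "i < n" for i y using that by (simp add: ATf_def)
  moreover have "Waf ws (0\<^sub>m n d) r = 0" for r using pos by (simp add: Waf_def less_mult_imp_div_less)
  ultimately show ?thesis using \<sigma>1(9) by (simp add: sketched_def rvs)
qed

lemma ok_read_and_search:
  assumes f: "memok \<sigma>" and b: "sketched ts ss ws (0\<^sub>m n d) \<sigma>" and us: "valid_stream n d us" and inp: "input \<sigma> = us"
  defines "A \<equiv> stream_mat n d us"
  shows "ok memok (Seq read_stream (search tx_bits wx_bits)) \<sigma> ((length us + 1) * (40 * H) + 250 * H ^ 3 * (2 * n + 1) ^ (s * k) + 1)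
     (\<lambda>\<sigma>'. \<exists>m. sketch_search.best n d k s t w (\<lambda>j y. table_sign 0 bd (ts ! y) j) (\<lambda>r l. entry_sign bn bd d (ws ! r) l)
          (SAf ss A) (ATf ts A) (Waf ws A) m \<and>
        (\<forall>i<n. nv \<sigma>' 1 i = sketch_search.cand_labels n d k s t (\<lambda>j y. table_sign 0 bd (ts ! y) j) (SAf ss A) (ATf ts A) m i) \<and>
        (\<forall>a<k. \<forall>j<d. rv \<sigma>' 1 (a * d + j) = sketch_search.cand_centers n k s (SAf ss A) m a j))"
proof -
  interpret ram: ram_search n d k s t w "\<lambda>j y. table_sign 0 bd (ts ! y) j" "\<lambda>r l. entry_sign bn bd d (ws ! r) l"
    "SAf ss A" "ATf ts A" "Waf ws A" tx_bits wx_bits "sketched ts ss ws A" H LN VN LR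
  proof
    fix \<sigma> assume D: "sketched ts ss ws A \<sigma>"
    then have b: "bits_ok ts ss ws \<sigma>" by (simp add: sketched_def)
    from b show "nv \<sigma> 0 0 = n" "nv \<sigma> 0 (Suc 0) = d" "nv \<sigma> 0 2 = k" "nv \<sigma> 0 3 = t" "nv \<sigma> 0 4 = s" "nv \<sigma> 0 5 = w"
      by (simp_all add: bits_ok_def)
    from D show "y < s \<Longrightarrow> j < d \<Longrightarrow> rv \<sigma> 5 (y * d + j) = SAf ss A y j" for y j by (simp add: sketched_def)
    from D show "i < n \<Longrightarrow> y < t \<Longrightarrow> rv \<sigma> 6 (i * t + y) = ATf ts A i y" for i y by (simp add: sketched_def)
    from D show "r < w \<Longrightarrow> rv \<sigma> 7 r = Waf ws A r" for r by (simp add: sketched_def)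
    show "nval e \<sigma> < d \<Longrightarrow> nval f \<sigma> < t \<Longrightarrow> rval (tx_bits e f) \<sigma> = table_sign 0 bd (ts ! nval f \<sigma>) (nval e \<sigma>)" for e f
      by (rule tx_bits[OF b])
    show "nval e \<sigma> < w \<Longrightarrow> nval f \<sigma> < n * d \<Longrightarrow> rval (wx_bits e f) \<sigma> = entry_sign bn bd d (ws ! nval e \<sigma>) (nval f \<sigma>)" for e f
      by (rule wx_bits[OF b])
    show "sketched ts ss ws A \<sigma>'" if "same workN workR \<sigma> \<sigma>'" for \<sigma>'
      using same_nv[OF that] same_rv[OF that] by (intro sketched_cong[OF D]) (auto simp: workN_def workR_def)
  next
    show "1 \<le> LN a" if "a \<in> {30..38}" for a using that by (auto simp: LN_def)
    show "H \<le> VN a" if "a \<in> {30..35}" for a using that by (auto simp: VN_def)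
    show "(2 * n + 1) ^ (s * k) \<le> VN a" if "a \<in> {36..38}" for a using that by (auto simp: VN_def)
  qed (use pos in \<open>auto simp: H_def LN_def VN_def LR_def mult.commute\<close>)
  show ?thesis
  proof (rule ok_Seq[THEN ok_mono])
    show "ok memok read_stream \<sigma> ((length us + 1) * (40 * H)) (sketched ts ss ws A)"
      unfolding A_def by (rule ok_read_stream[OF f b us inp])
    show "ok memok (search tx_bits wx_bits) \<sigma>1 (250 * H ^ 3 * (2 * n + 1) ^ (s * k))
      (\<lambda>\<sigma>'. \<exists>m. ram.best m \<and> ram.stored (ram.cand_centers m) (ram.cand_labels m) \<sigma>')"
      if "memok \<sigma>1" "sketched ts ss ws A \<sigma>1" for \<sigma>1
      by (rule ram.ok_search[OF that])
  qed (auto simp: ram.stored_def)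
qed

lemma runs_unique: "runs P c \<sigma> T (return_pmf a) \<Longrightarrow> runs P c \<sigma> T (return_pmf b) \<Longrightarrow> a = b"
  by (simp add: runs_def)

lemma lg_bounds: "lg \<ge> 1" "ln (real n) \<le> real lg"
proof -
  show 1: "lg \<ge> 1" using lg(1) pos by (cases lg) auto
  have "real n \<le> 2 ^ lg" using lg(1) by (metis of_nat_le_iff of_nat_numeral of_nat_power)
  then have "ln (real n) \<le> ln (2 ^ lg)" using pos by (intro ln_mono) auto
  also have "\<dots> = real lg * ln 2" by (simp add: ln_realpow)
  also have "\<dots> \<le> real lg * 1" using ln_2_less_1 by (intro mult_left_mono) auto
  finally show "ln (real n) \<le> real lg" by simp
qed

text \<open>The program replaces both logarithms by multiples of lg \<ge> 1. From k \<le> n one gets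
  ln (n k) \<le> 2 lg, so 16200 (2 lg + 12) \<le> 226800 lg with 226800 = 14 * 16200. Likewise ln (2
  n + 1) \<le> 3 lg gives 243000 = 15 * 16200.\<close>

lemma sizes_suffice:
  assumes "k \<le> n"
  shows "real s * \<epsilon> \<ge> 320000 * real k" "real t * \<epsilon>\<^sup>2 \<ge> 16200 * (ln (real n * real k) + 12)"
    "real w * \<epsilon>\<^sup>2 \<ge> 16200 * (real (s * k) * ln (2 * real n + 1) + 12)" "s \<ge> 1"
proof -
  have \<epsilon>2: "\<epsilon>\<^sup>2 > 0" using \<epsilon> by simp
  have "real (320000 * k) / \<epsilon> \<le> real s" unfolding s_def by linarith
  then show s: "real s * \<epsilon> \<ge> 320000 * real k" using \<epsilon> by (simp add: pos_divide_le_eq)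
  show s1: "s \<ge> 1" using s pos by (cases s) auto
  have "real (226800 * lg) / \<epsilon>\<^sup>2 \<le> real t" unfolding t_def by linarith
  then have t: "real t * \<epsilon>\<^sup>2 \<ge> 226800 * real lg" using \<epsilon>2 by (simp add: pos_divide_le_eq)
  have "ln (real n * real k) = ln (real n) + ln (real k)" using pos by (simp add: ln_mult)
  also have "ln (real k) \<le> ln (real n)" using assms pos by (intro ln_mono) auto
  finally have "ln (real n * real k) \<le> 2 * real lg" using lg_bounds by simp
  then show "real t * \<epsilon>\<^sup>2 \<ge> 16200 * (ln (real n * real k) + 12)" using t lg_bounds(1) by simp
  have "real (243000 * (s * (k * lg))) / \<epsilon>\<^sup>2 \<le> real w" unfolding w_def by linarith
  then have w: "real w * \<epsilon>\<^sup>2 \<ge> 243000 * (real (s * k) * real lg)" using \<epsilon>2 by (simp add: pos_divide_le_eq mult.assoc)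
  have "ln (2 * real n + 1) \<le> 3 * real lg" using ln_twice_succ_le[OF pos(1)] lg_bounds by simp
  then have "real (s * k) * ln (2 * real n + 1) \<le> real (s * k) * (3 * real lg)" by (intro mult_left_mono) auto
  moreover have "1 \<le> real (s * k) * real lg"
  proof -
    have "1 \<le> s * k * lg" using s1 pos lg_bounds(1) by simp
    then have "real 1 \<le> real (s * k * lg)" by (simp only: of_nat_le_iff)
    then show ?thesis by simp
  qed
  moreover have "16200 * (b + 12) \<le> v" if "b \<le> p * (3 * l)" "1 \<le> p * l" "243000 * (p * l) \<le> v" for b p l v :: real
  proof -
    have "b \<le> 3 * (p * l)" using that by (simp add: mult.left_commute)
    then show ?thesis using that by argo
  qed
  ultimately show "real w * \<epsilon>\<^sup>2 \<ge> 16200 * (real (s * k) * ln (2 * real n + 1) + 12)" using w by blast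
qed

lemma runs_stream_kmeans:
  assumes us: "valid_stream n d us" and kn: "k \<le> n"
  shows "\<exists>D. runs memok stream_kmeans (stream_input n d k \<epsilon> us) (total_time (length us)) D \<and>
     measure_pmf.prob (map_pmf (Pair Halt) D) (outputs_approx \<epsilon> k (stream_mat n d us)) \<ge> 2 / 3"
proof -
  define \<sigma>0 where "\<sigma>0 = stream_input n d k \<epsilon> us"
  define A where "A = stream_mat n d us"
  have A: "A \<in> carrier_mat n d"
  proof -
    have upd: "apply_update u M \<in> carrier_mat n d" if "M \<in> carrier_mat n d" for u M
      using that by (cases u) (simp add: apply_update_def)
    have "M \<in> carrier_mat n d \<Longrightarrow> fold apply_update vs M \<in> carrier_mat n d" for vs M
      by (induction vs arbitrary: M) (simp_all add: upd)
    then show ?thesis by (simp add: A_def stream_mat_def)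
  qed
  \<comment> \<open>Capacity 0 says that these two arrays stay empty while the sizes are computed,
    as \<open>runs_draw_bits\<close> demands.\<close>
  let ?LN = "LN(20 := 0, 28 := 0)"
  have "fits ?LN VN LR \<sigma>0"
    unfolding fits_def \<sigma>0_def stream_input_def by (auto simp: LN_def VN_def LR_def H_def)
  then have "ok (fits ?LN VN LR) set_sizes \<sigma>0 (40 * H) (\<lambda>\<sigma>'. same {0, 21, 22, 23, 24} {} \<sigma>0 \<sigma>' \<and>
     nv \<sigma>' 0 0 = n \<and> nv \<sigma>' 0 1 = d \<and> nv \<sigma>' 0 2 = k \<and> nv \<sigma>' 0 3 = t \<and> nv \<sigma>' 0 4 = s \<and> nv \<sigma>' 0 5 = w \<and>
     nv \<sigma>' 21 0 = bn \<and> nv \<sigma>' 22 0 = bd)"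
    by (rule ok_set_sizes) (auto simp: LN_def \<sigma>0_def stream_input_def nv_def rv_def fetch_def)
  then obtain \<sigma>1 where r1: "runs (fits ?LN VN LR) set_sizes \<sigma>0 (40 * H) (return_pmf \<sigma>1)"
    and sm1: "same {0, 21, 22, 23, 24} {} \<sigma>0 \<sigma>1"
    and v1: "nv \<sigma>1 0 0 = n" "nv \<sigma>1 0 1 = d" "nv \<sigma>1 0 2 = k" "nv \<sigma>1 0 3 = t" "nv \<sigma>1 0 4 = s" "nv \<sigma>1 0 5 = w"
     "nv \<sigma>1 21 0 = bn" "nv \<sigma>1 22 0 = bd" unfolding ok_def by blast
  have f1: "fits ?LN VN LR \<sigma>1" using runs_final[OF r1] by simp
  have weaken: "memok \<sigma>" if "fits ?LN VN LR \<sigma>" for \<sigma>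
    unfolding fits_def
  proof
    fix a
    have "length (nats \<sigma> a) \<le> ?LN a \<and> (\<forall>v\<in>set (nats \<sigma> a). v \<le> VN a) \<and> length (reals \<sigma> a) \<le> LR a"
      using that unfolding fits_def by blast
    moreover have "?LN a \<le> LN a" by simp
    ultimately show "length (nats \<sigma> a) \<le> LN a \<and> (\<forall>v\<in>set (nats \<sigma> a). v \<le> VN a) \<and> length (reals \<sigma> a) \<le> LR a"
      using order_trans by blast
  qed
  have r1': "runs memok set_sizes \<sigma>0 (40 * H) (return_pmf \<sigma>1)" using r1 weaken unfolding runs_def by blast
  have e1: "nats \<sigma>1 20 = []" "nats \<sigma>1 28 = []"
    using f1 unfolding fits_def by (auto dest: spec[of _ 20] spec[of _ 28])
  have rv0: "rv \<sigma>1 a i = 0" if "a \<in> {5, 6, 7}" for a i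
    using same_rv[OF sm1, of a i] that by (auto simp: \<sigma>0_def stream_input_def rv_def fetch_def)
  define cat where "cat = (\<lambda>(ts, ss, ws). concat ts @ concat ss @ concat ws :: nat list)"
  define st where "st l = \<sigma>1\<lparr>nats := (nats \<sigma>1)(20 := l, 28 := [len])\<rparr>" for l
  define PP where "PP = pair_pmf (replicate_pmf t (replicate_pmf (2 * bd) coin))
     (pair_pmf (replicate_pmf s (replicate_pmf (2 * bn) coin)) (replicate_pmf w (replicate_pmf (2 * bn + 2 * bd) coin)))"
  have PP: "map_pmf cat PP = replicate_pmf len coin"
    unfolding PP_def cat_def len_def by (rule replicate_three_blocks)
  have r2: "runs memok draw_bits \<sigma>1 (len * 5 + 3) (map_pmf (\<lambda>x. st (cat x)) PP)"
    using runs_draw_bits[OF weaken[OF f1] e1 v1(4-8)]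
    by (simp add: st_def PP[symmetric] pmf.map_comp o_def)
  let ?c = "Seq read_stream (search tx_bits wx_bits)"
  let ?T = "(length us + 1) * (40 * H) + 250 * H ^ 3 * (2 * n + 1) ^ (s * k) + 1"
  \<comment> \<open>\<open>runs_Seq\<close> needs the final state as a function of the intermediate
    state. It is chosen here, and \<open>runs_unique\<close> identifies it with the state whose
    output is known.\<close>
  define fin where "fin \<sigma> = (SOME \<sigma>'. runs memok ?c \<sigma> ?T (return_pmf \<sigma>'))" for \<sigma>
  define best' where "best' ts ss ws = sketch_search.best n d k s t w (\<lambda>j y. table_sign 0 bd (ts ! y) j)
      (\<lambda>r l. entry_sign bn bd d (ws ! r) l) (SAf ss A) (ATf ts A) (Waf ws A)" for ts ss ws
  define lab' where "lab' ts ss = sketch_search.cand_labels n d k s t (\<lambda>j y. table_sign 0 bd (ts ! y) j) (SAf ss A) (ATf ts A)" for ts ss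
  define cen' where "cen' ss = sketch_search.cand_centers n k s (SAf ss A)" for ss
  define Q where "Q = (\<lambda>(ts, ss, ws) \<sigma>'. \<exists>m. best' ts ss ws m \<and>
        (\<forall>i<n. nv \<sigma>' 1 i = lab' ts ss m i) \<and> (\<forall>a<k. \<forall>j<d. rv \<sigma>' 1 (a * d + j) = cen' ss m a j))"
  have final: "runs memok ?c (st (cat x)) ?T (return_pmf (fin (st (cat x)))) \<and> Q x (fin (st (cat x)))"
    if x: "x \<in> set_pmf PP" for x
  proof -
    obtain ts ss ws where x_eq: "x = (ts, ss, ws)" by (cases x) auto
    have mem: "memok (st (cat x))" using runs_final[OF r2] x by auto
    have sk: "sketched ts ss ws (0\<^sub>m n d) (st (cat x))"
      unfolding st_def x_eq cat_def prod.case
      by (rule sketched_start[OF v1 rv0]) (use x in \<open>auto simp: x_eq PP_def\<close>)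
    have inp: "input (st (cat x)) = us"
      using same_input[OF sm1] by (simp add: st_def \<sigma>0_def stream_input_def)
    have "ok memok ?c (st (cat x)) ?T (Q x)"
      unfolding Q_def x_eq prod.case best'_def lab'_def cen'_def A_def
      by (rule ok_read_and_search) (use mem sk us inp in \<open>auto simp: x_eq\<close>)
    then obtain \<sigma>' where \<sigma>': "runs memok ?c (st (cat x)) ?T (return_pmf \<sigma>')" "Q x \<sigma>'" unfolding ok_def by blast
    then have "runs memok ?c (st (cat x)) ?T (return_pmf (fin (st (cat x))))"
      unfolding fin_def by (intro someI)
    then show ?thesis using \<sigma>' runs_unique by blast
  qed
  define D where "D = map_pmf (\<lambda>x. fin (st (cat x))) PP"
  have "runs memok stream_kmeans \<sigma>0 (total_time (length us)) (bind_pmf (return_pmf \<sigma>1)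
     (\<lambda>_. bind_pmf (map_pmf (\<lambda>x. st (cat x)) PP) (\<lambda>\<sigma>. return_pmf (fin \<sigma>))))"
    unfolding stream_kmeans_def total_time_def
  proof (rule runs_Seq[OF r1'])
    fix \<sigma>' assume "\<sigma>' \<in> set_pmf (return_pmf \<sigma>1)"
    then have "\<sigma>' = \<sigma>1" by simp
    show "runs memok (Seq draw_bits ?c) \<sigma>' (len * 5 + 3 + ?T + 1) (bind_pmf (map_pmf (\<lambda>x. st (cat x)) PP) (\<lambda>\<sigma>. return_pmf (fin \<sigma>)))"
      unfolding \<open>\<sigma>' = \<sigma>1\<close> by (rule runs_Seq[OF r2]) (use final in auto)
  qed
  then have R: "runs memok stream_kmeans \<sigma>0 (total_time (length us)) D"
    by (simp add: bind_return_pmf D_def map_pmf_def[symmetric] pmf.map_comp o_def)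
  obtain f where f: "\<And>i. i < n \<Longrightarrow> f i < k"
    and opt: "kcost n d f (centroid n f (\<lambda>i j. A $$ (i, j))) (\<lambda>i j. A $$ (i, j)) \<le> kmeans_opt k A"
    using kmeans_opt_attained[OF A pos(3)] by blast
  define G where "G = {(ts, ss, ws). \<forall>m. best' ts ss ws m \<longrightarrow>
     kcost n d (lab' ts ss m) (cen' ss m) (\<lambda>i j. A $$ (i, j)) \<le> (1 + \<epsilon>) * kmeans_opt k A}"
  have n1: "n \<ge> 1" using pos by simp
  have gT: "good4 (replicate_pmf (2 * bd) coin) (table_sign 0 bd) {..<d} 81"
    by (rule good4_mono[OF good4_table[OF bd(1)]]) simp
  have gS: "good4 (replicate_pmf (2 * bn) coin) (table_sign 0 bn) {..<n} 81"
    by (rule good4_mono[OF good4_table[OF bn(1)]]) simp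
  have gW: "good4 (replicate_pmf (2 * bn + 2 * bd) coin) (entry_sign bn bd d) {..<n * d} 81"
    by (rule good4_entry[OF bn(1) bd(1)])
  have sgn: "table_sign 0 bn l i = 1 \<or> table_sign 0 bn l i = - 1" if "l \<in> set_pmf (replicate_pmf (2 * bn) coin)" "i < n" for l i
    by (rule table_sign_cases[OF that(1)]) (use that(2) bn(1) in linarith)
  have G: "measure_pmf.prob PP G \<ge> 2 / 3"
    unfolding G_def PP_def best'_def lab'_def cen'_def SAf_def ATf_def Waf_def
    using search_prob[OF gS gT gW sgn f opt n1 pos(3) \<epsilon> sizes_suffice(1-3)[OF kn]] by simp
  have "measure_pmf.prob (map_pmf (Pair Halt) D) (outputs_approx \<epsilon> k A)
     = measure_pmf.prob PP ((\<lambda>x. (Halt, fin (st (cat x)))) -` outputs_approx \<epsilon> k A)"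
    by (simp add: D_def pmf.map_comp o_def)
  also have "\<dots> \<ge> measure_pmf.prob PP G"
  proof (rule prob_le_on_support)
    fix x assume x: "x \<in> set_pmf PP" "x \<in> G"
    obtain ts ss ws where x_eq: "x = (ts, ss, ws)" by (cases x) auto
    let ?\<sigma> = "fin (st (cat x))"
    obtain m where m: "kcost n d (lab' ts ss m) (cen' ss m) (\<lambda>i j. A $$ (i, j)) \<le> (1 + \<epsilon>) * kmeans_opt k A"
      "\<And>i. i < n \<Longrightarrow> nv ?\<sigma> 1 i = lab' ts ss m i" "\<And>a j. a < k \<Longrightarrow> j < d \<Longrightarrow> rv ?\<sigma> 1 (a * d + j) = cen' ss m a j"
      using final[OF x(1)] x(2) unfolding G_def Q_def x_eq by auto
    have "(Halt, ?\<sigma>) \<in> outputs_approx \<epsilon> k A"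
      by (rule stored_outputs_approx[OF A m(2,3) _ m(1)])
        (auto simp: lab'_def sketch_search.cand_labels_def intro: nearest(1)[OF pos(3)])
    then show "x \<in> (\<lambda>x. (Halt, fin (st (cat x)))) -` outputs_approx \<epsilon> k A" by simp
  qed
  finally have "measure_pmf.prob (map_pmf (Pair Halt) D) (outputs_approx \<epsilon> k A) \<ge> 2 / 3" using G by linarith
  with R show ?thesis unfolding \<sigma>0_def A_def by blast
qed

end

subsection \<open>Space and time\<close>

lemma floorlog_le_ln:
  assumes "v \<ge> 1"
  shows "real (1 + floorlog 2 v) \<le> 2 + 2 * ln (real v)"
proof -
  have "real (floorlog 2 v) \<le> 1 + log 2 (real v)"
    using assms by (simp add: floorlog_def)
  moreover have "log 2 (real v) \<le> 2 * ln (real v)"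
  proof -
    have "ln (real v) * 1 \<le> ln (real v) * (2 * ln 2)"
      using assms ln2_ge_two_thirds by (intro mult_left_mono) auto
    then show ?thesis by (simp add: log_def pos_divide_le_eq)
  qed
  ultimately show ?thesis by simp
qed

lemma of_nat_ceiling_le: "0 \<le> y \<Longrightarrow> real (nat \<lceil>y\<rceil>) \<le> y + 1"
  by linarith

lemma mult_le_sum_squares: "(a::nat) * b \<le> a\<^sup>2 + b\<^sup>2"
proof (cases a b rule: le_cases)
  case le
  then show ?thesis by (simp add: power2_eq_square mult_le_mono1 trans_le_add2)
next
  case ge
  then show ?thesis by (simp add: power2_eq_square mult_le_mono2 trans_le_add1)
qed

locale large_stream = stream_sizes +
  assumes big: "(real k / \<epsilon>) ^ 6 < real n" "(real k / \<epsilon>) ^ 6 < real d"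
begin

text \<open>One parameter above both k and 1/\<epsilon>: up to logarithms, s is linear and w cubic
  in it.\<close>

definition \<kappa> :: real where "\<kappa> = real k / \<epsilon>"
definition X :: real where "X = real n / \<epsilon>\<^sup>2 + real d * real k / \<epsilon>"
definition L :: real where "L = ln (2 + X)"

lemma kappa: "1 \<le> \<kappa>" "real k \<le> \<kappa>" "1 / \<epsilon>\<^sup>2 \<le> \<kappa>\<^sup>2" "\<And>i. i \<le> 6 \<Longrightarrow> \<kappa> ^ i \<le> real n" "\<And>i. i \<le> 6 \<Longrightarrow> \<kappa> ^ i \<le> real d"
proof -
  have k1: "real k \<ge> 1" using pos by simp
  show kk: "real k \<le> \<kappa>" using \<epsilon> k1 by (simp add: \<kappa>_def le_divide_eq mult_left_le)
  then show 1: "1 \<le> \<kappa>" using k1 by simp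
  have "1 / \<epsilon> \<le> \<kappa>" using k1 \<epsilon> by (simp add: \<kappa>_def divide_right_mono)
  then have "(1 / \<epsilon>)\<^sup>2 \<le> \<kappa>\<^sup>2" using \<epsilon> by (intro power_mono) auto
  then show "1 / \<epsilon>\<^sup>2 \<le> \<kappa>\<^sup>2" by (simp add: power_divide)
  fix i :: nat assume "i \<le> 6"
  then have "\<kappa> ^ i \<le> \<kappa> ^ 6" using 1 by (intro power_increasing)
  then show "\<kappa> ^ i \<le> real n" "\<kappa> ^ i \<le> real d" using big by (simp_all add: \<kappa>_def)
qed

lemma k_le_n: "k \<le> n"
  using kappa(2) kappa(4)[of 1] by simp

lemma X_ge: "real n / \<epsilon>\<^sup>2 \<le> X" "real d * \<kappa> \<le> X" "real n \<le> X" "real d \<le> X" "2 \<le> X"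
proof -
  have \<epsilon>2: "0 < \<epsilon>\<^sup>2" "\<epsilon>\<^sup>2 \<le> 1" using \<epsilon> by (simp_all add: power_le_one)
  have n: "real n \<le> real n / \<epsilon>\<^sup>2" using \<epsilon>2 by (simp add: le_divide_eq mult_left_le)
  have d: "real d \<le> real d * \<kappa>" using kappa(1) by (simp add: mult_le_cancel_left1)
  have X: "X = real n / \<epsilon>\<^sup>2 + real d * \<kappa>" by (simp add: X_def \<kappa>_def)
  have "0 \<le> real d * \<kappa>" using kappa(1) by simp
  then show 1: "real n / \<epsilon>\<^sup>2 \<le> X" using X by simp
  show 2: "real d * \<kappa> \<le> X" using X n by linarith
  show "real n \<le> X" "real d \<le> X" using 1 2 n d by linarith+
  then show "2 \<le> X" using pos by linarith
qed

lemma L_ge: "1 \<le> L" "ln (real n) \<le> L" "ln (real d) \<le> L"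
proof -
  have "exp 1 \<le> 2 + X" using exp_le X_ge(5) by linarith
  then show "1 \<le> L" using X_ge(5) by (simp add: L_def ln_ge_iff)
  show "ln (real n) \<le> L" "ln (real d) \<le> L" using X_ge pos by (auto simp: L_def intro!: ln_mono)
qed

lemma lg_le: "real lg \<le> 3 * L" "lg \<le> n"
proof -
  show "lg \<le> n" unfolding lg_def by (rule Least_le) (simp add: less_imp_le)
  have "2 ^ (lg - 1) < n" using lg(2)[of "lg - 1"] lg_bounds(1) by simp
  then have "(2::real) ^ (lg - 1) \<le> real n" by (metis less_imp_le of_nat_le_iff of_nat_numeral of_nat_power)
  then have "ln ((2::real) ^ (lg - 1)) \<le> ln (real n)" by (intro ln_mono) auto
  then have a: "real (lg - 1) * ln 2 \<le> L" using L_ge(2) by (simp add: ln_realpow)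
  have "real (lg - 1) * 1 \<le> real (lg - 1) * (2 * ln 2)" using ln2_ge_two_thirds by (intro mult_left_mono) auto
  then show "real lg \<le> 3 * L" using a L_ge(1) lg_bounds(1) by (simp add: of_nat_diff)
qed

lemma s_le: "real s \<le> 320001 * \<kappa>"
proof -
  have "real s \<le> real (320000 * k) / \<epsilon> + 1" unfolding s_def using \<epsilon> by (intro of_nat_ceiling_le) simp
  then show ?thesis using kappa(1) by (simp add: \<kappa>_def)
qed

lemma t_le: "real t \<le> 226801 * (real lg / \<epsilon>\<^sup>2)"
proof -
  have "1 * 1 \<le> real lg * (1 / \<epsilon>\<^sup>2)"
    using lg_bounds(1) \<epsilon> by (intro mult_mono) (auto simp: le_divide_eq power_le_one)
  moreover have "real t \<le> real (226800 * lg) / \<epsilon>\<^sup>2 + 1" unfolding t_def using \<epsilon> by (intro of_nat_ceiling_le) simp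
  ultimately show ?thesis by simp
qed

lemma w_le: "real w \<le> 80000000000 * (real lg * \<kappa> ^ 3)"
proof -
  have s1: "s \<ge> 1" by (rule sizes_suffice(4)[OF k_le_n])
  define z where "z = real s * (real lg * (real k / \<epsilon>\<^sup>2))"
  have "1 \<le> s * (k * lg)" using s1 pos lg_bounds(1) by simp
  then have "real 1 \<le> real (s * (k * lg))" by (simp only: of_nat_le_iff)
  then have "1 * 1 \<le> real (s * (k * lg)) * (1 / \<epsilon>\<^sup>2)"
    using \<epsilon> by (intro mult_mono) (auto simp: le_divide_eq power_le_one)
  then have "1 \<le> z" by (simp add: z_def mult_ac)
  moreover have "real w \<le> real (243000 * (s * (k * lg))) / \<epsilon>\<^sup>2 + 1" unfolding w_def using \<epsilon> by (intro of_nat_ceiling_le) simp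
  then have "real w \<le> 243000 * z + 1" by (simp add: z_def mult_ac)
  ultimately have "real w \<le> 243001 * (real s * (real lg * (real k / \<epsilon>\<^sup>2)))" unfolding z_def[symmetric] by linarith
  also have "real k / \<epsilon>\<^sup>2 \<le> \<kappa>\<^sup>2"
  proof -
    have "real k * 1 \<le> real k * real k" using pos by (intro mult_left_mono) auto
    then show ?thesis using \<epsilon> by (simp add: \<kappa>_def power_divide divide_right_mono power2_eq_square)
  qed
  then have "real s * (real lg * (real k / \<epsilon>\<^sup>2)) \<le> (320001 * \<kappa>) * (real lg * \<kappa>\<^sup>2)"
    using s_le kappa(1) \<epsilon> by (intro mult_mono) auto
  also have "(320001 * \<kappa>) * (real lg * \<kappa>\<^sup>2) = 320001 * (real lg * \<kappa> ^ 3)" by (simp add: power2_eq_square power3_eq_cube)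
  finally have "real w \<le> 243001 * (320001 * (real lg * \<kappa> ^ 3))" by simp
  moreover have "0 \<le> real lg * \<kappa> ^ 3" using kappa(1) by simp
  ultimately show ?thesis by linarith
qed

text \<open>The origin of the sixth power: w is of order \<kappa>^3 lg and a table has at most 2
  sqrt m digits per position, so \<kappa>^3 \<le> sqrt m makes all tables of W together linear in m,
  up to the logarithm.\<close>

lemma cube_root_le:
  assumes "\<kappa> ^ 6 \<le> real m" "\<And>x. x < b \<Longrightarrow> x * x < m" "m \<ge> 1"
  shows "\<kappa> ^ 3 * real b \<le> 2 * real m"
proof -
  have "(\<kappa> ^ 3)\<^sup>2 \<le> real m" using assms(1) by (simp flip: power_mult)
  then have c: "\<kappa> ^ 3 \<le> sqrt (real m)" using real_le_rsqrt by blast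
  have "real b \<le> 2 * sqrt (real m)"
  proof (cases "b = 0")
    case False
    then have "(b - 1) * (b - 1) < m" using assms(2)[of "b - 1"] by simp
    then have "real ((b - 1) * (b - 1)) \<le> real m" by (simp only: of_nat_le_iff less_imp_le)
    then have "(real (b - 1))\<^sup>2 \<le> real m" by (simp add: power2_eq_square)
    then have "real (b - 1) \<le> sqrt (real m)" using real_le_rsqrt by blast
    moreover have "1 \<le> sqrt (real m)" using assms(3) by simp
    moreover have "real (b - 1) = real b - 1" using False by simp
    ultimately show ?thesis by linarith
  qed simp
  with c have "\<kappa> ^ 3 * real b \<le> sqrt (real m) * (2 * sqrt (real m))" using kappa(1) by (intro mult_mono) auto
  also have "\<dots> = 2 * (sqrt (real m) * sqrt (real m))" by simp
  also have "\<dots> = 2 * real m" by simp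
  finally show ?thesis .
qed

lemma kappa_bn: "\<kappa> ^ 3 * real bn \<le> 2 * real n" and kappa_bd: "\<kappa> ^ 3 * real bd \<le> 2 * real d"
  using kappa(4)[of 6] kappa(5)[of 6] bn(2) bd(2) pos by (auto intro!: cube_root_le)

lemma len_le: "real len \<le> 400000000000 * (real lg * (real n + real d))"
proof -
  have k2: "\<kappa>\<^sup>2 \<le> \<kappa> ^ 3" and k1: "\<kappa> \<le> \<kappa> ^ 3" using kappa(1) power_increasing[of 2 3 \<kappa>] power_increasing[of 1 3 \<kappa>] by auto
  have l1: "1 \<le> real lg" using lg_bounds(1) by simp
  have T: "real t * (2 * real bd) \<le> 226801 * (real lg * (2 * (2 * real d)))"
  proof -
    have "real t * (2 * real bd) \<le> 226801 * (real lg / \<epsilon>\<^sup>2) * (2 * real bd)" by (intro mult_right_mono t_le) auto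
    also have "\<dots> = 226801 * (real lg * (2 * (1 / \<epsilon>\<^sup>2 * real bd)))" by simp
    also have "1 / \<epsilon>\<^sup>2 * real bd \<le> \<kappa> ^ 3 * real bd" using kappa(3) k2 by (intro mult_right_mono) linarith+
    then have "226801 * (real lg * (2 * (1 / \<epsilon>\<^sup>2 * real bd))) \<le> 226801 * (real lg * (2 * (2 * real d)))"
      using kappa_bd by (intro mult_left_mono) linarith+
    finally show ?thesis .
  qed
  have S: "real s * (2 * real bn) \<le> 320001 * (real lg * (2 * (2 * real n)))"
  proof -
    have "real s * (2 * real bn) \<le> 320001 * \<kappa> * (2 * real bn)" by (intro mult_right_mono s_le) auto
    also have "\<dots> = 320001 * (1 * (2 * (\<kappa> * real bn)))" by simp
    also have "\<kappa> * real bn \<le> \<kappa> ^ 3 * real bn" using k1 by (intro mult_right_mono) auto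
    then have "2 * (\<kappa> * real bn) \<le> 2 * (2 * real n)" using kappa_bn by linarith
    then have "1 * (2 * (\<kappa> * real bn)) \<le> real lg * (2 * (2 * real n))"
      using l1 kappa(1) by (intro mult_mono[OF l1]) simp_all
    then have "320001 * (1 * (2 * (\<kappa> * real bn))) \<le> 320001 * (real lg * (2 * (2 * real n)))" by linarith
    finally show ?thesis .
  qed
  have W: "real w * (2 * real bn + 2 * real bd) \<le> 80000000000 * (real lg * (2 * (2 * real n) + 2 * (2 * real d)))"
  proof -
    have "real w * (2 * real bn + 2 * real bd) \<le> 80000000000 * (real lg * \<kappa> ^ 3) * (2 * real bn + 2 * real bd)"
      by (intro mult_right_mono w_le) auto
    also have "\<dots> = 80000000000 * (real lg * (2 * (\<kappa> ^ 3 * real bn) + 2 * (\<kappa> ^ 3 * real bd)))" by (simp add: algebra_simps)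
    also have "\<dots> \<le> 80000000000 * (real lg * (2 * (2 * real n) + 2 * (2 * real d)))"
      using kappa_bn kappa_bd by (intro mult_left_mono) auto
    finally show ?thesis .
  qed
  have eq: "real len = real t * (2 * real bd) + real s * (2 * real bn) + real w * (2 * real bn + 2 * real bd)"
    by (simp add: len_def)
  define a b where "a = real lg * real n" and "b = real lg * real d"
  have ab: "real lg * (2 * (2 * real d)) = 4 * b" "real lg * (2 * (2 * real n)) = 4 * a"
    "real lg * (2 * (2 * real n) + 2 * (2 * real d)) = 4 * a + 4 * b" "real lg * (real n + real d) = a + b"
    by (simp_all add: a_def b_def algebra_simps)
  have "0 \<le> a" "0 \<le> b" by (simp_all add: a_def b_def)
  then show ?thesis using T S W unfolding eq ab by argo
qed

text \<open>The size of the input, in which all polynomial time bounds are expressed.\<close>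

definition P :: real where "P = real n * real d"

lemma sk_le: "real s * real k \<le> 320001 * \<kappa>\<^sup>2"
proof -
  have "real s * real k \<le> 320001 * \<kappa> * \<kappa>" using s_le kappa by (intro mult_mono) auto
  then show ?thesis by (simp add: power2_eq_square)
qed

lemma nd_le_P: "1 \<le> P" "real n \<le> P" "real d \<le> P" "P \<le> P\<^sup>2"
proof -
  show n: "real n \<le> P" using pos by (simp add: P_def mult_le_cancel_left1)
  show "real d \<le> P" using pos by (simp add: P_def mult_le_cancel_right1)
  show 1: "1 \<le> P" using n pos by linarith
  show "P \<le> P\<^sup>2" using 1 by (simp add: power2_eq_square mult_le_cancel_left1)
qed

text \<open>The quadratic term comes from the number of random bits, which is bounded through lg (n
  + d) \<le> 2 P^2. All other contributions are linear in P.\<close>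

lemma H_le: "real H \<le> 10 ^ 12 * P\<^sup>2"
proof -
  have lgn: "real lg \<le> real n" using lg_le(2) by simp
  have kn: "real k \<le> real n" using k_le_n by simp
  have t1: "real t \<le> 226801 * P"
  proof -
    have "real lg * (1 / \<epsilon>\<^sup>2) \<le> P"
      unfolding P_def using lgn kappa(3) kappa(5)[of 2] by (intro mult_mono) auto
    then show ?thesis using t_le by simp
  qed
  have kt: "real k * real t \<le> 226801 * P"
  proof -
    have "real k * real t \<le> \<kappa> * (226801 * (real lg / \<epsilon>\<^sup>2))" using kappa(1,2) t_le by (intro mult_mono) auto
    also have "\<dots> = 226801 * (real lg * (\<kappa> * (1 / \<epsilon>\<^sup>2)))" by simp
    also have "\<kappa> * (1 / \<epsilon>\<^sup>2) \<le> \<kappa> * \<kappa>\<^sup>2" using kappa(1,3) by (intro mult_left_mono) auto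
    then have "\<kappa> * (1 / \<epsilon>\<^sup>2) \<le> real d" using kappa(5)[of 3] by (simp add: power2_eq_square power3_eq_cube)
    then have "real lg * (\<kappa> * (1 / \<epsilon>\<^sup>2)) \<le> P" unfolding P_def using lgn kappa(1) by (intro mult_mono) auto
    finally show ?thesis by simp
  qed
  have s1: "real s \<le> 320001 * P" using s_le kappa(4)[of 1] nd_le_P(2) by simp
  have sk: "real s * real k \<le> 320001 * P" using sk_le kappa(4)[of 2] nd_le_P(2) by simp
  have w1: "real w \<le> 80000000000 * P"
  proof -
    have "real lg * \<kappa> ^ 3 \<le> P" unfolding P_def using lgn kappa(1,5) by (intro mult_mono) auto
    then show ?thesis using w_le by simp
  qed
  have kd: "real k * real d \<le> P" unfolding P_def using kn by (intro mult_right_mono) auto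
  have bn1: "real bn \<le> real n" using bn_def by (simp add: bn_def Least_le)
  have bd1: "real bd \<le> real d" by (simp add: bd_def Least_le)
  have len1: "real len \<le> 800000000000 * P\<^sup>2"
  proof -
    have "real lg * (real n + real d) \<le> P * (P + P)" using lgn nd_le_P by (intro mult_mono) auto
    then show ?thesis using len_le by (simp add: power2_eq_square)
  qed
  have "real H = real n + real d + real k + real t + real s + real w + P + real s * real k + real k * real d + real k * real t
     + 2 * real n + real bn + real bd + real lg + real len" by (simp add: H_def P_def)
  also have "\<dots> \<le> 100000000000 * P + 800000000000 * P\<^sup>2"
    using t1 kt s1 sk w1 kd bn1 bd1 len1 lgn kn nd_le_P by linarith
  also have "\<dots> \<le> 10 ^ 12 * P\<^sup>2" using nd_le_P by simp
  finally show ?thesis .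
qed

text \<open>The dominant items are A T with n t cells, S A with s d cells, the sign tables and the
  labels; the guess counters add O(s k log n) bits. Each is at most X times one logarithm.\<close>

lemma mem_le:
  assumes "memok \<sigma>"
  shows "real (mem_size \<sigma>) \<le> 10 ^ 20 * (X * L)"
proof -
  define F where "F = 1 + floorlog 2 H"
  define Fk where "Fk = 1 + floorlog 2 k"
  define Fq where "Fq = 1 + floorlog 2 ((2 * n + 1) ^ (s * k))"
  let ?NA = "{0, 1, 10, 11, 12, 20, 21, 22, 23, 24, 28, 40} \<union> {30..38} :: nat set"
  let ?RA = "{0, 1, 5, 6, 7, 10} \<union> {30..41} :: nat set"
  have s30: "{30..38::nat} = {30, 31, 32, 33, 34, 35, 36, 37, 38}" "{30..41::nat} = {30, 31, 32, 33, 34, 35, 36, 37, 38, 39, 40, 41}"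
    by (simp_all add: atLeastAtMost_upt)
  have "mem_size \<sigma> \<le> (\<Sum>a\<in>?NA. LN a * (1 + floorlog 2 (VN a))) + (\<Sum>a\<in>?RA. LR a)"
    by (rule mem_size_le[OF assms]) (auto simp: LN_def LR_def)
  \<comment> \<open>Twenty single cells hold small naturals: six in array 0, eight in the arrays 10
    to 28, and the six counters 30 to 35. Each table bit is charged 2.\<close>
  also have "(\<Sum>a\<in>?NA. LN a * (1 + floorlog 2 (VN a))) = 20 * F + 2 * n * Fk + 2 * len + 3 * Fq"
    unfolding s30 by (simp add: LN_def VN_def F_def Fk_def Fq_def floorlog_def)
  also have "(\<Sum>a\<in>?RA. LR a) = 6 + 2 * (k * d) + s * d + n * t + 2 * w + 2 * (s * k) + 2 * k + s + k * t"
    unfolding s30 by (simp add: LR_def)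
  finally have "real (mem_size \<sigma>) \<le> real (20 * F + 2 * n * Fk + 2 * len + 3 * Fq
      + (6 + 2 * (k * d) + s * d + n * t + 2 * w + 2 * (s * k) + 2 * k + s + k * t))" by (simp only: of_nat_le_iff)
  also have "\<dots> = 20 * real F + 2 * (real n * real Fk) + 2 * real len + 3 * real Fq + 6 + 2 * (real k * real d) + real s * real d
      + real n * real t + 2 * real w + 2 * (real s * real k) + 2 * real k + real s + real k * real t" by simp
  also have "\<dots> \<le> 10 ^ 20 * (X * L)"
  proof -
    define Y where "Y = X * L"
    have X1: "1 \<le> X" using X_ge(5) by simp
    have XY: "X \<le> Y" using X1 L_ge(1) by (simp add: Y_def mult_le_cancel_left1)
    have LY: "L \<le> Y" using X1 L_ge(1) by (simp add: Y_def mult_le_cancel_right1)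
    have nX: "real n \<le> X" and dX: "real d \<le> X" by (rule X_ge)+
    have lnP: "ln (P\<^sup>2) \<le> 4 * L"
    proof -
      have "ln (P\<^sup>2) = 2 * (ln (real n) + ln (real d))" using pos by (simp add: P_def ln_mult ln_realpow)
      then show ?thesis using L_ge by simp
    qed
    have F: "real F \<le> 100000000000000 * Y"
    proof -
      have H1: "H \<ge> 1" using pos by (simp add: H_def)
      have "ln (real H) \<le> ln (10 ^ 12 * P\<^sup>2)" using H_le H1 by (intro ln_mono) auto
      also have "\<dots> = ln (10 ^ 12) + ln (P\<^sup>2)" using nd_le_P(1) by (simp add: ln_mult)
      \<comment> \<open>The crude estimate ln x \<le> x is enough for a constant; such steps explain
        the generous final constants.\<close>
      also have "ln (10 ^ 12 :: real) \<le> 1000000000000" using ln_bound[of "10 ^ 12 :: real"] by simp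
      finally have "ln (real H) \<le> 1000000000000 + 4 * L" using lnP by linarith
      then have "real F \<le> 100000000000000 * L" using floorlog_le_ln[OF H1] L_ge(1) unfolding F_def by linarith
      then show ?thesis using LY by linarith
    qed
    have Fk: "real n * real Fk \<le> 4 * Y"
    proof -
      have "ln (real k) \<le> ln (real n)" using k_le_n pos by (intro ln_mono) auto
      then have "ln (real k) \<le> L" using L_ge(2) by linarith
      then have "real Fk \<le> 4 * L" using floorlog_le_ln[OF pos(3)] L_ge(1) unfolding Fk_def by linarith
      then have "real n * real Fk \<le> X * (4 * L)" using nX X1 by (intro mult_mono) auto
      then show ?thesis by (simp add: Y_def)
    qed
    have lgX: "real lg * (real n + real d) \<le> 6 * Y"
    proof -
      have "real lg * (real n + real d) \<le> (3 * L) * (X + X)" using lg_le(1) nX dX X1 L_ge(1) by (intro mult_mono) auto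
      then show ?thesis by (simp add: Y_def mult_ac)
    qed
    have Fq: "real Fq \<le> 10000000 * Y"
    proof -
      have "ln (real ((2 * n + 1) ^ (s * k))) = real (s * k) * ln (2 * real n + 1)"
        by (simp add: ln_realpow add.commute)
      also have "\<dots> \<le> real (s * k) * (3 * L)" using ln_twice_succ_le[OF pos(1)] L_ge(2) by (intro mult_left_mono) auto
      also have "\<dots> \<le> (320001 * X) * (3 * L)"
        using sk_le kappa(4)[of 2] nX L_ge(1) by (intro mult_right_mono) auto
      finally have "ln (real ((2 * n + 1) ^ (s * k))) \<le> 960003 * Y" by (simp add: Y_def)
      moreover have "(2 * n + 1) ^ (s * k) \<ge> 1" by simp
      ultimately have "real Fq \<le> 2 + 2 * (960003 * Y)" using floorlog_le_ln unfolding Fq_def by fastforce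
      then show ?thesis using X1 XY by linarith
    qed
    have kd: "real k * real d \<le> X"
    proof -
      have "real k * real d \<le> \<kappa> * real d" using kappa by (intro mult_right_mono) auto
      then show ?thesis using X_ge(2) by (simp add: mult.commute)
    qed
    have sd: "real s * real d \<le> 320001 * X"
    proof -
      have "real s * real d \<le> 320001 * \<kappa> * real d" using s_le by (intro mult_right_mono) auto
      then show ?thesis using X_ge(2) by (simp add: mult.commute)
    qed
    have nt: "real n * real t \<le> 680403 * Y"
    proof -
      have "real n * real t \<le> real n * (226801 * (real lg / \<epsilon>\<^sup>2))" using t_le by (intro mult_left_mono) auto
      also have "\<dots> = 226801 * (real lg * (real n / \<epsilon>\<^sup>2))" by simp
      also have "\<dots> \<le> 226801 * ((3 * L) * X)" using lg_le(1) X_ge(1) L_ge(1) by (intro mult_left_mono mult_mono) auto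
      finally show ?thesis by (simp add: Y_def mult_ac)
    qed
    have kt: "real k * real t \<le> real n * real t" using k_le_n by (intro mult_right_mono) auto
    have w: "real w \<le> 240000000000 * Y"
    proof -
      have "real lg * \<kappa> ^ 3 \<le> (3 * L) * X" using lg_le(1) kappa(1) kappa(4)[of 3] nX L_ge(1) by (intro mult_mono) auto
      then show ?thesis using w_le by (simp add: Y_def mult_ac)
    qed
    have sk: "real s * real k \<le> 320001 * X" using sk_le kappa(4)[of 2] nX by simp
    have s1: "real s \<le> 320001 * X" using s_le kappa(4)[of 1] nX by simp
    have k1: "real k \<le> X" using k_le_n nX by linarith
    have len: "real len \<le> 2400000000000 * Y" using len_le lgX by linarith
    have "20 * real F + 2 * (real n * real Fk) + 2 * real len + 3 * real Fq + 6 + 2 * (real k * real d) + real s * real d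
      + real n * real t + 2 * real w + 2 * (real s * real k) + 2 * real k + real s + real k * real t
      \<le> 10000000000000000000 * Y" using F Fk len Fq kd sd nt kt w sk s1 k1 X1 XY by linarith
    also have "\<dots> \<le> 10 ^ 20 * Y" using X1 XY by simp
    finally show ?thesis unfolding Y_def .
  qed
  finally show ?thesis .
qed

text \<open>The search takes time H^3 Q, a product, while the target is a sum. Splitting by a b
  \<le> a^2 + b^2 squares both factors: H^6 is of order P^12, and Q^2 \<le> n^(6 s k) only doubles
  the exponent. The cube in 2 n + 1 \<le> n^3 accounts for the rest of the 6.\<close>

lemma total_time_le:
  "real (total_time m) \<le> 10 ^ 90 * real (m + 1) * P ^ 12 + real n powr (10 ^ 7 * ((real k)\<^sup>2 / \<epsilon>))"
proof -
  define Q where "Q = (2 * n + 1) ^ (s * k)"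
  have len: "len \<le> H" "1 \<le> H" using pos by (auto simp: H_def)
  have P1: "1 \<le> P" by (rule nd_le_P)
  have "total_time m = 40 * H + (m + 1) * (40 * H) + len * 5 + 6 + 250 * H ^ 3 * Q"
    by (simp add: total_time_def Q_def)
  also have "\<dots> \<le> (m + 1) * (91 * H) + 250 * H ^ 3 * Q"
    using len by (simp add: algebra_simps)
  also have "250 * H ^ 3 * Q \<le> (250 * H ^ 3)\<^sup>2 + Q\<^sup>2" by (rule mult_le_sum_squares)
  finally have "real (total_time m) \<le> real ((m + 1) * (91 * H) + ((250 * H ^ 3)\<^sup>2 + Q\<^sup>2))" by (simp only: of_nat_le_iff)
  also have "\<dots> = real (m + 1) * (91 * real H) + 62500 * real H ^ 6 + (real Q)\<^sup>2"
  proof -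
    have "real ((m + 1) * (91 * H)) = real (m + 1) * (91 * real H)" by (simp only: of_nat_mult of_nat_numeral)
    moreover have "real ((250 * H ^ 3)\<^sup>2) = 62500 * real H ^ 6" by (simp add: power_mult_distrib flip: power_mult)
    ultimately show ?thesis by simp
  qed
  also have "\<dots> \<le> 10 ^ 90 * real (m + 1) * P ^ 12 + real n powr (10 ^ 7 * ((real k)\<^sup>2 / \<epsilon>))"
  proof -
    have "91 * real H \<le> 10 ^ 14 * P ^ 12"
    proof -
      have "91 * real H \<le> 10 ^ 14 * P\<^sup>2" using H_le nd_le_P by simp
      also have "P\<^sup>2 \<le> P ^ 12" using P1 by (intro power_increasing) auto
      finally show ?thesis by simp
    qed
    then have 1: "real (m + 1) * (91 * real H) \<le> real (m + 1) * (10 ^ 14 * P ^ 12)" by (intro mult_left_mono) auto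
    have "real H ^ 6 \<le> (10 ^ 12 * P\<^sup>2) ^ 6" using H_le by (intro power_mono) auto
    then have "real H ^ 6 \<le> 10 ^ 72 * P ^ 12" by (simp add: power_mult_distrib flip: power_mult)
    then have "62500 * real H ^ 6 \<le> 62500 * 10 ^ 72 * P ^ 12" by simp
    moreover have "62500 * 10 ^ 72 * P ^ 12 \<le> 10 ^ 80 * P ^ 12" using P1 by (intro mult_right_mono) auto
    ultimately have "62500 * real H ^ 6 \<le> 10 ^ 80 * P ^ 12" by (rule order_trans)
    moreover have "1 * (10 ^ 80 * P ^ 12) \<le> real (m + 1) * (10 ^ 80 * P ^ 12)" using P1 by (intro mult_right_mono) auto
    ultimately have 2: "62500 * real H ^ 6 \<le> real (m + 1) * (10 ^ 80 * P ^ 12)" by linarith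
    have "(real Q)\<^sup>2 \<le> real n powr (10 ^ 7 * ((real k)\<^sup>2 / \<epsilon>))"
    proof -
      have n0: "real n \<ge> 1" "real n > 0" using pos by simp_all
      have "2 * n + 1 \<le> n * (n * n)"
      proof -
        have "2 * 2 \<le> n * n" using pos by (intro mult_mono) auto
        then have "n * 4 \<le> n * (n * n)" by (intro mult_left_mono) auto
        then show ?thesis using pos by linarith
      qed
      then have "real (2 * n + 1) \<le> real (n * (n * n))" by (simp only: of_nat_le_iff)
      then have "real (2 * n + 1) \<le> real n ^ 3" by (simp add: power3_eq_cube)
      then have "real (2 * n + 1) ^ (s * k * 2) \<le> (real n ^ 3) ^ (s * k * 2)" by (intro power_mono) auto
      then have "(real Q)\<^sup>2 \<le> real n ^ (6 * (s * k))"
        by (simp add: Q_def ac_simps flip: power_mult)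
      also have "\<dots> = real n powr (6 * (real s * real k))" using n0 by (simp flip: powr_realpow)
      also have "\<dots> \<le> real n powr (10 ^ 7 * ((real k)\<^sup>2 / \<epsilon>))"
      proof (rule powr_mono)
        have "real s * real k \<le> 320001 * \<kappa> * real k" using s_le by (intro mult_right_mono) auto
        also have "\<dots> = 320001 * ((real k)\<^sup>2 / \<epsilon>)" by (simp add: \<kappa>_def power2_eq_square)
        finally have "6 * (real s * real k) \<le> 10000000 * ((real k)\<^sup>2 / \<epsilon>)"
          using divide_nonneg_pos[OF zero_le_power2 \<epsilon>(1), of "real k"] by linarith
        then show "6 * (real s * real k) \<le> 10 ^ 7 * ((real k)\<^sup>2 / \<epsilon>)" by simp
      qed (use n0 in simp)
      finally show ?thesis .
    qed
    moreover have "real (m + 1) * (10 ^ 14 * P ^ 12) + real (m + 1) * (10 ^ 80 * P ^ 12) \<le> 10 ^ 90 * real (m + 1) * P ^ 12"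
    proof -
      have "0 \<le> real (m + 1) * P ^ 12" using P1 by simp
      then have "(10 ^ 14 + 10 ^ 80) * (real (m + 1) * P ^ 12) \<le> 10 ^ 90 * (real (m + 1) * P ^ 12)"
        by (intro mult_right_mono) auto
      then show ?thesis by (simp add: algebra_simps)
    qed
    ultimately show ?thesis using 1 2 by linarith
  qed
  finally show ?thesis .
qed

end

section \<open>Assembling the two halves\<close>

text \<open>The polynomial x^6 also yields n \<ge> 2, because k / \<epsilon> \<ge> 1. The exponent
  12 is the one of P in the running time; the space bound has a single logarithm and is weakened to
  match.\<close>

lemma streaming_part:
    "\<exists>(c::real) (e::nat) (q::real poly) (alg::com). c > 0 \<and>
       (\<forall>(n::nat) (d::nat) (k::nat) (\<epsilon>::real) (\<sigma>::update list).
          n \<ge> 1 \<and> d \<ge> 1 \<and> k \<ge> 1 \<and> 0 < \<epsilon> \<and> \<epsilon> < 1 \<and>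
          real n > poly q (real k / \<epsilon>) \<and> real d > poly q (real k / \<epsilon>) \<and>
          valid_stream n d \<sigma> \<longrightarrow>
          (\<exists>N.
             real N \<le> c * real (length \<sigma> + 1) * (real n * real d) ^ e
                       + real n powr soft_bound c e ((real k)\<^sup>2 / \<epsilon>) \<and>
             (\<forall>cfg \<in> set_pmf (steps N (alg, stream_input n d k \<epsilon> \<sigma>)). fst cfg = Halt) \<and>
             (\<forall>M. \<forall>cfg \<in> set_pmf (steps M (alg, stream_input n d k \<epsilon> \<sigma>)).
                real (mem_size (snd cfg))
                  \<le> soft_bound c e (real n / \<epsilon>\<^sup>2 + real d * real k / \<epsilon>)) \<and>
             measure_pmf.prob (steps N (alg, stream_input n d k \<epsilon> \<sigma>))
               (outputs_approx \<epsilon> k (stream_mat n d \<sigma>)) \<ge> 2 / 3))"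
proof (rule exI[of _ "10 ^ 90"], rule exI[of _ 12], rule exI[of _ "monom 1 6"], rule exI[of _ stream_kmeans], intro conjI allI impI)
  fix n d k :: nat and \<epsilon> :: real and \<sigma> :: "update list"
  assume *: "n \<ge> 1 \<and> d \<ge> 1 \<and> k \<ge> 1 \<and> 0 < \<epsilon> \<and> \<epsilon> < 1 \<and>
          real n > poly (monom 1 6) (real k / \<epsilon>) \<and> real d > poly (monom 1 6) (real k / \<epsilon>) \<and> valid_stream n d \<sigma>"
  have k1: "1 \<le> real k / \<epsilon>"
  proof -
    have "\<epsilon> \<le> real k" using * by linarith
    then show ?thesis using * by (simp add: le_divide_eq)
  qed
  have "1 \<le> (real k / \<epsilon>) ^ 6" using k1 by (rule one_le_power)
  moreover have "(real k / \<epsilon>) ^ 6 < real n" using * by (simp add: poly_monom)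
  ultimately have "1 < real n" by linarith
  then interpret large_stream n d k \<epsilon> using * by unfold_locales (auto simp: poly_monom)
  let ?c = "10 ^ 90 :: real" and ?cfg = "(stream_kmeans, stream_input n d k \<epsilon> \<sigma>)"
  obtain D where R: "runs memok stream_kmeans (stream_input n d k \<epsilon> \<sigma>) (total_time (length \<sigma>)) D"
    and pr: "measure_pmf.prob (map_pmf (Pair Halt) D) (outputs_approx \<epsilon> k (stream_mat n d \<sigma>)) \<ge> 2 / 3"
    using runs_stream_kmeans[OF _ k_le_n] * by blast
  have st: "steps (total_time (length \<sigma>)) ?cfg = map_pmf (Pair Halt) D" and inv: "\<And>M cfg. cfg \<in> set_pmf (steps M ?cfg) \<Longrightarrow> memok (snd cfg)"
    using R unfolding runs_def by blast+
  have space: "real (mem_size (snd cfg)) \<le> soft_bound ?c 12 (real n / \<epsilon>\<^sup>2 + real d * real k / \<epsilon>)" if "cfg \<in> set_pmf (steps M ?cfg)" for M cfg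
  proof -
    have XL: "0 \<le> X * L" using X_ge(5) L_ge(1) by simp
    have "real (mem_size (snd cfg)) \<le> 10 ^ 20 * (X * L)" by (rule mem_le[OF inv[OF that]])
    also have "\<dots> \<le> 10 ^ 90 * (X * L)" using XL by (intro mult_right_mono) auto
    also have "\<dots> \<le> 10 ^ 90 * (X * L ^ 12)"
      using X_ge(5) L_ge(1) power_increasing[of 1 12 L] by (intro mult_left_mono) auto
    finally show ?thesis by (simp only: soft_bound_def X_def L_def mult.assoc)
  qed
  have time: "real (total_time (length \<sigma>)) \<le> ?c * real (length \<sigma> + 1) * (real n * real d) ^ 12
                       + real n powr soft_bound ?c 12 ((real k)\<^sup>2 / \<epsilon>)"
  proof -
    let ?z = "(real k)\<^sup>2 / \<epsilon>"
    have z: "1 \<le> ?z"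
    proof -
      have "1 * 1 \<le> real k * (real k / \<epsilon>)" using k1 * by (intro mult_mono) auto
      then show ?thesis by (simp add: power2_eq_square)
    qed
    \<comment> \<open>Raising the logarithm to the power 12 is harmless only if it is at least 1,
      and z \<ge> 1 gives 2 + z \<ge> 3 > e.\<close>
    have "exp 1 \<le> 2 + ?z" using exp_le z by linarith
    then have l: "1 \<le> ln (2 + ?z)" using z by (subst ln_ge_iff) auto
    have "10 ^ 7 * ?z \<le> 10 ^ 90 * ?z * 1" using z by simp
    also have "\<dots> \<le> 10 ^ 90 * ?z * ln (2 + ?z) ^ 12" using z one_le_power[OF l, of 12] by (intro mult_left_mono) auto
    finally have "10 ^ 7 * ?z \<le> soft_bound ?c 12 ?z" by (simp only: soft_bound_def)
    then have "real n powr (10 ^ 7 * ?z) \<le> real n powr soft_bound ?c 12 ?z" using * by (intro powr_mono) auto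
    then show ?thesis using total_time_le[of "length \<sigma>"] unfolding P_def by linarith
  qed
  show "\<exists>N. real N \<le> ?c * real (length \<sigma> + 1) * (real n * real d) ^ 12
                       + real n powr soft_bound ?c 12 ((real k)\<^sup>2 / \<epsilon>) \<and>
             (\<forall>cfg \<in> set_pmf (steps N ?cfg). fst cfg = Halt) \<and>
             (\<forall>M. \<forall>cfg \<in> set_pmf (steps M ?cfg).
                real (mem_size (snd cfg)) \<le> soft_bound ?c 12 (real n / \<epsilon>\<^sup>2 + real d * real k / \<epsilon>)) \<and>
             measure_pmf.prob (steps N ?cfg) (outputs_approx \<epsilon> k (stream_mat n d \<sigma>)) \<ge> 2 / 3"
    using time space pr by (intro exI[of _ "total_time (length \<sigma>)"]) (auto simp: st)
qed simp

theorem mainTheorem12: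
  shows
    "(\<exists>(c::real) (recover::com). c > 0 \<and>
       (\<forall>(n::nat) (d::nat) (k::nat) (\<epsilon>::real).
          n \<ge> 1 \<and> d \<ge> 1 \<and> k \<ge> 1 \<and> 0 < \<epsilon> \<and> \<epsilon> < 1 \<longrightarrow>
          (\<exists>(t::nat) (s::nat) (w::nat)
             (DT::real mat pmf) (DS::real mat pmf) (DW::real mat pmf).
             set_pmf DT \<subseteq> carrier_mat d t \<and>
             set_pmf DS \<subseteq> carrier_mat s n \<and>
             set_pmf DW \<subseteq> carrier_mat w (n * d) \<and>
             real t \<le> c * (ln (real n * real k) / \<epsilon>\<^sup>2) \<and>
             real s \<le> c * (real k / \<epsilon>) \<and>
             real w \<le> c * ((real k)\<^sup>2 / \<epsilon> ^ 3 * ln (real n)) \<and>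
             (\<forall>A \<in> carrier_mat n d. \<exists>N.
                measure_pmf.prob
                  (bind_pmf (pair_pmf DT (pair_pmf DS DW))
                     (\<lambda>(T, S, W). steps N
                        (recover, sketch_input n d k \<epsilon> T S W (S * A) (A * T) (W *\<^sub>v flatten A))))
                  (outputs_approx \<epsilon> k A) \<ge> 2 / 3))))
     \<and>
     (\<exists>(c::real) (e::nat) (q::real poly) (alg::com). c > 0 \<and>
       (\<forall>(n::nat) (d::nat) (k::nat) (\<epsilon>::real) (\<sigma>::update list).
          n \<ge> 1 \<and> d \<ge> 1 \<and> k \<ge> 1 \<and> 0 < \<epsilon> \<and> \<epsilon> < 1 \<and>
          real n > poly q (real k / \<epsilon>) \<and> real d > poly q (real k / \<epsilon>) \<and>
          valid_stream n d \<sigma> \<longrightarrow>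
          (\<exists>N.
             real N \<le> c * real (length \<sigma> + 1) * (real n * real d) ^ e
                       + real n powr soft_bound c e ((real k)\<^sup>2 / \<epsilon>) \<and>
             (\<forall>cfg \<in> set_pmf (steps N (alg, stream_input n d k \<epsilon> \<sigma>)). fst cfg = Halt) \<and>
             (\<forall>M. \<forall>cfg \<in> set_pmf (steps M (alg, stream_input n d k \<epsilon> \<sigma>)).
                real (mem_size (snd cfg))
                  \<le> soft_bound c e (real n / \<epsilon>\<^sup>2 + real d * real k / \<epsilon>)) \<and>
             measure_pmf.prob (steps N (alg, stream_input n d k \<epsilon> \<sigma>))
               (outputs_approx \<epsilon> k (stream_mat n d \<sigma>)) \<ge> 2 / 3)))"
  by (rule conjI[OF sketching_part streaming_part])


end
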